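(* A matroid is an excluded minor for the class $\mathcal{N}$ of notch matroids (that is, it is not a notch matroid but every proper minor of it is) if and only if it is isomorphic to one of the following: (1) $U_{1,2}\oplus U_{1,2}\oplus U_{1,2}$ and $T_2(U_{1,2}\oplus U_{1,1}\oplus U_{1,1})\oplus U_{1,2}$; (2) the three-wheel $\mathcal{W}_3$ and the three-whirl $\mathcal{W}^3$; (3) $A_n$ for $n\ge 3$; (4) $B_{n,k}$ and $C_{n+k,k}$ for $2\le k\le n$; (5) $D_n$ for $n\ge 3$; (6) $E_n$ for $n\ge 3$; (7) for $n\ge 4$, $F_n:=T_n(U_{n-2,n-1}\oplus U_{n-2,n-1})$; (8) for $n\ge 2$, $G_n:=T_n(U_{n-1,n+1}\oplus U_{n-1,n+1})$; (9) for $n\ge 3$, $H_n:=T_n(U_{n-2,n-1}\oplus U_{n-1,n+1})$.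
   Context: Lattice paths start at $(0,0)$ and use steps $E=(1,0)$ and $N=(0,1)$, written as words in $\{E,N\}$. For lattice paths $P,Q$ from $(0,0)$ to $(m,r)$ with $P$ never going above $Q$, let $\mathcal{P}$ be the set of lattice paths from $(0,0)$ to $(m,r)$ going neither above $Q$ nor below $P$, and for $1\le i\le r$ let $N_i=\{j:\text{step } j \text{ is the } i\text{-th North step of some path in }\mathcal{P}\}$; $M[P,Q]$ is the transversal matroid on $[m+r]$ with presentation $(N_1,\ldots,N_r)$. A notch matroid is a matroid isomorphic to some $M[E^mN^r,Q]$ or $M[E^{m-1}NEN^{r-1},Q]$ (with $Q$ any lattice path from $(0,0)$ to $(m,r)$ not going below the first path). $U_{k,n}$ is the uniform matroid; $T_n(M)$ is the truncation of $M$ to rank $n$ (independent sets: independent sets of $M$ of size at most $n$); $M+y$ is the free extension of $M$ by a new element $y$. $A_n$ ($n\ge3$) is the rank-$n$ paving matroid on $\{x,y,a_2,\ldots,a_n,b_2,\ldots,b_n\}$ whose only nontrivial hyperplanes (hyperplanes that are dependent) are $\{x,a_2,\ldots,a_n\}$ and $\{x,b_2,\ldots,b_n\}$. $B_{n,k}=T_n(U_{n-1,n}\oplus U_{n-1,n}\oplus U_{k-1,k})$ and $C_{n+k,k}$ is the dual of $B_{n,k}$. $D_n=\bigl(T_{n-1}(U_{n-2,n-1}\oplus U_{n-2,n-1})\oplus U_{1,1}\bigr)+y$ and $E_n$ is the dual of $D_n$. $\mathcal{W}_3$ is the cycle matroid of $K_4$ and $\mathcal{W}^3$ is the rank-3 whirl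 (relaxing the rim circuit-hyperplane of $\mathcal{W}_3$). *)

theory Defs
  imports Main
begin

section \<open>Matroids\<close>

record 'a matroid =
  ground :: "'a set"
  indeps :: "'a set set"

definition matroid :: "'a matroid \<Rightarrow> bool" where
  "matroid M \<longleftrightarrow>
     finite (ground M) \<and>
     (\<forall>I\<in>indeps M. I \<subseteq> ground M) \<and>
     {} \<in> indeps M \<and>
     (\<forall>I\<in>indeps M. \<forall>J. J \<subseteq> I \<longrightarrow> J \<in> indeps M) \<and>
     (\<forall>I\<in>indeps M. \<forall>J\<in>indeps M. card I < card J \<longrightarrow>
        (\<exists>e\<in>J - I. insert e I \<in> indeps M))"

definition matroid_iso :: "'a matroid \<Rightarrow> 'b matroid \<Rightarrow> bool" where
  "matroid_iso M M' \<longleftrightarrow>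
     (\<exists>f. bij_betw f (ground M) (ground M') \<and>
          (\<forall>X. X \<subseteq> ground M \<longrightarrow> (X \<in> indeps M \<longleftrightarrow> f ` X \<in> indeps M')))"

definition bases :: "'a matroid \<Rightarrow> 'a set set" where
  "bases M = {B \<in> indeps M. \<forall>I\<in>indeps M. B \<subseteq> I \<longrightarrow> I = B}"

definition matroid_of_bases :: "'a set \<Rightarrow> 'a set set \<Rightarrow> 'a matroid" where
  "matroid_of_bases S \<B> = \<lparr>ground = S, indeps = {I. \<exists>B\<in>\<B>. I \<subseteq> B}\<rparr>"

definition circuits :: "'a matroid \<Rightarrow> 'a set set" where
  "circuits M = {C. C \<subseteq> ground M \<and> C \<notin> indeps M \<and> (\<forall>D. D \<subset> C \<longrightarrow> D \<in> indeps M)}"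

definition rank_of :: "'a matroid \<Rightarrow> 'a set \<Rightarrow> nat" where
  "rank_of M X = Max (card ` {I \<in> indeps M. I \<subseteq> X})"

definition matroid_rank :: "'a matroid \<Rightarrow> nat" where
  "matroid_rank M = rank_of M (ground M)"

definition flats :: "'a matroid \<Rightarrow> 'a set set" where
  "flats M = {F. F \<subseteq> ground M \<and> (\<forall>e\<in>ground M - F. rank_of M F < rank_of M (insert e F))}"

definition hyperplanes :: "'a matroid \<Rightarrow> 'a set set" where
  "hyperplanes M = {H \<in> flats M. rank_of M H + 1 = matroid_rank M}"

definition paving :: "'a matroid \<Rightarrow> bool" where
  "paving M \<longleftrightarrow> (\<forall>C\<in>circuits M. matroid_rank M \<le> card C)"

definition dual_matroid :: "'a matroid \<Rightarrow> 'a matroid" where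
  "dual_matroid M = matroid_of_bases (ground M) ((\<lambda>B. ground M - B) ` bases M)"

definition deletion :: "'a matroid \<Rightarrow> 'a set \<Rightarrow> 'a matroid" where
  "deletion M X = \<lparr>ground = ground M - X, indeps = {I \<in> indeps M. I \<inter> X = {}}\<rparr>"

definition contraction :: "'a matroid \<Rightarrow> 'a set \<Rightarrow> 'a matroid" where
  "contraction M X = dual_matroid (deletion (dual_matroid M) X)"

definition proper_minor :: "'a matroid \<Rightarrow> 'a matroid \<Rightarrow> bool" where
  "proper_minor M' M \<longleftrightarrow>
     (\<exists>X Y. X \<subseteq> ground M \<and> Y \<subseteq> ground M \<and> X \<inter> Y = {} \<and> X \<union> Y \<noteq> {} \<and>
            M' = contraction (deletion M X) Y)"

definition excluded_minor :: "('a matroid \<Rightarrow> bool) \<Rightarrow> 'a matroid \<Rightarrow> bool" where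
  "excluded_minor \<C> M \<longleftrightarrow> \<not> \<C> M \<and> (\<forall>M'. proper_minor M' M \<longrightarrow> \<C> M')"


section \<open>Constructions\<close>

definition uniform_matroid :: "nat \<Rightarrow> nat \<Rightarrow> nat matroid" where
  "uniform_matroid k n = \<lparr>ground = {1..n}, indeps = {I. I \<subseteq> {1..n} \<and> card I \<le> k}\<rparr>"

definition direct_sum :: "'a matroid \<Rightarrow> 'b matroid \<Rightarrow> ('a + 'b) matroid" where
  "direct_sum M M' = \<lparr>ground = ground M <+> ground M',
                      indeps = {I <+> J | I J. I \<in> indeps M \<and> J \<in> indeps M'}\<rparr>"

definition truncation :: "nat \<Rightarrow> 'a matroid \<Rightarrow> 'a matroid" where
  "truncation n M = \<lparr>ground = ground M, indeps = {I \<in> indeps M. card I \<le> n}\<rparr>"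

text \<open>The free extension \<open>M + y\<close>; the new element \<open>y\<close> is \<^const>\<open>None\<close>, and the old
  elements are embedded by \<^const>\<open>Some\<close>.\<close>

definition free_extension :: "'a matroid \<Rightarrow> 'a option matroid" where
  "free_extension M =
     \<lparr>ground = insert None (Some ` ground M),
      indeps = {Some ` I | I. I \<in> indeps M} \<union>
               {insert None (Some ` I) | I. I \<in> indeps M \<and> card I < matroid_rank M}\<rparr>"

text \<open>The relaxation of a circuit-hyperplane \<open>X\<close> of \<open>M\<close>.\<close>

definition relaxation :: "'a matroid \<Rightarrow> 'a set \<Rightarrow> 'a matroid" where
  "relaxation M X = matroid_of_bases (ground M) (insert X (bases M))"

definition transversal_matroid :: "'a set \<Rightarrow> 'i set \<Rightarrow> ('i \<Rightarrow> 'a set) \<Rightarrow> 'a matroid" where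
  "transversal_matroid S J A =
     \<lparr>ground = S,
      indeps = {X. X \<subseteq> S \<and> (\<exists>f. inj_on f X \<and> (\<forall>x\<in>X. f x \<in> J \<and> x \<in> A (f x)))}\<rparr>"

text \<open>The cycle matroid of the simple graph with edge set \<open>G\<close> (a set of two-element sets of
  vertices). The list \<open>vs\<close> gives the vertices of a cycle in cyclic order.\<close>

definition cycle_edges :: "'v list \<Rightarrow> 'v set set" where
  "cycle_edges vs = {{vs ! i, vs ! (Suc i mod length vs)} | i. i < length vs}"

definition cycle_matroid :: "'v set set \<Rightarrow> 'v set matroid" where
  "cycle_matroid G =
     \<lparr>ground = G,
      indeps = {X. X \<subseteq> G \<and> \<not> (\<exists>vs. 3 \<le> length vs \<and> distinct vs \<and> cycle_edges vs \<subseteq> X)}\<rparr>"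


section \<open>Lattice path matroids and notch matroids\<close>

datatype step = East | North

definition lattice_paths :: "nat \<Rightarrow> nat \<Rightarrow> step list set" where
  "lattice_paths m r = {R. count_list R East = m \<and> count_list R North = r}"

text \<open>\<open>P\<close> never goes above \<open>Q\<close>, for two paths with the same endpoints. After \<open>k\<close> steps both
  paths are on the antidiagonal \<open>x + y = k\<close>, so their positions are compared by their heights.\<close>

definition never_above :: "step list \<Rightarrow> step list \<Rightarrow> bool" where
  "never_above P Q \<longleftrightarrow>
     (\<forall>k. count_list (take k P) North \<le> count_list (take k Q) North)"

definition paths_between :: "step list \<Rightarrow> step list \<Rightarrow> step list set" where
  "paths_between P Q =
     {R \<in> lattice_paths (count_list P East) (count_list P North).
        never_above P R \<and> never_above R Q}"

text \<open>The set \<open>N\<^sub>i\<close>: steps are numbered from 1, whereas list positions start at 0.\<close>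

definition north_set :: "step list \<Rightarrow> step list \<Rightarrow> nat \<Rightarrow> nat set" where
  "north_set P Q i =
     {j. \<exists>R\<in>paths_between P Q. 1 \<le> j \<and> j \<le> length R \<and>
           R ! (j - 1) = North \<and> count_list (take j R) North = i}"

definition lattice_path_matroid :: "step list \<Rightarrow> step list \<Rightarrow> nat matroid" where
  "lattice_path_matroid P Q =
     transversal_matroid {1..length P} {1..count_list P North} (north_set P Q)"

definition notch_matroid :: "'a matroid \<Rightarrow> bool" where
  "notch_matroid M \<longleftrightarrow>
     (\<exists>m r P Q. P \<in> lattice_paths m r \<and> Q \<in> lattice_paths m r \<and> never_above P Q \<and>
        (P = replicate m East @ replicate r North \<or>
         m \<ge> 1 \<and> r \<ge> 1 \<and>
         P = replicate (m - 1) East @ [North, East] @ replicate (r - 1) North) \<and>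
        matroid_iso M (lattice_path_matroid P Q))"


section \<open>The excluded minors\<close>

text \<open>The three-wheel and the three-whirl; in \<open>K\<^sub>4\<close>, the hub is the vertex 0 and the rim is the
  triangle on the vertices 1, 2, 3.\<close>

definition wheel3 :: "nat set matroid" where
  "wheel3 = cycle_matroid {e. e \<subseteq> {0..3} \<and> card e = 2}"

definition whirl3 :: "nat set matroid" where
  "whirl3 = relaxation wheel3 {{1, 2}, {2, 3}, {1, 3}}"

datatype A_element = X_elem | Y_elem | A_elem nat | B_elem nat

text \<open>\<open>is_A n M\<close>: \<open>M\<close> is the matroid \<open>A\<^sub>n\<close> on its labelled ground set.\<close>

definition is_A :: "nat \<Rightarrow> A_element matroid \<Rightarrow> bool" where
  "is_A n M \<longleftrightarrow>
     matroid M \<and>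
     ground M = {X_elem, Y_elem} \<union> A_elem ` {2..n} \<union> B_elem ` {2..n} \<and>
     matroid_rank M = n \<and> paving M \<and>
     {H \<in> hyperplanes M. H \<notin> indeps M} =
       {insert X_elem (A_elem ` {2..n}), insert X_elem (B_elem ` {2..n})}"

definition B_matroid :: "nat \<Rightarrow> nat \<Rightarrow> ((nat + nat) + nat) matroid" where
  "B_matroid n k =
     truncation n (direct_sum (direct_sum (uniform_matroid (n - 1) n) (uniform_matroid (n - 1) n))
                              (uniform_matroid (k - 1) k))"

text \<open>The first index of \<open>C\<close> is the rank: \<open>C\<^bsub>n+k,k\<^esub>\<close> is the dual of \<open>B\<^bsub>n,k\<^esub>\<close>.\<close>

definition C_matroid :: "nat \<Rightarrow> nat \<Rightarrow> ((nat + nat) + nat) matroid" where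
  "C_matroid s k = dual_matroid (B_matroid (s - k) k)"

definition D_matroid :: "nat \<Rightarrow> ((nat + nat) + nat) option matroid" where
  "D_matroid n =
     free_extension
       (direct_sum
         (truncation (n - 1)
           (direct_sum (uniform_matroid (n - 2) (n - 1)) (uniform_matroid (n - 2) (n - 1))))
         (uniform_matroid 1 1))"

definition E_matroid :: "nat \<Rightarrow> ((nat + nat) + nat) option matroid" where
  "E_matroid n = dual_matroid (D_matroid n)"

definition F_matroid :: "nat \<Rightarrow> (nat + nat) matroid" where
  "F_matroid n =
     truncation n (direct_sum (uniform_matroid (n - 2) (n - 1)) (uniform_matroid (n - 2) (n - 1)))"

definition G_matroid :: "nat \<Rightarrow> (nat + nat) matroid" where
  "G_matroid n =
     truncation n (direct_sum (uniform_matroid (n - 1) (n + 1)) (uniform_matroid (n - 1) (n + 1)))"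

definition H_matroid :: "nat \<Rightarrow> (nat + nat) matroid" where
  "H_matroid n =
     truncation n (direct_sum (uniform_matroid (n - 2) (n - 1)) (uniform_matroid (n - 1) (n + 1)))"

end

(* A loopless matroid is a notch matroid iff some circuit-hyperplane B of the union of its circuits is
   a member of every pair of incomparable cyclic flats, and the two members of such a pair are
   disjoint or cover the union of the circuits; with loops, B also contains the loops. A matroid of
   this kind is given by bounds on the sizes of the intersections with a chain of sets, together with
   the condition that an independent set does not include B, and such presentations can be read off
   the two lattice paths. The condition is self-dual and minor-closed. In an excluded minor it fails
   for two or three incomparable cyclic flats, while this failure survives no deletion or contraction
   of an element; this determines the sizes and ranks of these flats, and independence then depends
   only on the number of elements in each block of a partition of the ground set. Conversely, the
   single-element minors of a matroid so described have presentations as above. *)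
theory Submission
  imports Defs
begin

section \<open>Rank functions and cyclic flats\<close>

text \<open>The condition concerns only incomparable pairs of cyclic flats, and complementation
  carries these pairs to those of the dual, so half of every case analysis comes from the dual. The
  obstacle is a pair whose union does not span: deleting an element then leaves coloops, and the
  union of the circuits shrinks. Such a gap turns out to be rigid: the flats are disjoint circuits,
  the rank of their union is one below full, and two elements lie outside. It accounts for the two
  direct sums of item (1) and for D_n, dually for E_n. Once all such unions span, in the matroid and
  in its dual, deleting an element outside both flats, or contracting a common one, leaves the
  condition as a statement on the pair itself: one of the two is a circuit-hyperplane, and they are
  disjoint or miss just that element, with the dual alternative for contraction. What can then go
  wrong is an antichain of three flats (wheel, whirl, B, C), a pair without a circuit-hyperplane (F,
  G, H), or a circuit-hyperplane that meets another flat while their union is not everything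
  (A).\<close>

abbreviation cnt :: "'a set \<Rightarrow> 'a set \<Rightarrow> nat" where
  "cnt I X \<equiv> card (I \<inter> X)"

definition cflat :: "'a set \<Rightarrow> ('a set \<Rightarrow> nat) \<Rightarrow> 'a set \<Rightarrow> bool" where
  "cflat E r Z \<longleftrightarrow> Z \<subseteq> E \<and> (\<forall>e\<in>E - Z. r Z < r (insert e Z)) \<and> (\<forall>e\<in>Z. r (Z - {e}) = r Z)"

definition loops :: "'a set \<Rightarrow> ('a set \<Rightarrow> nat) \<Rightarrow> 'a set" where
  "loops E r = {e \<in> E. r {e} = 0}"

text \<open>The union of the circuits contained in \<open>A\<close>, that is, \<open>A\<close>
  without the coloops of its restriction.\<close>

definition cyc :: "('a set \<Rightarrow> nat) \<Rightarrow> 'a set \<Rightarrow> 'a set" where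
  "cyc r A = {e \<in> A. r (A - {e}) = r A}"

definition clos :: "'a set \<Rightarrow> ('a set \<Rightarrow> nat) \<Rightarrow> 'a set \<Rightarrow> 'a set" where
  "clos E r A = {e \<in> E. r (insert e A) = r A}"

text \<open>Rank functions are total, and \<open>e\<close> is ignored rather than forbidden. A minor
  therefore keeps the type of the rank function, and facts such as \<open>ct_du\<close> are
  equations between functions.\<close>

definition dl :: "'a \<Rightarrow> ('a set \<Rightarrow> nat) \<Rightarrow> 'a set \<Rightarrow> nat" where
  "dl e r X = r (X - {e})"

definition ct :: "'a \<Rightarrow> ('a set \<Rightarrow> nat) \<Rightarrow> 'a set \<Rightarrow> nat" where
  "ct e r X = r (insert e X) - r {e}"

text \<open>The rank function of the dual matroid. The subtraction never truncates;
  \<open>du_add\<close> is the form used in computations.\<close>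

definition du :: "'a set \<Rightarrow> ('a set \<Rightarrow> nat) \<Rightarrow> 'a set \<Rightarrow> nat" where
  "du E r X = cnt X E + r (E - X) - r E"

text \<open>Once an incomparable pair exists, \<open>B\<close> is a circuit-hyperplane up to loops
  and coloops, \<open>cyc r E\<close> being the set of non-coloops. The numerical conditions stand
  under the quantifier over incomparable pairs, so a matroid whose cyclic flats form a chain
  satisfies the condition vacuously.\<close>

definition notchy :: "'a set \<Rightarrow> ('a set \<Rightarrow> nat) \<Rightarrow> bool" where
  "notchy E r \<longleftrightarrow> (\<exists>B. \<forall>X Y. cflat E r X \<longrightarrow> cflat E r Y \<longrightarrow> \<not> X \<subseteq> Y \<longrightarrow> \<not> Y \<subseteq> X \<longrightarrow>
     (X = B \<or> Y = B) \<and> r B + 1 = r (cyc r E) \<and> card B = r B + card (loops E r) + 1 \<and>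
     (X \<inter> Y = loops E r \<or> X \<union> Y = cyc r E))"

text \<open>\<open>res\<close> fixes the values on sets that are not subsets of \<open>E\<close>;
  with it, two rank functions on the same ground set can be compared as functions.\<close>

locale rank_matroid =
  fixes E :: "'a set" and r :: "'a set \<Rightarrow> nat"
  assumes fin: "finite E"
    and res: "r (X \<inter> E) = r X"
    and rcard: "r X \<le> cnt X E"
    and mono: "X \<subseteq> Y \<Longrightarrow> r X \<le> r Y"
    and submod: "r (X \<union> Y) + r (X \<inter> Y) \<le> r X + r Y"
begin

lemma finite_sub: "A \<subseteq> E \<Longrightarrow> finite A"
  using fin finite_subset by blast

lemma r_empty [simp]: "r {} = 0"
  using rcard[of "{}"] by simp

lemma r_le_card: "finite X \<Longrightarrow> r X \<le> card X"
  using rcard[of X] card_mono[of X "X \<inter> E"] by simp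

lemma r_Un: "r (X \<union> Y) \<le> r X + r Y"
  using submod[of X Y] by simp

lemma r_singleton: "r {e} \<le> 1"
  using r_le_card[of "{e}"] by simp

lemma r_insert: "r (insert e A) \<le> r A + 1"
  using r_Un[of "{e}" A] r_singleton[of e] by simp

lemma r_insert_ge: "r A \<le> r (insert e A)"
  by (rule mono) auto

lemma r_Diff1: "r A \<le> r (A - {e}) + 1"
  using r_insert[of e "A - {e}"] mono[OF subset_insertI, of A e] by auto

lemma r_Un_card: "finite D \<Longrightarrow> r (A \<union> D) \<le> r A + card D"
  using r_Un[of A D] r_le_card[of D] by simp

lemma r_card_Diff:
  assumes "A \<subseteq> B" "B \<subseteq> E"
  shows "r B \<le> r A + card (B - A)"
proof -
  have "B = A \<union> (B - A)" using assms by auto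
  thus ?thesis using r_Un_card[of "B - A" A] finite_sub[OF assms(2)] by auto
qed

text \<open>Submodularity for \<open>insert e A\<close> and \<open>B\<close>: an element spanned by
  \<open>A\<close> is spanned by every larger set.\<close>

lemma insert_mono_eq:
  assumes "r (insert e A) = r A" "A \<subseteq> B"
  shows "r (insert e B) = r B"
proof (cases "e \<in> B")
  case False
  have "r (insert e A \<union> B) + r (insert e A \<inter> B) \<le> r (insert e A) + r B" by (rule submod)
  moreover have "insert e A \<union> B = insert e B" "insert e A \<inter> B = A" using assms(2) False by auto
  ultimately show ?thesis using assms(1) r_insert_ge[of B e] by simp
qed (simp add: insert_absorb)

lemma Un_eq:
  assumes "finite C" "\<And>c. c \<in> C \<Longrightarrow> r (insert c A) = r A"
  shows "r (A \<union> C) = r A"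
  using assms
proof (induction C rule: finite_induct)
  case (insert c C)
  have "r (insert c (A \<union> C)) = r (A \<union> C)" by (rule insert_mono_eq[of c A]) (use insert in auto)
  thus ?case using insert by simp
qed simp

lemma clos_sub: "clos E r A \<subseteq> E" by (auto simp: clos_def)

lemma clos_ge: "A \<subseteq> E \<Longrightarrow> A \<subseteq> clos E r A"
  by (auto simp: clos_def insert_absorb)

lemma r_clos: assumes "A \<subseteq> E" shows "r (clos E r A) = r A"
proof -
  have "r (A \<union> clos E r A) = r A"
    by (rule Un_eq) (use finite_sub[OF clos_sub] in \<open>auto simp: clos_def\<close>)
  thus ?thesis using clos_ge[OF assms] by (simp add: sup.absorb2)
qed

lemma clos_E_iff: "A \<subseteq> E \<Longrightarrow> clos E r A = E \<longleftrightarrow> r A = r E"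
proof
  assume "A \<subseteq> E" "clos E r A = E" thus "r A = r E" using r_clos by metis
next
  assume a: "A \<subseteq> E" "r A = r E"
  have "r (insert e A) = r A" if "e \<in> E" for e
    using mono[of "insert e A" E] a that r_insert_ge[of A e] by auto
  thus "clos E r A = E" by (auto simp: clos_def)
qed

lemma cflatD: assumes "cflat E r Z"
  shows "Z \<subseteq> E" "\<And>e. e \<in> E \<Longrightarrow> e \<notin> Z \<Longrightarrow> r (insert e Z) = r Z + 1" "\<And>e. e \<in> Z \<Longrightarrow> r (Z - {e}) = r Z"
    "finite Z"
proof -
  show "r (insert e Z) = r Z + 1" if "e \<in> E" "e \<notin> Z" for e
    using assms that r_insert[of e Z] unfolding cflat_def by (metis DiffI Suc_eq_plus1 Suc_leI le_antisym)
qed (use assms finite_sub in \<open>auto simp: cflat_def\<close>)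

lemma clos_cflat_sub: "cflat E r Z \<Longrightarrow> A \<subseteq> Z \<Longrightarrow> clos E r A \<subseteq> Z"
  using cflatD(2)[of Z] insert_mono_eq[of _ A Z] by (force simp: clos_def)

lemma cflat_closed: "cflat E r Z \<Longrightarrow> A \<subseteq> Z \<Longrightarrow> e \<in> E \<Longrightarrow> r (insert e A) = r A \<Longrightarrow> e \<in> Z"
  using clos_cflat_sub[of Z A] by (auto simp: clos_def)

lemma cflat_r_less: "cflat E r X \<Longrightarrow> X \<subset> Y \<Longrightarrow> Y \<subseteq> E \<Longrightarrow> r X < r Y"
proof -
  assume a: "cflat E r X" "X \<subset> Y" "Y \<subseteq> E"
  then obtain e where "e \<in> Y - X" by auto
  thus ?thesis using cflatD(2)[OF a(1), of e] mono[of "insert e X" Y] a by auto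
qed

lemma cyclic_nullity_less:
  assumes "Y \<subseteq> E" "\<And>e. e \<in> Y \<Longrightarrow> r (Y - {e}) = r Y" "X \<subset> Y"
  shows "r Y + card X < r X + card Y"
proof -
  obtain e where e: "e \<in> Y - X" using assms by auto
  have f: "finite Y" using finite_sub assms(1) by auto
  have "r (Y - {e}) \<le> r X + card (Y - {e} - X)" by (rule r_card_Diff) (use assms e in auto)
  moreover have "card (Y - {e} - X) + 1 = card (Y - X)"
    using e f by (metis Diff_insert2 Diff_insert Suc_eq_plus1 card_Suc_Diff1 finite_Diff)
  moreover have "card (Y - X) + card X = card Y"
    using assms(3) f by (metis card_Diff_subset card_mono finite_subset le_add_diff_inverse2 psubset_imp_subset)
  ultimately show ?thesis using assms(2)[of e] e by auto
qed

lemma cflat_nullity_less: "cflat E r Y \<Longrightarrow> X \<subset> Y \<Longrightarrow> r Y + card X < r X + card Y"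
  using cyclic_nullity_less[of Y X] cflatD by blast

lemma cyclic_clos:
  assumes "A \<subseteq> E" "\<And>e. e \<in> A \<Longrightarrow> r (A - {e}) = r A"
  shows "cflat E r (clos E r A)"
  unfolding cflat_def
proof (intro conjI ballI)
  show "clos E r A \<subseteq> E" by (rule clos_sub)
  note rc = r_clos[OF assms(1)] and g = clos_ge[OF assms(1)]
  show "r (clos E r A) < r (insert e (clos E r A))" if "e \<in> E - clos E r A" for e
  proof -
    have "r (insert e A) > r A" using that r_insert_ge[of A e] by (auto simp: clos_def intro: le_neq_trans)
    moreover have "r (insert e A) \<le> r (insert e (clos E r A))" by (rule mono) (use g in auto)
    ultimately show ?thesis using rc by simp
  qed
  show "r (clos E r A - {e}) = r (clos E r A)" if "e \<in> clos E r A" for e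
  proof -
    have "r A \<le> r (clos E r A - {e})"
      using assms(2)[of e] mono[of "A - {e}" "clos E r A - {e}"] mono[of A "clos E r A - {e}"] g
      by (cases "e \<in> A") auto
    thus ?thesis using rc mono[of "clos E r A - {e}" "clos E r A"] by auto
  qed
qed

lemma cyclic_Un:
  assumes "\<And>e. e \<in> A \<Longrightarrow> r (A - {e}) = r A" "\<And>e. e \<in> B \<Longrightarrow> r (B - {e}) = r B" "e \<in> A \<union> B"
  shows "r (A \<union> B - {e}) = r (A \<union> B)"
proof -
  have *: "r (A \<union> B - {e}) = r (A \<union> B)" if "e \<in> A" "r (A - {e}) = r A" for A B
  proof -
    have "insert e (A - {e}) = A" "insert e (A \<union> B - {e}) = A \<union> B" using that by auto
    moreover have "A - {e} \<subseteq> A \<union> B - {e}" by auto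
    ultimately show ?thesis using insert_mono_eq[of e "A - {e}" "A \<union> B - {e}"] that by metis
  qed
  show ?thesis using assms(3) *[of A B] *[of B A] assms by (auto simp: Un_commute)
qed

lemma cflat_join: assumes "cflat E r X" "cflat E r Y" shows "cflat E r (clos E r (X \<union> Y))"
proof (rule cyclic_clos)
  show "X \<union> Y \<subseteq> E" using cflatD(1) assms by auto
  show "r (X \<union> Y - {e}) = r (X \<union> Y)" if "e \<in> X \<union> Y" for e
    by (rule cyclic_Un[OF _ _ that]) (use cflatD(3) assms in blast)+
qed

lemma cyc_sub: "cyc r A \<subseteq> A" by (auto simp: cyc_def)

text \<open>A coloop of \<open>A\<close> remains a coloop of each subset that contains it, so the
  elements of \<open>D\<close> can be removed one at a time, each at the cost of exactly one unit of
  rank.\<close>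

lemma r_Diff_coloops:
  assumes "A \<subseteq> E" "D \<subseteq> A - cyc r A"
  shows "r (A - D) + card D = r A"
proof -
  have "finite D" using assms finite_sub by (meson Diff_subset finite_subset)
  thus ?thesis using assms(2)
  proof (induction D rule: finite_induct)
    case (insert e D)
    have "r (A - insert e D) \<noteq> r (A - D)"
    proof
      assume "r (A - insert e D) = r (A - D)"
      moreover have "insert e (A - insert e D) = A - D" using insert by auto
      ultimately have "r (insert e (A - {e})) = r (A - {e})"
        using insert_mono_eq[of e "A - insert e D" "A - {e}"] by auto
      thus False using insert.prems by (auto simp: cyc_def insert_absorb)
    qed
    moreover have "r (A - D) \<le> r (A - D - {e}) + 1" "r (A - insert e D) \<le> r (A - D)"
      using r_Diff1 mono[of "A - insert e D" "A - D"] by auto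
    moreover have "A - D - {e} = A - insert e D" by auto
    ultimately show ?case using insert by auto
  qed simp
qed

lemma r_cyc: "A \<subseteq> E \<Longrightarrow> r (cyc r A) + card (A - cyc r A) = r A"
  using r_Diff_coloops[of A "A - cyc r A"] cyc_sub[of A] by (simp add: double_diff)

lemma card_cyc: assumes "A \<subseteq> E" shows "r (cyc r A) + card A = r A + card (cyc r A)"
proof -
  have "finite (cyc r A)" using finite_subset[OF cyc_sub finite_sub[OF assms]] .
  hence "card (A - cyc r A) + card (cyc r A) = card A"
    using card_Diff_subset[OF _ cyc_sub] card_mono[OF finite_sub[OF assms] cyc_sub] by simp
  thus ?thesis using r_cyc[OF assms] by simp
qed

lemma cyc_cyclic: assumes "A \<subseteq> E" "e \<in> cyc r A" shows "r (cyc r A - {e}) = r (cyc r A)"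
proof -
  have "r (A - {e}) \<le> r (cyc r A - {e}) + card (A - {e} - (cyc r A - {e}))"
    by (rule r_card_Diff) (use assms cyc_sub in auto)
  moreover have "A - {e} - (cyc r A - {e}) = A - cyc r A" using assms(2) by (auto simp: cyc_def)
  moreover have "r (A - {e}) = r A" using assms(2) by (auto simp: cyc_def)
  ultimately show ?thesis using r_cyc[OF assms(1)] mono[of "cyc r A - {e}" "cyc r A"] by auto
qed

text \<open>The ranks of a flat and of its cyclic part differ exactly by the number of coloops, and
  this count leaves no room for an element outside the cyclic part to be spanned by it.\<close>

lemma cflat_cyc:
  assumes "A \<subseteq> E" "\<And>e. e \<in> E \<Longrightarrow> e \<notin> A \<Longrightarrow> r A < r (insert e A)"
  shows "cflat E r (cyc r A)"
  unfolding cflat_def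
proof (intro conjI ballI)
  show "cyc r A \<subseteq> E" using assms(1) cyc_sub by auto
  show "r (cyc r A - {e}) = r (cyc r A)" if "e \<in> cyc r A" for e using cyc_cyclic assms(1) that by auto
  show "r (cyc r A) < r (insert f (cyc r A))" if f: "f \<in> E - cyc r A" for f
  proof (cases "f \<in> A")
    case True
    have "r (A - (A - cyc r A - {f})) + card (A - cyc r A - {f}) = r A"
      by (rule r_Diff_coloops) (use assms in auto)
    moreover have "A - (A - cyc r A - {f}) = insert f (cyc r A)" using True cyc_sub[of A] by auto
    moreover have "card (A - cyc r A - {f}) + 1 = card (A - cyc r A)"
      using f True finite_sub[OF assms(1)] by (metis DiffD2 DiffI Suc_eq_plus1 card_Suc_Diff1 finite_Diff)
    ultimately show ?thesis using r_cyc[OF assms(1)] by auto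
  next
    case False
    have "r (insert f A) \<le> r (insert f (cyc r A)) + card (insert f A - insert f (cyc r A))"
      by (rule r_card_Diff) (use assms f cyc_sub[of A] in auto)
    moreover have "insert f A - insert f (cyc r A) = A - cyc r A" using False by auto
    ultimately show ?thesis using assms(2)[of f] f False r_cyc[OF assms(1)] by auto
  qed
qed

lemma loops_sub: "cflat E r Z \<Longrightarrow> loops E r \<subseteq> Z"
  using cflat_closed[of Z "{}"] by (auto simp: loops_def)

lemma cflat_sub_cyc: "cflat E r Z \<Longrightarrow> A \<subseteq> E \<Longrightarrow> Z \<subseteq> A \<Longrightarrow> Z \<subseteq> cyc r A"
proof
  fix e assume a: "cflat E r Z" "A \<subseteq> E" "Z \<subseteq> A" "e \<in> Z"
  have "r (insert e (A - {e})) = r (A - {e})"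
    using insert_mono_eq[of e "Z - {e}" "A - {e}"] cflatD(3)[OF a(1,4)] a by (auto simp: insert_absorb)
  thus "e \<in> cyc r A" using a by (auto simp: cyc_def insert_absorb)
qed

lemma cflat_top: "cflat E r (cyc r E)"
  by (rule cflat_cyc) auto

lemma cflat_loops: "cflat E r (loops E r)"
proof -
  have "cflat E r (clos E r {})" by (rule cyclic_clos) auto
  moreover have "clos E r {} = loops E r" by (auto simp: clos_def loops_def)
  ultimately show ?thesis by simp
qed

lemma r_loops: "r (loops E r) = 0"
proof -
  have "r ({} \<union> loops E r) = r {}"
    by (rule Un_eq) (use finite_sub[of "loops E r"] in \<open>auto simp: loops_def\<close>)
  thus ?thesis by simp
qed

lemma indep_mono: assumes "r B = card B" "A \<subseteq> B" "finite B" shows "r A = card A"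
proof -
  have "r B \<le> r A + card (B - A)" using r_Un_card[of "B - A" A] assms
    by (metis Diff_partition finite_Diff)
  moreover have "card (B - A) + card A = card B"
    using assms by (metis card_Diff_subset card_mono finite_subset le_add_diff_inverse2)
  ultimately show ?thesis using r_le_card[of A] assms finite_subset by (metis add.commute add_le_cancel_left antisym)
qed

lemma basis_exists: assumes "A \<subseteq> E" obtains I where "I \<subseteq> A" "r I = card I" "r I = r A"
proof -
  have "finite A" using assms finite_sub by auto
  hence "\<exists>I\<subseteq>A. r I = card I \<and> r I = r A"
  proof (induction A rule: finite_induct)
    case (insert e A)
    then obtain I where I: "I \<subseteq> A" "r I = card I" "r I = r A" by auto
    have fI: "finite I" using I insert finite_subset by blast
    show ?case
    proof (cases "r (insert e A) = r A")
      case True thus ?thesis using I by (intro exI[of _ I]) auto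
    next
      case False
      have "r (insert e I) \<noteq> r I"
      proof
        assume "r (insert e I) = r I"
        thus False using insert_mono_eq[of e I A] I False by auto
      qed
      hence "r (insert e I) = card (insert e I)" "r (insert e A) = r (insert e I)"
        using r_insert[of e I] r_insert_ge[of I e] r_insert[of e A] r_insert_ge[of A e] I fI insert.hyps False
        by (auto simp: card_insert_if)
      thus ?thesis using I by (intro exI[of _ "insert e I"]) auto
    qed
  qed simp
  thus thesis using that by auto
qed

text \<open>The union of the circuits inside \<open>I\<close> has a cyclic flat as its closure, and
  the bound for this one flat already makes the union independent, hence empty. So the cyclic flats
  and their ranks determine the matroid.\<close>

lemma indep_cflats:
  assumes "I \<subseteq> E"
  shows "r I = card I \<longleftrightarrow> (\<forall>Z. cflat E r Z \<longrightarrow> cnt I Z \<le> r Z)"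
proof
  assume i: "r I = card I"
  show "\<forall>Z. cflat E r Z \<longrightarrow> cnt I Z \<le> r Z"
  proof (intro allI impI)
    fix Z assume "cflat E r Z"
    have "r (I \<inter> Z) = cnt I Z" using indep_mono[OF i] finite_sub[OF assms] by auto
    thus "cnt I Z \<le> r Z" using mono[of "I \<inter> Z" Z] by auto
  qed
next
  assume a: "\<forall>Z. cflat E r Z \<longrightarrow> cnt I Z \<le> r Z"
  define C where "C = cyc r I"
  have "cflat E r (clos E r C)" unfolding C_def
    by (rule cyclic_clos) (use assms cyc_sub cyc_cyclic in blast)+
  hence "card (I \<inter> clos E r C) \<le> r C"
    using a r_clos[of C] assms cyc_sub[of I] unfolding C_def by (metis subset_trans)
  moreover have "C \<subseteq> I \<inter> clos E r C" using clos_ge[of C] cyc_sub[of I] assms unfolding C_def by auto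
  moreover have "finite I" using finite_sub assms by auto
  ultimately have "card C \<le> r C" by (meson card_mono finite_Int order_trans)
  hence "card I \<le> r I" using card_cyc[OF assms] unfolding C_def by simp
  thus "r I = card I" using r_le_card[OF \<open>finite I\<close>] by simp
qed

section \<open>Deletion, duality and contraction of rank functions\<close>

lemma rank_matroid_dl: "rank_matroid (E - {e}) (dl e r)"
proof (rule rank_matroid.intro)
  show "finite (E - {e})" using fin by simp
  show "dl e r (X \<inter> (E - {e})) = dl e r X" for X
  proof -
    have "X \<inter> (E - {e}) - {e} = (X - {e}) \<inter> E" by auto
    thus ?thesis unfolding dl_def by (simp add: res)
  qed
  show "dl e r X \<le> cnt X (E - {e})" for X
  proof -
    have "X \<inter> (E - {e}) = (X - {e}) \<inter> E" by auto
    thus ?thesis unfolding dl_def by (simp add: rcard)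
  qed
  show "dl e r X \<le> dl e r Y" if "X \<subseteq> Y" for X Y
    unfolding dl_def using that by (intro mono) auto
  show "dl e r (X \<union> Y) + dl e r (X \<inter> Y) \<le> dl e r X + dl e r Y" for X Y
  proof -
    have "X \<union> Y - {e} = (X - {e}) \<union> (Y - {e})" "X \<inter> Y - {e} = (X - {e}) \<inter> (Y - {e})" by auto
    thus ?thesis unfolding dl_def using submod[of "X - {e}" "Y - {e}"] by simp
  qed
qed

lemma du_add: "du E r X + r E = cnt X E + r (E - X)"
proof -
  have "r E \<le> r (E - X) + card (E - (E - X))" by (rule r_card_Diff) auto
  moreover have "E - (E - X) = X \<inter> E" by auto
  ultimately show ?thesis unfolding du_def by auto
qed

lemma rank_matroid_du: "rank_matroid E (du E r)"
proof (rule rank_matroid.intro)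
  show "finite E" by (rule fin)
  show "du E r (X \<inter> E) = du E r X" for X
    unfolding du_def by (simp add: Diff_Int)
  show "du E r X \<le> cnt X E" for X
    using du_add[of X] mono[of "E - X" E] by auto
  show "du E r X \<le> du E r Y" if "X \<subseteq> Y" for X Y
  proof -
    have "r (E - X) \<le> r (E - Y) + card ((E - X) - (E - Y))" by (rule r_card_Diff) (use that in auto)
    moreover have "(E - X) - (E - Y) = (Y \<inter> E) - (X \<inter> E)" by auto
    moreover have "card ((Y \<inter> E) - (X \<inter> E)) + cnt X E = cnt Y E"
      using card_Diff_subset[of "X \<inter> E" "Y \<inter> E"] card_mono[of "Y \<inter> E" "X \<inter> E"] fin that by fastforce
    ultimately show ?thesis using du_add[of X] du_add[of Y] by auto
  qed
  show "du E r (X \<union> Y) + du E r (X \<inter> Y) \<le> du E r X + du E r Y" for X Y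
  proof -
    have "card ((X \<union> Y) \<inter> E) + card ((X \<inter> Y) \<inter> E) = cnt X E + cnt Y E"
      using card_Un_Int[of "X \<inter> E" "Y \<inter> E"] fin
      by (simp add: Int_Un_distrib2 inf_assoc inf_left_commute)
    moreover have "r (E - (X \<union> Y)) + r (E - (X \<inter> Y)) \<le> r (E - X) + r (E - Y)"
      using submod[of "E - X" "E - Y"] by (simp add: Diff_Un Diff_Int add.commute)
    ultimately show ?thesis
      using du_add[of X] du_add[of Y] du_add[of "X \<union> Y"] du_add[of "X \<inter> Y"] by auto
  qed
qed

lemma du_du: "du E (du E r) = r"
proof
  fix X
  interpret D: rank_matroid E "du E r" by (rule rank_matroid_du)
  have 1: "E - (E - X) = X \<inter> E" "(E - X) \<inter> E = E - X" by auto
  have "cnt X E + card (E - X) = card E"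
    using fin card_Diff_subset_Int[of E X] card_mono[of E "X \<inter> E"] by (simp add: Int_commute)
  thus "du E (du E r) X = r X"
    using D.du_add[of X] du_add[of "E - X"] du_add[of E] 1 res[of X] by auto
qed

text \<open>Complementation exchanges the two halves of the definition: being a flat becomes being
  cyclic, and conversely.\<close>

lemma cflat_du: assumes "Z \<subseteq> E" shows "cflat E (du E r) (E - Z) \<longleftrightarrow> cflat E r Z"
proof -
  have 1: "E - (E - Z) = Z" using assms by auto
  have fZ: "finite Z" using assms finite_sub by auto
  have 2: "du E r (E - Z) < du E r (insert e (E - Z)) \<longleftrightarrow> r (Z - {e}) = r Z" if "e \<in> Z" for e
  proof -
    have "E - insert e (E - Z) = Z - {e}" "insert e (E - Z) \<inter> E = insert e (E - Z)" "(E - Z) \<inter> E = E - Z"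
      using assms that by auto
    thus ?thesis using du_add[of "E - Z"] du_add[of "insert e (E - Z)"] 1 that fin
      mono[of "Z - {e}" Z] r_Diff1[of Z e] by (auto simp: card_insert_if)
  qed
  have 3: "du E r (E - Z - {e}) = du E r (E - Z) \<longleftrightarrow> r Z < r (insert e Z)" if "e \<in> E - Z" for e
  proof -
    have *: "E - (E - Z - {e}) = insert e Z" "(E - Z - {e}) \<inter> E = E - Z - {e}" "(E - Z) \<inter> E = E - Z"
      using assms that by auto
    have "card (E - Z) = card (E - Z - {e}) + 1" using that fin by (metis Suc_eq_plus1 card_Suc_Diff1 finite_Diff)
    thus ?thesis using du_add[of "E - Z"] du_add[of "E - Z - {e}"] 1 * r_insert[of e Z] r_insert_ge[of Z e] by auto
  qed
  show ?thesis unfolding cflat_def using 1 2 3 assms by auto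
qed

lemma loops_du: "loops E (du E r) = E - cyc r E"
proof -
  have "du E r {e} = 0 \<longleftrightarrow> r (E - {e}) \<noteq> r E" if "e \<in> E" for e
    using du_add[of "{e}"] that r_Diff1[of E e] mono[of "E - {e}" E] by auto
  thus ?thesis by (auto simp: loops_def cyc_def)
qed

lemma cyc_du: "cyc (du E r) E = E - loops E r"
proof -
  interpret D: rank_matroid E "du E r" by (rule rank_matroid_du)
  show ?thesis using D.loops_du du_du by (auto simp: loops_def cyc_def)
qed

lemma card_compl: assumes "X \<subseteq> E" shows "card X + card (E - X) = card E"
  using card_Diff_subset[OF finite_sub[OF assms] assms] card_mono[OF fin assms] by simp

text \<open>The complement of \<open>B\<close> is the new witness. Loops and coloops change places,
  and so do the two alternatives for an incomparable pair, meeting in the loops and covering the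
  non-coloops.\<close>

lemma notchy_du_imp: assumes "notchy E r" shows "notchy E (du E r)"
proof -
  interpret D: rank_matroid E "du E r" by (rule rank_matroid_du)
  obtain B where B: "\<forall>X Y. cflat E r X \<longrightarrow> cflat E r Y \<longrightarrow> \<not> X \<subseteq> Y \<longrightarrow> \<not> Y \<subseteq> X \<longrightarrow>
     (X = B \<or> Y = B) \<and> r B + 1 = r (cyc r E) \<and> card B = r B + card (loops E r) + 1 \<and>
     (X \<inter> Y = loops E r \<or> X \<union> Y = cyc r E)"
    using assms unfolding notchy_def by (rule exE)
  have "(X = E - B \<or> Y = E - B) \<and> du E r (E - B) + 1 = du E r (cyc (du E r) E) \<and>
    card (E - B) = du E r (E - B) + card (loops E (du E r)) + 1 \<and>
     (X \<inter> Y = loops E (du E r) \<or> X \<union> Y = cyc (du E r) E)"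
    if c: "cflat E (du E r) X" "cflat E (du E r) Y" and n: "\<not> X \<subseteq> Y" "\<not> Y \<subseteq> X" for X Y
  proof -
    have s: "X \<subseteq> E" "Y \<subseteq> E" using c D.cflatD by auto
    have XY: "E - (E - X) = X" "E - (E - Y) = Y" using s by auto
    have "cflat E r (E - X)" "cflat E r (E - Y)"
      using c cflat_du[of "E - X"] cflat_du[of "E - Y"] XY by auto
    moreover have "\<not> E - X \<subseteq> E - Y" "\<not> E - Y \<subseteq> E - X" using n s by auto
    ultimately have b: "(E - X = B \<or> E - Y = B) \<and> r B + 1 = r (cyc r E) \<and>
      card B = r B + card (loops E r) + 1 \<and> ((E - X) \<inter> (E - Y) = loops E r \<or> (E - X) \<union> (E - Y) = cyc r E)"
      by (rule B[rule_format])
    hence BE: "B \<subseteq> E" by auto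
    have L: "loops E r \<subseteq> E" "cyc r E \<subseteq> E" by (auto simp: loops_def cyc_def)
    have "E - (E - B) = B" "(E - B) \<inter> E = E - B" "E - (E - loops E r) = loops E r"
      "(E - loops E r) \<inter> E = E - loops E r" using BE L by auto
    hence "du E r (E - B) + r E = card (E - B) + r B"
      "du E r (E - loops E r) + r E = card (E - loops E r) + r (loops E r)"
      using du_add[of "E - B"] du_add[of "E - loops E r"] by auto
    moreover note card_compl[OF BE] card_compl[OF L(1)] r_cyc[of E] r_loops b
    ultimately have "du E r (E - B) + 1 = du E r (E - loops E r)"
      "card (E - B) = du E r (E - B) + card (E - cyc r E) + 1" by auto
    moreover have "X = E - B \<or> Y = E - B" "X \<inter> Y = E - cyc r E \<or> X \<union> Y = E - loops E r"
      using b XY L s by blast+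
    ultimately show ?thesis unfolding loops_du cyc_du by auto
  qed
  thus ?thesis unfolding notchy_def by (intro exI[of _ "E - B"] allI impI)
qed

lemma notchy_du: "notchy E (du E r) \<longleftrightarrow> notchy E r"
  using notchy_du_imp rank_matroid.notchy_du_imp[OF rank_matroid_du] du_du by auto

text \<open>Contraction is deletion in the dual, here as an equation between functions, so that
  \<open>notchy_ct\<close> can transfer the condition.\<close>

lemma ct_du: assumes "e \<in> E" shows "du (E - {e}) (dl e (du E r)) = ct e r"
proof
  fix X
  interpret D: rank_matroid E "du E r" by (rule rank_matroid_du)
  interpret DD: rank_matroid "E - {e}" "dl e (du E r)" by (rule D.rank_matroid_dl)
  have a: "X \<inter> (E - {e}) \<inter> (E - {e}) = X \<inter> (E - {e})" by auto
  have s: "E - {e} - X - {e} = E - insert e X" "E - {e} - {e} = E - {e}" "(E - insert e X) \<inter> E = E - insert e X"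
    "(E - {e}) \<inter> E = E - {e}" "E - (E - insert e X) = insert e X \<inter> E" "E - (E - {e}) = {e}" using assms by auto
  have c: "card (E - insert e X) + cnt X (E - {e}) = card (E - {e})"
  proof -
    have "E - insert e X = (E - {e}) - (X \<inter> (E - {e}))" by auto
    thus ?thesis using card_Diff_subset[of "X \<inter> (E - {e})" "E - {e}"] fin
      card_mono[of "E - {e}" "X \<inter> (E - {e})"] by simp
  qed
  have "r {e} \<le> r (insert e X)" by (rule mono) auto
  thus "du (E - {e}) (dl e (du E r)) X = ct e r X"
    using DD.du_add[of X] du_add[of "E - insert e X"] du_add[of "E - {e}"] c s res[of "insert e X"]
    unfolding ct_def dl_def by auto
qed

lemma rank_matroid_ct: "e \<in> E \<Longrightarrow> rank_matroid (E - {e}) (ct e r)"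
  using ct_du[of e] rank_matroid.rank_matroid_du[OF rank_matroid.rank_matroid_dl[OF rank_matroid_du, of e]] by metis

lemma notchy_ct: "e \<in> E \<Longrightarrow> notchy (E - {e}) (ct e r) \<longleftrightarrow> notchy (E - {e}) (dl e (du E r))"
  using rank_matroid.notchy_du[OF rank_matroid.rank_matroid_dl[OF rank_matroid_du, of e]] ct_du[of e] by metis

end

lemma (in rank_matroid) loops_dl: "loops (E - {e}) (dl e r) = loops E r - {e}"
proof -
  have "{f} - {e} = {f}" if "f \<noteq> e" for f using that by auto
  thus ?thesis unfolding loops_def dl_def by auto
qed

lemma (in rank_matroid) dl_notin: "e \<notin> X \<Longrightarrow> dl e r X = r X"
  by (simp add: dl_def)

text \<open>Taking closures embeds the cyclic flats of the deletion into those of the original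
  matroid and preserves incomparability, because the closure adds at most \<open>e\<close>.\<close>

lemma (in rank_matroid) dl_cflatD:
  assumes "cflat (E - {e}) (dl e r) Z"
  shows "cflat E r (clos E r Z)" "clos E r Z - {e} = Z" "e \<notin> Z" "Z \<subseteq> E"
    "r (clos E r Z) = r Z"
proof -
  interpret D: rank_matroid "E - {e}" "dl e r" by (rule rank_matroid_dl)
  show e: "e \<notin> Z" and s: "Z \<subseteq> E" using D.cflatD(1)[OF assms] by auto
  have n: "dl e r Z = r Z" "\<And>x. dl e r (Z - {x}) = r (Z - {x})" using e by (auto simp: dl_notin)
  show "cflat E r (clos E r Z)"
  proof (rule cyclic_clos)
    show "r (Z - {x}) = r Z" if "x \<in> Z" for x using D.cflatD(3)[OF assms that] n by simp
  qed (rule s)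
  show "clos E r Z - {e} = Z"
  proof
    show "Z \<subseteq> clos E r Z - {e}" using clos_ge[OF s] e by auto
    show "clos E r Z - {e} \<subseteq> Z"
    proof
      fix x assume x: "x \<in> clos E r Z - {e}"
      hence xE: "x \<in> E - {e}" and xr: "r (insert x Z) = r Z" by (auto simp: clos_def)
      have "dl e r (insert x Z) = r (insert x Z)" using e x by (intro dl_notin) auto
      thus "x \<in> Z" using D.cflatD(2)[OF assms xE] xr n(1) by fastforce
    qed
  qed
  show "r (clos E r Z) = r Z" by (rule r_clos[OF s])
qed

lemma (in rank_matroid) cflat_dl:
  assumes "cflat E r Z" "e \<notin> Z" shows "cflat (E - {e}) (dl e r) Z"
  unfolding cflat_def
proof (intro conjI ballI)
  show "Z \<subseteq> E - {e}" using cflatD(1)[OF assms(1)] assms(2) by auto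
  show "dl e r Z < dl e r (insert f Z)" if "f \<in> E - {e} - Z" for f
    using cflatD(2)[OF assms(1), of f] that assms(2) dl_notin[of e Z] dl_notin[of e "insert f Z"] by auto
  show "dl e r (Z - {f}) = dl e r Z" if "f \<in> Z" for f
    using cflatD(3)[OF assms(1) that] assms(2) dl_notin[of e Z] dl_notin[of e "Z - {f}"] by simp
qed

text \<open>Incomparable cyclic flats of the deletion have incomparable closures, to which the
  hypothesis applies; the witness becomes \<open>B - {e}\<close>. The work lies in showing that the
  rank and the nullity required of the witness survive.\<close>

lemma (in rank_matroid) notchy_dl:
  assumes "notchy E r" shows "notchy (E - {e}) (dl e r)"
proof -
  interpret D: rank_matroid "E - {e}" "dl e r" by (rule rank_matroid_dl)
  define L where "L = loops E r"
  define T where "T = cyc r E"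
  define T' where "T' = cyc (dl e r) (E - {e})"
  obtain B where B: "\<forall>X Y. cflat E r X \<longrightarrow> cflat E r Y \<longrightarrow> \<not> X \<subseteq> Y \<longrightarrow> \<not> Y \<subseteq> X \<longrightarrow>
     (X = B \<or> Y = B) \<and> r B + 1 = r T \<and> card B = r B + card L + 1 \<and>
     (X \<inter> Y = L \<or> X \<union> Y = T)"
    using assms unfolding notchy_def L_def T_def by (rule exE)
  have cfT: "cflat E r T" unfolding T_def by (rule cflat_top)
  have cfT': "cflat (E - {e}) (dl e r) T'" unfolding T'_def by (rule D.cflat_top)
  note T'D = dl_cflatD[OF cfT']
  have rT': "dl e r T' = r T'" using T'D(3) by (rule dl_notin)
  have T'T: "T' \<subseteq> T - {e}"
    using cflat_sub_cyc[OF T'D(1) subset_refl] clos_sub[of T'] T'D(2,3) unfolding T_def by blast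
  have LL: "loops (E - {e}) (dl e r) = L - {e}" unfolding L_def by (rule loops_dl)
  have L0: "r L = 0" unfolding L_def by (rule r_loops)
  have main: "dl e r (B - {e}) + 1 = dl e r T' \<and> card (B - {e}) = dl e r (B - {e}) + card (L - {e}) + 1
      \<and> T' = T - {e}"
    if X: "cflat (E - {e}) (dl e r) X" and Y: "cflat (E - {e}) (dl e r) Y"
      and n: "\<not> X \<subseteq> Y" "\<not> Y \<subseteq> X" and YB: "clos E r Y = B"
      and b: "r B + 1 = r T" "card B = r B + card L + 1" for X Y
  proof -
    note XD = dl_cflatD[OF X] and YD = dl_cflatD[OF Y]
    have BY: "B - {e} = Y" using YD(2) YB by simp
    have rY: "dl e r Y = r B" "r Y = r B" using YD(3,5) YB by (auto simp: dl_notin)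
    have sub: "X \<subseteq> T'" "Y \<subseteq> T'"
      using D.cflat_sub_cyc[OF X subset_refl] D.cflat_sub_cyc[OF Y subset_refl] D.cflatD(1)[OF X] D.cflatD(1)[OF Y]
      unfolding T'_def by auto
    \<comment> \<open>Its incomparable partner keeps \<open>Y\<close> strictly below the top flat,
      so the top loses no rank; hence it loses no element besides \<open>e\<close>.\<close>
    have "dl e r Y < dl e r T'" by (rule D.cflat_r_less[OF Y]) (use sub n D.cflatD(1)[OF cfT'] in auto)
    hence "r T \<le> r T'" using rY b rT' by simp
    moreover have "r T' \<le> r T" by (rule mono) (use T'T in auto)
    ultimately have rTT: "r T' = r T" by simp
    have T'e: "T' = T - {e}"
    proof
      show "T - {e} \<subseteq> T'"
      proof
        fix f assume f: "f \<in> T - {e}"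
        have "r (insert f T') \<le> r T" by (rule mono) (use f T'T in auto)
        moreover have "dl e r (insert f T') = r (insert f T')" using f T'D(3) by (intro dl_notin) auto
        ultimately show "f \<in> T'" using D.cflatD(2)[OF cfT', of f] f cflatD(1)[OF cfT] rT' rTT by fastforce
      qed
    qed (rule T'T)
    have LY: "L - {e} \<subseteq> Y" using D.loops_sub[OF Y] LL by simp
    have LX: "L - {e} \<subseteq> X" using D.loops_sub[OF X] LL by simp
    have "card (B - {e}) = r B + card (L - {e}) + 1"
    proof (cases "e \<in> B")
      case False
      moreover have "L \<subseteq> B" using loops_sub[of B] YD(1) YB unfolding L_def by simp
      ultimately have "B - {e} = B" "L - {e} = L" by auto
      thus ?thesis using b by simp
    next
      case True
      have fB: "finite B" using YD(1) YB cflatD(4) by blast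
      have cB: "card (B - {e}) + 1 = card B" using True fB by (metis Suc_eq_plus1 card_Suc_Diff1)
      have fL: "finite L" unfolding L_def by (rule finite_sub) (auto simp: loops_def)
      show ?thesis
      proof (cases "e \<in> L")
        case True
        have "card (L - {e}) + 1 = card L" using True fL by (metis Suc_eq_plus1 card_Suc_Diff1)
        thus ?thesis using cB b by simp
      next
        case False
        hence le: "L - {e} = L" by auto
        have "dl e r L = r L" using False by (rule dl_notin)
        \<comment> \<open>A non-loop \<open>e\<close> of \<open>B\<close> cannot occur: the flat
          \<open>Y = B - {e}\<close> would have the same nullity as the set \<open>L\<close> of
          loops, although it is cyclic and strictly larger.\<close>
        moreover have "L \<subset> Y" using LY LX n le by auto
        hence "dl e r Y + card L < dl e r L + card Y" by (rule D.cflat_nullity_less[OF Y])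
        ultimately show ?thesis using rY cB b L0 BY by simp
      qed
    qed
    thus ?thesis using BY rY b rT' rTT T'e by simp
  qed
  have fin: "(X = B - {e} \<or> Y = B - {e}) \<and> dl e r (B - {e}) + 1 = dl e r T' \<and>
     card (B - {e}) = dl e r (B - {e}) + card (L - {e}) + 1 \<and> (X \<inter> Y = L - {e} \<or> X \<union> Y = T')"
    if X: "cflat (E - {e}) (dl e r) X" and Y: "cflat (E - {e}) (dl e r) Y"
      and n: "\<not> X \<subseteq> Y" "\<not> Y \<subseteq> X" for X Y
  proof -
    note XD = dl_cflatD[OF X] and YD = dl_cflatD[OF Y]
    have "\<not> clos E r X \<subseteq> clos E r Y" "\<not> clos E r Y \<subseteq> clos E r X" using n XD(2) YD(2) by blast+
    hence b: "clos E r X = B \<or> clos E r Y = B" "r B + 1 = r T" "card B = r B + card L + 1"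
      "clos E r X \<inter> clos E r Y = L \<or> clos E r X \<union> clos E r Y = T"
      using B XD(1) YD(1) by blast+
    have m: "dl e r (B - {e}) + 1 = dl e r T' \<and> card (B - {e}) = dl e r (B - {e}) + card (L - {e}) + 1
      \<and> T' = T - {e}"
      using b(1) main[OF X Y n _ b(2,3)] main[OF Y X n(2,1) _ b(2,3)] by blast
    have "X = B - {e} \<or> Y = B - {e}" using b(1) XD(2) YD(2) by blast
    moreover have "X \<inter> Y = L - {e} \<or> X \<union> Y = T - {e}" using b(4) XD(2) YD(2) by blast
    ultimately show ?thesis using m by simp
  qed
  show ?thesis unfolding notchy_def LL T'_def[symmetric]
    by (intro exI[of _ "B - {e}"] allI impI) (rule fin)
qed

definition dls :: "'a set \<Rightarrow> ('a set \<Rightarrow> nat) \<Rightarrow> 'a set \<Rightarrow> nat" where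
  "dls X r A = r (A - X)"

lemma dls_insert: "dls (insert e X) r = dl e (dls X r)"
  unfolding dls_def dl_def by (auto intro!: ext arg_cong[of _ _ r])

lemma dls_empty [simp]: "dls {} r = r"
  by (rule ext) (simp add: dls_def)

lemma rank_matroid_dls:
  assumes "finite X" "rank_matroid E r"
  shows "rank_matroid (E - X) (dls X r) \<and> (notchy E r \<longrightarrow> notchy (E - X) (dls X r))"
  using assms(1)
proof (induction X rule: finite_induct)
  case (insert e X)
  then interpret D: rank_matroid "E - X" "dls X r" by simp
  have "E - insert e X = E - X - {e}" by auto
  thus ?case using D.rank_matroid_dl[of e] D.notchy_dl[of e] insert by (simp add: dls_insert)
qed (use assms in simp)

section \<open>Matroids given by independent sets, and their rank functions\<close>

lemma matroidD:
  assumes "matroid M"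
  shows "finite (ground M)" "I \<in> indeps M \<Longrightarrow> I \<subseteq> ground M" "{} \<in> indeps M"
    "I \<in> indeps M \<Longrightarrow> J \<subseteq> I \<Longrightarrow> J \<in> indeps M"
    "I \<in> indeps M \<Longrightarrow> J \<in> indeps M \<Longrightarrow> card I < card J \<Longrightarrow> \<exists>e\<in>J - I. insert e I \<in> indeps M"
    "I \<in> indeps M \<Longrightarrow> finite I" "finite (indeps M)"
proof -
  show 1: "finite (ground M)" "I \<in> indeps M \<Longrightarrow> I \<subseteq> ground M" "{} \<in> indeps M"
    "I \<in> indeps M \<Longrightarrow> J \<subseteq> I \<Longrightarrow> J \<in> indeps M"
    "I \<in> indeps M \<Longrightarrow> J \<in> indeps M \<Longrightarrow> card I < card J \<Longrightarrow> \<exists>e\<in>J - I. insert e I \<in> indeps M" for I J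
    using assms unfolding matroid_def by blast+
  show "I \<in> indeps M \<Longrightarrow> finite I" by (rule finite_subset[OF 1(2) 1(1)])
  have "indeps M \<subseteq> Pow (ground M)" using 1(2) by auto
  thus "finite (indeps M)" by (rule finite_subset) (simp add: 1(1))
qed

lemma rank_of_ge: "matroid M \<Longrightarrow> I \<in> indeps M \<Longrightarrow> I \<subseteq> X \<Longrightarrow> card I \<le> rank_of M X"
  unfolding rank_of_def by (rule Max_ge) (simp_all add: matroidD(7))

lemma rank_of_obtain:
  assumes "matroid M" obtains I where "I \<in> indeps M" "I \<subseteq> X" "card I = rank_of M X"
proof -
  have "rank_of M X \<in> card ` {I \<in> indeps M. I \<subseteq> X}"
    unfolding rank_of_def by (rule Max_in) (use matroidD(7,3)[OF assms] in auto)
  thus thesis using that by auto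
qed

lemma indep_extend:
  assumes M: "matroid M" and "I \<in> indeps M" "I \<subseteq> X"
  obtains J where "J \<in> indeps M" "I \<subseteq> J" "J \<subseteq> X" "card J = rank_of M X"
proof -
  have "\<exists>J. J \<in> indeps M \<and> I \<subseteq> J \<and> J \<subseteq> X \<and> card J = rank_of M X"
    using assms(2,3)
  proof (induction "rank_of M X - card I" arbitrary: I rule: less_induct)
    case less
    show ?case
    proof (cases "card I < rank_of M X")
      case True
      obtain J where J: "J \<in> indeps M" "J \<subseteq> X" "card J = rank_of M X" using rank_of_obtain[OF M] by blast
      then obtain e where e: "e \<in> J - I" "insert e I \<in> indeps M"
        using matroidD(5)[OF M less.prems(1) J(1)] True by auto
      have "card (insert e I) = card I + 1" using e matroidD(6)[OF M less.prems(1)] by simp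
      then obtain K where "K \<in> indeps M" "insert e I \<subseteq> K" "K \<subseteq> X" "card K = rank_of M X"
        using less.hyps[of "insert e I"] e J less.prems True by force
      thus ?thesis by blast
    next
      case False
      thus ?thesis using rank_of_ge[OF M less.prems] less.prems by (intro exI[of _ I]) simp
    qed
  qed
  thus thesis using that by blast
qed

lemma rank_matroid_rank_of: assumes M: "matroid M" shows "rank_matroid (ground M) (rank_of M)"
proof (rule rank_matroid.intro)
  show "finite (ground M)" by (rule matroidD(1)[OF M])
  show 1: "rank_of M (X \<inter> ground M) = rank_of M X" for X
  proof -
    have "{I \<in> indeps M. I \<subseteq> X \<inter> ground M} = {I \<in> indeps M. I \<subseteq> X}" using matroidD(2)[OF M] by auto
    thus ?thesis unfolding rank_of_def by simp
  qed
  show "rank_of M X \<le> card (X \<inter> ground M)" for X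
  proof -
    obtain I where I: "I \<in> indeps M" "I \<subseteq> X \<inter> ground M" "card I = rank_of M (X \<inter> ground M)"
      using rank_of_obtain[OF M] by blast
    have "card I \<le> card (X \<inter> ground M)" by (rule card_mono) (use I(2) matroidD(1)[OF M] in auto)
    thus ?thesis using I 1 by simp
  qed
  show "rank_of M X \<le> rank_of M Y" if "X \<subseteq> Y" for X Y
  proof -
    obtain I where I: "I \<in> indeps M" "I \<subseteq> X" "card I = rank_of M X" using rank_of_obtain[OF M] by blast
    show ?thesis using rank_of_ge[OF M I(1), of Y] I that by auto
  qed
  show "rank_of M (X \<union> Y) + rank_of M (X \<inter> Y) \<le> rank_of M X + rank_of M Y" for X Y
  proof -
    obtain I where I: "I \<in> indeps M" "I \<subseteq> X \<inter> Y" "card I = rank_of M (X \<inter> Y)" using rank_of_obtain[OF M] by blast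
    have "I \<subseteq> X \<union> Y" using I by auto
    then obtain J where J: "J \<in> indeps M" "I \<subseteq> J" "J \<subseteq> X \<union> Y" "card J = rank_of M (X \<union> Y)"
      using indep_extend[OF M I(1)] by blast
    have fJ: "finite J" by (rule matroidD(6)[OF M J(1)])
    have "cnt J X \<le> rank_of M X" "cnt J Y \<le> rank_of M Y"
      using rank_of_ge[OF M matroidD(4)[OF M J(1)], of "J \<inter> X" X] rank_of_ge[OF M matroidD(4)[OF M J(1)], of "J \<inter> Y" Y] by auto
    moreover have "cnt J X + cnt J Y = card J + cnt J (X \<inter> Y)"
    proof -
      have "J \<inter> X \<union> J \<inter> Y = J" "(J \<inter> X) \<inter> (J \<inter> Y) = J \<inter> (X \<inter> Y)" using J(3) by auto
      thus ?thesis using card_Un_Int[of "J \<inter> X" "J \<inter> Y"] fJ by simp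
    qed
    moreover have "card I \<le> cnt J (X \<inter> Y)" by (rule card_mono) (use fJ I J in auto)
    ultimately show ?thesis using I J by simp
  qed
qed

lemma indeps_iff: assumes M: "matroid M"
  shows "I \<in> indeps M \<longleftrightarrow> I \<subseteq> ground M \<and> rank_of M I = card I"
proof
  interpret rank_matroid "ground M" "rank_of M" by (rule rank_matroid_rank_of[OF M])
  assume I: "I \<in> indeps M"
  thus "I \<subseteq> ground M \<and> rank_of M I = card I"
    using rank_of_ge[OF M I subset_refl] r_le_card[OF matroidD(6)[OF M I]] matroidD(2)[OF M I] by simp
next
  assume I: "I \<subseteq> ground M \<and> rank_of M I = card I"
  obtain J where J: "J \<in> indeps M" "J \<subseteq> I" "card J = rank_of M I" using rank_of_obtain[OF M] by blast
  have "finite I" using I matroidD(1)[OF M] finite_subset by blast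
  hence "J = I" using card_subset_eq[of I J] J I by simp
  thus "I \<in> indeps M" using J by simp
qed

text \<open>Augmentation holds because a set \<open>I\<close> that no element of \<open>J\<close>
  extends spans \<open>J\<close>, and then \<open>J\<close> cannot be larger. The lemma identifies
  duals and deletions through their rank functions.\<close>

lemma matroid_of_rank:
  assumes "rank_matroid E s" "ground N = E" "\<And>I. I \<in> indeps N \<longleftrightarrow> I \<subseteq> E \<and> s I = card I"
  shows "matroid N" "rank_of N = s"
proof -
  interpret rank_matroid E s by (rule assms(1))
  show M: "matroid N"
    unfolding matroid_def
  proof (intro conjI ballI allI impI)
    show "finite (ground N)" using fin assms by simp
    show "I \<subseteq> ground N" if "I \<in> indeps N" for I using assms that by simp
    show "{} \<in> indeps N" using assms by simp
    show "J \<in> indeps N" if "I \<in> indeps N" "J \<subseteq> I" for I J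
      using that assms indep_mono[of I J] finite_sub by auto
    show "\<exists>e\<in>J - I. insert e I \<in> indeps N" if IJ: "I \<in> indeps N" "J \<in> indeps N" "card I < card J" for I J
    proof (rule ccontr)
      assume no: "\<not> (\<exists>e\<in>J - I. insert e I \<in> indeps N)"
      have i: "I \<subseteq> E" "s I = card I" "J \<subseteq> E" "s J = card J" using IJ assms by auto
      have f: "finite I" "finite J" using i finite_sub by auto
      have "s (insert e I) = s I" if "e \<in> J" for e
      proof (cases "e \<in> I")
        case False
        hence "insert e I \<notin> indeps N" using no that by auto
        hence "s (insert e I) \<noteq> card (insert e I)" using assms i that by auto
        thus ?thesis using r_insert[of e I] r_insert_ge[of I e] i f False by simp
      qed (simp add: insert_absorb)
      hence "s (I \<union> J) = s I" using Un_eq[OF f(2)] by blast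
      thus False using mono[of J "I \<union> J"] i IJ by simp
    qed
  qed
  show "rank_of N = s"
  proof
    fix X
    obtain I where I: "I \<subseteq> X \<inter> E" "s I = card I" "s I = s (X \<inter> E)" using basis_exists[of "X \<inter> E"] by auto
    have "card I \<le> rank_of N X" by (rule rank_of_ge[OF M]) (use I assms in auto)
    moreover obtain J where J: "J \<in> indeps N" "J \<subseteq> X" "card J = rank_of N X" using rank_of_obtain[OF M] by blast
    have "rank_of N X \<le> s X" using mono[OF J(2)] J assms by simp
    ultimately show "rank_of N X = s X" using I res[of X] by simp
  qed
qed

lemma bases_iff: assumes M: "matroid M"
  shows "B \<in> bases M \<longleftrightarrow> B \<in> indeps M \<and> card B = rank_of M (ground M)"
proof
  assume "B \<in> bases M"
  hence B: "B \<in> indeps M" "\<And>I. I \<in> indeps M \<Longrightarrow> B \<subseteq> I \<Longrightarrow> I = B" unfolding bases_def by auto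
  obtain J where "J \<in> indeps M" "B \<subseteq> J" "J \<subseteq> ground M" "card J = rank_of M (ground M)"
    by (rule indep_extend[OF M B(1) matroidD(2)[OF M B(1)]])
  thus "B \<in> indeps M \<and> card B = rank_of M (ground M)" using B by metis
next
  assume B: "B \<in> indeps M \<and> card B = rank_of M (ground M)"
  have "I = B" if "I \<in> indeps M" "B \<subseteq> I" for I
    using card_subset_eq[OF matroidD(6)[OF M that(1)] that(2)] rank_of_ge[OF M that(1) matroidD(2)[OF M that(1)]] B
      card_mono[OF matroidD(6)[OF M that(1)] that(2)] by simp
  thus "B \<in> bases M" unfolding bases_def using B by auto
qed

lemma dual_matroid_rank:
  assumes M: "matroid M"
  shows "ground (dual_matroid M) = ground M" "matroid (dual_matroid M)"
    "rank_of (dual_matroid M) = du (ground M) (rank_of M)"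
proof -
  interpret rank_matroid "ground M" "rank_of M" by (rule rank_matroid_rank_of[OF M])
  let ?E = "ground M" and ?r = "rank_of M"
  show g: "ground (dual_matroid M) = ?E" by (simp add: dual_matroid_def matroid_of_bases_def)
  have "I \<in> indeps (dual_matroid M) \<longleftrightarrow> I \<subseteq> ?E \<and> du ?E ?r I = card I" for I
  proof -
    have "I \<in> indeps (dual_matroid M) \<longleftrightarrow> (\<exists>B\<in>bases M. I \<subseteq> ?E - B)"
      by (auto simp: dual_matroid_def matroid_of_bases_def)
    also have "\<dots> \<longleftrightarrow> I \<subseteq> ?E \<and> ?r (?E - I) = ?r ?E"
    proof
      assume "\<exists>B\<in>bases M. I \<subseteq> ?E - B"
      then obtain B where B: "B \<in> indeps M" "card B = ?r ?E" "I \<subseteq> ?E - B" using bases_iff[OF M] by blast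
      have "card B \<le> ?r (?E - I)" by (rule rank_of_ge[OF M B(1)]) (use B matroidD(2)[OF M B(1)] in auto)
      thus "I \<subseteq> ?E \<and> ?r (?E - I) = ?r ?E" using B mono[of "?E - I" ?E] by auto
    next
      assume I: "I \<subseteq> ?E \<and> ?r (?E - I) = ?r ?E"
      obtain B where "B \<in> indeps M" "B \<subseteq> ?E - I" "card B = ?r (?E - I)" using rank_of_obtain[OF M] by blast
      thus "\<exists>B\<in>bases M. I \<subseteq> ?E - B" using I bases_iff[OF M, of B] by auto
    qed
    also have "\<dots> \<longleftrightarrow> I \<subseteq> ?E \<and> du ?E ?r I = card I"
      using du_add[of I] by (auto simp: Int_absorb2)
    finally show ?thesis .
  qed
  thus "matroid (dual_matroid M)" "rank_of (dual_matroid M) = du ?E ?r"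
    using matroid_of_rank[OF rank_matroid_du g] by auto
qed

lemma deletion_rank:
  assumes M: "matroid M" and X: "finite X"
  shows "ground (deletion M X) = ground M - X" "matroid (deletion M X)"
    "rank_of (deletion M X) = dls X (rank_of M)"
proof -
  have rm: "rank_matroid (ground M - X) (dls X (rank_of M))"
    using rank_matroid_dls[OF X rank_matroid_rank_of[OF M]] by blast
  show g: "ground (deletion M X) = ground M - X" by (simp add: deletion_def)
  have "I \<in> indeps (deletion M X) \<longleftrightarrow> I \<subseteq> ground M - X \<and> dls X (rank_of M) I = card I" for I
  proof -
    show ?thesis
    proof (cases "I \<inter> X = {}")
      case True
      hence "I - X = I" "I \<subseteq> ground M - X \<longleftrightarrow> I \<subseteq> ground M" by auto
      thus ?thesis using indeps_iff[OF M, of I] True by (simp add: deletion_def dls_def)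
    next
      case False
      thus ?thesis by (auto simp: deletion_def)
    qed
  qed
  thus "matroid (deletion M X)" "rank_of (deletion M X) = dls X (rank_of M)"
    using matroid_of_rank[OF rm g] by auto
qed

definition notch_like :: "'a matroid \<Rightarrow> bool" where
  "notch_like M \<longleftrightarrow> notchy (ground M) (rank_of M)"

lemma notch_like_dual: "matroid M \<Longrightarrow> notch_like (dual_matroid M) \<longleftrightarrow> notch_like M"
  unfolding notch_like_def
  using dual_matroid_rank[of M] rank_matroid.notchy_du[OF rank_matroid_rank_of[of M]] by simp

lemma notch_like_deletion: "matroid M \<Longrightarrow> finite X \<Longrightarrow> notch_like M \<Longrightarrow> notch_like (deletion M X)"
  unfolding notch_like_def
  using deletion_rank[of M X] rank_matroid_dls[OF _ rank_matroid_rank_of[of M], of X] by simp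

lemma contraction_matroid:
  assumes "matroid M" "finite X"
  shows "matroid (contraction M X)" "ground (contraction M X) = ground M - X"
    "notch_like (contraction M X) \<longleftrightarrow> notch_like (deletion (dual_matroid M) X)"
  unfolding contraction_def
  using deletion_rank[OF dual_matroid_rank(2)[OF assms(1)] assms(2)] dual_matroid_rank(1)[OF assms(1)]
    dual_matroid_rank(1,2)[OF deletion_rank(2)[OF dual_matroid_rank(2)[OF assms(1)] assms(2)]]
    notch_like_dual[OF deletion_rank(2)[OF dual_matroid_rank(2)[OF assms(1)] assms(2)]]
  by auto

lemma notch_like_contraction:
  assumes M: "matroid M" and X: "finite X" and n: "notch_like M"
  shows "notch_like (contraction M X)"
proof -
  have "notch_like (dual_matroid M)" using notch_like_dual[OF M] n by simp
  hence "notch_like (deletion (dual_matroid M) X)"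
    by (rule notch_like_deletion[OF dual_matroid_rank(2)[OF M] X])
  thus ?thesis using contraction_matroid(3)[OF M X] by simp
qed

text \<open>Only single-element minors are tested, which is enough for a minor-closed condition; see
  \<open>excluded_minor_exc\<close>.\<close>

definition exc :: "'a set \<Rightarrow> ('a set \<Rightarrow> nat) \<Rightarrow> bool" where
  "exc E r \<longleftrightarrow> \<not> notchy E r \<and> (\<forall>e\<in>E. notchy (E - {e}) (dl e r) \<and> notchy (E - {e}) (ct e r))"

lemma excluded_minor_cong:
  assumes "matroid M" "\<C> M = \<D> M" "\<And>M'. proper_minor M' M \<Longrightarrow> \<C> M' = \<D> M'"
  shows "excluded_minor \<C> M = excluded_minor \<D> M"
  unfolding excluded_minor_def using assms by blast

lemma proper_minor_matroid:
  assumes "matroid M" "proper_minor M' M" shows "matroid M'"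
proof -
  obtain X Y where *: "X \<subseteq> ground M" "Y \<subseteq> ground M" "M' = contraction (deletion M X) Y"
    using assms(2) unfolding proper_minor_def by blast
  have "finite X" "finite Y" using * matroidD(1)[OF assms(1)] finite_subset by blast+
  thus ?thesis using contraction_matroid(1)[OF deletion_rank(2)[OF assms(1)]] * by simp
qed

text \<open>A proper minor removes at least one element \<open>e\<close>, so it is a minor of the
  deletion or of the contraction of \<open>e\<close>, and the condition passes from there to all
  minors.\<close>

lemma excluded_minor_exc:
  assumes M: "matroid M"
  shows "excluded_minor notch_like M \<longleftrightarrow> exc (ground M) (rank_of M)"
proof -
  interpret rank_matroid "ground M" "rank_of M" by (rule rank_matroid_rank_of[OF M])
  let ?E = "ground M" and ?r = "rank_of M"
  note MD = dual_matroid_rank[OF M]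
  have del1: "notch_like (deletion M {e}) \<longleftrightarrow> notchy (?E - {e}) (dl e ?r)" for e
    using deletion_rank[OF M, of "{e}"] dls_insert[of e "{}" ?r] by (simp add: notch_like_def)
  have con1: "notch_like (contraction M {e}) \<longleftrightarrow> notchy (?E - {e}) (ct e ?r)" if "e \<in> ?E" for e
    using contraction_matroid(3)[OF M, of "{e}"] deletion_rank[OF MD(2), of "{e}"] MD dls_insert[of e "{}"]
      notchy_ct[OF that] by (simp add: notch_like_def)
  have emp: "notch_like (contraction N {}) \<longleftrightarrow> notch_like N" if "matroid N" for N :: "'a matroid"
  proof -
    have "deletion (dual_matroid N) {} = dual_matroid N" by (simp add: deletion_def)
    thus ?thesis using contraction_matroid(3)[OF that, of "{}"] notch_like_dual[OF that] by simp
  qed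
  have emp': "deletion M {} = M" by (simp add: deletion_def)
  have "(\<forall>M'. proper_minor M' M \<longrightarrow> notch_like M') \<longleftrightarrow>
      (\<forall>e\<in>?E. notch_like (deletion M {e}) \<and> notch_like (contraction M {e}))"
  proof
    assume a: "\<forall>M'. proper_minor M' M \<longrightarrow> notch_like M'"
    show "\<forall>e\<in>?E. notch_like (deletion M {e}) \<and> notch_like (contraction M {e})"
    proof
      fix e assume e: "e \<in> ?E"
      have "proper_minor (contraction (deletion M {e}) {}) M"
        unfolding proper_minor_def using e by (intro exI[of _ "{e}"] exI[of _ "{}"]) simp
      moreover have "proper_minor (contraction (deletion M {}) {e}) M"
        unfolding proper_minor_def using e by (intro exI[of _ "{}"] exI[of _ "{e}"]) simp
      ultimately show "notch_like (deletion M {e}) \<and> notch_like (contraction M {e})"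
        using a emp[OF deletion_rank(2)[OF M, of "{e}"]] emp' by simp
    qed
  next
    assume a: "\<forall>e\<in>?E. notch_like (deletion M {e}) \<and> notch_like (contraction M {e})"
    show "\<forall>M'. proper_minor M' M \<longrightarrow> notch_like M'"
    proof (intro allI impI)
      fix M' assume "proper_minor M' M"
      then obtain X Y where XY: "X \<subseteq> ?E" "Y \<subseteq> ?E" "X \<union> Y \<noteq> {}" "M' = contraction (deletion M X) Y"
        unfolding proper_minor_def by blast
      have f: "finite X" "finite Y" using XY fin finite_subset by blast+
      show "notch_like M'"
      proof (cases "X = {}")
        case False
        then obtain e where e: "e \<in> X" by auto
        \<comment> \<open>Deleting \<open>X\<close> absorbs the earlier deletion of
          \<open>e\<close>, so the minor is obtained from the deletion of \<open>e\<close>.\<close>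
        have "deletion (deletion M {e}) X = deletion M X" using e unfolding deletion_def by auto
        hence "notch_like (deletion M X)"
          using notch_like_deletion[OF deletion_rank(2)[OF M, of "{e}"] f(1)] a e XY by auto
        thus ?thesis using notch_like_contraction[OF deletion_rank(2)[OF M f(1)] f(2)] XY by simp
      next
        case True
        then obtain e where e: "e \<in> Y" using XY by auto
        have "deletion (deletion (dual_matroid M) {e}) Y = deletion (dual_matroid M) Y"
          using e unfolding deletion_def by auto
        moreover have "notch_like (deletion (dual_matroid M) {e})"
          using a e XY contraction_matroid(3)[OF M, of "{e}"] by auto
        ultimately have "notch_like (deletion (dual_matroid M) Y)"
          using notch_like_deletion[OF deletion_rank(2)[OF MD(2), of "{e}"] f(2)] by auto
        thus ?thesis using contraction_matroid(3)[OF M f(2)] XY True emp' by simp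
      qed
    qed
  qed
  thus ?thesis unfolding excluded_minor_def exc_def using del1 con1 by (auto simp: notch_like_def)
qed

lemma (in rank_matroid) exc_du: "exc E (du E r) \<longleftrightarrow> exc E r"
proof -
  have "notchy (E - {e}) (ct e (du E r)) \<longleftrightarrow> notchy (E - {e}) (dl e r)" if "e \<in> E" for e
    using rank_matroid.notchy_ct[OF rank_matroid_du that] du_du by simp
  thus ?thesis unfolding exc_def using notchy_du notchy_ct by auto
qed

lemma matroid_iso_rank:
  assumes M: "matroid M" and M': "matroid M'"
  shows "matroid_iso M M' \<longleftrightarrow> (\<exists>f. bij_betw f (ground M) (ground M') \<and>
    (\<forall>X. X \<subseteq> ground M \<longrightarrow> rank_of M' (f ` X) = rank_of M X))"
proof -
  have "(\<forall>X. X \<subseteq> ground M \<longrightarrow> (X \<in> indeps M \<longleftrightarrow> f ` X \<in> indeps M')) \<longleftrightarrow>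
      (\<forall>X. X \<subseteq> ground M \<longrightarrow> rank_of M' (f ` X) = rank_of M X)"
    if f: "bij_betw f (ground M) (ground M')" for f
  proof -
    have inj: "inj_on f X" if "X \<subseteq> ground M" for X using f that by (meson bij_betw_def inj_on_subset)
    have img: "f ` X \<subseteq> ground M'" if "X \<subseteq> ground M" for X using f that unfolding bij_betw_def by blast
    show ?thesis
    proof
      assume a: "\<forall>X. X \<subseteq> ground M \<longrightarrow> (X \<in> indeps M \<longleftrightarrow> f ` X \<in> indeps M')"
      show "\<forall>X. X \<subseteq> ground M \<longrightarrow> rank_of M' (f ` X) = rank_of M X"
      proof (intro allI impI)
        fix X assume X: "X \<subseteq> ground M"
        obtain I where I: "I \<in> indeps M" "I \<subseteq> X" "card I = rank_of M X" using rank_of_obtain[OF M] by blast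
        have "card (f ` I) \<le> rank_of M' (f ` X)" by (rule rank_of_ge[OF M']) (use I X a in auto)
        hence 1: "rank_of M X \<le> rank_of M' (f ` X)" using I X card_image[OF inj[of I]] by auto
        obtain J where J: "J \<in> indeps M'" "J \<subseteq> f ` X" "card J = rank_of M' (f ` X)" using rank_of_obtain[OF M'] by blast
        obtain K where K: "K \<subseteq> X" "J = f ` K" using J(2) by (meson subset_imageE)
        have "K \<in> indeps M" using a K X J by auto
        hence "card K \<le> rank_of M X" using rank_of_ge[OF M _ K(1)] by simp
        thus "rank_of M' (f ` X) = rank_of M X" using 1 K J card_image[OF inj[of K]] X by auto
      qed
    next
      assume a: "\<forall>X. X \<subseteq> ground M \<longrightarrow> rank_of M' (f ` X) = rank_of M X"
      thus "\<forall>X. X \<subseteq> ground M \<longrightarrow> (X \<in> indeps M \<longleftrightarrow> f ` X \<in> indeps M')"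
        using indeps_iff[OF M] indeps_iff[OF M'] card_image inj img by (metis (no_types, lifting))
    qed
  qed
  thus ?thesis unfolding matroid_iso_def by (intro ex_cong1 conj_cong refl)
qed

lemma matroid_iso_dual:
  assumes M: "matroid M" and M': "matroid M'" and "matroid_iso M M'"
  shows "matroid_iso (dual_matroid M) (dual_matroid M')"
proof -
  note D = dual_matroid_rank[OF M] and D' = dual_matroid_rank[OF M']
  obtain f where f: "bij_betw f (ground M) (ground M')"
    "\<And>X. X \<subseteq> ground M \<Longrightarrow> rank_of M' (f ` X) = rank_of M X"
    using assms(3) matroid_iso_rank[OF M M'] by auto
  have "du (ground M') (rank_of M') (f ` X) = du (ground M) (rank_of M) X" if X: "X \<subseteq> ground M" for X
  proof -
    have inj: "inj_on f (ground M)" and im: "f ` ground M = ground M'" using f(1) by (auto simp: bij_betw_def)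
    have "ground M' - f ` X = f ` (ground M - X)" using inj_on_image_set_diff[OF inj, of "ground M" X] X im by auto
    moreover have "card (f ` X \<inter> ground M') = card (X \<inter> ground M)"
      using X im card_image[OF inj_on_subset[OF inj X]] image_mono[OF X, of f]
      by (simp add: Int_absorb2)
    ultimately show ?thesis unfolding du_def using f(2)[of "ground M - X"] f(2)[of "ground M"] im by auto
  qed
  thus ?thesis using matroid_iso_rank[OF D(2) D'(2)] D D' f(1) by auto
qed

lemma dual_dual: assumes N: "matroid N" shows "dual_matroid (dual_matroid N) = N"
proof -
  interpret rank_matroid "ground N" "rank_of N" by (rule rank_matroid_rank_of[OF N])
  note D = dual_matroid_rank[OF N]
  note DD = dual_matroid_rank[OF D(2)]
  have "ground (dual_matroid (dual_matroid N)) = ground N" using D DD by simp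
  moreover have "indeps (dual_matroid (dual_matroid N)) = indeps N"
    using indeps_iff[OF N] indeps_iff[OF DD(2)] D DD du_du by auto
  ultimately show ?thesis by simp
qed

lemma matroid_iso_dual_dual:
  assumes M: "matroid M" and M': "matroid M'"
  shows "matroid_iso M (dual_matroid M') \<longleftrightarrow> matroid_iso (dual_matroid M) M'"
  using matroid_iso_dual[OF M dual_matroid_rank(2)[OF M']] matroid_iso_dual[OF dual_matroid_rank(2)[OF M] M']
    dual_dual[OF M] dual_dual[OF M'] by auto

section \<open>Lattice paths and presentations\<close>

text \<open>These are the matroids of the paths above \<open>E^m N^r\<close>: after labelling, the
  members of the chain are initial segments and the bounds become prefix counts.\<close>

definition nested_pres :: "'a set \<Rightarrow> ('a set \<Rightarrow> bool) \<Rightarrow> bool" where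
  "nested_pres E P \<longleftrightarrow> (\<exists>S :: ('a set \<times> nat) set. finite S \<and> (\<forall>(Z, k)\<in>S. Z \<subseteq> E) \<and>
     (\<forall>p\<in>S. \<forall>q\<in>S. fst p \<subseteq> fst q \<or> fst q \<subseteq> fst p) \<and>
     (\<forall>I. I \<subseteq> E \<longrightarrow> (P I \<longleftrightarrow> (\<forall>(Z, k)\<in>S. cnt I Z \<le> k))))"

text \<open>\<open>B\<close> stands for the circuit-hyperplane without the loops; the elements
  outside \<open>T\<close> occur in no bound and are coloops. The side conditions keep every proper
  subset of \<open>B\<close> within all bounds, make every member of the chain comparable with
  \<open>T - B\<close>, and exclude that \<open>T - B\<close> consists of loops.\<close>

definition notch_pres :: "'a set \<Rightarrow> ('a set \<Rightarrow> bool) \<Rightarrow> bool" where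
  "notch_pres E P \<longleftrightarrow> (\<exists>(S :: ('a set \<times> nat) set) B T. finite S \<and>
     (\<forall>p\<in>S. \<forall>q\<in>S. fst p \<subseteq> fst q \<or> fst q \<subseteq> fst p) \<and>
     T \<subseteq> E \<and> B \<subset> T \<and> (T, card B) \<in> S \<and>
     (\<forall>(Z, k)\<in>S. Z \<subseteq> T \<and> ((Z, k) = (T, card B) \<or> Z \<inter> B = {} \<and> (0 < k \<or> \<not> T \<subseteq> Z \<union> B) \<or>
        T \<subseteq> Z \<union> B \<and> cnt B Z < k)) \<and>
     (\<forall>I. I \<subseteq> E \<longrightarrow> (P I \<longleftrightarrow> (\<forall>(Z, k)\<in>S. cnt I Z \<le> k) \<and> \<not> B \<subseteq> I)))"

section \<open>Heights of lattice paths\<close>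

definition hgt :: "step list \<Rightarrow> nat \<Rightarrow> nat" where
  "hgt P k = count_list (take k P) North"

definition path_of :: "(nat \<Rightarrow> nat) \<Rightarrow> nat \<Rightarrow> step list" where
  "path_of q n = map (\<lambda>j. if q j < q (Suc j) then North else East) [0..<n]"

definition height_fun :: "(nat \<Rightarrow> nat) \<Rightarrow> nat \<Rightarrow> bool" where
  "height_fun q n \<longleftrightarrow> q 0 = 0 \<and> (\<forall>j<n. q j \<le> q (Suc j) \<and> q (Suc j) \<le> Suc (q j))"

lemma count_East_North: "count_list P East + count_list P North = length P"
proof (induction P)
  case (Cons a P) thus ?case by (cases a) auto
qed simp

lemma hgt_Suc: "k < length P \<Longrightarrow> hgt P (Suc k) = hgt P k + (if P ! k = North then 1 else 0)"
  by (simp add: hgt_def take_Suc_conv_app_nth)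

lemma hgt_ge_length: "length P \<le> k \<Longrightarrow> hgt P k = count_list P North"
  by (simp add: hgt_def)

lemma hgt_0 [simp]: "hgt P 0 = 0"
  by (simp add: hgt_def)

lemma height_fun_hgt: "height_fun (hgt P) (length P)"
  unfolding height_fun_def by (simp add: hgt_Suc)

lemma height_fun_mono: "height_fun q n \<Longrightarrow> i \<le> j \<Longrightarrow> j \<le> n \<Longrightarrow> q i \<le> q j"
proof (induction j)
  case (Suc j)
  show ?case
  proof (cases "i = Suc j")
    case False
    hence "q i \<le> q j" using Suc by simp
    also have "q j \<le> q (Suc j)" using Suc.prems by (simp add: height_fun_def)
    finally show ?thesis .
  qed simp
qed simp

lemma height_fun_slope: "height_fun q n \<Longrightarrow> i \<le> j \<Longrightarrow> j \<le> n \<Longrightarrow> q j \<le> q i + (j - i)"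
proof (induction j)
  case (Suc j)
  show ?case
  proof (cases "i = Suc j")
    case False
    hence "q j \<le> q i + (j - i)" using Suc by simp
    moreover have "q (Suc j) \<le> Suc (q j)" using Suc.prems by (simp add: height_fun_def)
    ultimately show ?thesis using False Suc.prems by simp
  qed simp
qed simp

lemma length_path_of [simp]: "length (path_of q n) = n"
  by (simp add: path_of_def)

lemma hgt_path_of: "height_fun q n \<Longrightarrow> k \<le> n \<Longrightarrow> hgt (path_of q n) k = q k"
proof (induction k)
  case 0 thus ?case by (simp add: height_fun_def)
next
  case (Suc k)
  have "hgt (path_of q n) (Suc k) = q k + (if q k < q (Suc k) then 1 else 0)"
    using Suc hgt_Suc[of k "path_of q n"] by (simp add: path_of_def)
  moreover have "q k \<le> q (Suc k)" "q (Suc k) \<le> Suc (q k)" using Suc.prems by (auto simp: height_fun_def)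
  ultimately show ?case by auto
qed

lemma path_of_lattice: "height_fun q n \<Longrightarrow> q n = r \<Longrightarrow> n = m + r \<Longrightarrow> path_of q n \<in> lattice_paths m r"
  using hgt_path_of[of q n n] hgt_ge_length[of "path_of q n" n] count_East_North[of "path_of q n"]
  by (simp add: lattice_paths_def)

lemma never_above_iff:
  assumes "P \<in> lattice_paths m r" "Q \<in> lattice_paths m r"
  shows "never_above P Q \<longleftrightarrow> (\<forall>k\<le>m + r. hgt P k \<le> hgt Q k)"
proof -
  have l: "length P = m + r" "length Q = m + r" "count_list P North = r" "count_list Q North = r"
    using assms count_East_North[of P] count_East_North[of Q] by (auto simp: lattice_paths_def)
  have "hgt P k \<le> hgt Q k" if "k > m + r" for k using that hgt_ge_length[of P k] hgt_ge_length[of Q k] l by simp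
  thus ?thesis unfolding never_above_def hgt_def[symmetric] by (meson not_le)
qed

text \<open>A path whose \<open>i\<close>-th North step is step \<open>j\<close> arises by clamping,
  between the heights of \<open>P\<close> and \<open>Q\<close>, the step function that jumps from
  \<open>i - 1\<close> to \<open>i\<close> at \<open>j\<close>.\<close>

lemma north_set_iff:
  assumes P: "P \<in> lattice_paths m r" and Q: "Q \<in> lattice_paths m r" and PQ: "never_above P Q"
  shows "j \<in> north_set P Q i \<longleftrightarrow> 1 \<le> j \<and> j \<le> m + r \<and> hgt P (j - 1) < i \<and> i \<le> hgt Q j"
proof
  have l: "length P = m + r" "length Q = m + r" "count_list P North = r" "count_list Q North = r"
    "count_list P East = m"
    using assms count_East_North[of P] count_East_North[of Q] by (auto simp: lattice_paths_def)
  have le: "\<And>k. k \<le> m + r \<Longrightarrow> hgt P k \<le> hgt Q k" using PQ never_above_iff[OF P Q] by blast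
  {
    assume "j \<in> north_set P Q i"
    then obtain R where R: "R \<in> paths_between P Q" "1 \<le> j" "j \<le> length R" "R ! (j - 1) = North"
      "count_list (take j R) North = i" unfolding north_set_def by blast
    have RL: "R \<in> lattice_paths m r" "never_above P R" "never_above R Q" using R(1) l by (auto simp: paths_between_def)
    hence lR: "length R = m + r" using count_East_North[of R] by (simp add: lattice_paths_def)
    have "hgt R j = i" using R by (simp add: hgt_def)
    moreover have "hgt R j = hgt R (j - 1) + 1" using hgt_Suc[of "j - 1" R] R by simp
    moreover have "hgt P (j - 1) \<le> hgt R (j - 1)" "hgt R j \<le> hgt Q j"
      using RL(2,3) by (auto simp: never_above_def hgt_def)
    ultimately show "1 \<le> j \<and> j \<le> m + r \<and> hgt P (j - 1) < i \<and> i \<le> hgt Q j" using R lR by simp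
  }
  assume a: "1 \<le> j \<and> j \<le> m + r \<and> hgt P (j - 1) < i \<and> i \<le> hgt Q j"
  define c where "c = (\<lambda>k. if k < j then i - 1 else i)"
  define g where "g = (\<lambda>k. max (hgt P k) (min (hgt Q k) (c k)))"
  have hP: "height_fun (hgt P) (m + r)" and hQ: "height_fun (hgt Q) (m + r)" using height_fun_hgt[of P] height_fun_hgt[of Q] l by auto
  have hg: "height_fun g (m + r)"
    unfolding height_fun_def
  proof (intro conjI allI impI)
    show "g 0 = 0" by (simp add: g_def)
    fix k assume k: "k < m + r"
    have "hgt P k \<le> hgt P (Suc k)" "hgt P (Suc k) \<le> Suc (hgt P k)" "hgt Q k \<le> hgt Q (Suc k)" "hgt Q (Suc k) \<le> Suc (hgt Q k)"
      using k hP hQ by (auto simp: height_fun_def)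
    moreover have "c k \<le> c (Suc k)" "c (Suc k) \<le> Suc (c k)" by (auto simp: c_def)
    ultimately show "g k \<le> g (Suc k)" "g (Suc k) \<le> Suc (g k)" unfolding g_def by linarith+
  qed
  define R where "R = path_of g (m + r)"
  have hR: "\<And>k. k \<le> m + r \<Longrightarrow> hgt R k = g k" unfolding R_def by (rule hgt_path_of[OF hg])
  have "hgt P (m + r) = r" "hgt Q (m + r) = r" using hgt_ge_length[of P "m + r"] hgt_ge_length[of Q "m + r"] l by auto
  hence "g (m + r) = r" by (simp add: g_def)
  hence RL: "R \<in> lattice_paths m r" unfolding R_def using path_of_lattice[OF hg] by simp
  have "never_above P R" unfolding never_above_iff[OF P RL] using hR by (simp add: g_def)
  moreover have "never_above R Q" unfolding never_above_iff[OF RL Q] using hR le by (simp add: g_def)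
  ultimately have "R \<in> paths_between P Q" using RL l by (simp add: paths_between_def)
  moreover
  have Sj: "Suc (j - 1) = j" "j - 1 < m + r" "j - 1 \<le> m + r" using a by auto
  have "hgt P j \<le> Suc (hgt P (j - 1))" "hgt Q j \<le> Suc (hgt Q (j - 1))"
    using hP hQ Sj(1) Sj(2) unfolding height_fun_def by metis+
  hence gj: "g j = i" and gj1: "g (j - 1) = i - 1" using a by (auto simp: g_def c_def)
  have "R ! (j - 1) = (if g (j - 1) < g (Suc (j - 1)) then North else East)"
    using Sj(2) by (simp add: R_def path_of_def)
  hence "R ! (j - 1) = North" using a gj gj1 Sj(1) by simp
  ultimately show "j \<in> north_set P Q i"
    unfolding north_set_def using a hR[of j] gj by (intro CollectI bexI[of _ R]) (simp_all add: hgt_def, simp add: R_def)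
qed

lemma lpm_indep:
  assumes P: "P \<in> lattice_paths m r" and Q: "Q \<in> lattice_paths m r" and PQ: "never_above P Q"
  shows "ground (lattice_path_matroid P Q) = {1..m + r}"
    "X \<in> indeps (lattice_path_matroid P Q) \<longleftrightarrow>
      X \<subseteq> {1..m + r} \<and> (\<exists>f. inj_on f X \<and> (\<forall>x\<in>X. hgt P (x - 1) < f x \<and> f x \<le> hgt Q x))"
proof -
  have l: "length P = m + r" "length Q = m + r" "count_list P North = r" "count_list Q North = r"
    using assms count_East_North[of P] count_East_North[of Q] by (auto simp: lattice_paths_def)
  show "ground (lattice_path_matroid P Q) = {1..m + r}"
    by (simp add: lattice_path_matroid_def transversal_matroid_def l)
  have r: "hgt Q x \<le> r" if "x \<le> m + r" for x
    using height_fun_mono[OF height_fun_hgt, of x "m + r" Q] hgt_ge_length[of Q "m + r"] l that by simp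
  have *: "(f x \<in> {1..r} \<and> x \<in> north_set P Q (f x)) \<longleftrightarrow> hgt P (x - 1) < f x \<and> f x \<le> hgt Q x"
    if "x \<in> {1..m + r}" for f :: "nat \<Rightarrow> nat" and x
    using north_set_iff[OF assms, of x "f x"] that r[of x] by auto
  have "(\<forall>x\<in>X. f x \<in> {1..r} \<and> x \<in> north_set P Q (f x)) \<longleftrightarrow> (\<forall>x\<in>X. hgt P (x - 1) < f x \<and> f x \<le> hgt Q x)"
    if "X \<subseteq> {1..m + r}" for f using *[of _ f] that by blast
  thus "X \<in> indeps (lattice_path_matroid P Q) \<longleftrightarrow>
      X \<subseteq> {1..m + r} \<and> (\<exists>f. inj_on f X \<and> (\<forall>x\<in>X. hgt P (x - 1) < f x \<and> f x \<le> hgt Q x))"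
    unfolding lattice_path_matroid_def transversal_matroid_def l by auto
qed

lemma count_list_replicate: "count_list (replicate n x) y = (if x = y then n else 0)"
  by (induction n) auto

lemma hgt_EN: "k \<le> m + r \<Longrightarrow> hgt (replicate m East @ replicate r North) k = k - m"
  by (auto simp: hgt_def count_list_replicate min_def)

lemma hgt_notch: "1 \<le> m \<Longrightarrow> 1 \<le> r \<Longrightarrow> k \<le> m + r \<Longrightarrow>
   hgt (replicate (m - 1) East @ [North, East] @ replicate (r - 1) North) k = (if k < m then 0 else max 1 (k - m))"
proof -
  assume a: "1 \<le> m" "1 \<le> r" "k \<le> m + r"
  consider "k < m" | "k = m" | d where "k = m + 1 + d" "d \<le> r - 1"
    using a by (metis add.assoc diff_le_mono2 le_add_diff_inverse less_or_eq_imp_le linorder_neqE_nat add_le_cancel_left diff_add_inverse le_diff_conv2 Suc_eq_plus1 Suc_leI diff_le_mono)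
  thus ?thesis
  proof cases
    case 1 thus ?thesis by (simp add: hgt_def count_list_replicate)
  next
    case 2 thus ?thesis using a by (simp add: hgt_def count_list_replicate)
  next
    case 3
    hence "k - (m - 1) = Suc (Suc d)" using a by simp
    thus ?thesis using 3 a by (simp add: hgt_def count_list_replicate)
  qed
qed

section \<open>Matchings into the sets of North steps\<close>

lemma card_prefix_bound:
  assumes "inj_on f X" "\<forall>x\<in>X. a < f x \<and> f x \<le> q x" "height_fun q n" "j \<le> n" "X \<subseteq> {1..n}"
  shows "cnt X {1..j} \<le> q j - a"
proof -
  have "f ` (X \<inter> {1..j}) \<subseteq> {a<..q j}"
  proof
    fix y assume "y \<in> f ` (X \<inter> {1..j})"
    then obtain x where x: "x \<in> X" "x \<le> j" "y = f x" by auto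
    thus "y \<in> {a<..q j}" using assms(2) height_fun_mono[OF assms(3) x(2) assms(4)] by force
  qed
  hence "card (f ` (X \<inter> {1..j})) \<le> card {a<..q j}" by (intro card_mono) auto
  moreover have "card (f ` (X \<inter> {1..j})) = cnt X {1..j}"
    using assms(1) by (intro card_image) (auto intro: inj_on_subset)
  ultimately show ?thesis by simp
qed

lemma card_prefix_strict:
  fixes X :: "nat set"
  assumes "x \<in> X" "y \<in> X" "x < y" "X \<subseteq> {1..n}"
  shows "cnt X {1..x} < cnt X {1..y}"
proof (rule psubset_card_mono)
  have "y \<in> {1..n}" using assms by blast
  hence "y \<in> X \<inter> {1..y}" "y \<notin> X \<inter> {1..x}" using assms by auto
  moreover have "X \<inter> {1..x} \<subseteq> X \<inter> {1..y}" using assms(3) by auto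
  ultimately show "X \<inter> {1..x} \<subset> X \<inter> {1..y}" by blast
qed simp

lemma strict_inj_on: "(\<And>x y. x \<in> X \<Longrightarrow> y \<in> X \<Longrightarrow> x < y \<Longrightarrow> f x < (f y :: nat)) \<Longrightarrow> inj_on f (X :: nat set)"
  unfolding inj_on_def by (metis less_irrefl linorder_neqE_nat)

text \<open>Necessity is a count on prefixes. For sufficiency the \<open>i\<close>-th element of
  \<open>X\<close> is sent to \<open>i\<close>, or to \<open>x - m\<close> if that is larger: the
  first value is at most \<open>q x\<close> by the prefix bound, the second because \<open>q\<close>
  climbs by at most one per step and ends at \<open>n - m\<close>.\<close>

lemma nested_matching:
  assumes q: "height_fun q n" and n: "n = m + q n" and X: "X \<subseteq> {1..n}"
  shows "(\<exists>f. inj_on f X \<and> (\<forall>x\<in>X. x - 1 - m < f x \<and> f x \<le> q x)) \<longleftrightarrow> (\<forall>j\<le>n. cnt X {1..j} \<le> q j)"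
proof
  assume "\<exists>f. inj_on f X \<and> (\<forall>x\<in>X. x - 1 - m < f x \<and> f x \<le> q x)"
  then obtain f where f: "inj_on f X" "\<forall>x\<in>X. x - 1 - m < f x \<and> f x \<le> q x" by blast
  have "\<forall>x\<in>X. 0 < f x \<and> f x \<le> q x" using f(2) by fastforce
  thus "\<forall>j\<le>n. cnt X {1..j} \<le> q j" using card_prefix_bound[OF f(1) _ q, of 0] X by simp
next
  assume a: "\<forall>j\<le>n. cnt X {1..j} \<le> q j"
  define f where "f = (\<lambda>x. max (cnt X {1..x}) (x - m))"
  have c: "1 \<le> cnt X {1..x}" if "x \<in> X" for x
  proof -
    have "x \<in> X \<inter> {1..x}" using that X by auto
    thus ?thesis by (metis One_nat_def Suc_leI card_gt_0_iff empty_iff finite_Int finite_atLeastAtMost)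
  qed
  have "inj_on f X"
  proof (rule strict_inj_on)
    fix x y assume xy: "x \<in> X" "y \<in> X" "x < y"
    show "f x < f y" using card_prefix_strict[OF xy X] xy(3) by (auto simp: f_def less_max_iff_disj)
  qed
  moreover have "x - 1 - m < f x \<and> f x \<le> q x" if x: "x \<in> X" for x
  proof -
    have "x \<le> n" using x X by auto
    hence "x - m \<le> q x" using height_fun_slope[OF q, of x n] n by linarith
    thus ?thesis using c[OF x] a \<open>x \<le> n\<close> by (auto simp: f_def)
  qed
  ultimately show "\<exists>f. inj_on f X \<and> (\<forall>x\<in>X. x - 1 - m < f x \<and> f x \<le> q x)" by blast
qed

text \<open>From step \<open>m\<close> on the lower path has height at least 1, so only elements of
  \<open>{1..m}\<close> can use the value 1. If \<open>X\<close> misses this prefix, that value is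
  wasted and each later bound loses one; the shift \<open>d\<close> in the matching accounts for
  it.\<close>

lemma notch_matching:
  assumes q: "height_fun q n" and n: "n = m + q n" and X: "X \<subseteq> {1..n}" and m: "1 \<le> m" and qm: "1 \<le> q m"
  shows "(\<exists>f. inj_on f X \<and> (\<forall>x\<in>X. (if x - 1 < m then 0 else max 1 (x - 1 - m)) < f x \<and> f x \<le> q x)) \<longleftrightarrow>
    (\<forall>j\<le>n. cnt X {1..j} \<le> q j) \<and> (X \<inter> {1..m} = {} \<longrightarrow> (\<forall>j\<le>n. m < j \<longrightarrow> cnt X {1..j} < q j))"
    (is "(\<exists>f. inj_on f X \<and> (\<forall>x\<in>X. ?c f x)) \<longleftrightarrow> _")
proof
  assume "\<exists>f. inj_on f X \<and> (\<forall>x\<in>X. ?c f x)"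
  then obtain f where f: "inj_on f X" "\<forall>x\<in>X. ?c f x" by blast
  have "\<forall>x\<in>X. 0 < f x \<and> f x \<le> q x" using f(2) by fastforce
  hence 1: "\<forall>j\<le>n. cnt X {1..j} \<le> q j" using card_prefix_bound[OF f(1) _ q, of 0] X by simp
  have "cnt X {1..j} < q j" if "X \<inter> {1..m} = {}" "j \<le> n" "m < j" for j
  proof -
    have "\<forall>x\<in>X. 1 < f x \<and> f x \<le> q x"
    proof
      fix x assume x: "x \<in> X"
      hence "x \<in> {1..n}" "x \<notin> {1..m}" using that(1) X by blast+
      hence "\<not> x - 1 < m" by auto
      thus "1 < f x \<and> f x \<le> q x" using f(2) x by fastforce
    qed
    hence "cnt X {1..j} \<le> q j - 1" using card_prefix_bound[OF f(1) _ q that(2) X] by blast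
    moreover have "1 \<le> q j" using height_fun_mono[OF q, of m j] that qm by simp
    ultimately show ?thesis by simp
  qed
  thus "(\<forall>j\<le>n. cnt X {1..j} \<le> q j) \<and> (X \<inter> {1..m} = {} \<longrightarrow> (\<forall>j\<le>n. m < j \<longrightarrow> cnt X {1..j} < q j))"
    using 1 by blast
next
  assume a: "(\<forall>j\<le>n. cnt X {1..j} \<le> q j) \<and> (X \<inter> {1..m} = {} \<longrightarrow> (\<forall>j\<le>n. m < j \<longrightarrow> cnt X {1..j} < q j))"
  define d where "d = (if X \<inter> {1..m} = {} then 1 else 0 :: nat)"
  define f where "f = (\<lambda>x. max (cnt X {1..x} + d) (x - m))"
  have c: "1 \<le> cnt X {1..x}" if "x \<in> X" for x
  proof -
    have "x \<in> X \<inter> {1..x}" using that X by auto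
    thus ?thesis by (metis One_nat_def Suc_leI card_gt_0_iff empty_iff finite_Int finite_atLeastAtMost)
  qed
  have "inj_on f X"
  proof (rule strict_inj_on)
    fix x y assume xy: "x \<in> X" "y \<in> X" "x < y"
    show "f x < f y" using card_prefix_strict[OF xy X] xy(3) by (auto simp: f_def less_max_iff_disj)
  qed
  moreover have "?c f x" if x: "x \<in> X" for x
  proof -
    have xn: "x \<le> n" "1 \<le> x" using x X by auto
    hence xm: "x - m \<le> q x" using height_fun_slope[OF q, of x n] n by linarith
    have up: "cnt X {1..x} + d \<le> q x"
    proof (cases "X \<inter> {1..m} = {}")
      case True
      hence "m < x" using x xn by (auto simp: disjoint_iff not_le)
      thus ?thesis using a True xn by (auto simp: d_def Suc_le_eq)
    qed (use a xn in \<open>simp add: d_def\<close>)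
    \<comment> \<open>Past \<open>m\<close> the value 1 is barred. It is avoided by the shift, or
      because an element of \<open>X\<close> in the prefix comes before \<open>x\<close>.\<close>
    have lo: "2 \<le> cnt X {1..x} + d" if "m < x"
    proof (cases "X \<inter> {1..m} = {}")
      case False
      then obtain y where "y \<in> X" "y \<le> m" by auto
      hence "y \<in> X" "y < x" using that by auto
      thus ?thesis using card_prefix_strict[OF _ x _ X, of y] c[of y] by simp
    qed (use c[OF x] in \<open>simp add: d_def\<close>)
    have "x - 1 < m \<or> m < x" using xn by linarith
    thus ?thesis using xm up lo c[OF x] xn by (auto simp: f_def less_max_iff_disj)
  qed
  ultimately show "\<exists>f. inj_on f X \<and> (\<forall>x\<in>X. ?c f x)" by blast
qed

lemma lpm_nested:
  assumes Q: "Q \<in> lattice_paths m r"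
  shows "replicate m East @ replicate r North \<in> lattice_paths m r"
    "never_above (replicate m East @ replicate r North) Q"
    "X \<in> indeps (lattice_path_matroid (replicate m East @ replicate r North) Q) \<longleftrightarrow>
      X \<subseteq> {1..m + r} \<and> (\<forall>j\<le>m + r. cnt X {1..j} \<le> hgt Q j)"
proof -
  let ?P = "replicate m East @ replicate r North"
  have lQ: "length Q = m + r" "hgt Q (m + r) = r"
    using Q count_East_North[of Q] hgt_ge_length[of Q "m + r"] by (auto simp: lattice_paths_def)
  have hQ: "height_fun (hgt Q) (m + r)" using height_fun_hgt[of Q] lQ by simp
  show P: "?P \<in> lattice_paths m r" by (simp add: lattice_paths_def count_list_replicate)
  show PQ: "never_above ?P Q"
    unfolding never_above_iff[OF P Q]
  proof (intro allI impI)
    fix k assume "k \<le> m + r"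
    thus "hgt ?P k \<le> hgt Q k" using height_fun_slope[OF hQ, of k "m + r"] hgt_EN[of k m r] lQ by simp
  qed
  show "X \<in> indeps (lattice_path_matroid ?P Q) \<longleftrightarrow>
      X \<subseteq> {1..m + r} \<and> (\<forall>j\<le>m + r. cnt X {1..j} \<le> hgt Q j)"
  proof (cases "X \<subseteq> {1..m + r}")
    case True
    have "(\<forall>x\<in>X. hgt ?P (x - 1) < f x \<and> f x \<le> hgt Q x) \<longleftrightarrow> (\<forall>x\<in>X. x - 1 - m < f x \<and> f x \<le> hgt Q x)" for f
    proof (rule ball_cong[OF refl])
      fix x assume "x \<in> X"
      hence "x \<in> {1..m + r}" using True by blast
      hence "x - 1 \<le> m + r" by auto
      thus "(hgt ?P (x - 1) < f x \<and> f x \<le> hgt Q x) \<longleftrightarrow> (x - 1 - m < f x \<and> f x \<le> hgt Q x)" by (simp only: hgt_EN)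
    qed
    thus ?thesis using lpm_indep(2)[OF P Q PQ, of X] nested_matching[OF hQ _ True, of m] lQ True by simp
  qed (use lpm_indep(2)[OF P Q PQ, of X] in simp)
qed

lemma lpm_notch:
  assumes Q: "Q \<in> lattice_paths m r" and mr: "1 \<le> m" "1 \<le> r"
    and P_def: "P = replicate (m - 1) East @ [North, East] @ replicate (r - 1) North"
  shows "P \<in> lattice_paths m r" "never_above P Q \<longleftrightarrow> 1 \<le> hgt Q m"
    "1 \<le> hgt Q m \<Longrightarrow> X \<in> indeps (lattice_path_matroid P Q) \<longleftrightarrow>
      X \<subseteq> {1..m + r} \<and> (\<forall>j\<le>m + r. cnt X {1..j} \<le> hgt Q j) \<and>
      (X \<inter> {1..m} = {} \<longrightarrow> (\<forall>j\<le>m + r. m < j \<longrightarrow> cnt X {1..j} < hgt Q j))"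
proof -
  have lQ: "length Q = m + r" "hgt Q (m + r) = r"
    using Q count_East_North[of Q] hgt_ge_length[of Q "m + r"] by (auto simp: lattice_paths_def)
  have hQ: "height_fun (hgt Q) (m + r)" using height_fun_hgt[of Q] lQ by simp
  show P: "P \<in> lattice_paths m r" using mr by (simp add: lattice_paths_def count_list_replicate P_def)
  have hP: "\<And>k. k \<le> m + r \<Longrightarrow> hgt P k = (if k < m then 0 else max 1 (k - m))"
    unfolding P_def by (rule hgt_notch[OF mr])
  show PQ: "never_above P Q \<longleftrightarrow> 1 \<le> hgt Q m"
  proof
    assume "never_above P Q"
    hence "hgt P m \<le> hgt Q m" unfolding never_above_iff[OF P Q] by simp
    thus "1 \<le> hgt Q m" using hP[of m] by simp
  next
    assume a: "1 \<le> hgt Q m"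
    show "never_above P Q" unfolding never_above_iff[OF P Q]
    proof (intro allI impI)
      fix k assume k: "k \<le> m + r"
      have "k - m \<le> hgt Q k" using height_fun_slope[OF hQ k] lQ k by auto
      moreover have "1 \<le> hgt Q k" if "m \<le> k" using height_fun_mono[OF hQ that k] a by simp
      ultimately show "hgt P k \<le> hgt Q k" using hP[OF k] by auto
    qed
  qed
  assume a: "1 \<le> hgt Q m"
  hence PQ': "never_above P Q" using PQ by simp
  show "X \<in> indeps (lattice_path_matroid P Q) \<longleftrightarrow>
      X \<subseteq> {1..m + r} \<and> (\<forall>j\<le>m + r. cnt X {1..j} \<le> hgt Q j) \<and>
      (X \<inter> {1..m} = {} \<longrightarrow> (\<forall>j\<le>m + r. m < j \<longrightarrow> cnt X {1..j} < hgt Q j))"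
  proof (cases "X \<subseteq> {1..m + r}")
    case True
    have "(\<forall>x\<in>X. hgt P (x - 1) < f x \<and> f x \<le> hgt Q x) \<longleftrightarrow>
      (\<forall>x\<in>X. (if x - 1 < m then 0 else max 1 (x - 1 - m)) < f x \<and> f x \<le> hgt Q x)" for f
    proof (rule ball_cong[OF refl])
      fix x assume "x \<in> X"
      hence "x \<in> {1..m + r}" using True by blast
      hence "x - 1 \<le> m + r" by auto
      thus "(hgt P (x - 1) < f x \<and> f x \<le> hgt Q x) \<longleftrightarrow>
        ((if x - 1 < m then 0 else max 1 (x - 1 - m)) < f x \<and> f x \<le> hgt Q x)" by (simp only: hP)
    qed
    thus ?thesis using lpm_indep(2)[OF P Q PQ', of X] notch_matching[OF hQ _ True mr(1) a] lQ True by simp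
  qed (use lpm_indep(2)[OF P Q PQ', of X] in simp)
qed

section \<open>From lattice paths to presentations\<close>

lemma card_slice:
  assumes "bij_betw f E {1..n}" "X \<subseteq> E"
  shows "card {e \<in> X. a < f e \<and> f e \<le> b} = card (f ` X \<inter> {a<..b})"
proof -
  have inj: "inj_on f X" using assms by (meson bij_betw_def inj_on_subset)
  have "f ` {e \<in> X. a < f e \<and> f e \<le> b} = f ` X \<inter> {a<..b}" by auto
  moreover have "inj_on f {e \<in> X. a < f e \<and> f e \<le> b}" using inj by (rule inj_on_subset) auto
  ultimately show ?thesis using card_image by metis
qed

lemma card_slice_full:
  assumes "bij_betw f E {1..n}" "b \<le> n"
  shows "card {e \<in> E. a < f e \<and> f e \<le> b} = b - a"
proof -
  have "f ` E \<inter> {a<..b} = {a<..b}" using assms by (auto simp: bij_betw_def)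
  thus ?thesis using card_slice[OF assms(1) subset_refl, of a b] by simp
qed

text \<open>The chain consists of the sets \<open>J j\<close> of elements with labels up to
  \<open>j\<close>. For the notched lower path, \<open>T\<close> is cut off where the paths meet
  again and \<open>B\<close> is the slice of labels from \<open>m + 1\<close> to that point; the
  strict bounds for sets that miss \<open>J m\<close> then say exactly that \<open>B\<close> is not
  included.\<close>

lemma notch_matroid_imp_pres:
  assumes M: "matroid M" and N: "notch_matroid M"
  shows "nested_pres (ground M) (\<lambda>I. I \<in> indeps M) \<or> notch_pres (ground M) (\<lambda>I. I \<in> indeps M)"
proof -
  obtain m r P Q where PQ: "P \<in> lattice_paths m r" "Q \<in> lattice_paths m r" "never_above P Q"
    "P = replicate m East @ replicate r North \<or>
         m \<ge> 1 \<and> r \<ge> 1 \<and> P = replicate (m - 1) East @ [North, East] @ replicate (r - 1) North"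
    and iso: "matroid_iso M (lattice_path_matroid P Q)"
    using N unfolding notch_matroid_def by (elim exE conjE) (rule that)
  define n where "n = m + r"
  define q where "q = hgt Q"
  have lQ: "length Q = n" "q n = r"
    using PQ(2) count_East_North[of Q] hgt_ge_length[of Q n] by (auto simp: lattice_paths_def n_def q_def)
  have hq: "height_fun q n" unfolding q_def using height_fun_hgt[of Q] lQ by simp
  let ?E = "ground M"
  have gl: "ground (lattice_path_matroid P Q) = {1..n}" using lpm_indep(1)[OF PQ(1-3)] by (simp add: n_def)
  obtain f where f: "bij_betw f ?E {1..n}"
    "\<And>X. X \<subseteq> ?E \<Longrightarrow> X \<in> indeps M \<longleftrightarrow> f ` X \<in> indeps (lattice_path_matroid P Q)"
    using iso unfolding matroid_iso_def gl by blast
  define J where "J = (\<lambda>j. {e \<in> ?E. f e \<le> j})"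
  have f1: "1 \<le> f e" "f e \<le> n" if "e \<in> ?E" for e using f(1) that by (auto simp: bij_betw_def)
  have fX: "f ` X \<subseteq> {1..n}" if "X \<subseteq> ?E" for X using that f1 by auto
  have cJ: "card (X \<inter> J j) = card (f ` X \<inter> {1..j})" if X: "X \<subseteq> ?E" for X j
  proof -
    have "X \<inter> J j = {e \<in> X. 0 < f e \<and> f e \<le> j}" using X f1 by (fastforce simp: J_def)
    moreover have "f ` X \<inter> {1..j} = f ` X \<inter> {0<..j}" by auto
    ultimately show ?thesis using card_slice[OF f(1) X, of 0 j] by simp
  qed
  have Jmono: "J i \<subseteq> J j" if "i \<le> j" for i j using that by (auto simp: J_def)
  have chain: "J i \<subseteq> J j \<or> J j \<subseteq> J i" for i j using Jmono[of i j] Jmono[of j i] by linarith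
  from PQ(4) show ?thesis
  proof
    assume P: "P = replicate m East @ replicate r North"
    have "X \<in> indeps M \<longleftrightarrow> (\<forall>j\<le>n. card (X \<inter> J j) \<le> q j)" if X: "X \<subseteq> ?E" for X
      using lpm_nested(3)[OF PQ(2), of "f ` X"] f(2)[OF X] fX[OF X] cJ[OF X] by (simp add: P n_def q_def)
    hence "nested_pres ?E (\<lambda>I. I \<in> indeps M)"
      unfolding nested_pres_def
      by (intro exI[of _ "(\<lambda>j. (J j, q j)) ` {..n}"] conjI) (use chain in \<open>auto simp: J_def\<close>)
    thus ?thesis ..
  next
    assume P: "m \<ge> 1 \<and> r \<ge> 1 \<and> P = replicate (m - 1) East @ [North, East] @ replicate (r - 1) North"
    note ln = lpm_notch[OF PQ(2), of P]
    have qm: "1 \<le> q m" using ln(2) P PQ(3) by (simp add: q_def)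
    have ind: "X \<in> indeps M \<longleftrightarrow> (\<forall>j\<le>n. card (X \<inter> J j) \<le> q j) \<and>
        (X \<inter> J m = {} \<longrightarrow> (\<forall>j\<le>n. m < j \<longrightarrow> card (X \<inter> J j) < q j))" if X: "X \<subseteq> ?E" for X
    proof -
      have "f ` X \<inter> {1..m} = {} \<longleftrightarrow> X \<inter> J m = {}" using X f1 by (fastforce simp: J_def)
      thus ?thesis using ln(3)[of "f ` X"] P f(2)[OF X] fX[OF X] cJ[OF X] qm by (simp add: n_def q_def)
    qed
    have ex: "m < n \<and> q n = n - m" using P lQ by (simp add: n_def)
    \<comment> \<open>The first index after \<open>m\<close> at which the upper path is as low as
      the lower one. It exists because the paths have a common end.\<close>
    define j0 where "j0 = (LEAST j. m < j \<and> q j = j - m)"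
    have j0: "m < j0" "q j0 = j0 - m" "j0 \<le> n"
      using LeastI[of "\<lambda>j. m < j \<and> q j = j - m", OF ex] Least_le[of "\<lambda>j. m < j \<and> q j = j - m", OF ex] by (auto simp: j0_def)
    have j0min: "j0 \<le> j" if "m < j" "q j = j - m" for j
      unfolding j0_def by (rule Least_le) (use that in simp)
    have qge: "j - m \<le> q j" if "j \<le> n" for j using height_fun_slope[OF hq that] ex that by auto
    define B where "B = {e \<in> ?E. m < f e \<and> f e \<le> j0}"
    have cB: "card B = j0 - m" unfolding B_def by (rule card_slice_full[OF f(1) j0(3)])
    have cBJ: "card (B \<inter> J j) = j - m" if "j \<le> j0" for j
    proof -
      have "B \<inter> J j = {e \<in> ?E. m < f e \<and> f e \<le> j}" using that by (auto simp: B_def J_def)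
      thus ?thesis using card_slice_full[OF f(1), of j m] that j0 by simp
    qed
    have "m \<in> f ` ?E" using f(1) P j0 by (auto simp: bij_betw_def)
    then obtain em where em: "em \<in> ?E" "f em = m" by auto
    have fin: "finite ?E" by (rule matroidD(1)[OF M])
    have BT: "B \<subset> J j0"
    proof
      show "B \<subseteq> J j0" unfolding B_def J_def by blast
      have "em \<in> J j0" "em \<notin> B" using em j0(1) unfolding B_def J_def by auto
      thus "B \<noteq> J j0" by blast
    qed
    \<comment> \<open>An index below \<open>m\<close> gives a set disjoint from \<open>B\<close>
      that misses the element labelled \<open>m\<close>; at \<open>m\<close> the bound is positive
      by \<open>qm\<close>; strictly between \<open>m\<close> and \<open>j0\<close> the height
      exceeds \<open>j - m\<close>, the size of \<open>B \<inter> J j\<close>.\<close>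
    have cond: "(J j, q j) = (J j0, card B) \<or> J j \<inter> B = {} \<and> (0 < q j \<or> \<not> J j0 \<subseteq> J j \<union> B) \<or>
        J j0 \<subseteq> J j \<union> B \<and> card (B \<inter> J j) < q j" if j: "j \<le> j0" for j
    proof -
      consider "j = j0" | "j < m" | "j = m" | "m < j" "j < j0" using j by linarith
      thus ?thesis
      proof cases
        case 2
        have "em \<in> J j0" "em \<notin> J j \<union> B" using em j0 2 by (auto simp: J_def B_def)
        moreover have "J j \<inter> B = {}" using 2 by (auto simp: J_def B_def)
        ultimately show ?thesis by blast
      next
        case 4
        hence "j - m < q j" using j0min[of j] qge[of j] j0 by linarith
        moreover have "J j0 \<subseteq> J j \<union> B" using 4 by (auto simp: J_def B_def)
        ultimately show ?thesis using cBJ[OF j] by simp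
      qed (use qm j0 cB in \<open>auto simp: J_def B_def\<close>)
    qed
    have ind': "X \<in> indeps M \<longleftrightarrow> (\<forall>j\<le>j0. card (X \<inter> J j) \<le> q j) \<and> \<not> B \<subseteq> X" if X: "X \<subseteq> ?E" for X
    proof
      assume i: "X \<in> indeps M"
      hence 1: "\<forall>j\<le>n. card (X \<inter> J j) \<le> q j" using ind[OF X] by blast
      have "\<not> B \<subseteq> X"
      proof
        assume "B \<subseteq> X"
        hence "B \<subseteq> X \<inter> J j0" using BT by auto
        moreover have "finite (X \<inter> J j0)" using fin finite_subset[OF X] by simp
        moreover have "card (X \<inter> J j0) \<le> card B" using 1[rule_format, OF j0(3)] j0(2) cB by simp
        ultimately have B: "X \<inter> J j0 = B" using card_seteq[of "X \<inter> J j0" B] by simp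
        have "X \<inter> J m = {}"
        proof -
          have "X \<inter> J m \<subseteq> B \<inter> J m" using B Jmono[of m j0] j0 by auto
          thus ?thesis by (auto simp: B_def J_def)
        qed
        hence "card (X \<inter> J j0) < q j0" using i ind[OF X] j0 by blast
        thus False using B cB j0 by simp
      qed
      moreover have "\<forall>j\<le>j0. card (X \<inter> J j) \<le> q j" using 1 le_trans[OF _ j0(3)] by blast
      ultimately show "(\<forall>j\<le>j0. card (X \<inter> J j) \<le> q j) \<and> \<not> B \<subseteq> X" by blast
    next
      assume a: "(\<forall>j\<le>j0. card (X \<inter> J j) \<le> q j) \<and> \<not> B \<subseteq> X"
      have 1: "card (X \<inter> J j) \<le> q j" if j: "j \<le> n" for j
      proof (cases "j \<le> j0")
        case False
        \<comment> \<open>Past \<open>j0\<close> the prefix gains at most one element per step,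
          while the least admissible height \<open>j - m\<close> grows by one per step, so the bound
          at \<open>j0\<close> implies the later ones.\<close>
        have "X \<inter> J j \<subseteq> (X \<inter> J j0) \<union> {e \<in> ?E. j0 < f e \<and> f e \<le> j}" using X by (auto simp: J_def)
        hence "card (X \<inter> J j) \<le> card ((X \<inter> J j0) \<union> {e \<in> ?E. j0 < f e \<and> f e \<le> j})"
          by (rule card_mono[rotated]) (use fin finite_subset[OF X] in simp)
        also have "\<dots> \<le> card (X \<inter> J j0) + (j - j0)"
          using card_Un_le[of "X \<inter> J j0" "{e \<in> ?E. j0 < f e \<and> f e \<le> j}"] card_slice_full[OF f(1) j, of j0] by simp
        also have "\<dots> \<le> q j0 + (j - j0)" using a by simp
        finally show ?thesis using j0 False qge[OF j] by linarith
      qed (use a in simp)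
      \<comment> \<open>A set missing \<open>J m\<close> lies, up to \<open>j\<close>, in the slice
        of labels \<open>m + 1..j\<close>. Equality in the bound forces the whole slice into
        \<open>X\<close> and makes the paths meet at \<open>j\<close>; then
        \<open>j0 \<le> j\<close> and \<open>B\<close> lies in that slice.\<close>
      have 2: "card (X \<inter> J j) < q j" if e: "X \<inter> J m = {}" and j: "j \<le> n" "m < j" for j
      proof (rule ccontr)
        assume "\<not> card (X \<inter> J j) < q j"
        hence ge: "j - m \<le> card (X \<inter> J j)" using qge[OF j(1)] by simp
        let ?D = "{x \<in> ?E. m < f x \<and> f x \<le> j}"
        have D: "X \<inter> J j \<subseteq> ?D" using e X by (auto simp: J_def disjoint_iff not_le)
        have cD: "card ?D = j - m" by (rule card_slice_full[OF f(1) j(1)])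
        have eq: "X \<inter> J j = ?D" using card_seteq[OF _ D] fin cD ge by simp
        hence "q j = j - m" using 1[OF j(1)] qge[OF j(1)] cD \<open>\<not> card (X \<inter> J j) < q j\<close> by simp
        hence "j0 \<le> j" using j0min j by simp
        hence "B \<subseteq> ?D" by (auto simp: B_def)
        thus False using a eq by auto
      qed
      show "X \<in> indeps M" using ind[OF X] 1 2 by blast
    qed
    have "notch_pres ?E (\<lambda>I. I \<in> indeps M)"
      unfolding notch_pres_def
    proof (rule exI[of _ "(\<lambda>j. (J j, q j)) ` {..j0}"], rule exI[of _ B], rule exI[of _ "J j0"], intro conjI allI impI)
      show "\<forall>p\<in>(\<lambda>j. (J j, q j)) ` {..j0}. \<forall>q\<in>(\<lambda>j. (J j, q j)) ` {..j0}. fst p \<subseteq> fst q \<or> fst q \<subseteq> fst p"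
        using chain by simp
      show "J j0 \<subseteq> ?E" by (auto simp: J_def)
      show "B \<subset> J j0" by (rule BT)
      show "(J j0, card B) \<in> (\<lambda>j. (J j, q j)) ` {..j0}" using cB j0 by auto
      show "\<forall>(Z, k)\<in>(\<lambda>j. (J j, q j)) ` {..j0}. Z \<subseteq> J j0 \<and> ((Z, k) = (J j0, card B) \<or> Z \<inter> B = {} \<and> (0 < k \<or> \<not> J j0 \<subseteq> Z \<union> B) \<or>
        J j0 \<subseteq> Z \<union> B \<and> cnt B Z < k)"
      proof (rule ballI)
        fix p assume "p \<in> (\<lambda>j. (J j, q j)) ` {..j0}"
        then obtain j where j: "j \<le> j0" "p = (J j, q j)" by auto
        show "case p of (Z, k) \<Rightarrow> Z \<subseteq> J j0 \<and> ((Z, k) = (J j0, card B) \<or> Z \<inter> B = {} \<and>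
          (0 < k \<or> \<not> J j0 \<subseteq> Z \<union> B) \<or> J j0 \<subseteq> Z \<union> B \<and> cnt B Z < k)"
          unfolding j(2) prod.case using Jmono[OF j(1)] cond[OF j(1)] by blast
      qed
      fix I assume I: "I \<subseteq> ?E"
      show "I \<in> indeps M \<longleftrightarrow> (\<forall>(Z, k)\<in>(\<lambda>j. (J j, q j)) ` {..j0}. cnt I Z \<le> k) \<and> \<not> B \<subseteq> I"
        using ind'[OF I] by auto
    qed simp
    thus ?thesis ..
  qed
qed

section \<open>From presentations to lattice paths\<close>

lemma chain_enumeration:
  assumes "finite E" "finite D" "\<And>Z. Z \<in> D \<Longrightarrow> Z \<subseteq> E" "\<And>Y Z. Y \<in> D \<Longrightarrow> Z \<in> D \<Longrightarrow> Y \<subseteq> Z \<or> Z \<subseteq> Y"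
  shows "\<exists>f :: 'a \<Rightarrow> nat. bij_betw f E {1..card E} \<and> (\<forall>Z\<in>D. \<forall>x\<in>E. x \<in> Z \<longleftrightarrow> f x \<le> card Z)"
  using assms
proof (induction "card E" arbitrary: E D)
  case 0
  hence "E = {}" by simp
  thus ?case by (intro exI[of _ "\<lambda>_. 0"]) (simp add: bij_betw_def)
next
  case (Suc n)
  \<comment> \<open>The union of the proper members of the chain is again a proper member, or empty.
    An element outside it exists and takes the last label.\<close>
  have "\<Union>(D - {E}) \<noteq> E"
  proof (cases "D - {E} = {}")
    case True
    have "E \<noteq> {}" using Suc.hyps(2) by auto
    thus ?thesis using True by (metis Union_empty)
  next
    case False
    have un: "finite C \<Longrightarrow> C \<noteq> {} \<Longrightarrow> C \<subseteq> D \<Longrightarrow> \<Union>C \<in> C" for C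
    proof (induction C rule: finite_ne_induct)
      case (insert Z C)
      hence "Z \<subseteq> \<Union>C \<or> \<Union>C \<subseteq> Z" using Suc.prems(4)[of Z "\<Union>C"] by blast
      hence "\<Union>(insert Z C) = \<Union>C \<or> \<Union>(insert Z C) = Z" by auto
      thus ?case using insert by auto
    qed simp
    have "\<Union>(D - {E}) \<in> D - {E}" by (rule un) (use False Suc.prems(2) in auto)
    thus ?thesis by blast
  qed
  moreover have "\<Union>(D - {E}) \<subseteq> E" using Suc.prems(3) by auto
  ultimately obtain e where e: "e \<in> E" "e \<notin> \<Union>(D - {E})" by blast
  have cE: "card (E - {e}) = n" using Suc.hyps(2) e Suc.prems(1) by simp
  have "\<exists>f :: 'a \<Rightarrow> nat. bij_betw f (E - {e}) {1..card (E - {e})} \<and>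
      (\<forall>Z\<in>D - {E}. \<forall>x\<in>E - {e}. x \<in> Z \<longleftrightarrow> f x \<le> card Z)"
  proof (rule Suc.hyps(1))
    show "Z \<subseteq> E - {e}" if "Z \<in> D - {E}" for Z using that Suc.prems(3)[of Z] e by auto
    show "Y \<subseteq> Z \<or> Z \<subseteq> Y" if "Y \<in> D - {E}" "Z \<in> D - {E}" for Y Z using that Suc.prems(4) by blast
  qed (use cE Suc.prems in auto)
  then obtain f :: "'a \<Rightarrow> nat" where f: "bij_betw f (E - {e}) {1..n}"
    "\<And>Z x. Z \<in> D - {E} \<Longrightarrow> x \<in> E - {e} \<Longrightarrow> x \<in> Z \<longleftrightarrow> f x \<le> card Z" using cE by auto
  define g where "g = f(e := Suc n)"
  have ge: "g x = f x" if "x \<in> E - {e}" for x using that by (simp add: g_def)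
  have "bij_betw g (E - {e}) {1..n}" using f(1) bij_betw_cong[of "E - {e}" g f] ge by blast
  moreover have "g e \<notin> {1..n}" by (simp add: g_def)
  ultimately have "bij_betw g (insert e (E - {e})) (insert (g e) {1..n})"
    using notIn_Un_bij_betw[of e "E - {e}" g "{1..n}"] by simp
  moreover have "insert e (E - {e}) = E" "insert (g e) {1..n} = {1..card E}" using e Suc.hyps(2) by (auto simp: g_def)
  ultimately have bij: "bij_betw g E {1..card E}" by simp
  have "x \<in> Z \<longleftrightarrow> g x \<le> card Z" if Z: "Z \<in> D" and x: "x \<in> E" for Z x
  proof (cases "Z = E")
    case True
    have "g x \<in> {1..card E}" using bij x by (auto simp: bij_betw_def)
    thus ?thesis using True x by simp
  next
    case False
    hence Z': "Z \<in> D - {E}" "e \<notin> Z" "Z \<subseteq> E - {e}" using Z e Suc.prems(3)[OF Z] by auto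
    hence "card Z \<le> n" using cE card_mono[of "E - {e}" Z] Suc.prems(1) by simp
    thus ?thesis using f(2)[OF Z'(1), of x] ge[of x] x Z' by (cases "x = e") (auto simp: g_def)
  qed
  thus ?case using bij by blast
qed

locale chain_enum =
  fixes E :: "'a set" and S :: "('a set \<times> nat) set" and f :: "'a \<Rightarrow> nat"
  assumes finE: "finite E" and finS: "finite S" and SE: "(Z, k) \<in> S \<Longrightarrow> Z \<subseteq> E"
    and bij: "bij_betw f E {1..card E}"
    and init: "(Z, k) \<in> S \<Longrightarrow> x \<in> E \<Longrightarrow> x \<in> Z \<longleftrightarrow> f x \<le> card Z"
begin

definition J :: "nat \<Rightarrow> 'a set" where "J j = {e \<in> E. f e \<le> j}"

text \<open>The best bound on \<open>card (X \<inter> J j)\<close> that follows from a single member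
  of \<open>S\<close>: at most \<open>k\<close> elements inside \<open>Z\<close>, and all of
  \<open>J j\<close> outside it. The pair \<open>({}, 0)\<close> contributes the trivial bound
  \<open>card (J j)\<close>; with it the heights start at 0.\<close>

definition q :: "nat \<Rightarrow> nat" where "q j = Min ((\<lambda>(Z, k). k + card (J j - Z)) ` insert ({}, 0) S)"

lemma J_card: "j \<le> card E \<Longrightarrow> card (J j) = j"
proof -
  assume j: "j \<le> card E"
  have "J j = {e \<in> E. 0 < f e \<and> f e \<le> j}" using bij unfolding J_def bij_betw_def by fastforce
  thus ?thesis using card_slice_full[OF bij j, of 0] by simp
qed

lemma J_sub: "J j \<subseteq> E" by (auto simp: J_def)

lemma J_mono: "i \<le> j \<Longrightarrow> J i \<subseteq> J j" by (auto simp: J_def)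

lemma J_fin: "finite (J j)" using J_sub finE finite_subset by blast

lemma J_init: "(Z, k) \<in> S \<Longrightarrow> J (card Z) = Z"
  using init[of Z k] SE[of Z k] by (auto simp: J_def)

lemma q_le: "(Z, k) \<in> insert ({}, 0) S \<Longrightarrow> q j \<le> k + card (J j - Z)"
  unfolding q_def using finS by (intro Min_le) (auto intro!: image_eqI[of _ _ "(Z, k)"])

lemma q_obtain: obtains Z k where "(Z, k) \<in> insert ({}, 0) S" "q j = k + card (J j - Z)"
proof -
  have "q j \<in> (\<lambda>(Z, k). k + card (J j - Z)) ` insert ({}, 0) S"
    unfolding q_def using finS by (intro Min_in) auto
  then obtain p where "p \<in> insert ({}, 0) S" "q j = (case p of (Z, k) \<Rightarrow> k + card (J j - Z))" by (rule imageE)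
  thus thesis using that[of "fst p" "snd p"] by (simp add: case_prod_beta)
qed

lemma J_Suc_le: "card (J (Suc j) - Z) \<le> card (J j - Z) + 1"
proof -
  have "card {e \<in> E. j < f e \<and> f e \<le> Suc j} \<le> 1"
    using card_slice[OF bij subset_refl, of j "Suc j"] card_mono[of "{j<..Suc j}" "f ` E \<inter> {j<..Suc j}"] by simp
  moreover have "J (Suc j) - Z \<subseteq> (J j - Z) \<union> {e \<in> E. j < f e \<and> f e \<le> Suc j}" by (auto simp: J_def)
  hence "card (J (Suc j) - Z) \<le> card ((J j - Z) \<union> {e \<in> E. j < f e \<and> f e \<le> Suc j})"
    by (rule card_mono[rotated]) (use finE J_fin in simp)
  ultimately show ?thesis using card_Un_le[of "J j - Z" "{e \<in> E. j < f e \<and> f e \<le> Suc j}"] by linarith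
qed

lemma q_height: "height_fun q (card E)"
  unfolding height_fun_def
proof (intro conjI allI impI)
  have "J 0 = {}" using J_card[of 0] J_fin[of 0] by simp
  thus "q 0 = 0" using q_le[of "{}" 0 0] by simp
  fix j
  show "q j \<le> q (Suc j)"
  proof -
    obtain Z k where Z: "(Z, k) \<in> insert ({}, 0) S" "q (Suc j) = k + card (J (Suc j) - Z)" by (rule q_obtain)
    have "card (J j - Z) \<le> card (J (Suc j) - Z)" by (rule card_mono) (use J_fin in \<open>auto simp: J_def\<close>)
    thus ?thesis using q_le[OF Z(1), of j] Z(2) by simp
  qed
  show "q (Suc j) \<le> Suc (q j)"
  proof -
    obtain Z k where Z: "(Z, k) \<in> insert ({}, 0) S" "q j = k + card (J j - Z)" by (rule q_obtain)
    thus ?thesis using q_le[OF Z(1), of "Suc j"] J_Suc_le[of j Z] by simp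
  qed
qed

lemma q_n_le: "q (card E) \<le> card E"
  using q_le[of "{}" 0 "card E"] J_card[of "card E"] by simp

text \<open>Each \<open>Z\<close> is itself the prefix of length \<open>card Z\<close>, where
  \<open>q\<close> is at most \<open>k\<close>; conversely, the bound of \<open>Z\<close> limits
  every prefix up to the elements outside \<open>Z\<close>.\<close>

lemma bounds_iff:
  assumes X: "X \<subseteq> E"
  shows "(\<forall>(Z, k)\<in>S. cnt X Z \<le> k) \<longleftrightarrow> (\<forall>j\<le>card E. card (X \<inter> J j) \<le> q j)"
proof
  have fX: "finite X" using X finE finite_subset by blast
  {
    assume a: "\<forall>(Z, k)\<in>S. cnt X Z \<le> k"
    show "\<forall>j\<le>card E. card (X \<inter> J j) \<le> q j"
    proof (intro allI impI)
      fix j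
      obtain Z k where Z: "(Z, k) \<in> insert ({}, 0) S" "q j = k + card (J j - Z)" by (rule q_obtain)
      have "card (X \<inter> J j) \<le> card ((X \<inter> Z) \<union> (J j - Z))" by (rule card_mono) (use fX J_fin in auto)
      also have "\<dots> \<le> cnt X Z + card (J j - Z)" by (rule card_Un_le)
      also have "\<dots> \<le> q j" using Z a by auto
      finally show "card (X \<inter> J j) \<le> q j" .
    qed
  }
  assume a: "\<forall>j\<le>card E. card (X \<inter> J j) \<le> q j"
  show "\<forall>(Z, k)\<in>S. cnt X Z \<le> k"
  proof clarify
    fix Z k assume Z: "(Z, k) \<in> S"
    have "card Z \<le> card E" using SE[OF Z] finE card_mono by blast
    hence "cnt X Z \<le> q (card Z)" using a J_init[OF Z] by fastforce
    also have "\<dots> \<le> k" using q_le[of Z k "card Z"] Z J_init[OF Z] by simp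
    finally show "cnt X Z \<le> k" .
  qed
qed

lemma image_prefix: assumes "X \<subseteq> E" shows "card (f ` X \<inter> {1..j}) = card (X \<inter> J j)"
proof -
  have "X \<inter> J j = {e \<in> X. 0 < f e \<and> f e \<le> j}" using assms bij unfolding J_def bij_betw_def by fastforce
  moreover have "f ` X \<inter> {1..j} = f ` X \<inter> {0<..j}" by auto
  ultimately show ?thesis using card_slice[OF bij assms, of 0 j] by simp
qed

lemma image_E: "X \<subseteq> E \<Longrightarrow> f ` X \<subseteq> {1..card E}"
  using bij by (auto simp: bij_betw_def)

end

lemma nested_pres_imp_notch:
  assumes M: "matroid M" and p: "nested_pres (ground M) (\<lambda>I. I \<in> indeps M)"
  shows "notch_matroid M"
proof -
  let ?E = "ground M"
  obtain S :: "('a set \<times> nat) set" where S: "finite S" "\<forall>(Z, k)\<in>S. Z \<subseteq> ?E"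
    "\<forall>p\<in>S. \<forall>q\<in>S. fst p \<subseteq> fst q \<or> fst q \<subseteq> fst p"
    "\<forall>I. I \<subseteq> ?E \<longrightarrow> (I \<in> indeps M \<longleftrightarrow> (\<forall>(Z, k)\<in>S. cnt I Z \<le> k))"
    using p unfolding nested_pres_def by (elim exE conjE) (rule that)
  have fE: "finite ?E" by (rule matroidD(1)[OF M])
  obtain f where f: "bij_betw f ?E {1..card ?E}" "\<forall>Z\<in>fst ` S. \<forall>x\<in>?E. x \<in> Z \<longleftrightarrow> f x \<le> card Z"
  proof -
    have "\<exists>f :: 'a \<Rightarrow> nat. bij_betw f ?E {1..card ?E} \<and> (\<forall>Z\<in>fst ` S. \<forall>x\<in>?E. x \<in> Z \<longleftrightarrow> f x \<le> card Z)"
    proof (rule chain_enumeration[OF fE])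
      show "Z \<subseteq> ?E" if "Z \<in> fst ` S" for Z using that S(2) by fastforce
      show "Y \<subseteq> Z \<or> Z \<subseteq> Y" if "Y \<in> fst ` S" "Z \<in> fst ` S" for Y Z using that S(3) by fastforce
    qed (use S in simp)
    thus thesis using that by blast
  qed
  interpret chain_enum ?E S f
  proof
    show "Z \<subseteq> ?E" if "(Z, k) \<in> S" for Z k using S(2) that by blast
    show "x \<in> Z \<longleftrightarrow> f x \<le> card Z" if "(Z, k) \<in> S" "x \<in> ?E" for Z k x using f(2) that by (force simp: image_iff)
  qed (use fE S f in auto)
  define n where "n = card ?E"
  define r where "r = q n"
  define m where "m = n - r"
  have n: "n = m + r" using q_n_le by (simp add: n_def m_def r_def)
  define Q where "Q = path_of q n"
  have hq: "height_fun q n" using q_height by (simp add: n_def)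
  have Q: "Q \<in> lattice_paths m r" unfolding Q_def by (rule path_of_lattice[OF hq _ n]) (simp add: r_def)
  have hQ: "hgt Q j = q j" if "j \<le> n" for j unfolding Q_def by (rule hgt_path_of[OF hq that])
  define P where "P = replicate m East @ replicate r North"
  note l = lpm_nested[OF Q, folded P_def n]
  have g: "ground (lattice_path_matroid P Q) = {1..n}" using lpm_indep(1)[OF l(1) Q l(2)] n by simp
  have "X \<in> indeps M \<longleftrightarrow> f ` X \<in> indeps (lattice_path_matroid P Q)" if X: "X \<subseteq> ?E" for X
  proof -
    have "X \<in> indeps M \<longleftrightarrow> (\<forall>j\<le>n. card (X \<inter> J j) \<le> q j)" using S(4) X bounds_iff[OF X] by (simp add: n_def)
    also have "\<dots> \<longleftrightarrow> f ` X \<in> indeps (lattice_path_matroid P Q)"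
      using l(3)[of "f ` X"] image_E[OF X] image_prefix[OF X] hQ by (simp add: n_def)
    finally show ?thesis .
  qed
  hence "matroid_iso M (lattice_path_matroid P Q)"
    unfolding matroid_iso_def g using f(1) by (intro exI[of _ f]) (simp add: n_def)
  thus ?thesis unfolding notch_matroid_def using l(1,2) Q P_def by blast
qed

text \<open>The set \<open>T - B\<close> is added to the chain before labelling. It becomes the
  prefix of length \<open>m\<close>, the elements of \<open>B\<close> receive the next labels up to
  \<open>t\<close>, and the notch of the lower path sits at \<open>m\<close>.\<close>

lemma notch_pres_imp_notch:
  assumes M: "matroid M" and p: "notch_pres (ground M) (\<lambda>I. I \<in> indeps M)"
  shows "notch_matroid M"
proof -
  let ?E = "ground M"
  obtain S :: "('a set \<times> nat) set" and B T where S: "finite S"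
    "\<forall>p\<in>S. \<forall>q\<in>S. fst p \<subseteq> fst q \<or> fst q \<subseteq> fst p"
    and T: "T \<subseteq> ?E" "B \<subset> T" "(T, card B) \<in> S"
    and c: "\<forall>(Z, k)\<in>S. Z \<subseteq> T \<and> ((Z, k) = (T, card B) \<or> Z \<inter> B = {} \<and> (0 < k \<or> \<not> T \<subseteq> Z \<union> B) \<or>
        T \<subseteq> Z \<union> B \<and> cnt B Z < k)"
    and ind: "\<forall>I. I \<subseteq> ?E \<longrightarrow> (I \<in> indeps M \<longleftrightarrow> (\<forall>(Z, k)\<in>S. cnt I Z \<le> k) \<and> \<not> B \<subseteq> I)"
    using p unfolding notch_pres_def by (elim exE conjE) (rule that)
  have fE: "finite ?E" by (rule matroidD(1)[OF M])
  have fT: "finite T" "finite B"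
    using finite_subset[OF T(1) fE] finite_subset[OF psubset_imp_subset[OF T(2)]] by blast+
  have "{} \<in> indeps M" by (rule matroidD(3)[OF M])
  hence B0: "B \<noteq> {}" using ind[rule_format, of "{}"] by simp
  have c': "Z \<subseteq> T" "(Z, k) = (T, card B) \<or> Z \<inter> B = {} \<and> (0 < k \<or> \<not> T \<subseteq> Z \<union> B) \<or>
      T \<subseteq> Z \<union> B \<and> cnt B Z < k" if "(Z, k) \<in> S" for Z k
    using bspec[OF c that] by (simp_all only: prod.case)
  have cmp: "Z \<subseteq> T - B \<or> T - B \<subseteq> Z" if "(Z, k) \<in> S" for Z k
    using c'[OF that] by blast
  have cmp': "Y \<subseteq> T - B \<or> T - B \<subseteq> Y" if "Y \<in> fst ` S" for Y
  proof -
    from that obtain k where "(Y, k) \<in> S" by force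
    thus ?thesis by (rule cmp)
  qed
  have cmp2: "Y \<subseteq> Z \<or> Z \<subseteq> Y" if YZ: "Y \<in> fst ` S" "Z \<in> fst ` S" for Y Z
  proof -
    from YZ obtain k l where kl: "(Y, k) \<in> S" "(Z, l) \<in> S" by force
    thus ?thesis using S(2)[rule_format, OF kl] by simp
  qed
  obtain f where f: "bij_betw f ?E {1..card ?E}"
    "\<forall>Z\<in>insert (T - B) (fst ` S). \<forall>x\<in>?E. x \<in> Z \<longleftrightarrow> f x \<le> card Z"
  proof -
    have "\<exists>f :: 'a \<Rightarrow> nat. bij_betw f ?E {1..card ?E} \<and> (\<forall>Z\<in>insert (T - B) (fst ` S). \<forall>x\<in>?E. x \<in> Z \<longleftrightarrow> f x \<le> card Z)"
    proof (rule chain_enumeration[OF fE])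
      show "Z \<subseteq> ?E" if "Z \<in> insert (T - B) (fst ` S)" for Z using that c'(1) T(1) by fastforce
      show "Y \<subseteq> Z \<or> Z \<subseteq> Y" if "Y \<in> insert (T - B) (fst ` S)" "Z \<in> insert (T - B) (fst ` S)" for Y Z
        using that cmp'[of Y] cmp'[of Z] cmp2[of Y Z] by blast
    qed (use S in simp)
    thus thesis using that by blast
  qed
  interpret chain_enum ?E S f
  proof
    show "Z \<subseteq> ?E" if "(Z, k) \<in> S" for Z k using c'(1)[OF that] T(1) by blast
    show "x \<in> Z \<longleftrightarrow> f x \<le> card Z" if "(Z, k) \<in> S" "x \<in> ?E" for Z k x using f(2) that by (force simp: image_iff)
  qed (use fE S f in auto)
  define n where "n = card ?E"
  define m where "m = card (T - B)"
  have Jm: "J m = T - B" using f(2) T unfolding J_def m_def by auto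
  have m1: "1 \<le> m" unfolding m_def using T(2) fT by (metis One_nat_def Suc_leI card_gt_0_iff finite_Diff psubset_imp_ex_mem empty_iff)
  have cT: "card T = m + card B" unfolding m_def using card_Diff_subset[of B T] T(2) fT card_mono[of T B] by auto
  define t where "t = card T"
  have Jt: "J t = T" using J_init[OF T(3)] by (simp add: t_def)
  have tn: "t \<le> n" unfolding t_def n_def using card_mono[OF fE T(1)] .
  have mt: "m < t" using cT B0 fT by (simp add: t_def card_gt_0_iff)
  \<comment> \<open>Used three times: the empty set gives \<open>1 \<le> q m\<close>, so the notched
    path stays below \<open>Q\<close>; a set of almost all of \<open>B\<close> together with the
    coloops gives the height of the endpoint; an arbitrary set that avoids \<open>J m\<close> gives
    the strict bounds.\<close>
  have strict: "card (X \<inter> J j) < q j"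
    if X: "X \<subseteq> ?E" and XB: "X \<inter> T \<subset> B" and le: "\<And>Z k. (Z, k) \<in> S \<Longrightarrow> cnt X Z \<le> k" and j: "m \<le> j" for X j
  proof -
    have fX: "finite X" using X fE finite_subset by blast
    obtain Z k where Z: "(Z, k) \<in> insert ({}, 0) S" "q j = k + card (J j - Z)" by (rule q_obtain)
    have Tj: "T - B \<subseteq> J j" using Jm J_mono[OF j] by simp
    have gen: "card (X \<inter> J j) \<le> cnt X Z + card (J j - Z)"
    proof -
      have "X \<inter> J j \<subseteq> (X \<inter> Z) \<union> (J j - Z)" by auto
      thus ?thesis
        using card_mono[of "(X \<inter> Z) \<union> (J j - Z)" "X \<inter> J j"] card_Un_le[of "X \<inter> Z" "J j - Z"] fX J_fin[of j] by simp
    qed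
    have less: "card (X \<inter> J j) < card (J j - Z)" if "X \<inter> Z = {}" "\<not> T - B \<subseteq> Z"
    proof (rule psubset_card_mono)
      show "X \<inter> J j \<subset> J j - Z" using that Tj XB by blast
    qed (use J_fin in simp)
    have "Z = {} \<and> k = 0 \<or> (Z, k) = (T, card B) \<or> Z \<inter> B = {} \<and> Z \<subseteq> T \<and> (0 < k \<or> \<not> T \<subseteq> Z \<union> B) \<or>
        T \<subseteq> Z \<union> B \<and> cnt B Z < k \<and> Z \<subseteq> T" using Z(1) c'[of Z k] by blast
    then consider "Z = {}" "k = 0" | "Z = T" "k = card B" | "Z \<inter> B = {}" "Z \<subseteq> T" "0 < k" |
      "Z \<inter> B = {}" "Z \<subseteq> T" "\<not> T \<subseteq> Z \<union> B" | "cnt B Z < k" "Z \<subseteq> T" by blast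
    thus ?thesis
    proof cases
      case 1
      thus ?thesis using less Z(2) T(2) by auto
    next
      case 2
      have "cnt X T < card B" by (rule psubset_card_mono[OF fT(2) XB])
      thus ?thesis using gen Z(2) 2 by simp
    next
      case 3
      hence "X \<inter> Z = {}" using XB by blast
      thus ?thesis using gen Z(2) 3 by simp
    next
      case 4
      hence "X \<inter> Z = {}" "\<not> T - B \<subseteq> Z" using XB by blast+
      from less[OF this] show ?thesis using Z(2) by simp
    next
      case 5
      have "cnt X Z \<le> cnt B Z" by (rule card_mono) (use fT 5 XB in auto)
      thus ?thesis using gen Z(2) 5 by simp
    qed
  qed
  have qm: "1 \<le> q m"
  proof -
    have "{} \<inter> T \<subset> B" using B0 by blast
    thus ?thesis using strict[of "{}" m] by simp
  qed
  define r where "r = q n"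
  have qt: "q t \<le> card B" using q_le[of T "card B" t] T(3) Jt by simp
  \<comment> \<open>The final height has to be \<open>card B\<close> plus the number of elements
    outside \<open>T\<close>, which leaves exactly \<open>m\<close> East steps.\<close>
  have qn: "n = m + r"
  proof -
    have cTE: "card (?E - T) = n - t" unfolding n_def t_def using card_Diff_subset[OF fT(1) T(1)] .
    have Jn: "J n = ?E" using J_card[of n] card_subset_eq[OF fE J_sub] by (simp add: n_def)
    have up: "q n \<le> card B + (n - t)" using q_le[of T "card B" n] T(3) Jn cTE by simp
    obtain b where b: "b \<in> B" using B0 by auto
    \<comment> \<open>the independent set \<open>B - {b}\<close> together with all coloops outside \<open>T\<close>\<close>
    let ?X = "(B - {b}) \<union> (?E - T)"
    have XE: "?X \<subseteq> ?E" using T by auto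
    have XT: "?X \<inter> T = B - {b}" using T by auto
    have le: "card (?X \<inter> Z) \<le> k" if Z: "(Z, k) \<in> S" for Z k
    proof -
      have ZT: "Z \<subseteq> T" by (rule c'(1)[OF Z])
      hence XZ: "?X \<inter> Z = (B - {b}) \<inter> Z" using T by auto
      have "(Z, k) = (T, card B) \<or> Z \<inter> B = {} \<or> cnt B Z < k" using c'(2)[OF Z] by blast
      moreover have "card ((B - {b}) \<inter> Z) \<le> cnt B Z" "card ((B - {b}) \<inter> T) \<le> card B"
        by (rule card_mono; use fT in auto)+
      ultimately show ?thesis unfolding XZ by (auto simp: Int_commute)
    qed
    have "?X \<inter> T \<subset> B" unfolding XT using b by blast
    hence "card (?X \<inter> J n) < q n" by (rule strict[OF XE]) (use le mt tn in auto)
    moreover have "?X \<inter> J n = ?X" using XE Jn by auto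
    moreover have "card ?X = card (B - {b}) + card (?E - T)" by (rule card_Un_disjoint) (use fT fE T in auto)
    moreover have "card (B - {b}) + 1 = card B" using b fT by (metis Suc_eq_plus1 card_Suc_Diff1)
    ultimately have "card B + (n - t) \<le> q n" using cTE by simp
    thus ?thesis using up cT tn unfolding r_def t_def by simp
  qed
  have r1: "1 \<le> r" using qn mt tn by simp
  define Q where "Q = path_of q n"
  have hq: "height_fun q n" using q_height by (simp add: n_def)
  have Q: "Q \<in> lattice_paths m r" unfolding Q_def by (rule path_of_lattice[OF hq _ qn]) (simp add: r_def)
  have hQ: "hgt Q j = q j" if "j \<le> n" for j unfolding Q_def by (rule hgt_path_of[OF hq that])
  define P where "P = replicate (m - 1) East @ [North, East] @ replicate (r - 1) North"
  have hm: "1 \<le> hgt Q m" using hQ[of m] qm mt tn by simp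
  note l = lpm_notch[OF Q m1 r1 P_def, folded qn]
  have PQ: "never_above P Q" using l(2) hm by simp
  have g: "ground (lattice_path_matroid P Q) = {1..n}" using lpm_indep(1)[OF l(1) Q PQ] qn by simp
  have "X \<in> indeps M \<longleftrightarrow> f ` X \<in> indeps (lattice_path_matroid P Q)" if X: "X \<subseteq> ?E" for X
  proof -
    have fX: "finite X" using X fE finite_subset by blast
    have em: "f ` X \<inter> {1..m} = {} \<longleftrightarrow> X \<inter> J m = {}"
      using image_prefix[OF X, of m] fX by (metis card_0_eq card_eq_0_iff finite_Int finite_imageI)
    have "f ` X \<in> indeps (lattice_path_matroid P Q) \<longleftrightarrow> (\<forall>j\<le>n. card (X \<inter> J j) \<le> q j) \<and>
      (X \<inter> J m = {} \<longrightarrow> (\<forall>j\<le>n. m < j \<longrightarrow> card (X \<inter> J j) < q j))"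
      using l(3)[OF hm, of "f ` X"] image_E[OF X] image_prefix[OF X] hQ em by (simp add: n_def)
    also have "\<dots> \<longleftrightarrow> (\<forall>(Z, k)\<in>S. cnt X Z \<le> k) \<and> \<not> B \<subseteq> X"
    proof (intro iffI conjI)
      assume a: "(\<forall>j\<le>n. card (X \<inter> J j) \<le> q j) \<and> (X \<inter> J m = {} \<longrightarrow> (\<forall>j\<le>n. m < j \<longrightarrow> card (X \<inter> J j) < q j))"
      thus "\<forall>(Z, k)\<in>S. cnt X Z \<le> k" using bounds_iff[OF X] by (simp add: n_def)
      show "\<not> B \<subseteq> X"
      proof
        assume BX: "B \<subseteq> X"
        have "cnt X T \<le> card B" using a tn Jt qt by (metis order_trans)
        hence "X \<inter> T = B" using card_seteq[of "X \<inter> T" B] BX T(2) fX by auto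
        hence "X \<inter> J m = {}" "X \<inter> J t = B" using Jm Jt by auto
        hence "card B < q t" using a mt tn by metis
        thus False using qt by simp
      qed
    next
      assume a: "(\<forall>(Z, k)\<in>S. cnt X Z \<le> k) \<and> \<not> B \<subseteq> X"
      thus "\<forall>j\<le>n. card (X \<inter> J j) \<le> q j" using bounds_iff[OF X] by (simp add: n_def)
      show "X \<inter> J m = {} \<longrightarrow> (\<forall>j\<le>n. m < j \<longrightarrow> card (X \<inter> J j) < q j)"
      proof (intro impI allI)
        fix j assume e: "X \<inter> J m = {}" and j: "j \<le> n" "m < j"
        show "card (X \<inter> J j) < q j"
          by (rule strict[OF X]) (use e Jm a j in auto)
      qed
    qed
    finally show ?thesis using ind X by blast
  qed
  hence "matroid_iso M (lattice_path_matroid P Q)"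
    unfolding matroid_iso_def g using f(1) by (intro exI[of _ f]) (simp add: n_def)
  thus ?thesis unfolding notch_matroid_def using l(1) PQ Q P_def m1 r1 by blast
qed

text \<open>A basis of \<open>Y - {b}\<close> becomes dependent when \<open>b\<close> is added. A
  bound violated in this way was tight before, so each element of its set is spanned by the part of
  the basis inside it and hence lies in \<open>Y\<close>. The predicate \<open>Q\<close> leaves room
  for the extra requirement of a notch presentation.\<close>

lemma (in rank_matroid) cflat_element_cover:
  assumes Y: "cflat E r Y" and b: "b \<in> Y" and S: "\<And>Z k. (Z, k) \<in> S \<Longrightarrow> Z \<subseteq> E"
    and ind: "\<And>I. I \<subseteq> E \<Longrightarrow> r I = card I \<longleftrightarrow> (\<forall>(Z, k)\<in>S. cnt I Z \<le> k) \<and> Q I"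
  shows "(\<exists>Z k. (Z, k) \<in> S \<and> b \<in> Z \<and> Z \<subseteq> Y) \<or> (\<exists>I\<subseteq>Y. r I = card I \<and> Q I \<and> \<not> Q (insert b I))"
proof -
  note YD = cflatD[OF Y]
  obtain I where I: "I \<subseteq> Y - {b}" "r I = card I" "r I = r (Y - {b})"
    using basis_exists[of "Y - {b}"] YD(1) by blast
  have IE: "I \<subseteq> E" "insert b I \<subseteq> E" using I(1) YD(1) b by auto
  have fI: "finite I" by (rule finite_sub[OF IE(1)])
  have bI: "b \<notin> I" using I(1) by auto
  have "r (insert b I) \<le> r Y" by (rule mono) (use I(1) b in auto)
  hence "r (insert b I) \<noteq> card (insert b I)" using I YD(3)[OF b] fI bI by simp
  hence nI: "\<not> ((\<forall>(Z, k)\<in>S. cnt (insert b I) Z \<le> k) \<and> Q (insert b I))" using ind[OF IE(2)] by blast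
  have iI: "\<forall>(Z, k)\<in>S. cnt I Z \<le> k" "Q I" using ind[OF IE(1)] I(2) by blast+
  show ?thesis
  proof (cases "Q (insert b I)")
    case False
    thus ?thesis using iI(2) I by blast
  next
    case True
    then obtain Z k where Z: "(Z, k) \<in> S" "k < cnt (insert b I) Z" using nI by force
    have le: "cnt I Z \<le> k" using iI(1) Z(1) by blast
    have bZ: "b \<in> Z" using le Z(2) by (cases "b \<in> Z") auto
    hence ck: "cnt I Z = k" using le Z(2) fI bI by simp
    have iZ: "r (I \<inter> Z) = cnt I Z" by (rule indep_mono[OF I(2) _ fI]) auto
    have "Z \<subseteq> Y"
    proof
      fix z assume z: "z \<in> Z"
      have zE: "z \<in> E" using z S[OF Z(1)] by blast
      show "z \<in> Y"
      proof (cases "z \<in> I")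
        case False
        have sub: "insert z (I \<inter> Z) \<subseteq> E" using zE IE by auto
        have "insert z (I \<inter> Z) \<inter> Z = insert z (I \<inter> Z)" using z by auto
        hence "\<not> card (insert z (I \<inter> Z) \<inter> Z) \<le> k" using ck False fI by simp
        hence "r (insert z (I \<inter> Z)) \<noteq> card (insert z (I \<inter> Z))" using ind[OF sub] Z(1) by blast
        hence "r (insert z (I \<inter> Z)) = r (I \<inter> Z)"
          using r_insert[of z "I \<inter> Z"] r_insert_ge[of "I \<inter> Z" z] iZ False fI by simp
        thus ?thesis by (rule cflat_closed[OF Y _ zE, rotated]) (use I(1) in auto)
      qed (use I(1) in auto)
    qed
    thus ?thesis using Z(1) bZ by blast
  qed
qed

text \<open>Two elements that separate incomparable cyclic flats would lie in incomparable members
  of the chain.\<close>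

lemma (in rank_matroid) nested_pres_notchy:
  assumes "nested_pres E (\<lambda>I. r I = card I)"
  shows "notchy E r"
proof -
  obtain S :: "('a set \<times> nat) set" where S: "finite S" "\<forall>(Z, k)\<in>S. Z \<subseteq> E"
    "\<forall>p\<in>S. \<forall>q\<in>S. fst p \<subseteq> fst q \<or> fst q \<subseteq> fst p"
    "\<forall>I. I \<subseteq> E \<longrightarrow> (r I = card I \<longleftrightarrow> (\<forall>(Z, k)\<in>S. cnt I Z \<le> k))"
    using assms unfolding nested_pres_def by (elim exE conjE) (rule that)
  have cov: "\<exists>Z k. (Z, k) \<in> S \<and> b \<in> Z \<and> Z \<subseteq> Y" if "cflat E r Y" "b \<in> Y" for Y b
  proof -
    have "Z \<subseteq> E" if "(Z, k) \<in> S" for Z k using bspec[OF S(2) that] by simp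
    hence "(\<exists>Z k. (Z, k) \<in> S \<and> b \<in> Z \<and> Z \<subseteq> Y) \<or> (\<exists>I\<subseteq>Y. r I = card I \<and> True \<and> \<not> True)"
      by (rule cflat_element_cover[OF that]) (use S(4) in \<open>simp only: simp_thms, blast\<close>)
    thus ?thesis by simp
  qed
  have "X \<subseteq> Y \<or> Y \<subseteq> X" if X: "cflat E r X" and Y: "cflat E r Y" for X Y
  proof (rule ccontr)
    assume "\<not> (X \<subseteq> Y \<or> Y \<subseteq> X)"
    then obtain a b where ab: "a \<in> X" "a \<notin> Y" "b \<in> Y" "b \<notin> X" by blast
    obtain Z k where Z: "(Z, k) \<in> S" "a \<in> Z" "Z \<subseteq> X" using cov[OF X ab(1)] by blast
    obtain W l where W: "(W, l) \<in> S" "b \<in> W" "W \<subseteq> Y" using cov[OF Y ab(3)] by blast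
    have "Z \<subseteq> W \<or> W \<subseteq> Z" using S(3)[rule_format, OF Z(1) W(1)] by simp
    thus False using Z W ab by blast
  qed
  thus ?thesis unfolding notchy_def by blast
qed

text \<open>The witness is \<open>B\<close> together with the loops. Separating elements covered by
  members of the chain are impossible, as for a nested presentation, so one of the two flats
  includes \<open>B\<close>; its rank is then forced by \<open>r T \<le> card B\<close>.\<close>

lemma (in rank_matroid) notch_pres_notchy:
  assumes "notch_pres E (\<lambda>I. r I = card I)"
  shows "notchy E r"
proof -
  obtain S :: "('a set \<times> nat) set" and B T where S: "finite S"
    "\<forall>p\<in>S. \<forall>q\<in>S. fst p \<subseteq> fst q \<or> fst q \<subseteq> fst p"
    and T: "T \<subseteq> E" "B \<subset> T" "(T, card B) \<in> S"
    and c: "\<forall>(Z, k)\<in>S. Z \<subseteq> T \<and> ((Z, k) = (T, card B) \<or> Z \<inter> B = {} \<and> (0 < k \<or> \<not> T \<subseteq> Z \<union> B) \<or>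
        T \<subseteq> Z \<union> B \<and> cnt B Z < k)"
    and ind: "\<forall>I. I \<subseteq> E \<longrightarrow> (r I = card I \<longleftrightarrow> (\<forall>(Z, k)\<in>S. cnt I Z \<le> k) \<and> \<not> B \<subseteq> I)"
    using assms unfolding notch_pres_def by (elim exE conjE) (rule that)
  have c': "Z \<subseteq> T" "(Z, k) = (T, card B) \<or> Z \<inter> B = {} \<and> (0 < k \<or> \<not> T \<subseteq> Z \<union> B) \<or>
      T \<subseteq> Z \<union> B \<and> cnt B Z < k" if "(Z, k) \<in> S" for Z k
    using bspec[OF c that] by (simp_all only: prod.case)
  have BE: "B \<subseteq> E" using T by auto
  have fB: "finite B" by (rule finite_sub[OF BE])
  have cov: "(\<exists>Z k. (Z, k) \<in> S \<and> b \<in> Z \<and> Z \<subseteq> Y) \<or> b \<in> B \<and> B \<subseteq> Y" if Y: "cflat E r Y" and b: "b \<in> Y" for Y b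
  proof -
    have "(\<exists>Z k. (Z, k) \<in> S \<and> b \<in> Z \<and> Z \<subseteq> Y) \<or> (\<exists>I\<subseteq>Y. r I = card I \<and> \<not> B \<subseteq> I \<and> \<not> \<not> B \<subseteq> insert b I)"
      by (rule cflat_element_cover[OF Y b]) (use c'(1) T(1) ind in \<open>blast+\<close>)
    thus ?thesis using b by blast
  qed
  have subT: "Y \<subseteq> T" if "cflat E r Y" for Y
    using cov[OF that] c'(1) T(2) by blast
  have indB: "r (B - {b}) = card (B - {b})" if b: "b \<in> B" for b
  proof -
    have "card ((B - {b}) \<inter> Z) \<le> k" if Z: "(Z, k) \<in> S" for Z k
    proof -
      have "card ((B - {b}) \<inter> Z) \<le> cnt B Z" "card ((B - {b}) \<inter> T) \<le> card B"
        by (rule card_mono; use fB in auto)+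
      thus ?thesis using c'(2)[OF Z] by (auto simp: Int_commute)
    qed
    moreover have "B - {b} \<subseteq> E" "\<not> B \<subseteq> B - {b}" using b BE by auto
    ultimately show ?thesis using ind by blast
  qed
  have rT: "r T \<le> card B"
  proof -
    obtain I where I: "I \<subseteq> T" "r I = card I" "r I = r T" using basis_exists[OF T(1)] by blast
    have "I \<subseteq> E" using I T by auto
    hence "cnt I T \<le> card B" using ind I(2) T(3) by blast
    thus ?thesis using I by (simp add: Int_absorb2)
  qed
  let ?L = "loops E r"
  have main: "Y = B \<union> ?L \<and> r Y + 1 = r (cyc r E) \<and> card Y = r Y + card ?L + 1 \<and> (X \<inter> Y = ?L \<or> X \<union> Y = cyc r E)"
    if X: "cflat E r X" and Y: "cflat E r Y" and ab: "a \<in> X" "a \<notin> Y" "b \<in> Y" "b \<notin> X" and b: "b \<in> B" "B \<subseteq> Y" for X Y a b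
  proof -
    note XD = cflatD[OF X] and YD = cflatD[OF Y]
    have LY: "?L \<subseteq> Y" "?L \<subseteq> X" using loops_sub X Y by auto
    have rY1: "r (insert a Y) = r Y + 1" using YD(2)[of a] XD(1) ab by blast
    have "r (insert a Y) \<le> r T" by (rule mono) (use subT[OF X] subT[OF Y] ab in auto)
    moreover have "card (B - {b}) \<le> r Y" using mono[of "B - {b}" Y] indB[OF b(1)] b by auto
    moreover have cB: "card (B - {b}) + 1 = card B" using b(1) fB by (metis Suc_eq_plus1 card_Suc_Diff1)
    ultimately have rY: "r Y + 1 = card B" "r T = card B" using rT rY1 by auto
    have nl: "b' \<notin> ?L" if "b' \<in> B" for b'
    proof
      assume l: "b' \<in> ?L"
      have "b' \<noteq> b" using l ab LY by auto
      hence "r {b'} = card {b'}" using that indep_mono[OF indB[OF b(1)], of "{b'}"] fB by auto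
      thus False using l by (simp add: loops_def)
    qed
    \<comment> \<open>Together with \<open>B - {b}\<close>, the element \<open>y\<close> forms a set
      larger than the rank of \<open>Y\<close>, so some bound is violated. The side conditions leave
      only a bound 0 on a set that contains \<open>y\<close>.\<close>
    have "y \<in> ?L" if y: "y \<in> Y" "y \<notin> B" for y
    proof -
      have yE: "y \<in> E" using y YD by auto
      have s: "insert y (B - {b}) \<subseteq> E" using yE BE by auto
      have "r (insert y (B - {b})) \<le> r Y" by (rule mono) (use y b in auto)
      hence "r (insert y (B - {b})) \<noteq> card (insert y (B - {b}))" using rY cB y fB by simp
      moreover have "\<not> B \<subseteq> insert y (B - {b})" using b y by auto
      ultimately obtain Z k where Z: "(Z, k) \<in> S" "k < card (insert y (B - {b}) \<inter> Z)" using ind s by force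
      have le: "card (insert y (B - {b}) \<inter> Z) \<le> card ((B - {b}) \<inter> Z) + 1"
        by (cases "y \<in> Z") (use fB y in auto)
      have m: "card ((B - {b}) \<inter> Z) \<le> cnt B Z" "card ((B - {b}) \<inter> Z) \<le> card (B - {b})"
        by (rule card_mono; use fB in auto)+
      have "\<not> (Z, k) = (T, card B)" using Z(2) le m cB by auto
      moreover have "\<not> cnt B Z < k" using Z(2) le m by auto
      ultimately have d: "Z \<inter> B = {}" using c'(2)[OF Z(1)] by blast
      hence "(B - {b}) \<inter> Z = {}" by blast
      hence k0: "k = 0" using Z(2) le by simp
      have yZ: "y \<in> Z" using Z(2) \<open>(B - {b}) \<inter> Z = {}\<close> by (cases "y \<in> Z") auto
      have "{y} \<subseteq> E" using yE by simp
      have "\<not> (\<forall>(Z, k)\<in>S. card ({y} \<inter> Z) \<le> k)"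
      proof
        assume "\<forall>(Z, k)\<in>S. card ({y} \<inter> Z) \<le> k"
        from bspec[OF this Z(1)] show False using k0 yZ by simp
      qed
      hence "r {y} \<noteq> card {y}" using ind[rule_format, OF \<open>{y} \<subseteq> E\<close>] by blast
      thus ?thesis using r_singleton[of y] yE by (simp add: loops_def)
    qed
    hence Yeq: "Y = B \<union> ?L" using b LY by auto
    have Ltop: "X \<subseteq> cyc r E" "Y \<subseteq> cyc r E" using cflat_sub_cyc[OF X subset_refl XD(1)] cflat_sub_cyc[OF Y subset_refl YD(1)] .
    have top: "cyc r E = T"
    proof
      show "cyc r E \<subseteq> T" by (rule subT[OF cflat_top])
      show "T \<subseteq> cyc r E"
      proof
        fix t assume t: "t \<in> T"
        have "r (insert t (insert a Y)) \<le> r T" by (rule mono) (use t subT[OF X] subT[OF Y] ab in auto)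
        hence "r (insert t (insert a Y)) = r (insert a Y)" using r_insert_ge[of "insert a Y" t] rY rY1 by simp
        thus "t \<in> cyc r E" by (rule cflat_closed[OF cflat_top, rotated -1]) (use Ltop ab t T in auto)
      qed
    qed
    have "card Y = card B + card ?L"
      unfolding Yeq by (rule card_Un_disjoint) (use fB nl finite_sub[OF cflatD(1)[OF cflat_loops]] in auto)
    \<comment> \<open>If \<open>X\<close> meets \<open>B\<close>, then a member of the chain inside
      \<open>X\<close> meets \<open>B\<close>, and such a member covers
      \<open>T - B\<close>.\<close>
    moreover have "X \<inter> Y = ?L \<or> X \<union> Y = T"
    proof (cases "X \<inter> B = {}")
      case True
      thus ?thesis using Yeq LY by blast
    next
      case False
      then obtain b' where b': "b' \<in> X" "b' \<in> B" by blast
      have "\<not> B \<subseteq> X" using ab b by auto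
      then obtain Z k where Z: "(Z, k) \<in> S" "b' \<in> Z" "Z \<subseteq> X" using cov[OF X b'(1)] by blast
      hence "T \<subseteq> Z \<union> B" using c'(2)[OF Z(1)] b' by blast
      thus ?thesis using Z b subT[OF X] subT[OF Y] by blast
    qed
    ultimately show ?thesis using Yeq rY top by simp
  qed
  have "(X = B \<union> ?L \<or> Y = B \<union> ?L) \<and> r (B \<union> ?L) + 1 = r (cyc r E) \<and> card (B \<union> ?L) = r (B \<union> ?L) + card ?L + 1 \<and>
     (X \<inter> Y = ?L \<or> X \<union> Y = cyc r E)"
    if X: "cflat E r X" and Y: "cflat E r Y" and n: "\<not> X \<subseteq> Y" "\<not> Y \<subseteq> X" for X Y
  proof -
    obtain a b where ab: "a \<in> X" "a \<notin> Y" "b \<in> Y" "b \<notin> X" using n by blast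
    show ?thesis
    proof (cases "b \<in> B \<and> B \<subseteq> Y")
      case True
      thus ?thesis using main[OF X Y ab] by blast
    next
      case False
      show ?thesis
      proof (cases "a \<in> B \<and> B \<subseteq> X")
        case True
        thus ?thesis using main[OF Y X ab(3,4,1,2)] by (simp add: Int_commute Un_commute) blast
      next
        case nF: False
        obtain Z k where Z: "(Z, k) \<in> S" "a \<in> Z" "Z \<subseteq> X" using cov[OF X ab(1)] nF by blast
        obtain W l where W: "(W, l) \<in> S" "b \<in> W" "W \<subseteq> Y" using cov[OF Y ab(3)] False by blast
        have "Z \<subseteq> W \<or> W \<subseteq> Z" using S(2)[rule_format, OF Z(1) W(1)] by simp
        thus ?thesis using Z W ab by blast
      qed
    qed
  qed
  thus ?thesis unfolding notchy_def by blast
qed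

text \<open>The cyclic flats with their ranks serve as the bounds. If they do not form a chain, all
  of them except \<open>B\<close> do, and the bound of \<open>B\<close> is expressed by not
  including \<open>C\<close>, which is \<open>B\<close> without the loops.\<close>

lemma (in rank_matroid) notchy_imp_pres:
  assumes "notchy E r"
  shows "nested_pres E (\<lambda>I. r I = card I) \<or> notch_pres E (\<lambda>I. r I = card I)"
proof (cases "\<forall>X Y. cflat E r X \<longrightarrow> cflat E r Y \<longrightarrow> X \<subseteq> Y \<or> Y \<subseteq> X")
  case True
  let ?S = "(\<lambda>Z. (Z, r Z)) ` {Z. cflat E r Z}"
  have "{Z. cflat E r Z} \<subseteq> Pow E" by (auto simp: cflat_def)
  hence "finite ?S" using fin finite_subset by blast
  moreover have "\<forall>I. I \<subseteq> E \<longrightarrow> (r I = card I \<longleftrightarrow> (\<forall>(Z, k)\<in>?S. cnt I Z \<le> k))" using indep_cflats by auto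
  ultimately have "nested_pres E (\<lambda>I. r I = card I)"
    unfolding nested_pres_def using True by (intro exI[of _ ?S]) (auto simp: cflat_def)
  thus ?thesis ..
next
  case False
  define L where "L = loops E r"
  define T where "T = cyc r E"
  obtain B where B: "\<forall>X Y. cflat E r X \<longrightarrow> cflat E r Y \<longrightarrow> \<not> X \<subseteq> Y \<longrightarrow> \<not> Y \<subseteq> X \<longrightarrow>
     (X = B \<or> Y = B) \<and> r B + 1 = r T \<and> card B = r B + card L + 1 \<and>
     (X \<inter> Y = L \<or> X \<union> Y = T)"
    using assms unfolding notchy_def L_def T_def by (rule exE)
  obtain X0 Y0 where XY: "cflat E r X0" "cflat E r Y0" "\<not> X0 \<subseteq> Y0" "\<not> Y0 \<subseteq> X0" using False by blast
  have B0: "X0 = B \<or> Y0 = B" "r B + 1 = r T" "card B = r B + card L + 1" using B[rule_format, OF XY] by auto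
  have cB: "cflat E r B" using B0(1) XY by auto
  have cL: "cflat E r L" unfolding L_def by (rule cflat_loops)
  have cT: "cflat E r T" unfolding T_def by (rule cflat_top)
  have LZ: "L \<subseteq> Z" if "cflat E r Z" for Z unfolding L_def by (rule loops_sub[OF that])
  have ZT: "Z \<subseteq> T" if "cflat E r Z" for Z unfolding T_def using cflat_sub_cyc[OF that subset_refl cflatD(1)[OF that]] .
  have rL: "r L = 0" unfolding L_def by (rule r_loops)
  note fB = cflatD(4)[OF cB] and fL = cflatD(4)[OF cL]
  define C where "C = B - L"
  have BC: "B = C \<union> L" using LZ[OF cB] by (auto simp: C_def)
  have cC: "card C = r B + 1" unfolding C_def using card_Diff_subset[OF fL LZ[OF cB]] B0(3) by simp
  have LB: "L \<noteq> B" using B0(3) by auto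
  have TB: "T \<noteq> B" using B0(2) by auto
  let ?S = "(\<lambda>Z. (Z, r Z)) ` {Z. cflat E r Z \<and> Z \<noteq> B}"
  have indS: "r I = card I \<longleftrightarrow> (\<forall>(Z, k)\<in>?S. cnt I Z \<le> k) \<and> \<not> C \<subseteq> I" if I: "I \<subseteq> E" for I
  proof -
    have fI: "finite I" by (rule finite_sub[OF I])
    \<comment> \<open>Since \<open>card C = r B + 1\<close> and the bound of \<open>L\<close>
      excludes loops, the bound of \<open>B\<close> fails only when all of \<open>C\<close> is
      included.\<close>
    have "cnt I B \<le> r B \<longleftrightarrow> \<not> C \<subseteq> I" if IL: "cnt I L \<le> r L"
    proof
      assume a: "cnt I B \<le> r B"
      show "\<not> C \<subseteq> I"
      proof
        assume "C \<subseteq> I"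
        hence "card C \<le> cnt I B" using BC fI by (intro card_mono) auto
        thus False using a cC by simp
      qed
    next
      assume a: "\<not> C \<subseteq> I"
      have "I \<inter> L = {}" using IL rL fI by simp
      hence "I \<inter> B \<subset> C" using a BC by blast
      hence "cnt I B < card C" by (rule psubset_card_mono[rotated]) (use fB in \<open>simp add: C_def\<close>)
      thus "cnt I B \<le> r B" using cC by simp
    qed
    moreover have "(\<forall>Z. cflat E r Z \<longrightarrow> cnt I Z \<le> r Z) \<longleftrightarrow>
      (\<forall>(Z, k)\<in>?S. cnt I Z \<le> k) \<and> cnt I B \<le> r B" using cB by auto
    moreover have "(\<forall>(Z, k)\<in>?S. cnt I Z \<le> k) \<Longrightarrow> cnt I L \<le> r L" using cL LB by auto
    ultimately show ?thesis using indep_cflats[OF I] by blast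
  qed
  have cond: "(Z, r Z) = (T, card C) \<or> Z \<inter> C = {} \<and> (0 < r Z \<or> \<not> T \<subseteq> Z \<union> C) \<or> T \<subseteq> Z \<union> C \<and> cnt C Z < r Z"
    if Z: "cflat E r Z" "Z \<noteq> B" for Z
  proof -
    \<comment> \<open>Nullity leaves only \<open>L\<close> strictly below \<open>B\<close>, and rank
      leaves only \<open>T\<close> strictly above it. For a flat incomparable with \<open>B\<close>
      the two alternatives of the hypothesis become the two side conditions.\<close>
    consider "Z \<subset> B" | "B \<subset> Z" | "\<not> Z \<subseteq> B" "\<not> B \<subseteq> Z" using Z(2) by blast
    thus ?thesis
    proof cases
      case 1
      have "r B + card Z < r Z + card B" by (rule cflat_nullity_less[OF cB 1])
      moreover have "r Z + card L < r L + card Z" if "L \<noteq> Z" using cflat_nullity_less[OF Z(1), of L] LZ[OF Z(1)] that by blast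
      ultimately have "Z = L" using B0(3) rL by force
      hence "Z \<inter> C = {}" "Z \<union> C = B" using BC by (auto simp: C_def)
      thus ?thesis using TB ZT[OF cB] by auto
    next
      case 2
      have "r B < r Z" by (rule cflat_r_less[OF cB 2 cflatD(1)[OF Z(1)]])
      hence "Z = T" using cflat_r_less[OF Z(1), of T] ZT[OF Z(1)] cflatD(1)[OF cT] B0(2) by force
      thus ?thesis using cC B0(2) by simp
    next
      case 3
      have "Z \<inter> B = L \<or> Z \<union> B = T" using B[rule_format, OF Z(1) cB 3] by blast
      thus ?thesis
      proof
        assume "Z \<inter> B = L"
        hence "Z \<inter> C = {}" by (auto simp: C_def)
        moreover have "0 < r Z"
        proof (rule ccontr)
          assume "\<not> 0 < r Z"
          hence "z \<in> L" if "z \<in> Z" for z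
            using mono[of "{z}" Z] that cflatD(1)[OF Z(1)] by (auto simp: L_def loops_def)
          thus False using 3 LZ[OF cB] by blast
        qed
        ultimately show ?thesis by blast
      next
        assume T: "Z \<union> B = T"
        hence "T \<subseteq> Z \<union> C" using BC LZ[OF Z(1)] by auto
        moreover have "r (Z \<inter> B) + 1 \<le> r Z" using submod[of Z B] T B0(2) by simp
        moreover have "cnt C Z \<le> r (Z \<inter> B)"
        proof -
          let ?D = "(C \<inter> Z) \<union> L"
          obtain x where "x \<in> B" "x \<notin> Z" using 3 by blast
          hence "?D \<subset> B" using BC LZ[OF Z(1)] by blast
          hence "r B + card ?D < r ?D + card B" by (rule cflat_nullity_less[OF cB])
          moreover have "card ?D = cnt C Z + card L"
            by (rule card_Un_disjoint) (use fB fL in \<open>auto simp: C_def\<close>)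
          moreover have "r ?D \<le> r (Z \<inter> B)" by (rule mono) (use BC LZ[OF Z(1)] in auto)
          ultimately show ?thesis using B0(3) by simp
        qed
        ultimately show ?thesis by simp
      qed
    qed
  qed
  have "notch_pres E (\<lambda>I. r I = card I)"
    unfolding notch_pres_def
  proof (rule exI[of _ ?S], rule exI[of _ C], rule exI[of _ T], intro conjI allI impI)
    have "{Z. cflat E r Z \<and> Z \<noteq> B} \<subseteq> Pow E" by (auto simp: cflat_def)
    thus "finite ?S" using fin by (meson finite_Pow_iff finite_imageI finite_subset)
    show "\<forall>p\<in>?S. \<forall>q\<in>?S. fst p \<subseteq> fst q \<or> fst q \<subseteq> fst p" using B by auto
    show "T \<subseteq> E" by (rule cflatD(1)[OF cT])
    show "C \<subset> T" using BC ZT[OF cB] TB by blast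
    show "(T, card C) \<in> ?S" using cT TB cC B0(2) by auto
    show "\<forall>(Z, k)\<in>?S. Z \<subseteq> T \<and> ((Z, k) = (T, card C) \<or> Z \<inter> C = {} \<and> (0 < k \<or> \<not> T \<subseteq> Z \<union> C) \<or>
        T \<subseteq> Z \<union> C \<and> cnt C Z < k)"
    proof (rule ballI)
      fix p assume "p \<in> ?S"
      then obtain Z where Z: "cflat E r Z" "Z \<noteq> B" "p = (Z, r Z)" by auto
      show "case p of (Z, k) \<Rightarrow> Z \<subseteq> T \<and> ((Z, k) = (T, card C) \<or> Z \<inter> C = {} \<and> (0 < k \<or> \<not> T \<subseteq> Z \<union> C) \<or>
        T \<subseteq> Z \<union> C \<and> cnt C Z < k)"
        unfolding Z(3) prod.case using ZT[OF Z(1)] cond[OF Z(1,2)] by blast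
    qed
    fix I assume "I \<subseteq> E"
    thus "r I = card I \<longleftrightarrow> (\<forall>(Z, k)\<in>?S. cnt I Z \<le> k) \<and> \<not> C \<subseteq> I" by (rule indS)
  qed
  thus ?thesis ..
qed

lemma pres_cong:
  assumes "\<And>I. I \<subseteq> E \<Longrightarrow> P I = P' I"
  shows "nested_pres E P \<longleftrightarrow> nested_pres E P'" "notch_pres E P \<longleftrightarrow> notch_pres E P'"
  unfolding nested_pres_def notch_pres_def using assms by (simp_all cong: imp_cong)

theorem notch_matroid_iff:
  assumes M: "matroid M"
  shows "notch_matroid M \<longleftrightarrow> notch_like M"
proof -
  interpret rank_matroid "ground M" "rank_of M" by (rule rank_matroid_rank_of[OF M])
  have ind: "I \<in> indeps M \<longleftrightarrow> rank_of M I = card I" if "I \<subseteq> ground M" for I using indeps_iff[OF M] that by simp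
  have c: "nested_pres (ground M) (\<lambda>I. I \<in> indeps M) \<longleftrightarrow> nested_pres (ground M) (\<lambda>I. rank_of M I = card I)"
    "notch_pres (ground M) (\<lambda>I. I \<in> indeps M) \<longleftrightarrow> notch_pres (ground M) (\<lambda>I. rank_of M I = card I)"
    by (rule pres_cong; rule ind; assumption)+
  show ?thesis
    unfolding notch_like_def
    using notch_matroid_imp_pres[OF M] nested_pres_imp_notch[OF M] notch_pres_imp_notch[OF M]
      nested_pres_notchy notch_pres_notchy notchy_imp_pres c by blast
qed

theorem excluded_minor_notch:
  assumes M: "matroid M"
  shows "excluded_minor notch_matroid M \<longleftrightarrow> exc (ground M) (rank_of M)"
proof -
  have "excluded_minor notch_matroid M = excluded_minor notch_like M"
    by (rule excluded_minor_cong[OF M]) (use notch_matroid_iff M proper_minor_matroid[OF M] in blast)+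
  thus ?thesis using excluded_minor_exc[OF M] by simp
qed

section \<open>Cyclic flats of an excluded minor\<close>

fun pdisj :: "'a set list \<Rightarrow> bool" where
  "pdisj [] = True"
| "pdisj (P # Ps) = (P \<inter> \<Union>(set Ps) = {} \<and> pdisj Ps)"

text \<open>\<open>cs\<close> lists the block sizes of a partition, and \<open>\<phi>\<close>
  decides independence from the numbers of elements chosen in each block. Matroids with the same
  \<open>cs\<close> and \<open>\<phi>\<close> are isomorphic (\<open>looks_iso\<close>), so no
  explicit isomorphism to a constructed matroid has to be written down.\<close>

definition looks :: "'a set \<Rightarrow> ('a set \<Rightarrow> bool) \<Rightarrow> nat list \<Rightarrow> (nat list \<Rightarrow> bool) \<Rightarrow> bool" where
  "looks E ind cs \<phi> \<longleftrightarrow> (\<exists>Ps. map card Ps = cs \<and> pdisj Ps \<and> \<Union>(set Ps) = E \<and>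
     (\<forall>I. I \<subseteq> E \<longrightarrow> (ind I \<longleftrightarrow> \<phi> (map (\<lambda>P. cnt I P) Ps))))"

section \<open>Cyclic flats of an excluded minor and of its single-element minors\<close>

locale excl = rank_matroid +
  assumes exc: "exc E r"
begin

lemma not_notchy: "\<not> notchy E r"
  and notchy_del: "e \<in> E \<Longrightarrow> notchy (E - {e}) (dl e r)"
  and notchy_con: "e \<in> E \<Longrightarrow> notchy (E - {e}) (ct e r)"
  using exc unfolding exc_def by blast+

lemma excl_du: "excl E (du E r)"
  using rank_matroid_du exc exc_du unfolding excl_def excl_axioms_def by blast

text \<open>A loop lies in every cyclic flat, so its deletion preserves incomparability of pairs,
  and a witness of the deletion becomes one of the whole matroid after the loop is added to
  it.\<close>

lemma loopless: "loops E r = {}"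
proof (rule ccontr)
  assume "loops E r \<noteq> {}"
  then obtain e where e: "e \<in> E" "r {e} = 0" by (auto simp: loops_def)
  have ins: "r (insert e A) = r A" for A using insert_mono_eq[of e "{}" A] e by simp
  have del: "r (A - {e}) = r A" for A
    using ins[of "A - {e}"] ins[of A] by simp
  have dlr: "dl e r = r" by (rule ext) (simp add: dl_def del)
  have eZ: "e \<in> Z" if "cflat E r Z" for Z using cflat_closed[OF that, of "{}" e] e by simp
  have cf: "cflat (E - {e}) r (Z - {e})" if Z: "cflat E r Z" for Z
    unfolding cflat_def
  proof (intro conjI ballI)
    show "Z - {e} \<subseteq> E - {e}" using cflatD(1)[OF Z] by auto
    show "r (Z - {e}) < r (insert f (Z - {e}))" if "f \<in> E - {e} - (Z - {e})" for f
    proof -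
      have "insert f Z - {e} = insert f (Z - {e})" using that by auto
      moreover have "f \<in> E" "f \<notin> Z" using that by auto
      ultimately show ?thesis using del[of Z] del[of "insert f Z"] cflatD(2)[OF Z, of f] by simp
    qed
    show "r (Z - {e} - {f}) = r (Z - {e})" if "f \<in> Z - {e}" for f
    proof -
      have "Z - {e} - {f} = Z - {f} - {e}" by auto
      moreover have "f \<in> Z" using that by auto
      ultimately show ?thesis using del[of Z] del[of "Z - {f}"] cflatD(3)[OF Z, of f] by simp
    qed
  qed
  have L: "loops (E - {e}) r = loops E r - {e}" by (auto simp: loops_def)
  have fL: "finite (loops E r)" by (rule finite_sub) (auto simp: loops_def)
  have cL: "card (loops E r) = card (loops E r - {e}) + 1"
    using e fL by (metis (mono_tags, lifting) CollectI Suc_eq_plus1 card_Suc_Diff1 loops_def)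
  have C: "cyc r (E - {e}) = cyc r E - {e}"
  proof -
    have "r (E - {e} - {f}) = r (E - {f})" for f
    proof -
      have "E - {e} - {f} = E - {f} - {e}" by auto
      thus ?thesis using del by metis
    qed
    thus ?thesis using del[of E] by (auto simp: cyc_def)
  qed
  obtain B where B: "\<forall>X Y. cflat (E - {e}) r X \<longrightarrow> cflat (E - {e}) r Y \<longrightarrow> \<not> X \<subseteq> Y \<longrightarrow> \<not> Y \<subseteq> X \<longrightarrow>
     (X = B \<or> Y = B) \<and> r B + 1 = r (cyc r E - {e}) \<and> card B = r B + card (loops E r - {e}) + 1 \<and>
     (X \<inter> Y = loops E r - {e} \<or> X \<union> Y = cyc r E - {e})"
    using notchy_del[OF e(1)] unfolding notchy_def dlr L C by (rule exE)
  have "(X = insert e B \<or> Y = insert e B) \<and> r (insert e B) + 1 = r (cyc r E) \<and>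
      card (insert e B) = r (insert e B) + card (loops E r) + 1 \<and> (X \<inter> Y = loops E r \<or> X \<union> Y = cyc r E)"
    if X: "cflat E r X" and Y: "cflat E r Y" and n: "\<not> X \<subseteq> Y" "\<not> Y \<subseteq> X" for X Y
  proof -
    have n': "\<not> X - {e} \<subseteq> Y - {e}" "\<not> Y - {e} \<subseteq> X - {e}" using n eZ[OF X] eZ[OF Y] by auto
    note b = B[rule_format, OF cf[OF X] cf[OF Y] n']
    have BXY: "X = insert e B \<or> Y = insert e B" using b eZ[OF X] eZ[OF Y] by auto
    have b1: "r B + 1 = r (cyc r E - {e})" "card B = r B + card (loops E r - {e}) + 1"
      "(X - {e}) \<inter> (Y - {e}) = loops E r - {e} \<or> (X - {e}) \<union> (Y - {e}) = cyc r E - {e}"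
      "X - {e} = B \<or> Y - {e} = B" using b by (blast, blast, blast, blast)
    have fB: "finite B" using b1(4) cflatD(4)[OF X] cflatD(4)[OF Y] by auto
    have eB: "e \<notin> B" using b1(4) by auto
    have eL: "e \<in> loops E r" "e \<in> cyc r E" unfolding loops_def cyc_def using e del[of E] by auto
    have "X \<inter> Y = loops E r \<or> X \<union> Y = cyc r E" using b1(3) eL eZ[OF X] eZ[OF Y] by blast
    moreover have "r (insert e B) + 1 = r (cyc r E)" using b1(1) ins[of B] del[of "cyc r E"] by simp
    moreover have "card (insert e B) = r (insert e B) + card (loops E r) + 1"
      using b1(2) ins[of B] cL fB eB by simp
    ultimately show ?thesis using BXY by blast
  qed
  thus False using not_notchy unfolding notchy_def by blast
qed

lemma coloopless: "cyc r E = E"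
proof -
  interpret D: excl E "du E r" by (rule excl_du)
  show ?thesis using D.loopless loops_du cyc_sub[of E] by auto
qed

lemma r_Diff_E: "e \<in> E \<Longrightarrow> r (E - {e}) = r E"
  using coloopless by (auto simp: cyc_def)

lemma r_single: "e \<in> E \<Longrightarrow> r {e} = 1"
  using loopless r_singleton[of e] by (auto simp: loops_def)

lemma cflat_card_gt: "cflat E r Z \<Longrightarrow> Z \<noteq> {} \<Longrightarrow> r Z < card Z"
  using cflat_nullity_less[of Z "{}"] by auto

lemma cflat_r_less_E: "cflat E r Z \<Longrightarrow> Z \<noteq> E \<Longrightarrow> r Z < r E"
  using cflat_r_less[of Z E] cflatD(1)[of Z] by auto

lemma cflat_r_pos: "cflat E r Z \<Longrightarrow> Z \<noteq> {} \<Longrightarrow> 0 < r Z"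
proof -
  assume a: "cflat E r Z" "Z \<noteq> {}"
  then obtain z where "z \<in> Z" by auto
  thus ?thesis using mono[of "{z}" Z] r_single[of z] cflatD(1)[OF a(1)] by auto
qed

lemma cflat_card_ge2: "cflat E r Z \<Longrightarrow> Z \<noteq> {} \<Longrightarrow> 2 \<le> card Z"
  using cflat_card_gt[of Z] cflat_r_pos[of Z] by simp

text \<open>The witness would have to belong to all three pairs, but each flat is missing from one
  of them.\<close>

lemma no_antichain3:
  assumes "notchy E' s" "cflat E' s X" "cflat E' s Y" "cflat E' s K"
    "\<not> X \<subseteq> Y" "\<not> Y \<subseteq> X" "\<not> X \<subseteq> K" "\<not> K \<subseteq> X" "\<not> K \<subseteq> Y" "\<not> Y \<subseteq> K"
  shows False
proof -
  obtain B where B: "\<forall>X Y. cflat E' s X \<longrightarrow> cflat E' s Y \<longrightarrow> \<not> X \<subseteq> Y \<longrightarrow> \<not> Y \<subseteq> X \<longrightarrow>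
     (X = B \<or> Y = B) \<and> s B + 1 = s (cyc s E') \<and> card B = s B + card (loops E' s) + 1 \<and>
     (X \<inter> Y = loops E' s \<or> X \<union> Y = cyc s E')"
    using assms(1) unfolding notchy_def by (rule exE)
  have "X = B \<or> Y = B" "X = B \<or> K = B" "Y = B \<or> K = B"
    using B[rule_format, OF assms(2,3,5,6)] B[rule_format, OF assms(2,4,7,8)] B[rule_format, OF assms(3,4,10,9)] by blast+
  thus False using assms(5-10) by blast
qed

text \<open>The deletion has no loops, and its top cyclic flat is the closure of
  \<open>X \<union> Y\<close> without \<open>e\<close>. The elements outside this closure are the
  coloops of the deletion, whence the rank formula.\<close>

lemma del_pair:
  assumes e: "e \<in> E" and X: "cflat (E - {e}) (dl e r) X" and Y: "cflat (E - {e}) (dl e r) Y"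
    and n: "\<not> X \<subseteq> Y" "\<not> Y \<subseteq> X"
  shows "card X = r X + 1 \<and> r X + 1 = r (X \<union> Y) \<or> card Y = r Y + 1 \<and> r Y + 1 = r (X \<union> Y)"
    "r E = r (X \<union> Y) + card (E - {e} - clos E r (X \<union> Y))"
    "X \<inter> Y = {} \<or> X \<union> Y = clos E r (X \<union> Y) - {e}"
proof -
  interpret D: rank_matroid "E - {e}" "dl e r" by (rule rank_matroid_dl)
  define T where "T = cyc (dl e r) (E - {e})"
  have L: "loops (E - {e}) (dl e r) = {}" using loops_dl loopless by simp
  obtain B where "\<forall>X Y. cflat (E - {e}) (dl e r) X \<longrightarrow> cflat (E - {e}) (dl e r) Y \<longrightarrow> \<not> X \<subseteq> Y \<longrightarrow> \<not> Y \<subseteq> X \<longrightarrow>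
     (X = B \<or> Y = B) \<and> dl e r B + 1 = dl e r T \<and> card B = dl e r B + card ({}::'a set) + 1 \<and>
     (X \<inter> Y = {} \<or> X \<union> Y = T)"
    using notchy_del[OF e] unfolding notchy_def T_def L by (rule exE)
  note B = this[rule_format, OF X Y n]
  have cT: "cflat (E - {e}) (dl e r) T" unfolding T_def by (rule D.cflat_top)
  note XD = dl_cflatD[OF X] and YD = dl_cflatD[OF Y] and TD = dl_cflatD[OF cT]
  have dX: "dl e r X = r X" "dl e r Y = r Y" "dl e r T = r T" "dl e r (X \<union> Y) = r (X \<union> Y)"
    by (rule dl_notin; use XD(3) YD(3) TD(3) in blast)+
  have sub: "X \<subseteq> T" "Y \<subseteq> T" using D.cflat_sub_cyc[OF X subset_refl] D.cflat_sub_cyc[OF Y subset_refl]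
      D.cflatD(1)[OF X] D.cflatD(1)[OF Y] unfolding T_def by auto
  have XYE: "X \<union> Y \<subseteq> E - {e}" "X \<union> Y \<subseteq> E" using D.cflatD(1)[OF X] D.cflatD(1)[OF Y] by auto
  have less: "r X < r (X \<union> Y)" "r Y < r (X \<union> Y)"
    using D.cflat_r_less[OF X, of "X \<union> Y"] D.cflat_r_less[OF Y, of "X \<union> Y"] XYE(1) n dX by auto
  have "r (X \<union> Y) \<le> r T" by (rule mono) (use sub in auto)
  hence rT: "r (X \<union> Y) = r T" using B dX less by auto
  show "card X = r X + 1 \<and> r X + 1 = r (X \<union> Y) \<or> card Y = r Y + 1 \<and> r Y + 1 = r (X \<union> Y)"
    using B dX rT by auto
  have Tcl: "T = clos E r (X \<union> Y) - {e}"
  proof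
    show "T \<subseteq> clos E r (X \<union> Y) - {e}"
    proof
      fix t assume t: "t \<in> T"
      have "r (insert t (X \<union> Y)) \<le> r T" by (rule mono) (use t sub in auto)
      hence "r (insert t (X \<union> Y)) = r (X \<union> Y)" using rT r_insert_ge[of "X \<union> Y" t] by simp
      thus "t \<in> clos E r (X \<union> Y) - {e}" using t TD(3,4) by (auto simp: clos_def)
    qed
    show "clos E r (X \<union> Y) - {e} \<subseteq> T"
    proof
      fix t assume t: "t \<in> clos E r (X \<union> Y) - {e}"
      hence te: "t \<in> E - {e}" "r (insert t (X \<union> Y)) = r (X \<union> Y)" by (auto simp: clos_def)
      have "dl e r (insert t (X \<union> Y)) = dl e r (X \<union> Y)"
        using te dl_notin[of e "insert t (X \<union> Y)"] dX(4) XD(3) YD(3) by auto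
      thus "t \<in> T" by (rule D.cflat_closed[OF cT _ te(1), rotated]) (use sub in simp)
    qed
  qed
  show "X \<inter> Y = {} \<or> X \<union> Y = clos E r (X \<union> Y) - {e}" using B Tcl by simp
  have "dl e r T + card (E - {e} - T) = dl e r (E - {e})" unfolding T_def by (rule D.r_cyc) simp
  moreover have "dl e r (E - {e}) = r E" using r_Diff_E[OF e] by (simp add: dl_def)
  moreover have "E - {e} - T = E - {e} - clos E r (X \<union> Y)" using Tcl by auto
  ultimately show "r E = r (X \<union> Y) + card (E - {e} - clos E r (X \<union> Y))" using dX rT by simp
qed

lemma ct_val: "e \<in> E \<Longrightarrow> ct e r A + 1 = r (insert e A)"
  using r_single[of e] mono[of "{e}" "insert e A"] by (simp add: ct_def)

lemma cflat_ct:
  assumes e: "e \<in> E" and A: "A \<subseteq> E - {e}"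
    and fl: "\<And>f. f \<in> E \<Longrightarrow> f \<noteq> e \<Longrightarrow> f \<notin> A \<Longrightarrow> r (insert f (insert e A)) \<noteq> r (insert e A)"
    and cy: "\<And>f. f \<in> A \<Longrightarrow> r (insert e (A - {f})) = r (insert e A)"
  shows "cflat (E - {e}) (ct e r) A"
  unfolding cflat_def
proof (intro conjI ballI)
  show "A \<subseteq> E - {e}" by (rule A)
  show "ct e r A < ct e r (insert f A)" if "f \<in> E - {e} - A" for f
  proof -
    have "f \<in> E" "f \<noteq> e" "f \<notin> A" using that by auto
    moreover have "insert e (insert f A) = insert f (insert e A)" by auto
    ultimately show ?thesis
      using fl[of f] ct_val[OF e, of A] ct_val[OF e, of "insert f A"] r_insert_ge[of "insert e A" f] by simp
  qed
  show "ct e r (A - {f}) = ct e r A" if "f \<in> A" for f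
    using cy[OF that] ct_val[OF e, of A] ct_val[OF e, of "A - {f}"] by simp
qed

lemma cflat_ct_mem:
  assumes Z: "cflat E r Z" and e: "e \<in> Z" shows "cflat (E - {e}) (ct e r) (Z - {e})"
proof (rule cflat_ct)
  have i: "insert e (Z - {e}) = Z" using e by auto
  show "e \<in> E" "Z - {e} \<subseteq> E - {e}" using cflatD(1)[OF Z] e by auto
  show "r (insert f (insert e (Z - {e}))) \<noteq> r (insert e (Z - {e}))" if "f \<in> E" "f \<noteq> e" "f \<notin> Z - {e}" for f
    using cflatD(2)[OF Z, of f] that i by simp
  show "r (insert e (Z - {e} - {f})) = r (insert e (Z - {e}))" if "f \<in> Z - {e}" for f
  proof -
    have "insert e (Z - {e} - {f}) = Z - {f}" using e that by auto
    thus ?thesis using cflatD(3)[OF Z, of f] that i by simp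
  qed
qed

text \<open>No subset of the flat \<open>H\<close> spans \<open>e\<close>, so inside
  \<open>H\<close> the contraction adds nothing to the closure of \<open>X\<close>. Only elements
  outside \<open>H\<close> could enter, and \<open>out\<close> excludes them.\<close>

lemma cflat_ct_keep:
  assumes X: "cflat E r X" and H: "cflat E r H" "X \<subseteq> H" and e: "e \<in> E - H"
    and out: "\<And>f. f \<in> E \<Longrightarrow> f \<noteq> e \<Longrightarrow> f \<notin> H \<Longrightarrow> r (insert f (insert e X)) \<noteq> r (insert e X)"
  shows "cflat (E - {e}) (ct e r) X"
proof (rule cflat_ct)
  show "e \<in> E" "X \<subseteq> E - {e}" using e H(2) cflatD(1)[OF X] by auto
  show "r (insert f (insert e X)) \<noteq> r (insert e X)" if f: "f \<in> E" "f \<noteq> e" "f \<notin> X" for f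
  proof (cases "f \<in> H")
    case True
    have "r (insert e (insert f X)) \<noteq> r (insert f X)"
    proof
      assume "r (insert e (insert f X)) = r (insert f X)"
      hence "e \<in> H" by (rule cflat_closed[OF H(1), rotated -1]) (use True H(2) e in auto)
      thus False using e by simp
    qed
    hence "r (insert e (insert f X)) > r (insert f X)" using r_insert_ge[of "insert f X" e] by simp
    moreover have "r (insert f X) = r X + 1" using cflatD(2)[OF X] f by blast
    moreover have "r (insert e X) \<le> r X + 1" by (rule r_insert)
    ultimately show ?thesis by (simp add: insert_commute)
  qed (use out f in blast)
  show "r (insert e (X - {f})) = r (insert e X)" if f: "f \<in> X" for f
  proof -
    have "r (insert f (X - {f})) = r (X - {f})" using cflatD(3)[OF X f] f by (simp add: insert_absorb)
    hence "r (insert f (insert e (X - {f}))) = r (insert e (X - {f}))" by (rule insert_mono_eq) auto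
    moreover have "insert f (insert e (X - {f})) = insert e X" using f by auto
    ultimately show ?thesis by simp
  qed
qed

text \<open>Contraction creates no coloops, so the top cyclic flat is all of \<open>E - {e}\<close>.
  It may create loops, namely the elements parallel to \<open>e\<close>, and they enter the
  count.\<close>

lemma con_pair:
  assumes e: "e \<in> E" and X: "cflat (E - {e}) (ct e r) X" and Y: "cflat (E - {e}) (ct e r) Y"
    and n: "\<not> X \<subseteq> Y" "\<not> Y \<subseteq> X"
  shows "r (insert e (X \<union> Y)) = r E"
    "\<exists>Z\<in>{X, Y}. card Z + 1 = r (insert e Z) + card (loops (E - {e}) (ct e r)) + 1"
proof -
  interpret C: rank_matroid "E - {e}" "ct e r" by (rule rank_matroid_ct[OF e])
  define L where "L = loops (E - {e}) (ct e r)"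
  have "ct e r (E - {e} - {f}) = ct e r (E - {e})" if f: "f \<in> E - {e}" for f
  proof -
    have "insert e (E - {e} - {f}) = E - {f}" "insert e (E - {e}) = E" using e f by auto
    thus ?thesis using r_Diff_E[of f] f by (simp add: ct_def)
  qed
  hence T: "cyc (ct e r) (E - {e}) = E - {e}" by (auto simp: cyc_def)
  obtain B where "\<forall>X Y. cflat (E - {e}) (ct e r) X \<longrightarrow> cflat (E - {e}) (ct e r) Y \<longrightarrow> \<not> X \<subseteq> Y \<longrightarrow> \<not> Y \<subseteq> X \<longrightarrow>
     (X = B \<or> Y = B) \<and> ct e r B + 1 = ct e r (E - {e}) \<and> card B = ct e r B + card L + 1 \<and>
     (X \<inter> Y = L \<or> X \<union> Y = E - {e})"
    using notchy_con[OF e] unfolding notchy_def T L_def by (rule exE)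
  note B = this[rule_format, OF X Y n]
  have XYE: "X \<union> Y \<subseteq> E - {e}" using C.cflatD(1)[OF X] C.cflatD(1)[OF Y] by auto
  obtain Z where Z: "Z \<in> {X, Y}" "card Z = ct e r Z + card L + 1" "ct e r Z + 1 = ct e r (E - {e})"
  proof -
    have "B \<in> {X, Y}" "card B = ct e r B + card L + 1" "ct e r B + 1 = ct e r (E - {e})" using B by (blast, blast, blast)
    thus thesis by (rule that)
  qed
  have "ct e r X < ct e r (X \<union> Y)" "ct e r Y < ct e r (X \<union> Y)"
    using C.cflat_r_less[OF X, of "X \<union> Y"] C.cflat_r_less[OF Y, of "X \<union> Y"] XYE n by auto
  moreover have "ct e r (X \<union> Y) \<le> ct e r (E - {e})" by (rule C.mono[OF XYE])
  ultimately have "ct e r (X \<union> Y) = ct e r (E - {e})" using Z(1,3) by auto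
  moreover have "insert e (E - {e}) = E" using e by auto
  ultimately show "r (insert e (X \<union> Y)) = r E" using ct_val[OF e, of "X \<union> Y"] ct_val[OF e, of "E - {e}"] by simp
  show "\<exists>Z\<in>{X, Y}. card Z + 1 = r (insert e Z) + card (loops (E - {e}) (ct e r)) + 1"
    by (rule bexI[OF _ Z(1)]) (simp add: Z(2) L_def[symmetric] ct_val[OF e, symmetric])
qed

text \<open>Removing an element of a cyclic flat lowers the nullity by one and keeps the rank;
  discarding the coloops that arise keeps the nullity. This supplies a cyclic flat of the deletion
  when \<open>e\<close> lies inside \<open>Z\<close>.\<close>

lemma cflat_dl_cyc:
  assumes Z: "cflat E r Z" and e: "e \<in> Z"
  shows "cflat (E - {e}) (dl e r) (cyc r (Z - {e}))"
    "card (cyc r (Z - {e})) + r Z + 1 = r (cyc r (Z - {e})) + card Z"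
proof -
  interpret D: rank_matroid "E - {e}" "dl e r" by (rule rank_matroid_dl)
  note ZD = cflatD[OF Z]
  have sE: "Z - {e} \<subseteq> E" using ZD(1) by auto
  have "cflat (E - {e}) (dl e r) (cyc (dl e r) (Z - {e}))"
  proof (rule D.cflat_cyc)
    show "Z - {e} \<subseteq> E - {e}" using ZD(1) by auto
    fix f assume f: "f \<in> E - {e}" "f \<notin> Z - {e}"
    have 1: "insert f Z - {e} = insert f (Z - {e})" using f by auto
    have "r (insert f Z) \<le> r (insert f (Z - {e}))"
    proof -
      have "r (insert e (Z - {e})) = r (Z - {e})" using ZD(3)[OF e] e by (simp add: insert_absorb)
      hence "r (insert e (insert f (Z - {e}))) = r (insert f (Z - {e}))" by (rule insert_mono_eq) auto
      moreover have "insert e (insert f (Z - {e})) = insert f Z" using e by auto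
      ultimately show ?thesis by simp
    qed
    hence "r (Z - {e}) < r (insert f (Z - {e}))" using ZD(2)[of f] ZD(3)[OF e] f by auto
    moreover have "dl e r (Z - {e}) = r (Z - {e})" "dl e r (insert f (Z - {e})) = r (insert f (Z - {e}))"
      using f by (auto intro!: dl_notin)
    ultimately show "dl e r (Z - {e}) < dl e r (insert f (Z - {e}))" by simp
  qed
  moreover have "cyc (dl e r) (Z - {e}) = cyc r (Z - {e})"
    unfolding cyc_def dl_def by (simp add: Diff_insert2[symmetric] insert_commute)
  ultimately show "cflat (E - {e}) (dl e r) (cyc r (Z - {e}))" by simp
  have "card (Z - {e}) + 1 = card Z" using e ZD(4) by (metis Suc_eq_plus1 card_Suc_Diff1)
  thus "card (cyc r (Z - {e})) + r Z + 1 = r (cyc r (Z - {e})) + card Z"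
    using card_cyc[OF sE] ZD(3)[OF e] by simp
qed

end

section \<open>Incomparable cyclic flats whose union does not span\<close>

context excl
begin

text \<open>Contracting a common element would make the union span. So would contracting an element
  outside the closure \<open>H\<close> if there were three or more such elements, since both flats
  then survive. Deleting an element of \<open>H\<close> outside both flats would contradict the rank
  formula of \<open>del_pair\<close>.\<close>

lemma join_gap:
  assumes X: "cflat E r X" and Y: "cflat E r Y" and n: "\<not> X \<subseteq> Y" "\<not> Y \<subseteq> X" and lt: "r (X \<union> Y) < r E"
  shows "X \<inter> Y = {}" "cflat E r (X \<union> Y)" "r E = r (X \<union> Y) + 1" "card (E - (X \<union> Y)) = 2"
    "card X = r X + 1 \<and> r X + 1 = r (X \<union> Y) \<or> card Y = r Y + 1 \<and> r Y + 1 = r (X \<union> Y)"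
proof -
  note XD = cflatD[OF X] and YD = cflatD[OF Y]
  define H where "H = clos E r (X \<union> Y)"
  have XYE: "X \<union> Y \<subseteq> E" using XD(1) YD(1) by auto
  have cH: "cflat E r H" unfolding H_def by (rule cflat_join[OF X Y])
  have rH: "r H = r (X \<union> Y)" unfolding H_def by (rule r_clos[OF XYE])
  have XH: "X \<subseteq> H" "Y \<subseteq> H" using clos_ge[OF XYE] unfolding H_def by auto
  have HE: "H \<subseteq> E" by (rule cflatD(1)[OF cH])
  have "H \<noteq> E" using rH lt by auto
  then obtain e where e: "e \<in> E" "e \<notin> H" using HE by blast
  have eX: "e \<notin> X" "e \<notin> Y" using e XH by auto
  note dp = del_pair[OF e(1) cflat_dl[OF X eX(1)] cflat_dl[OF Y eX(2)] n, folded H_def]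
  have cE: "card (E - {e} - H) + 1 = card (E - H)"
  proof -
    have "E - {e} - H = E - H - {e}" by auto
    moreover have "e \<in> E - H" using e by simp
    ultimately show ?thesis using fin by (metis Suc_eq_plus1 card_Suc_Diff1 finite_Diff)
  qed
  have rE: "r E + 1 = r H + card (E - H)" using dp(2) cE rH by simp
  show disj: "X \<inter> Y = {}"
  proof (rule ccontr)
    assume "X \<inter> Y \<noteq> {}"
    then obtain z where z: "z \<in> X" "z \<in> Y" by blast
    have zE: "z \<in> E" using z XD by auto
    have "r (insert z ((X - {z}) \<union> (Y - {z}))) = r E"
      by (rule con_pair(1)[OF zE cflat_ct_mem[OF X z(1)] cflat_ct_mem[OF Y z(2)]]) (use n z in auto)
    moreover have "insert z ((X - {z}) \<union> (Y - {z})) = X \<union> Y" using z by auto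
    ultimately show False using lt by simp
  qed
  have cK: "card (E - H) = 2"
  proof (rule ccontr)
    assume ne: "card (E - H) \<noteq> 2"
    have "r H < r E" using rH lt by simp
    hence ge3: "3 \<le> card (E - H)" using rE ne by simp
    have keep: "cflat (E - {e}) (ct e r) Z" if Z: "cflat E r Z" "Z \<subseteq> H" for Z
    proof (rule cflat_ct_keep[OF Z(1) cH Z(2)])
      show "e \<in> E - H" using e by simp
      fix f assume f: "f \<in> E" "f \<noteq> e" "f \<notin> H"
      have c2: "card {e, f} = 2" using f by simp
      have "\<not> E - H \<subseteq> {e, f}" using ge3 card_mono[of "{e, f}" "E - H"] c2 by auto
      then obtain g where g: "g \<in> E" "g \<notin> H" "g \<noteq> e" "g \<noteq> f" by blast
      \<comment> \<open>Deleting \<open>g\<close> loses no rank, so by the count \<open>rE\<close>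
        the remaining elements outside \<open>H\<close> are independent over \<open>H\<close>; in
        particular \<open>e\<close> and \<open>f\<close> are.\<close>
      have "r (E - {g}) \<le> r (H \<union> {e, f}) + card (E - {g} - (H \<union> {e, f}))"
        by (rule r_card_Diff) (use g HE e f in auto)
      moreover have "E - {g} - (H \<union> {e, f}) = E - H - {e, f, g}" by auto
      moreover have "card (E - H - {e, f, g}) + 3 = card (E - H)"
      proof -
        have "card {e, f, g} = 3" using f g by simp
        moreover have "{e, f, g} \<subseteq> E - H" using e f g by auto
        ultimately show ?thesis using card_Diff_subset[of "{e, f, g}" "E - H"] ge3 by simp
      qed
      ultimately have two: "r H + 2 \<le> r (H \<union> {e, f})" using r_Diff_E[OF g(1)] rE by simp
      show "r (insert f (insert e Z)) \<noteq> r (insert e Z)"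
      proof
        assume "r (insert f (insert e Z)) = r (insert e Z)"
        hence "r (insert f (insert e H)) = r (insert e H)" by (rule insert_mono_eq) (use Z(2) in auto)
        moreover have "insert f (insert e H) = H \<union> {e, f}" by auto
        ultimately show False using two r_insert[of e H] by simp
      qed
    qed
    have "r (insert e (X \<union> Y)) = r E" by (rule con_pair(1)[OF e(1) keep[OF X XH(1)] keep[OF Y XH(2)] n])
    thus False using r_insert[of e "X \<union> Y"] rH rE ge3 by simp
  qed
  hence rE1: "r E = r H + 1" using rE by simp
  have XYH: "X \<union> Y = H"
  proof (rule ccontr)
    assume "X \<union> Y \<noteq> H"
    then obtain z where z: "z \<in> H" "z \<notin> X" "z \<notin> Y" using XH by blast
    have zE: "z \<in> E" using z HE by auto
    have "r E = r (X \<union> Y) + card (E - {z} - H)"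
      using del_pair(2)[OF zE cflat_dl[OF X z(2)] cflat_dl[OF Y z(3)] n] unfolding H_def .
    moreover have "E - {z} - H = E - H" using z by auto
    ultimately show False using cK rH rE1 by simp
  qed
  show "cflat E r (X \<union> Y)" "r E = r (X \<union> Y) + 1" "card (E - (X \<union> Y)) = 2"
    using XYH cH rE1 cK by auto
  show "card X = r X + 1 \<and> r X + 1 = r (X \<union> Y) \<or> card Y = r Y + 1 \<and> r Y + 1 = r (X \<union> Y)"
    by (rule dp(1))
qed

text \<open>If \<open>Y\<close> had smaller rank, contracting an element of \<open>X\<close> would
  leave two incomparable cyclic flats whose union stays inside \<open>X \<union> Y\<close> and so
  cannot span. If \<open>Y\<close> had nullity above one, deleting one of its elements would leave a
  nonempty cyclic part, and with two coloops outside \<open>X \<union> Y\<close> the rank formula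
  for the deletion would exceed the rank.\<close>

lemma join_gap_other:
  assumes X: "cflat E r X" and Y: "cflat E r Y" and n: "\<not> X \<subseteq> Y" "\<not> Y \<subseteq> X" and lt: "r (X \<union> Y) < r E"
    and cX: "card X = r X + 1" "r X + 1 = r (X \<union> Y)"
  shows "r Y + 1 = r (X \<union> Y)" "card Y = r Y + 1"
proof -
  note XD = cflatD[OF X] and YD = cflatD[OF Y]
  note g = join_gap[OF X Y n lt]
  define H where "H = X \<union> Y"
  have cH: "cflat E r H" unfolding H_def by (rule g(2))
  have HE: "H \<subseteq> E" by (rule cflatD(1)[OF cH])
  have rYH: "r Y < r H" by (rule cflat_r_less[OF Y]) (use n HE in \<open>auto simp: H_def\<close>)
  show rY: "r Y + 1 = r (X \<union> Y)"
  proof (rule ccontr)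
    assume "r Y + 1 \<noteq> r (X \<union> Y)"
    hence lt2: "r Y + 1 < r H" using rYH H_def by simp
    obtain x where x: "x \<in> X" using n by blast
    have xE: "x \<in> E" and xY: "x \<notin> Y" using x XD(1) g(1) by auto
    interpret C: rank_matroid "E - {x}" "ct x r" by (rule rank_matroid_ct[OF xE])
    have YE: "Y \<subseteq> E - {x}" using YD(1) xY by auto
    \<comment> \<open>The set \<open>Y\<close> is still cyclic after the contraction of
      \<open>x\<close> but need not be a flat, so its closure there is taken; it stays inside
      \<open>H\<close>.\<close>
    define Y1 where "Y1 = clos (E - {x}) (ct x r) Y"
    have cyY: "ct x r (Y - {y}) = ct x r Y" if y: "y \<in> Y" for y
    proof -
      have "r (insert y (Y - {y})) = r (Y - {y})" using YD(3)[OF y] y by (simp add: insert_absorb)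
      hence "r (insert y (insert x (Y - {y}))) = r (insert x (Y - {y}))" by (rule insert_mono_eq) auto
      moreover have "insert y (insert x (Y - {y})) = insert x Y" using y by auto
      ultimately show ?thesis by (simp add: ct_def)
    qed
    have c1: "cflat (E - {x}) (ct x r) Y1" unfolding Y1_def by (rule C.cyclic_clos[OF YE cyY])
    have c2: "cflat (E - {x}) (ct x r) (X - {x})" by (rule cflat_ct_mem[OF X x])
    have YY1: "Y \<subseteq> Y1" unfolding Y1_def by (rule C.clos_ge[OF YE])
    have rY1: "ct x r Y1 = ct x r Y" unfolding Y1_def by (rule C.r_clos[OF YE])
    have Y1H: "insert x (X - {x} \<union> Y1) \<subseteq> H"
    proof -
      have "y \<in> H" if y: "y \<in> Y1" for y
      proof -
        have yE: "y \<in> E" and "ct x r (insert y Y) = ct x r Y" using y unfolding Y1_def clos_def by auto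
        hence "r (insert x (insert y Y)) = r (insert x Y)"
          using ct_val[OF xE, of "insert y Y"] ct_val[OF xE, of Y] by simp
        hence "r (insert y (insert x Y)) = r (insert x Y)" by (simp add: insert_commute)
        thus "y \<in> H" by (rule cflat_closed[OF cH _ yE, rotated]) (use x in \<open>auto simp: H_def\<close>)
      qed
      thus ?thesis using x by (auto simp: H_def)
    qed
    have "\<not> Y1 \<subseteq> X - {x}" using YY1 n g(1) by blast
    moreover have "\<not> X - {x} \<subseteq> Y1"
    proof
      assume a: "X - {x} \<subseteq> Y1"
      have "ct x r (X \<union> Y - {x}) \<le> ct x r Y1" by (rule C.mono) (use a YY1 in auto)
      moreover have "insert x (X \<union> Y - {x}) = H" using x by (auto simp: H_def)
      ultimately have "r H \<le> r (insert x Y)"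
        using rY1 ct_val[OF xE, of "X \<union> Y - {x}"] ct_val[OF xE, of Y] by simp
      thus False using r_insert[of x Y] lt2 by simp
    qed
    ultimately have "r (insert x (X - {x} \<union> Y1)) = r E" using con_pair(1)[OF xE c2 c1] by blast
    thus False using mono[OF Y1H] g(3) H_def by simp
  qed
  show "card Y = r Y + 1"
  proof (rule ccontr)
    assume ne: "card Y \<noteq> r Y + 1"
    obtain y where y: "y \<in> Y" using n by blast
    have yE: "y \<in> E" using y YD by auto
    have yX: "y \<notin> X" using y g(1) by auto
    define Y0 where "Y0 = cyc r (Y - {y})"
    note c0 = cflat_dl_cyc[OF Y y, folded Y0_def]
    have "r Y < card Y" by (rule cflat_card_gt[OF Y]) (use y in auto)
    hence "Y0 \<noteq> {}" using c0(2) ne by auto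
    moreover have Y0Y: "Y0 \<subseteq> Y - {y}" unfolding Y0_def by (rule cyc_sub)
    ultimately have "\<not> X \<subseteq> Y0" "\<not> Y0 \<subseteq> X" using g(1) n by blast+
    note dp = del_pair(2)[OF yE cflat_dl[OF X yX] c0(1) this]
    have XY0: "X \<union> Y0 \<subseteq> H - {y}" using Y0Y yX by (auto simp: H_def)
    define Q where "Q = clos E r (X \<union> Y0)"
    have QH: "Q \<subseteq> H" unfolding Q_def by (rule clos_cflat_sub[OF cH]) (use XY0 in auto)
    have XY0E: "X \<union> Y0 \<subseteq> E" using XY0 HE by auto
    have "r (H - {y}) \<le> r (Q \<inter> (H - {y})) + card ((H - {y}) - Q \<inter> (H - {y}))"
      by (rule r_card_Diff) (use HE in auto)
    also have "r (Q \<inter> (H - {y})) \<le> r Q" by (rule mono) auto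
    also have "r Q = r (X \<union> Y0)" unfolding Q_def by (rule r_clos[OF XY0E])
    finally have a: "r (H - {y}) \<le> r (X \<union> Y0) + card (H - {y} - Q)" by (simp add: Diff_Int)
    have "E - {y} - Q = (H - {y} - Q) \<union> (E - H)" using HE QH y by (auto simp: H_def)
    moreover have "card ((H - {y} - Q) \<union> (E - H)) = card (H - {y} - Q) + card (E - H)"
      by (rule card_Un_disjoint) (use fin finite_sub[OF HE] in auto)
    ultimately have "r E = r (X \<union> Y0) + card (H - {y} - Q) + 2" using dp g(4) unfolding Q_def H_def by simp
    moreover have "r (H - {y}) = r H" by (rule cflatD(3)[OF cH]) (use y in \<open>auto simp: H_def\<close>)
    ultimately show False using a g(3) H_def by simp
  qed
qed

lemma join_gap_sym:
  assumes X: "cflat E r X" and Y: "cflat E r Y" and n: "\<not> X \<subseteq> Y" "\<not> Y \<subseteq> X" and lt: "r (X \<union> Y) < r E"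
  shows "card X = r X + 1" "r X + 1 = r (X \<union> Y)" "card Y = r Y + 1" "r Y + 1 = r (X \<union> Y)"
proof -
  have eq: "Y \<union> X = X \<union> Y" by auto
  have "card X = r X + 1 \<and> r X + 1 = r (X \<union> Y) \<and> card Y = r Y + 1 \<and> r Y + 1 = r (X \<union> Y)"
    using join_gap(5)[OF X Y n lt]
  proof
    assume a: "card X = r X + 1 \<and> r X + 1 = r (X \<union> Y)"
    show ?thesis using a join_gap_other[OF X Y n lt] by blast
  next
    assume a: "card Y = r Y + 1 \<and> r Y + 1 = r (X \<union> Y)"
    show ?thesis using a join_gap_other[OF Y X n(2,1), unfolded eq, OF lt] by blast
  qed
  thus "card X = r X + 1" "r X + 1 = r (X \<union> Y)" "card Y = r Y + 1" "r Y + 1 = r (X \<union> Y)" by blast+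
qed

text \<open>Nullity drops strictly below a cyclic flat, and only the empty cyclic flat has nullity
  0.\<close>

lemma circuit_sub_cflat:
  assumes X: "cflat E r X" "card X = r X + 1" and W: "cflat E r W" "W \<subset> X" shows "W = {}"
proof (rule ccontr)
  assume "W \<noteq> {}"
  hence "r W < card W" by (rule cflat_card_gt[OF W(1)])
  thus False using cflat_nullity_less[OF X(1) W(2)] X(2) by simp
qed

text \<open>With \<open>K = E - (X \<union> Y)\<close>, the matroid is \<open>D\<^sub>n\<close> if \<open>X \<union> K\<close> and \<open>Y \<union> K\<close> both span, and has
  exactly six elements otherwise.\<close>

lemma join_gap_spanning:
  assumes X: "cflat E r X" and Y: "cflat E r Y" and n: "\<not> X \<subseteq> Y" "\<not> Y \<subseteq> X" and lt: "r (X \<union> Y) < r E"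
    and sp: "r (X \<union> (E - (X \<union> Y))) = r E" "r (Y \<union> (E - (X \<union> Y))) = r E" and W: "cflat E r W"
  shows "W \<in> {{}, X, Y, X \<union> Y, E}"
proof -
  note XD = cflatD[OF X] and YD = cflatD[OF Y] and WD = cflatD[OF W]
  note g = join_gap[OF X Y n lt] and s = join_gap_sym[OF X Y n lt]
  define H where "H = X \<union> Y"
  define K where "K = E - H"
  note cH = g(2)[folded H_def]
  have HE: "H \<subseteq> E" by (rule cflatD(1)[OF cH])
  show ?thesis
  proof (cases "K \<subseteq> W")
    case False
    then obtain k where k: "k \<in> E" "k \<notin> H" "k \<notin> W" unfolding K_def by blast
    \<comment> \<open>Otherwise \<open>W\<close> has exactly one element outside \<open>H\<close>,
      which is spanned by the rest of \<open>W\<close> and hence by the flat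
      \<open>H\<close>.\<close>
    have WH: "W \<subseteq> H"
    proof (rule ccontr)
      assume nW: "\<not> W \<subseteq> H"
      obtain w where w: "w \<in> W" "w \<notin> H" using nW by blast
      have Ek: "card (E - H) = 2" using g(4) by (simp add: H_def)
      have "w \<noteq> k" "w \<in> E" using w k WD by auto
      hence Ekw: "E - {k} - {w} = H"
      proof -
        have sub: "{k, w} \<subseteq> E - H" using k w WD(1) by auto
        have "E - H = {k, w}" using card_subset_eq[OF _ sub] fin Ek \<open>w \<noteq> k\<close> by simp
        thus ?thesis using HE k w by blast
      qed
      have "r (insert w (W - {w})) = r (W - {w})" using WD(3)[OF w(1)] w by (simp add: insert_absorb)
      hence "r (insert w H) = r H" by (rule insert_mono_eq) (use Ekw WD(1) k in auto)
      thus False using cflatD(2)[OF cH, of w] w WD(1) by auto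
    qed
    show ?thesis
    proof (cases "W = H \<or> W = X \<or> W = {}")
      case False
      have "\<not> W \<subseteq> X" using circuit_sub_cflat[OF X s(1) W] False by blast
      moreover have "\<not> X \<subseteq> W"
      proof
        assume "X \<subseteq> W"
        hence "r X < r W" using cflat_r_less[OF X _ WD(1)] False by blast
        moreover have "r W < r H" using cflat_r_less[OF W _ HE] WH False by blast
        ultimately show False using s(2) H_def by simp
      qed
      moreover have "r (X \<union> W) < r E" using mono[of "X \<union> W" H] WH lt by (auto simp: H_def)
      moreover have "r (X \<union> W) = r H"
      proof -
        have "r X < r (X \<union> W)" by (rule cflat_r_less[OF X]) (use calculation XD WD in auto)
        thus ?thesis using mono[of "X \<union> W" H] WH s(2) by (auto simp: H_def)
      qed
      ultimately have "X \<inter> W = {}" "cflat E r (X \<union> W)" "r (X \<union> W) = r H" using join_gap(1,2)[OF X W] by auto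
      moreover have "X \<union> W = H"
        using cflat_r_less[OF calculation(2) _ HE] calculation(3) WH by (auto simp: H_def)
      ultimately show ?thesis using g(1) unfolding H_def by blast
    qed (auto simp: H_def)
  next
    case True
    show ?thesis
    proof (cases "W = E")
      case False
      have rW: "r W < r E" by (rule cflat_r_less_E[OF W False])
      have nXW: "\<not> X \<subseteq> W" "\<not> Y \<subseteq> W"
        using mono[of "X \<union> K" W] mono[of "Y \<union> K" W] sp rW True unfolding K_def H_def by auto
      have "card K = 2" using g(4) unfolding K_def H_def .
      hence "K \<noteq> {}" by auto
      then obtain k where k: "k \<in> K" by blast
      have kE: "k \<in> E" "k \<in> E - H" using k by (auto simp: K_def)
      have "card (K - {k}) = 1" using g(4) k unfolding K_def H_def by simp
      then obtain k' where k': "K - {k} = {k'}" by (rule card_1_singletonE)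
      \<comment> \<open>If \<open>W\<close> contains both elements of \<open>K\<close> and is not
        \<open>E\<close>, contracting one of them keeps \<open>X\<close> and \<open>Y\<close> and
        leaves the rest of \<open>W\<close> as a third member of an antichain.\<close>
      have keep: "cflat (E - {k}) (ct k r) Z" if Z: "cflat E r Z" "Z \<subseteq> H" "r (Z \<union> K) = r E" "r Z + 2 = r E" for Z
      proof (rule cflat_ct_keep[OF Z(1) cH Z(2) kE(2)])
        fix f assume "f \<in> E" "f \<noteq> k" "f \<notin> H"
        hence "f = k'" using k' by (auto simp: K_def)
        hence "insert f (insert k Z) = Z \<union> K" using k k' by auto
        thus "r (insert f (insert k Z)) \<noteq> r (insert k Z)" using Z(3,4) r_insert[of k Z] by simp
      qed
      have cX: "cflat (E - {k}) (ct k r) X" "cflat (E - {k}) (ct k r) Y"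
        using keep[OF X] keep[OF Y] sp s g(3) unfolding K_def H_def by auto
      have cW: "cflat (E - {k}) (ct k r) (W - {k})" by (rule cflat_ct_mem[OF W]) (use k True in auto)
      have k'W: "k' \<in> W - {k}" "k' \<notin> X" "k' \<notin> Y" using k' True by (auto simp: K_def H_def)
      have "k \<notin> X" "k \<notin> Y" using kE by (auto simp: H_def)
      thus ?thesis
        using no_antichain3[OF notchy_con[OF kE(1)] cX cW n] nXW k'W by blast
    qed simp
  qed
qed

text \<open>The closure \<open>H'\<close> of \<open>X \<union> K\<close> is a second hyperplane
  through \<open>X\<close>. After contraction of an element of \<open>X\<close>, one of
  \<open>H\<close> and \<open>H'\<close> must become a circuit up to loops; both have nullity at
  least two, so the contraction has a loop, and the circuit \<open>X\<close> is a parallel pair. The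
  last conclusion exhibits flats whose complements have a non-spanning union in the dual;
  \<open>exc_listed\<close> uses it to dispose of this case when it arises in the dual.\<close>

lemma join_gap_nonspanning:
  assumes X: "cflat E r X" and Y: "cflat E r Y" and n: "\<not> X \<subseteq> Y" "\<not> Y \<subseteq> X" and lt: "r (X \<union> Y) < r E"
    and sp: "r (X \<union> (E - (X \<union> Y))) \<noteq> r E"
  shows "card X = 2" "card Y = 2" "r X = 1" "r Y = 1" "r (X \<union> Y) = 2" "r E = 3"
    "r (X \<union> (E - (X \<union> Y))) = 2"
    "\<exists>U V. cflat E r U \<and> cflat E r V \<and> \<not> U \<subseteq> V \<and> \<not> V \<subseteq> U \<and> r (U \<inter> V) < cnt U V"
proof -
  note XD = cflatD[OF X] and YD = cflatD[OF Y]
  note g = join_gap[OF X Y n lt] and s = join_gap_sym[OF X Y n lt]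
  define H where "H = X \<union> Y"
  define K where "K = E - H"
  note cH = g(2)[folded H_def]
  have HE: "H \<subseteq> E" by (rule cflatD(1)[OF cH])
  have XKE: "X \<union> K \<subseteq> E" using XD by (auto simp: K_def)
  have cK: "card K = 2" using g(4) by (simp add: K_def H_def)
  have up: "r H = r (insert k X)" if "k \<in> K" for k
  proof -
    have "r (insert k X) = r X + 1" by (rule cflatD(2)[OF X]) (use that in \<open>auto simp: K_def H_def\<close>)
    thus ?thesis using s(2) H_def by simp
  qed
  have rXK: "r (X \<union> K) < r E" using sp mono[OF XKE] by (simp add: K_def H_def)
  have rXK': "r (X \<union> K) = r H"
  proof -
    obtain k where k: "k \<in> K" using cK by (metis card.empty equals0I zero_neq_numeral)
    have "r (insert k X) \<le> r (X \<union> K)" by (rule mono) (use k in auto)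
    thus ?thesis using up[OF k] rXK g(3) H_def by simp
  qed
  have cyXK: "r (X \<union> K - {f}) = r (X \<union> K)" if f: "f \<in> X \<union> K" for f
  proof (cases "f \<in> X")
    case True
    have "r (insert f (X - {f})) = r (X - {f})" using XD(3)[OF True] True by (simp add: insert_absorb)
    hence "r (insert f (X \<union> K - {f})) = r (X \<union> K - {f})" by (rule insert_mono_eq) auto
    thus ?thesis using f by (simp add: insert_absorb)
  next
    case False
    hence fK: "f \<in> K" using f by simp
    have "card (K - {f}) = 1" using cK fK by simp
    then obtain k where k: "K - {f} = {k}" by (rule card_1_singletonE)
    hence "r H = r (insert k X)" using up[of k] by blast
    also have "\<dots> \<le> r (X \<union> K - {f})" by (rule mono) (use k False in auto)
    finally show ?thesis using rXK' mono[of "X \<union> K - {f}" "X \<union> K"] by auto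
  qed
  define H' where "H' = clos E r (X \<union> K)"
  have cH': "cflat E r H'" unfolding H'_def by (rule cyclic_clos[OF XKE cyXK])
  have rH': "r H' = r H" unfolding H'_def using r_clos[OF XKE] rXK' by simp
  have XKH': "X \<union> K \<subseteq> H'" unfolding H'_def by (rule clos_ge[OF XKE])
  have nYH': "\<not> Y \<subseteq> H'"
  proof
    assume "Y \<subseteq> H'"
    hence "E \<subseteq> H'" using XKH' by (auto simp: K_def H_def)
    hence "r E \<le> r H'" by (rule mono)
    thus False using rH' g(3) H_def by simp
  qed
  have "K \<noteq> {}" using cK by auto
  obtain x where x: "x \<in> X" using n by blast
  have xE: "x \<in> E" using x XD by auto
  have xH: "x \<in> H" "x \<in> H'" using x XKH' by (auto simp: H_def)
  have nHH': "\<not> H - {x} \<subseteq> H' - {x}"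
  proof -
    obtain y where "y \<in> Y" "y \<notin> H'" using nYH' by blast
    thus ?thesis using xH by (auto simp: H_def)
  qed
  have nH'H: "\<not> H' - {x} \<subseteq> H - {x}"
  proof -
    obtain k where "k \<in> K" using \<open>K \<noteq> {}\<close> by blast
    thus ?thesis using XKH' x by (auto simp: K_def H_def)
  qed
  have fHH: "finite (H \<inter> H')" using cflatD(4)[OF cH] by simp
  have "X \<subseteq> H \<inter> H'" using XKH' by (auto simp: H_def)
  hence "r (H \<inter> H') \<noteq> cnt H H'" using indep_mono[of "H \<inter> H'" X] s(1) fHH by auto
  hence "r (H \<inter> H') < cnt H H'" using r_le_card[OF fHH] by simp
  thus "\<exists>U V. cflat E r U \<and> cflat E r V \<and> \<not> U \<subseteq> V \<and> \<not> V \<subseteq> U \<and> r (U \<inter> V) < cnt U V"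
    using cH cH' nHH' nH'H by blast
  from nHH' nH'H have "\<exists>Z\<in>{H - {x}, H' - {x}}. card Z + 1 = r (insert x Z) + card (loops (E - {x}) (ct x r)) + 1"
    by (rule con_pair(2)[OF xE cflat_ct_mem[OF cH xH(1)] cflat_ct_mem[OF cH' xH(2)]])
  then obtain Z0 where Z0: "Z0 \<in> {H, H'}" "card (Z0 - {x}) + 1 = r (insert x (Z0 - {x})) + card (loops (E - {x}) (ct x r)) + 1"
    by blast
  have xZ0: "x \<in> Z0" using Z0(1) xH by auto
  have fZ0: "finite Z0" using Z0(1) cflatD(4)[OF cH] cflatD(4)[OF cH'] by auto
  have "card (Z0 - {x}) + 1 = card Z0" using xZ0 fZ0 by (metis Suc_eq_plus1 card_Suc_Diff1)
  moreover have "insert x (Z0 - {x}) = Z0" using xZ0 by auto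
  moreover have "r Z0 = r H" using Z0(1) rH' by auto
  moreover have "r H + 2 \<le> card Z0"
  proof -
    have dH: "card H = card X + card Y" unfolding H_def by (rule card_Un_disjoint[OF XD(4) YD(4) g(1)])
    have "2 \<le> card Y" by (rule cflat_card_ge2[OF Y]) (use n in blast)
    hence 1: "r H + 2 \<le> card H" using dH s H_def by simp
    have "card (X \<union> K) = card X + card K"
      by (rule card_Un_disjoint) (use XD fin in \<open>auto simp: K_def H_def\<close>)
    hence "r H + 2 \<le> card (X \<union> K)" using s cK H_def by simp
    also have "\<dots> \<le> card H'" by (rule card_mono[OF cflatD(4)[OF cH'] XKH'])
    finally show ?thesis using 1 Z0(1) by auto
  qed
  ultimately have "loops (E - {x}) (ct x r) \<noteq> {}" using Z0(2) by auto
  then obtain f where f: "f \<in> E" "f \<noteq> x" "ct x r {f} = 0" by (auto simp: loops_def)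
  hence rf: "r {x, f} = 1" using ct_val[OF xE, of "{f}"] by simp
  hence "r (insert f {x}) = r {x}" using r_single[OF xE] by (simp add: insert_commute)
  hence fX: "f \<in> X" by (rule cflat_closed[OF X _ f(1), rotated]) (use x in simp)
  have "r X = 1"
  proof (rule ccontr)
    assume ne: "r X \<noteq> 1"
    have sub: "{x, f} \<subset> X"
    proof
      show "{x, f} \<subseteq> X" using x fX by simp
      show "{x, f} \<noteq> X" using ne rf by auto
    qed
    have "r X + card {x, f} < r {x, f} + card X" by (rule cflat_nullity_less[OF X sub])
    thus False using rf s(1) f(2) by simp
  qed
  thus "card X = 2" "card Y = 2" "r X = 1" "r Y = 1" "r (X \<union> Y) = 2" "r E = 3"
    "r (X \<union> (E - (X \<union> Y))) = 2"
    using s g(3) rXK' by (simp_all add: K_def H_def)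
qed

end

lemma card_Int_Un: "finite I \<Longrightarrow> A \<inter> B = {} \<Longrightarrow> cnt I (A \<union> B) = cnt I A + cnt I B"
  using card_Un_disjoint[of "I \<inter> A" "I \<inter> B"] by (simp add: Int_Un_distrib disjoint_iff)

section \<open>Independence conditions of the listed matroids, in terms of blocks\<close>

definition phi_1a :: "nat list \<Rightarrow> bool" where
  "phi_1a c \<longleftrightarrow> c ! 0 \<le> 1 \<and> c ! 1 \<le> 1 \<and> c ! 2 \<le> 1"

text \<open>The first block is the parallel pair inside the truncation, the second is the outer
  summand, and the third joins the two single elements.\<close>

definition phi_1b :: "nat list \<Rightarrow> bool" where
  "phi_1b c \<longleftrightarrow> c ! 0 \<le> 1 \<and> c ! 1 \<le> 1 \<and> c ! 0 + c ! 2 \<le> 2"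

definition phi_D :: "nat \<Rightarrow> nat list \<Rightarrow> bool" where
  "phi_D n c \<longleftrightarrow> c ! 0 \<le> n - 2 \<and> c ! 1 \<le> n - 2 \<and> c ! 0 + c ! 1 \<le> n - 1 \<and> c ! 0 + c ! 1 + c ! 2 \<le> n"

definition phi_FGH :: "nat \<Rightarrow> nat \<Rightarrow> nat \<Rightarrow> nat list \<Rightarrow> bool" where
  "phi_FGH a b n c \<longleftrightarrow> c ! 0 \<le> a \<and> c ! 1 \<le> b \<and> c ! 0 + c ! 1 \<le> n"

text \<open>In order: the element common to the two circuit-hyperplanes, the element outside both,
  and what remains of each of the two.\<close>

definition phi_A :: "nat \<Rightarrow> nat list \<Rightarrow> bool" where
  "phi_A n c \<longleftrightarrow> c ! 0 + c ! 2 \<le> n - 1 \<and> c ! 0 + c ! 3 \<le> n - 1 \<and> c ! 0 + c ! 1 + c ! 2 + c ! 3 \<le> n"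

definition phi_B :: "nat \<Rightarrow> nat \<Rightarrow> nat list \<Rightarrow> bool" where
  "phi_B n k c \<longleftrightarrow> c ! 0 \<le> n - 1 \<and> c ! 1 \<le> n - 1 \<and> c ! 2 \<le> k - 1 \<and> c ! 0 + c ! 1 + c ! 2 \<le> n"

text \<open>Six points in rank 3 with the lines \<open>0 3 4\<close>, \<open>1 3 5\<close> and
  \<open>2 4 5\<close>; the points 3, 4 and 5 are the pairwise intersections. In the wheel the
  remaining points \<open>0 1 2\<close> form a fourth line.\<close>

definition phi_whirl :: "nat list \<Rightarrow> bool" where
  "phi_whirl c \<longleftrightarrow> c ! 0 + c ! 3 + c ! 4 \<le> 2 \<and> c ! 1 + c ! 3 + c ! 5 \<le> 2 \<and> c ! 2 + c ! 4 + c ! 5 \<le> 2 \<and>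
     c ! 0 + c ! 1 + c ! 2 + c ! 3 + c ! 4 + c ! 5 \<le> 3"

definition phi_wheel :: "nat list \<Rightarrow> bool" where
  "phi_wheel c \<longleftrightarrow> phi_whirl c \<and> c ! 0 + c ! 1 + c ! 2 \<le> 2"

context rank_matroid
begin

abbreviation "ind \<equiv> \<lambda>I. r I = card I"

lemma ind_card_le: "r I = card I \<Longrightarrow> I \<subseteq> E \<Longrightarrow> cnt I W \<le> r W"
  using indep_mono[of I "I \<inter> W"] finite_sub[of I] mono[of "I \<inter> W" W] by auto

text \<open>\<open>\<W>\<close> may contain sets that are not cyclic flats, because an independent
  set obeys the rank bound of every set.\<close>

lemma indep_list:
  assumes "\<And>W. cflat E r W \<Longrightarrow> W \<in> \<W>" "I \<subseteq> E"
  shows "r I = card I \<longleftrightarrow> (\<forall>W\<in>\<W>. cnt I W \<le> r W)"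
  using indep_cflats[OF assms(2)] ind_card_le[of I] assms by blast

lemma rank_swap: "A \<subseteq> X \<Longrightarrow> r A = r X \<Longrightarrow> r (X \<union> B) = r (A \<union> B)"
proof -
  assume a: "A \<subseteq> X" "r A = r X"
  have "r (X \<union> (A \<union> B)) + r (X \<inter> (A \<union> B)) \<le> r X + r (A \<union> B)" by (rule submod)
  moreover have "r A \<le> r (X \<inter> (A \<union> B))" by (rule mono) (use a in auto)
  moreover have "X \<union> (A \<union> B) = X \<union> B" using a by auto
  moreover have "r (A \<union> B) \<le> r (X \<union> B)" by (rule mono) (use a in auto)
  ultimately show ?thesis using a(2) by simp
qed

end

context excl
begin

lemma at_most_one: assumes "cnt I X \<le> 1" "finite I" "X \<noteq> {}" obtains x where "x \<in> X" "I \<inter> X \<subseteq> {x}"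
proof (cases "I \<inter> X = {}")
  case True thus thesis using that assms(3) by blast
next
  case False
  hence "cnt I X = 1" using assms by (simp add: le_Suc_eq)
  then obtain x where "I \<inter> X = {x}" by (rule card_1_singletonE)
  thus thesis using that[of x] by blast
qed

text \<open>A parallel pair can be replaced by one of its elements without changing ranks, which
  handles \<open>X\<close> and \<open>Y\<close>. What distinguishes the two matroids is whether the
  elements of \<open>K\<close> are parallel as well.\<close>

lemma six_element_case:
  assumes X: "cflat E r X" and Y: "cflat E r Y" and n: "\<not> X \<subseteq> Y" "\<not> Y \<subseteq> X" and lt: "r (X \<union> Y) < r E"
    and sp: "r (X \<union> (E - (X \<union> Y))) \<noteq> r E"
  shows "looks E ind [2,2,2] phi_1a \<or> looks E ind [2,2,2] phi_1b"
proof -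
  note XD = cflatD[OF X] and YD = cflatD[OF Y]
  note g = join_gap[OF X Y n lt] and s = join_gap_nonspanning[OF X Y n lt sp]
  define K where "K = E - (X \<union> Y)"
  have cK: "card K = 2" using g(4) by (simp add: K_def)
  have rXK: "r (X \<union> K) = 2" using s(7) by (simp add: K_def)
  have cov: "X \<union> Y \<union> K = E" using XD YD by (auto simp: K_def)
  have sub: "X \<subseteq> E" "Y \<subseteq> E" "K \<subseteq> E" using cov by auto
  have ne: "X \<noteq> {}" "Y \<noteq> {}" "K \<noteq> {}" using s(1,2) cK by auto
  have dj: "X \<inter> Y = {}" "X \<inter> K = {}" "Y \<inter> K = {}" using g(1) by (auto simp: K_def)
  have pd: "pdisj [X, Y, K]" using dj by (simp add: Int_Un_distrib)
  have rsX: "r {x} = r X" if "x \<in> X" for x using r_single[of x] that sub s(3) by auto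
  have rsY: "r {y} = r Y" if "y \<in> Y" for y using r_single[of y] that sub s(4) by auto
  have rxyK: "r ({x} \<union> ({y} \<union> K)) = 3" if "x \<in> X" "y \<in> Y" for x y
  proof -
    have "r ({x} \<union> ({y} \<union> K)) = r (X \<union> ({y} \<union> K))" by (rule rank_swap[symmetric]) (use that rsX in auto)
    also have "X \<union> ({y} \<union> K) = {y} \<union> (X \<union> K)" by auto
    also have "r ({y} \<union> (X \<union> K)) = r (Y \<union> (X \<union> K))" by (rule rank_swap[symmetric]) (use that rsY in auto)
    also have "Y \<union> (X \<union> K) = E" using cov by auto
    finally show ?thesis using s(6) by simp
  qed
  have kX: "r {x, k} = 2" if "x \<in> X" "k \<in> K" for x k
  proof -
    have kE: "k \<in> E" "k \<notin> X" using that sub dj by auto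
    have "r (X \<union> {k}) = r ({x} \<union> {k})" by (rule rank_swap) (use that rsX in auto)
    moreover have "r (insert k X) = r X + 1" by (rule cflatD(2)[OF X kE])
    ultimately show ?thesis using s(3) by (simp add: insert_commute)
  qed
  have rK: "r K = 1 \<or> r K = 2"
  proof -
    obtain k where "k \<in> K" using ne by blast
    hence "1 \<le> r K" using mono[of "{k}" K] r_single[of k] sub by auto
    moreover have "r K \<le> 2" using r_le_card[of K] finite_sub[OF sub(3)] cK by simp
    ultimately show ?thesis by linarith
  qed
  have fI: "finite I" if "I \<subseteq> E" for I by (rule finite_sub[OF that])
  from rK show ?thesis
  proof
    assume rK: "r K = 1"
    have "ind I \<longleftrightarrow> phi_1a (map (\<lambda>P. cnt I P) [X, Y, K])" if I: "I \<subseteq> E" for I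
    proof
      assume "ind I"
      thus "phi_1a (map (\<lambda>P. cnt I P) [X, Y, K])"
        using ind_card_le[of I X] ind_card_le[of I Y] ind_card_le[of I K] I s rK by (simp add: phi_1a_def)
    next
      assume "phi_1a (map (\<lambda>P. cnt I P) [X, Y, K])"
      hence c: "cnt I X \<le> 1" "cnt I Y \<le> 1" "cnt I K \<le> 1" by (simp_all add: phi_1a_def)
      obtain x where x: "x \<in> X" "I \<inter> X \<subseteq> {x}" by (rule at_most_one[OF c(1) fI[OF I] ne(1)])
      obtain y where y: "y \<in> Y" "I \<inter> Y \<subseteq> {y}" by (rule at_most_one[OF c(2) fI[OF I] ne(2)])
      obtain k where k: "k \<in> K" "I \<inter> K \<subseteq> {k}" by (rule at_most_one[OF c(3) fI[OF I] ne(3)])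
      have "r (K \<union> {x, y}) = r ({k} \<union> {x, y})"
        by (rule rank_swap) (use k rK r_single[of k] sub in auto)
      moreover have "K \<union> {x, y} = {x} \<union> ({y} \<union> K)" "{k} \<union> {x, y} = {x, y, k}" by auto
      ultimately have r3: "r {x, y, k} = 3" using rxyK[OF x(1) y(1)] by simp
      have "card {x, y, k} = 3" using x y k dj by (simp add: card_insert_if) blast
      moreover have "I \<subseteq> {x, y, k}" using I cov x y k by blast
      ultimately show "ind I" using indep_mono[of "{x, y, k}" I] r3 by simp
    qed
    hence "looks E ind [2,2,2] phi_1a"
      unfolding looks_def by (intro exI[of _ "[X, Y, K]"] conjI pd allI impI) (use s cK cov in auto)
    thus ?thesis ..
  next
    assume rK: "r K = 2"
    have "ind I \<longleftrightarrow> phi_1b (map (\<lambda>P. cnt I P) [X, Y, K])" if I: "I \<subseteq> E" for I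
    proof
      assume "ind I"
      thus "phi_1b (map (\<lambda>P. cnt I P) [X, Y, K])"
        using ind_card_le[of I X] ind_card_le[of I Y] ind_card_le[of I "X \<union> K"] I s rXK
          card_Int_Un[OF fI[OF I] dj(2)] by (simp add: phi_1b_def)
    next
      assume "phi_1b (map (\<lambda>P. cnt I P) [X, Y, K])"
      hence c: "cnt I X \<le> 1" "cnt I Y \<le> 1" "cnt I X + cnt I K \<le> 2" by (simp_all add: phi_1b_def)
      obtain y where y: "y \<in> Y" "I \<inter> Y \<subseteq> {y}" by (rule at_most_one[OF c(2) fI[OF I] ne(2)])
      have "\<exists>J. I \<inter> (X \<union> K) \<subseteq> J \<and> J \<subseteq> X \<union> K \<and> r J = 2 \<and> card J = 2"
      proof (cases "I \<inter> X = {}")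
        case True thus ?thesis using rK cK by (intro exI[of _ K]) auto
      next
        case False
        hence "cnt I X \<noteq> 0" using fI[OF I] by simp
        hence ck: "cnt I K \<le> 1" using c(3) by linarith
        obtain x where x: "x \<in> X" "I \<inter> X \<subseteq> {x}" by (rule at_most_one[OF c(1) fI[OF I] ne(1)])
        obtain k where k: "k \<in> K" "I \<inter> K \<subseteq> {k}" by (rule at_most_one[OF ck fI[OF I] ne(3)])
        have "x \<noteq> k" using x k dj by auto
        thus ?thesis using x k kX[OF x(1) k(1)] by (intro exI[of _ "{x, k}"]) auto
      qed
      then obtain J where J: "I \<inter> (X \<union> K) \<subseteq> J" "J \<subseteq> X \<union> K" "r J = 2" "card J = 2" by blast
      have fJ: "finite J" using J(4) by (metis card.infinite zero_neq_numeral)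
      have yJ: "y \<notin> J" using y J(2) dj by auto
      obtain x where x: "x \<in> X" using ne by blast
      have "r (insert y (X \<union> K)) = 3"
      proof -
        have "r ({x} \<union> ({y} \<union> K)) \<le> r (insert y (X \<union> K))" by (rule mono) (use x in auto)
        thus ?thesis using rxyK[OF x y(1)] rXK r_insert[of y "X \<union> K"] by simp
      qed
      hence "r (insert y J) \<noteq> r J" using insert_mono_eq[of y J "X \<union> K"] J(2) rXK by auto
      hence "r (insert y J) = card (insert y J)" using r_insert[of y J] r_insert_ge[of J y] J fJ yJ by simp
      moreover have "I \<subseteq> insert y J" using I cov y J by blast
      ultimately show "ind I" using indep_mono[of "insert y J" I] fJ by simp
    qed
    hence "looks E ind [2,2,2] phi_1b"
      unfolding looks_def by (intro exI[of _ "[X, Y, K]"] conjI pd allI impI) (use s cK cov in auto)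
    thus ?thesis ..
  qed
qed

lemma join_gap_looks:
  assumes X: "cflat E r X" and Y: "cflat E r Y" and n: "\<not> X \<subseteq> Y" "\<not> Y \<subseteq> X" and lt: "r (X \<union> Y) < r E"
  shows "(looks E ind [2,2,2] phi_1a \<or> looks E ind [2,2,2] phi_1b) \<and>
      (\<exists>U V. cflat E r U \<and> cflat E r V \<and> \<not> U \<subseteq> V \<and> \<not> V \<subseteq> U \<and> r (U \<inter> V) < cnt U V) \<or>
    (\<exists>n\<ge>3. looks E ind [n - 1, n - 1, 2] (phi_D n))"
proof (cases "r (X \<union> (E - (X \<union> Y))) = r E \<and> r (Y \<union> (E - (X \<union> Y))) = r E")
  case False
  have YX: "Y \<union> X = X \<union> Y" by auto
  show ?thesis using False six_element_case[OF X Y n lt] six_element_case[OF Y X n(2,1)] join_gap_nonspanning(8)[OF X Y n lt]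
      join_gap_nonspanning(8)[OF Y X n(2,1)] lt unfolding YX by blast
next
  case True
  note g = join_gap[OF X Y n lt] and s = join_gap_sym[OF X Y n lt]
  note XD = cflatD[OF X] and YD = cflatD[OF Y]
  define K where "K = E - (X \<union> Y)"
  have cov: "X \<union> Y \<union> K = E" using XD YD by (auto simp: K_def)
  have dj: "X \<inter> Y = {}" "(X \<union> Y) \<inter> K = {}" using g(1) by (auto simp: K_def)
  have pd: "pdisj [X, Y, K]" using dj by (auto simp: Int_Un_distrib)
  define m where "m = r E"
  have rs: "r X = m - 2" "r Y = m - 2" "r (X \<union> Y) = m - 1" "card X = m - 1" "card Y = m - 1" "card K = 2"
    using s g by (auto simp: m_def K_def)
  have "0 < r X" by (rule cflat_r_pos[OF X]) (use n in auto)
  hence m3: "3 \<le> m" using rs by simp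
  have "ind I \<longleftrightarrow> phi_D m (map (\<lambda>P. cnt I P) [X, Y, K])" if I: "I \<subseteq> E" for I
  proof -
    have fI: "finite I" by (rule finite_sub[OF I])
    have "ind I \<longleftrightarrow> (\<forall>W\<in>{{}, X, Y, X \<union> Y, E}. cnt I W \<le> r W)"
      by (rule indep_list[OF join_gap_spanning[OF X Y n lt conjunct1[OF True] conjunct2[OF True]] I])
    moreover have "cnt I E = cnt I X + cnt I Y + cnt I K"
      using card_Int_Un[OF fI dj(2)] card_Int_Un[OF fI dj(1)] cov by simp
    ultimately show ?thesis using card_Int_Un[OF fI dj(1)] rs by (simp add: phi_D_def m_def)
  qed
  hence "looks E ind [m - 1, m - 1, 2] (phi_D m)"
    unfolding looks_def by (intro exI[of _ "[X, Y, K]"] conjI pd allI impI) (use rs cov in auto)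
  thus ?thesis using m3 by blast
qed

end

section \<open>Excluded minors in which all unions of incomparable cyclic flats span, also in the
  dual\<close>

locale excl_full = excl +
  assumes join: "cflat E r X \<Longrightarrow> cflat E r Y \<Longrightarrow> \<not> X \<subseteq> Y \<Longrightarrow> \<not> Y \<subseteq> X \<Longrightarrow> r (X \<union> Y) = r E"
    and join_du: "cflat E (du E r) X \<Longrightarrow> cflat E (du E r) Y \<Longrightarrow> \<not> X \<subseteq> Y \<Longrightarrow> \<not> Y \<subseteq> X \<Longrightarrow> du E r (X \<union> Y) = du E r E"
begin

lemma excl_full_du: "excl_full E (du E r)"
  unfolding excl_full_def excl_full_axioms_def du_du
  using excl_du join_du join by blast

text \<open>For a cyclic flat this means being a circuit-hyperplane; as a pair of equations it is
  preserved by complementation (\<open>ch_du\<close>).\<close>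

definition ch :: "'a set \<Rightarrow> bool" where "ch Z \<longleftrightarrow> card Z = r Z + 1 \<and> r Z + 1 = r E"

text \<open>Both flats survive the deletion of an element outside them, and their union spans, so
  the condition on the deletion becomes a statement about \<open>X\<close> and \<open>Y\<close> in
  the whole matroid.\<close>

lemma pair_del:
  assumes X: "cflat E r X" and Y: "cflat E r Y" and n: "\<not> X \<subseteq> Y" "\<not> Y \<subseteq> X" and e: "e \<in> E" "e \<notin> X" "e \<notin> Y"
  shows "ch X \<or> ch Y" "X \<inter> Y = {} \<or> X \<union> Y = E - {e}"
proof -
  note dp = del_pair[OF e(1) cflat_dl[OF X e(2)] cflat_dl[OF Y e(3)] n]
  have j: "r (X \<union> Y) = r E" by (rule join[OF X Y n])
  show "ch X \<or> ch Y" using dp(1) j by (simp add: ch_def)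
  have "clos E r (X \<union> Y) = E" using clos_E_iff[of "X \<union> Y"] j cflatD(1)[OF X] cflatD(1)[OF Y] by simp
  thus "X \<inter> Y = {} \<or> X \<union> Y = E - {e}" using dp(3) by simp
qed

end

context excl_full
begin

interpretation D: excl_full E "du E r" by (rule excl_full_du)

lemma ch_du: assumes "Z \<subseteq> E" shows "D.ch (E - Z) \<longleftrightarrow> ch Z"
proof -
  have 1: "E - (E - Z) = Z" "(E - Z) \<inter> E = E - Z" using assms by auto
  have "du E r (E - Z) + r E = card (E - Z) + r Z" using du_add[of "E - Z"] 1 by simp
  moreover have "du E r E + r E = card E" using du_add[of E] by simp
  ultimately show ?thesis unfolding D.ch_def ch_def using card_compl[OF assms] by auto
qed

lemma pair_con:
  assumes X: "cflat E r X" and Y: "cflat E r Y" and n: "\<not> X \<subseteq> Y" "\<not> Y \<subseteq> X" and e: "e \<in> X" "e \<in> Y"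
  shows "ch X \<or> ch Y" "X \<union> Y = E \<or> X \<inter> Y = {e}"
proof -
  note XE = cflatD(1)[OF X] and YE = cflatD(1)[OF Y]
  have c: "cflat E (du E r) (E - X)" "cflat E (du E r) (E - Y)" using X Y cflat_du[OF XE] cflat_du[OF YE] by auto
  have n': "\<not> E - X \<subseteq> E - Y" "\<not> E - Y \<subseteq> E - X" using n XE YE by auto
  have e': "e \<in> E" "e \<notin> E - X" "e \<notin> E - Y" using e XE by auto
  note p = D.pair_del[OF c n' e']
  show "ch X \<or> ch Y" using p(1) ch_du XE YE by simp
  show "X \<union> Y = E \<or> X \<inter> Y = {e}" using p(2) XE YE e' by blast
qed

text \<open>An uncovered element could be deleted, and the antichain of three would survive.\<close>

lemma triple_cover:
  assumes X: "cflat E r X" and Y: "cflat E r Y" and K: "cflat E r K"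
    and n: "\<not> X \<subseteq> Y" "\<not> Y \<subseteq> X" "\<not> X \<subseteq> K" "\<not> K \<subseteq> X" "\<not> K \<subseteq> Y" "\<not> Y \<subseteq> K"
  shows "X \<union> Y \<union> K = E"
proof (rule ccontr)
  assume "X \<union> Y \<union> K \<noteq> E"
  then obtain e where e: "e \<in> E" "e \<notin> X" "e \<notin> Y" "e \<notin> K"
    using cflatD(1)[OF X] cflatD(1)[OF Y] cflatD(1)[OF K] by blast
  show False
    by (rule no_antichain3[OF notchy_del[OF e(1)] cflat_dl[OF X e(2)] cflat_dl[OF Y e(3)] cflat_dl[OF K e(4)] n])
qed

text \<open>If \<open>X\<close> met \<open>K\<close>, deleting suitable elements would determine
  \<open>X \<union> K\<close> and \<open>Y \<union> K\<close> up to one element. Then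
  \<open>X\<close> would consist of two parallel elements, only one of them in the flat
  \<open>K\<close>.\<close>

lemma triple_disjoint:
  assumes X: "cflat E r X" and Y: "cflat E r Y" and K: "cflat E r K"
    and n: "\<not> X \<subseteq> Y" "\<not> Y \<subseteq> X" "\<not> X \<subseteq> K" "\<not> K \<subseteq> X" "\<not> K \<subseteq> Y" "\<not> Y \<subseteq> K" and XY: "X \<inter> Y = {}"
  shows "X \<inter> K = {}"
proof (rule ccontr)
  assume "X \<inter> K \<noteq> {}"
  then obtain f where f: "f \<in> X" "f \<in> K" by blast
  note XE = cflatD(1)[OF X] and YE = cflatD(1)[OF Y]
  obtain e where e: "e \<in> Y" "e \<notin> K" using n(6) by blast
  have e': "e \<in> E" "e \<notin> X" using e XY YE by auto
  have p1: "X \<union> K = E - {e}" using pair_del(2)[OF X K n(3,4) e' e(2)] f by blast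
  have p2: "X \<inter> K = {f}" using pair_con(2)[OF X K n(3,4) f] p1 e' by blast
  have "\<not> Y \<subseteq> {e}"
  proof
    assume "Y \<subseteq> {e}"
    hence "card Y \<le> 1" using card_mono[of "{e}" Y] by simp
    thus False using cflat_card_ge2[OF Y] e by auto
  qed
  then obtain g where g: "g \<in> Y" "g \<in> K" using p1 XY YE by blast
  obtain e2 where e2: "e2 \<in> X" "e2 \<notin> K" using n(3) by blast
  have e2': "e2 \<in> E" "e2 \<notin> Y" using e2 XY XE by auto
  have p3: "Y \<union> K = E - {e2}" using pair_del(2)[OF Y K n(6,5) e2' e2(2)] g by blast
  have Xeq: "X = {e2, f}" using p2 p3 XY XE f e2 by blast
  have "e2 \<noteq> f" using f e2 by auto
  hence "card X = 2" using Xeq by simp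
  hence "r X = 1" using cflat_card_gt[OF X] cflat_r_pos[OF X] f by fastforce
  hence "r (insert e2 {f}) = r {f}" using r_single[of f] Xeq f XE by auto
  hence "e2 \<in> K" by (rule cflat_closed[OF K _ e2'(1), rotated]) (use f in simp)
  thus False using e2 by simp
qed

end

section \<open>Antichains of three cyclic flats\<close>

context excl_full
begin

interpretation D: excl_full E "du E r" by (rule excl_full_du)

text \<open>A circuit contains no smaller nonempty cyclic flat, and no flat lies strictly between a
  hyperplane and \<open>E\<close>.\<close>

lemma ch_sub:
  assumes X: "cflat E r X" "ch X" and W: "cflat E r W" "W \<noteq> {}" "W \<noteq> X" "W \<noteq> E"
  shows "\<not> W \<subseteq> X \<and> \<not> X \<subseteq> W"
proof
  have c: "card X = r X + 1" "r X + 1 = r E" using X(2) by (auto simp: ch_def)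
  show "\<not> W \<subseteq> X" using circuit_sub_cflat[OF X(1) c(1) W(1)] W(2,3) by blast
  show "\<not> X \<subseteq> W"
  proof
    assume "X \<subseteq> W"
    hence "r X < r W" using cflat_r_less[OF X(1) _ cflatD(1)[OF W(1)]] W(3) by blast
    thus False using c(2) cflat_r_less_E[OF W(1,4)] by simp
  qed
qed

text \<open>The third flat has nullity one, since otherwise deleting one of its elements leaves an
  antichain of three. A further proper cyclic flat would be disjoint from \<open>X\<close> and
  \<open>Y\<close> and complete them to a cover, hence would be \<open>K\<close>. The parameters are
  \<open>n = r E\<close> and \<open>k = card K\<close>.\<close>

lemma disjoint_triple_looks_aux:
  assumes X: "cflat E r X" and Y: "cflat E r Y" and K: "cflat E r K"
    and n: "\<not> X \<subseteq> Y" "\<not> Y \<subseteq> X" "\<not> X \<subseteq> K" "\<not> K \<subseteq> X" "\<not> K \<subseteq> Y" "\<not> Y \<subseteq> K"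
    and dj: "X \<inter> Y = {}" "X \<inter> K = {}" "Y \<inter> K = {}" and c: "ch X" "ch Y"
  shows "\<exists>n k. 2 \<le> k \<and> k \<le> n \<and> looks E ind [n, n, k] (phi_B n k)"
proof -
  note KD = cflatD[OF K]
  have Kne: "K \<noteq> {}" "X \<noteq> {}" "Y \<noteq> {}" using n by auto
  have KE: "K \<noteq> E" using n(3) cflatD(1)[OF X] by auto
  have cov: "X \<union> Y \<union> K = E" by (rule triple_cover[OF X Y K n])
  have rK: "r K < r E" by (rule cflat_r_less_E[OF K KE])
  have cK: "card K = r K + 1"
  proof (rule ccontr)
    assume ne: "card K \<noteq> r K + 1"
    obtain z where z: "z \<in> K" using Kne by blast
    have zE: "z \<in> E" "z \<notin> X" "z \<notin> Y" using z KD(1) dj by auto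
    define K0 where "K0 = cyc r (K - {z})"
    note c0 = cflat_dl_cyc[OF K z, folded K0_def]
    have "r K < card K" by (rule cflat_card_gt[OF K Kne(1)])
    hence "K0 \<noteq> {}" using c0(2) ne by auto
    moreover have "K0 \<subseteq> K" unfolding K0_def using cyc_sub[of "K - {z}"] by auto
    ultimately have "\<not> X \<subseteq> K0" "\<not> K0 \<subseteq> X" "\<not> K0 \<subseteq> Y" "\<not> Y \<subseteq> K0" using dj Kne by blast+
    thus False
      using no_antichain3[OF notchy_del[OF zE(1)] cflat_dl[OF X zE(2)] cflat_dl[OF Y zE(3)] c0(1) n(1,2)] by blast
  qed
  have all: "W \<in> {{}, X, Y, K, E}" if W: "cflat E r W" for W
  proof (rule ccontr)
    assume a: "W \<notin> {{}, X, Y, K, E}"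
    hence nX: "\<not> W \<subseteq> X \<and> \<not> X \<subseteq> W" and nY: "\<not> W \<subseteq> Y \<and> \<not> Y \<subseteq> W"
      using ch_sub[OF X c(1) W] ch_sub[OF Y c(2) W] by auto
    have "X \<union> Y \<union> W = E" by (rule triple_cover[OF X Y W]) (use n nX nY in auto)
    moreover have "X \<inter> W = {}" by (rule triple_disjoint[OF X Y W _ _ _ _ _ _ dj(1)]) (use n nX nY in auto)
    moreover have "Y \<inter> W = {}" by (rule triple_disjoint[OF Y X W]) (use n nX nY dj in auto)
    ultimately have "W = K" using cov dj by blast
    thus False using a by simp
  qed
  define m where "m = r E"
  define k where "k = card K"
  have rs: "r X = m - 1" "r Y = m - 1" "card X = m" "card Y = m" "r K = k - 1" "r E = m"
    using c cK by (auto simp: ch_def m_def k_def)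
  have "2 \<le> k" unfolding k_def by (rule cflat_card_ge2[OF K Kne(1)])
  moreover have "k \<le> m" using rK cK by (simp add: k_def m_def)
  moreover have "looks E ind [m, m, k] (phi_B m k)"
    unfolding looks_def
  proof (intro exI[of _ "[X, Y, K]"] conjI allI impI)
    show "map card [X, Y, K] = [m, m, k]" using rs by (simp add: k_def)
    show "pdisj [X, Y, K]" using dj by (simp add: Int_Un_distrib)
    show "\<Union>(set [X, Y, K]) = E" using cov by auto
    fix I assume I: "I \<subseteq> E"
    have fI: "finite I" by (rule finite_sub[OF I])
    have "cnt I E = cnt I X + cnt I Y + cnt I K"
    proof -
      have "(X \<union> Y) \<inter> K = {}" using dj by auto
      thus ?thesis using card_Int_Un[OF fI, of "X \<union> Y" K] card_Int_Un[OF fI dj(1)] cov by simp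
    qed
    thus "ind I \<longleftrightarrow> phi_B m k (map (\<lambda>P. cnt I P) [X, Y, K])"
      using indep_list[OF all I] rs by (simp add: phi_B_def)
  qed
  ultimately show ?thesis by blast
qed

text \<open>Each pair avoids the elements of the third flat, so \<open>pair_del\<close> applies to
  every pair and makes at least two of the three flats circuit-hyperplanes.\<close>

lemma disjoint_triple_looks:
  assumes X: "cflat E r X" and Y: "cflat E r Y" and K: "cflat E r K"
    and n: "\<not> X \<subseteq> Y" "\<not> Y \<subseteq> X" "\<not> X \<subseteq> K" "\<not> K \<subseteq> X" "\<not> K \<subseteq> Y" "\<not> Y \<subseteq> K"
    and d: "X \<inter> Y = {}"
  shows "\<exists>n k. 2 \<le> k \<and> k \<le> n \<and> looks E ind [n, n, k] (phi_B n k)"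
proof -
  have XK: "X \<inter> K = {}" by (rule triple_disjoint[OF X Y K n d])
  have YK: "Y \<inter> K = {}" by (rule triple_disjoint[OF Y X K]) (use n d in auto)
  have ne: "X \<noteq> {}" "Y \<noteq> {}" "K \<noteq> {}" using n by auto
  note XE = cflatD(1)[OF X] and YE = cflatD(1)[OF Y] and KE = cflatD(1)[OF K]
  obtain x y k where e: "x \<in> X" "y \<in> Y" "k \<in> K" using ne by blast
  have "ch X \<or> ch Y" by (rule pair_del(1)[OF X Y n(1,2), of k]) (use e KE XK YK in auto)
  moreover have "ch X \<or> ch K" by (rule pair_del(1)[OF X K n(3,4), of y]) (use e YE d YK in auto)
  moreover have "ch Y \<or> ch K" by (rule pair_del(1)[OF Y K n(6,5), of x]) (use e XE d XK in auto)
  ultimately consider "ch X" "ch Y" | "ch X" "ch K" | "ch Y" "ch K" by blast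
  thus ?thesis
  proof cases
    case 1
    show ?thesis by (rule disjoint_triple_looks_aux[OF X Y K n d XK YK 1])
  next
    case 2
    show ?thesis by (rule disjoint_triple_looks_aux[OF X K Y _ _ _ _ _ _ _ _ _ 2]) (use n d XK YK in auto)
  next
    case 3
    show ?thesis by (rule disjoint_triple_looks_aux[OF Y K X _ _ _ _ _ _ _ _ _ 3]) (use n d XK YK in auto)
  qed
qed

lemma compl_triple:
  assumes X: "cflat E r X" and Y: "cflat E r Y" and K: "cflat E r K"
    and n: "\<not> X \<subseteq> Y" "\<not> Y \<subseteq> X" "\<not> X \<subseteq> K" "\<not> K \<subseteq> X" "\<not> K \<subseteq> Y" "\<not> Y \<subseteq> K"
  shows "cflat E (du E r) (E - X)" "cflat E (du E r) (E - Y)" "cflat E (du E r) (E - K)"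
    "\<not> E - X \<subseteq> E - Y" "\<not> E - Y \<subseteq> E - X" "\<not> E - X \<subseteq> E - K" "\<not> E - K \<subseteq> E - X" "\<not> E - K \<subseteq> E - Y" "\<not> E - Y \<subseteq> E - K"
proof -
  note s = cflatD(1)[OF X] cflatD(1)[OF Y] cflatD(1)[OF K]
  show "cflat E (du E r) (E - X)" "cflat E (du E r) (E - Y)" "cflat E (du E r) (E - K)"
    using cflat_du[OF s(1)] cflat_du[OF s(2)] cflat_du[OF s(3)] X Y K by simp_all
  have "E - A \<subseteq> E - B \<longleftrightarrow> B \<subseteq> A" if "B \<subseteq> E" for A B using that by blast
  thus "\<not> E - X \<subseteq> E - Y" "\<not> E - Y \<subseteq> E - X" "\<not> E - X \<subseteq> E - K" "\<not> E - K \<subseteq> E - X"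
    "\<not> E - K \<subseteq> E - Y" "\<not> E - Y \<subseteq> E - K" using n s by simp_all
qed

lemma triple_inter:
  assumes X: "cflat E r X" and Y: "cflat E r Y" and K: "cflat E r K"
    and n: "\<not> X \<subseteq> Y" "\<not> Y \<subseteq> X" "\<not> X \<subseteq> K" "\<not> K \<subseteq> X" "\<not> K \<subseteq> Y" "\<not> Y \<subseteq> K"
  shows "X \<inter> Y \<inter> K = {}"
proof -
  have "(E - X) \<union> (E - Y) \<union> (E - K) = E" by (rule D.triple_cover[OF compl_triple[OF X Y K n]])
  thus ?thesis using cflatD(1)[OF X] by blast
qed

text \<open>Two elements of \<open>K\<close> of which just one lies in the flat \<open>X\<close> are
  not parallel.\<close>

lemma crossing_rank:
  assumes X: "cflat E r X" and K: "cflat E r K" and f: "f \<in> X" "f \<in> K" and k: "k \<in> K" "k \<notin> X"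
  shows "2 \<le> r K"
proof (rule ccontr)
  assume "\<not> 2 \<le> r K"
  have "f \<in> E" "k \<in> E" using f k cflatD(1)[OF K] by auto
  have "r (insert k {f}) \<le> r K" by (rule mono) (use f k in auto)
  hence "r (insert k {f}) = r {f}"
    using \<open>\<not> 2 \<le> r K\<close> r_single[OF \<open>f \<in> E\<close>] r_insert_ge[of "{f}" k] by linarith
  hence "k \<in> X" by (rule cflat_closed[OF X _ \<open>k \<in> E\<close>, rotated]) (use f in simp)
  thus False using k by simp
qed

lemma crossing_pair:
  assumes X: "cflat E r X" and Y: "cflat E r Y" and n: "\<not> X \<subseteq> Y" "\<not> Y \<subseteq> X" and m: "X \<inter> Y \<noteq> {}" "X \<union> Y \<noteq> E"
  shows "ch X \<or> ch Y" "\<exists>f. X \<inter> Y = {f}" "\<exists>e\<in>E. X \<union> Y = E - {e}"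
proof -
  obtain e where e: "e \<in> E" "e \<notin> X" "e \<notin> Y" using m(2) cflatD(1)[OF X] cflatD(1)[OF Y] by blast
  obtain f where f: "f \<in> X" "f \<in> Y" using m(1) by blast
  note p = pair_del[OF X Y n e]
  show "ch X \<or> ch Y" by (rule p(1))
  show "\<exists>e\<in>E. X \<union> Y = E - {e}" using p(2) m(1) e(1) by blast
  show "\<exists>f. X \<inter> Y = {f}" using pair_con(2)[OF X Y n f] m(2) by blast
qed

lemma card_Int_insert: "finite I \<Longrightarrow> x \<notin> A \<Longrightarrow> card (I \<inter> insert x A) = cnt I {x} + cnt I A"
  using card_Int_Un[of I "{x}" A] by simp

text \<open>Every two of the flats share one element and miss one, which gives six points on three
  three-point lines in rank 3. The only other proper nonempty set that can be a cyclic flat is the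
  set \<open>W\<close> of points on a single line each: it is one in the wheel and not in the
  whirl.\<close>

lemma crossing_triple_looks:
  assumes X: "cflat E r X" and Y: "cflat E r Y" and K: "cflat E r K"
    and n: "\<not> X \<subseteq> Y" "\<not> Y \<subseteq> X" "\<not> X \<subseteq> K" "\<not> K \<subseteq> X" "\<not> K \<subseteq> Y" "\<not> Y \<subseteq> K"
    and m: "X \<inter> Y \<noteq> {}" "X \<inter> K \<noteq> {}" "Y \<inter> K \<noteq> {}" and u: "X \<union> Y \<noteq> E" "X \<union> K \<noteq> E" "Y \<union> K \<noteq> E"
  shows "looks E ind [1,1,1,1,1,1] phi_wheel \<or> looks E ind [1,1,1,1,1,1] phi_whirl"
proof -
  note XE = cflatD(1)[OF X] and YE = cflatD(1)[OF Y] and KE = cflatD(1)[OF K]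
  note pXY = crossing_pair[OF X Y n(1,2) m(1) u(1)] and pXK = crossing_pair[OF X K n(3,4) m(2) u(2)]
    and pYK = crossing_pair[OF Y K n(6,5) m(3) u(3)]
  obtain a b c where abc: "X \<inter> Y = {a}" "X \<inter> K = {b}" "Y \<inter> K = {c}" using pXY(2) pXK(2) pYK(2) by blast
  obtain k where k: "k \<in> E" "X \<union> Y = E - {k}" using pXY(3) by blast
  obtain y where y: "y \<in> E" "X \<union> K = E - {y}" using pXK(3) by blast
  obtain x where x: "x \<in> E" "Y \<union> K = E - {x}" using pYK(3) by blast
  note kyx = k(1) y(1) x(1) k(2) y(2) x(2)
  have cov: "X \<union> Y \<union> K = E" by (rule triple_cover[OF X Y K n])
  have int: "X \<inter> Y \<inter> K = {}" by (rule triple_inter[OF X Y K n])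
  have "x \<notin> Y" "x \<notin> K" "y \<notin> X" "y \<notin> K" "k \<notin> X" "k \<notin> Y" using kyx(4-6) by (blast, blast, blast, blast, blast, blast)
  moreover have "x \<in> X" using cov kyx(3,6) by blast
  moreover have "y \<in> Y" using cov kyx(2,5) by blast
  moreover have "k \<in> K" using cov kyx(1,4) by blast
  moreover have "a \<in> X" "a \<in> Y" "b \<in> X" "b \<in> K" "c \<in> Y" "c \<in> K" using abc by (blast, blast, blast, blast, blast, blast)
  moreover have "a \<notin> K" using int abc(1) by blast
  moreover have "b \<notin> Y" using int abc(2) by blast
  moreover have "c \<notin> X" using int abc(3) by blast
  ultimately have mem: "x \<in> X" "x \<notin> Y" "x \<notin> K" "y \<notin> X" "y \<in> Y" "y \<notin> K" "k \<notin> X" "k \<notin> Y" "k \<in> K"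
    "a \<in> X" "a \<in> Y" "a \<notin> K" "b \<in> X" "b \<notin> Y" "b \<in> K" "c \<notin> X" "c \<in> Y" "c \<in> K" by simp_all
  have "X \<subseteq> {x, a, b}" using abc(1,2) kyx(6) XE by blast
  hence Xeq: "X = {x, a, b}" using mem(1,10,13) by blast
  have "Y \<subseteq> {y, a, c}" using abc(1,3) kyx(5) YE by blast
  hence Yeq: "Y = {y, a, c}" using mem(5,11,17) by blast
  have "K \<subseteq> {k, b, c}" using abc(2,3) kyx(4) KE by blast
  hence Keq: "K = {k, b, c}" using mem(9,15,18) by blast
  have dist: "distinct [x, y, k, a, b, c]"
    using mem by (simp only: distinct.simps list.set insert_iff empty_iff simp_thms) metis
  have Eeq: "E = {x, y, k, a, b, c}" using cov Xeq Yeq Keq by auto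
  have card3: "card X = 3" "card Y = 3" "card K = 3" using dist by (simp_all add: Xeq Yeq Keq)
  have lo: "2 \<le> r X" "2 \<le> r Y" "2 \<le> r K"
    using crossing_rank[OF Y X, of a x] crossing_rank[OF X Y, of a y] crossing_rank[OF X K, of b k] mem by simp_all
  have hi: "r X < r E" "r Y < r E" "r K < r E"
    using cflat_r_less_E[OF X] cflat_r_less_E[OF Y] cflat_r_less_E[OF K] mem(4,2,3) kyx(2,3) by (blast, blast, blast)
  have rE: "r E = 3" using pXY(1) card3 unfolding ch_def by linarith
  have rs: "r X = 2" "r Y = 2" "r K = 2" using lo hi rE by auto
  have chs: "ch X" "ch Y" "ch K" using rs rE card3 by (simp_all add: ch_def)
  define W where "W = {x, y, k}"
  have all: "V \<in> {{}, X, Y, K, E, W}" if V: "cflat E r V" for V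
  proof (rule ccontr)
    assume v: "V \<notin> {{}, X, Y, K, E, W}"
    have nX: "\<not> V \<subseteq> X" "\<not> X \<subseteq> V" and nY: "\<not> V \<subseteq> Y" "\<not> Y \<subseteq> V" and nK: "\<not> V \<subseteq> K" "\<not> K \<subseteq> V"
      using ch_sub[OF X chs(1) V] ch_sub[OF Y chs(2) V] ch_sub[OF K chs(3) V] v by auto
    \<comment> \<open>Covering with each pair puts the three points on a single line into
      \<open>V\<close>, and the empty triple intersections keep the three crossing points
      out.\<close>
    have 1: "X \<union> Y \<union> V = E" "X \<union> K \<union> V = E" "Y \<union> K \<union> V = E"
      by (rule triple_cover[OF X Y V n(1,2) nX(2,1) nY], rule triple_cover[OF X K V n(3,4) nX(2,1) nK],
        rule triple_cover[OF Y K V n(6,5) nY(2,1) nK])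
    have 2: "X \<inter> Y \<inter> V = {}" "X \<inter> K \<inter> V = {}" "Y \<inter> K \<inter> V = {}"
      by (rule triple_inter[OF X Y V n(1,2) nX(2,1) nY], rule triple_inter[OF X K V n(3,4) nX(2,1) nK],
        rule triple_inter[OF Y K V n(6,5) nY(2,1) nK])
    have "a \<notin> V" "b \<notin> V" "c \<notin> V" using 2 mem by (blast, blast, blast)
    moreover have "x \<in> V" "y \<in> V" "k \<in> V" using 1 mem kyx(1-3) by (blast, blast, blast)
    ultimately have "V = W" using cflatD(1)[OF V] unfolding W_def Eeq by blast
    thus False using v by simp
  qed
  let ?Ps = "[{x}, {y}, {k}, {a}, {b}, {c}]"
  have parts: "map card ?Ps = [1,1,1,1,1,1]" "pdisj ?Ps" "\<Union>(set ?Ps) = E" using dist Eeq by auto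
  have cnt: "cnt I X = cnt I {x} + cnt I {a} + cnt I {b}"
    "cnt I Y = cnt I {y} + cnt I {a} + cnt I {c}"
    "cnt I K = cnt I {k} + cnt I {b} + cnt I {c}"
    "cnt I W = cnt I {x} + cnt I {y} + cnt I {k}"
    "cnt I E = cnt I {x} + cnt I {y} + cnt I {k} + cnt I {a} + cnt I {b} + cnt I {c}"
    if I: "I \<subseteq> E" for I
  proof -
    have fI: "finite I" by (rule finite_sub[OF I])
    show "cnt I X = cnt I {x} + cnt I {a} + cnt I {b}"
      unfolding Xeq using dist card_Int_insert[OF fI, of x "{a, b}"] card_Int_insert[OF fI, of a "{b}"] by simp
    show "cnt I Y = cnt I {y} + cnt I {a} + cnt I {c}"
      unfolding Yeq using dist card_Int_insert[OF fI, of y "{a, c}"] card_Int_insert[OF fI, of a "{c}"] by simp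
    show "cnt I K = cnt I {k} + cnt I {b} + cnt I {c}"
      unfolding Keq using dist card_Int_insert[OF fI, of k "{b, c}"] card_Int_insert[OF fI, of b "{c}"] by simp
    show "cnt I W = cnt I {x} + cnt I {y} + cnt I {k}"
      unfolding W_def using dist card_Int_insert[OF fI, of x "{y, k}"] card_Int_insert[OF fI, of y "{k}"] by simp
    show "cnt I E = cnt I {x} + cnt I {y} + cnt I {k} + cnt I {a} + cnt I {b} + cnt I {c}"
      unfolding Eeq using dist card_Int_insert[OF fI, of x "{y, k, a, b, c}"] card_Int_insert[OF fI, of y "{k, a, b, c}"]
        card_Int_insert[OF fI, of k "{a, b, c}"] card_Int_insert[OF fI, of a "{b, c}"] card_Int_insert[OF fI, of b "{c}"] by simp
  qed
  show ?thesis
  proof (cases "cflat E r W")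
    case True
    have "2 \<le> r W" using crossing_rank[OF X True, of x y] mem by (auto simp: W_def)
    moreover have "a \<in> E" "a \<notin> W" using Eeq dist by (auto simp: W_def)
    hence "r W < r E" using cflat_r_less_E[OF True] by blast
    ultimately have rW: "r W = 2" using rE by simp
    have "looks E ind [1,1,1,1,1,1] phi_wheel"
      unfolding looks_def
    proof (intro exI[of _ ?Ps] conjI allI impI parts)
      fix I assume I: "I \<subseteq> E"
      show "ind I \<longleftrightarrow> phi_wheel (map (\<lambda>P. cnt I P) ?Ps)"
        using indep_list[OF all I] cnt[OF I] rs rW rE by (simp add: phi_wheel_def phi_whirl_def numeral_nat)
    qed
    thus ?thesis ..
  next
    case False
    have all': "V \<in> {{}, X, Y, K, E}" if V: "cflat E r V" for V using all[OF V] False V by auto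
    have "looks E ind [1,1,1,1,1,1] phi_whirl"
      unfolding looks_def
    proof (intro exI[of _ ?Ps] conjI allI impI parts)
      fix I assume I: "I \<subseteq> E"
      show "ind I \<longleftrightarrow> phi_whirl (map (\<lambda>P. cnt I P) ?Ps)"
        using indep_list[OF all' I] cnt[OF I] rs rE by (simp add: phi_whirl_def numeral_nat)
    qed
    thus ?thesis ..
  qed
qed

lemma triple_looks:
  assumes X: "cflat E r X" and Y: "cflat E r Y" and K: "cflat E r K"
    and n: "\<not> X \<subseteq> Y" "\<not> Y \<subseteq> X" "\<not> X \<subseteq> K" "\<not> K \<subseteq> X" "\<not> K \<subseteq> Y" "\<not> Y \<subseteq> K"
  shows "looks E ind [1,1,1,1,1,1] phi_wheel \<or> looks E ind [1,1,1,1,1,1] phi_whirl \<or>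
    (\<exists>n k. 2 \<le> k \<and> k \<le> n \<and> looks E ind [n, n, k] (phi_B n k)) \<or>
    (\<exists>n k. 2 \<le> k \<and> k \<le> n \<and> looks E (\<lambda>I. du E r I = card I) [n, n, k] (phi_B n k))"
proof -
  note C = compl_triple[OF X Y K n]
  note XE = cflatD(1)[OF X] and YE = cflatD(1)[OF Y] and KE = cflatD(1)[OF K]
  consider "X \<inter> Y = {}" | "X \<inter> K = {}" | "Y \<inter> K = {}" | "X \<union> Y = E" | "X \<union> K = E" | "Y \<union> K = E" |
    "X \<inter> Y \<noteq> {}" "X \<inter> K \<noteq> {}" "Y \<inter> K \<noteq> {}" "X \<union> Y \<noteq> E" "X \<union> K \<noteq> E" "Y \<union> K \<noteq> E" by blast
  thus ?thesis
  proof cases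
    case 1 thus ?thesis using disjoint_triple_looks[OF X Y K n] by blast
  next
    case 2 thus ?thesis using disjoint_triple_looks[OF X K Y n(3,4,1,2,6,5)] by blast
  next
    case 3 thus ?thesis using disjoint_triple_looks[OF Y K X n(6,5,2,1,3,4)] by blast
  next
    \<comment> \<open>A covering pair is a disjoint pair in the dual; this and the next two cases
      yield the duals of the \<open>B\<close> matroids.\<close>
    case 4
    hence "(E - X) \<inter> (E - Y) = {}" by blast
    thus ?thesis using excl_full.disjoint_triple_looks[OF excl_full_du C] by blast
  next
    case 5
    hence "(E - X) \<inter> (E - K) = {}" by blast
    thus ?thesis using excl_full.disjoint_triple_looks[OF excl_full_du C(1,3,2,6,7,4,5,9,8)] by blast
  next
    case 6
    hence "(E - Y) \<inter> (E - K) = {}" by blast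
    thus ?thesis using excl_full.disjoint_triple_looks[OF excl_full_du C(2,3,1,9,8,5,4,6,7)] by blast
  next
    case 7 thus ?thesis using crossing_triple_looks[OF X Y K n] by blast
  qed
qed

end

section \<open>Incomparable pairs of cyclic flats without an antichain of three\<close>

context excl_full
begin

lemma nonch_partition:
  assumes X: "cflat E r X" and Y: "cflat E r Y" and n: "\<not> X \<subseteq> Y" "\<not> Y \<subseteq> X" and c: "\<not> ch X" "\<not> ch Y"
  shows "X \<inter> Y = {}" "X \<union> Y = E"
proof -
  show "X \<inter> Y = {}" using pair_con(1)[OF X Y n] c by blast
  show "X \<union> Y = E"
  proof (rule ccontr)
    assume "X \<union> Y \<noteq> E"
    then obtain e where e: "e \<in> E" "e \<notin> X" "e \<notin> Y" using cflatD(1)[OF X] cflatD(1)[OF Y] by blast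
    show False using pair_del(1)[OF X Y n e] c by blast
  qed
qed

text \<open>Deleting an element of \<open>Y\<close> leaves a nonempty cyclic part of
  \<open>Y\<close>, incomparable with \<open>X\<close>. As \<open>X\<close> is not a
  circuit-hyperplane, this part has to be one in the deletion, which fixes the nullity and the rank
  of \<open>Y\<close>.\<close>

lemma partition_large:
  assumes X: "cflat E r X" and Y: "cflat E r Y" and p: "X \<inter> Y = {}" "X \<union> Y = E" "X \<noteq> {}"
    and all: "\<And>W. cflat E r W \<Longrightarrow> W \<in> {{}, X, Y, E}" and c: "\<not> ch X" and big: "r Y + 2 \<le> card Y"
  shows "card Y = r Y + 2" "r Y + 1 = r E"
proof -
  note XD = cflatD[OF X] and YD = cflatD[OF Y]
  have "Y \<noteq> {}" using big by auto
  then obtain y where y: "y \<in> Y" by blast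
  have yE: "y \<in> E" "y \<notin> X" using y YD(1) p by auto
  define Y0 where "Y0 = cyc r (Y - {y})"
  note c0 = cflat_dl_cyc[OF Y y, folded Y0_def]
  have Y0: "Y0 \<noteq> {}" "Y0 \<subseteq> Y" using c0(2) big cyc_sub[of "Y - {y}"] by (auto simp: Y0_def)
  have n: "\<not> X \<subseteq> Y0" "\<not> Y0 \<subseteq> X" using Y0 p by blast+
  note dp = del_pair(1)[OF yE(1) cflat_dl[OF X yE(2)] c0(1) n]
  have sE: "X \<union> Y0 \<subseteq> E" using p Y0 by auto
  have "r (X \<union> Y0 - {e}) = r (X \<union> Y0)" if "e \<in> X \<union> Y0" for e
    by (rule cyclic_Un[OF XD(3) _ that]) (use cyc_cyclic[of "Y - {y}"] YD(1) Y0_def in auto)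
  hence cc: "cflat E r (clos E r (X \<union> Y0))" by (rule cyclic_clos[OF sE])
  have "X \<union> Y0 \<subseteq> clos E r (X \<union> Y0)" by (rule clos_ge[OF sE])
  hence "clos E r (X \<union> Y0) = E" using all[OF cc] n p Y0 by auto
  hence j: "r (X \<union> Y0) = r E" using clos_E_iff[OF sE] by simp
  hence d: "card Y0 = r Y0 + 1" "r Y0 + 1 = r E" using dp c unfolding ch_def by auto
  have "r Y < r E" by (rule cflat_r_less_E[OF Y]) (use p in auto)
  moreover have "r Y0 \<le> r Y" by (rule mono[OF Y0(2)])
  ultimately show "card Y = r Y + 2" "r Y + 1 = r E" using d c0(2) by auto
qed

text \<open>This is \<open>partition_large\<close> in the dual, where \<open>X\<close>, the
  complement of \<open>Y\<close>, plays the part of the complement of the large flat; its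
  conclusions translate back into the rank and nullity of \<open>X\<close>.\<close>

lemma partition_small:
  assumes X: "cflat E r X" and Y: "cflat E r Y" and p: "X \<inter> Y = {}" "X \<union> Y = E" "X \<noteq> {}" "Y \<noteq> {}"
    and all: "\<And>W. cflat E r W \<Longrightarrow> W \<in> {{}, X, Y, E}" and c: "\<not> ch Y" and big: "r X + 2 \<le> r E"
  shows "r X + 2 = r E" "card X = r X + 1"
proof -
  note XE = cflatD(1)[OF X] and YE = cflatD(1)[OF Y]
  have co: "E - X = Y" "E - Y = X" using p by auto
  have cd: "cflat E (du E r) X" "cflat E (du E r) Y" using cflat_du[OF XE] cflat_du[OF YE] X Y co by auto
  have alld: "W \<in> {{}, X, Y, E}" if W: "cflat E (du E r) W" for W
  proof -
    have WE: "W \<subseteq> E" using W by (simp add: cflat_def)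
    hence "E - (E - W) = W" by auto
    hence "cflat E r (E - W)" using cflat_du[of "E - W"] W by auto
    hence "E - W \<in> {{}, X, Y, E}" by (rule all)
    thus ?thesis using WE co by auto
  qed
  interpret D: excl_full E "du E r" by (rule excl_full_du)
  have cX: "\<not> D.ch X" using ch_du[OF YE] c co by simp
  have dY: "du E r Y + r E = card Y + r X" using du_add[of Y] co YE by (simp add: Int_absorb2)
  have dE: "du E r E + r E = card E" using du_add[of E] by simp
  have cE: "card E = card X + card Y" using card_compl[OF XE] co by simp
  have "du E r Y + 2 \<le> card Y" using dY big by simp
  note l = D.partition_large[OF cd p(1,2,3) alld cX this]
  show "r X + 2 = r E" using l(1) dY by simp
  thus "card X = r X + 1" using l(2) dY dE cE by simp
qed

lemma partition_looks:
  assumes X: "cflat E r X" and Y: "cflat E r Y" and p: "X \<inter> Y = {}" "X \<union> Y = E"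
    and all: "\<And>W. cflat E r W \<Longrightarrow> W \<in> {{}, X, Y, E}"
  shows "looks E ind [card X, card Y] (phi_FGH (r X) (r Y) (r E))"
  unfolding looks_def
proof (intro exI[of _ "[X, Y]"] conjI allI impI)
  fix I assume I: "I \<subseteq> E"
  have fI: "finite I" by (rule finite_sub[OF I])
  show "ind I \<longleftrightarrow> phi_FGH (r X) (r Y) (r E) (map (\<lambda>P. cnt I P) [X, Y])"
    using indep_list[OF all I] card_Int_Un[OF fI p(1)] p(2) by (simp add: phi_FGH_def)
qed (use p in auto)

text \<open>There are no other proper nonempty cyclic flats. Each of the two has nullity two and
  rank \<open>r E - 1\<close>, or nullity one and rank \<open>r E - 2\<close>: two of the first kind
  give \<open>G\<close>, two of the second give \<open>F\<close>, and one of each gives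
  \<open>H\<close>.\<close>

lemma nonch_pair_looks:
  assumes X: "cflat E r X" and Y: "cflat E r Y" and n: "\<not> X \<subseteq> Y" "\<not> Y \<subseteq> X" and c: "\<not> ch X" "\<not> ch Y"
    and n3: "\<And>K. cflat E r K \<Longrightarrow> X \<subseteq> K \<or> K \<subseteq> X \<or> Y \<subseteq> K \<or> K \<subseteq> Y"
  shows "(\<exists>n\<ge>4. looks E ind [n - 1, n - 1] (phi_FGH (n - 2) (n - 2) n)) \<or>
    (\<exists>n\<ge>2. looks E ind [n + 1, n + 1] (phi_FGH (n - 1) (n - 1) n)) \<or>
    (\<exists>n\<ge>3. looks E ind [n - 1, n + 1] (phi_FGH (n - 2) (n - 1) n))"
proof -
  note p = nonch_partition[OF X Y n c]
  have ne: "X \<noteq> {}" "Y \<noteq> {}" using n by auto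
  have nE: "X \<noteq> E" "Y \<noteq> E" using n p by auto
  have nch: "\<not> ch W" if W: "cflat E r W" and Z: "cflat E r Z" "Z \<noteq> {}" "Z \<noteq> E" "W \<noteq> Z" "W \<subseteq> Z \<or> Z \<subseteq> W" for W Z
    using ch_sub[OF W _ Z(1,2)] Z by blast
  have aux: "W = X \<or> W = E"
    if W: "cflat E r W" and X': "cflat E r X" "X \<noteq> {}" "X \<noteq> E" and Y': "cflat E r Y" "\<not> ch Y" and p': "X \<inter> Y = {}" "X \<union> Y = E"
      and cmp: "X \<subseteq> W \<or> W \<subseteq> X" and w: "W \<noteq> {}" for W X Y
  proof (rule ccontr)
    assume a: "\<not> (W = X \<or> W = E)"
    have "\<not> ch W" by (rule nch[OF W X']) (use a cmp in auto)
    show False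
    proof (cases "W \<subseteq> Y \<or> Y \<subseteq> W")
      case False
      hence "W \<inter> Y = {}" "W \<union> Y = E" using nonch_partition[OF W Y'(1)] \<open>\<not> ch W\<close> Y'(2) by blast+
      thus False using p' a by blast
    next
      case True
      have Yne: "Y \<noteq> {}" using p'(2) X'(3) by blast
      from cmp show False
      proof
        assume XW: "X \<subseteq> W"
        show False using True
        proof
          assume "W \<subseteq> Y" thus False using XW p'(1) X'(2) by blast
        next
          assume "Y \<subseteq> W"
          hence "E \<subseteq> W" using XW p'(2) by blast
          thus False using a cflatD(1)[OF W] by blast
        qed
      next
        assume WX: "W \<subseteq> X"
        show False using True
        proof
          assume "W \<subseteq> Y" thus False using WX p'(1) w by blast
        next
          assume "Y \<subseteq> W" thus False using WX p'(1) Yne by blast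
        qed
      qed
    qed
  qed
  have all: "W \<in> {{}, X, Y, E}" if W: "cflat E r W" for W
  proof (cases "W = {}")
    case False
    have p2: "Y \<inter> X = {}" "Y \<union> X = E" using p by auto
    show ?thesis using n3[OF W] aux[OF W X ne(1) nE(1) Y c(2) p _ False] aux[OF W Y ne(2) nE(2) X c(1) p2 _ False] by blast
  qed simp
  have type: "card Z = r Z + 2 \<and> r Z + 1 = r E \<or> card Z = r Z + 1 \<and> r Z + 2 = r E"
    if Z: "cflat E r Z" "Z \<noteq> {}" "\<not> ch Z" and V: "cflat E r V" "V \<noteq> {}" "\<not> ch V" and q: "V \<inter> Z = {}" "V \<union> Z = E" "Z \<noteq> E"
      and al: "\<And>W. cflat E r W \<Longrightarrow> W \<in> {{}, V, Z, E}" for Z V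
  proof (cases "r Z + 2 \<le> card Z")
    case True
    thus ?thesis using partition_large[OF V(1) Z(1) q(1,2) V(2) al V(3)] by blast
  next
    case False
    hence cZ: "card Z = r Z + 1" using cflat_card_gt[OF Z(1,2)] by simp
    hence "r Z + 2 \<le> r E" using Z(3) cflat_r_less_E[OF Z(1) q(3)] unfolding ch_def by linarith
    moreover have "Z \<inter> V = {}" "Z \<union> V = E" using q by auto
    moreover have "W \<in> {{}, Z, V, E}" if "cflat E r W" for W using al[OF that] by blast
    ultimately show ?thesis using partition_small[OF Z(1) V(1) _ _ Z(2) V(2) _ V(3)] cZ by blast
  qed
  have tX: "card X = r X + 2 \<and> r X + 1 = r E \<or> card X = r X + 1 \<and> r X + 2 = r E"
    by (rule type[OF X ne(1) c(1) Y ne(2) c(2) _ _ nE(1)]) (use p all in blast)+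
  have tY: "card Y = r Y + 2 \<and> r Y + 1 = r E \<or> card Y = r Y + 1 \<and> r Y + 2 = r E"
    by (rule type[OF Y ne(2) c(2) X ne(1) c(1) p nE(2)]) (use all in blast)
  have pos: "0 < r X" "0 < r Y" using cflat_r_pos[OF X ne(1)] cflat_r_pos[OF Y ne(2)] .
  have sum: "r E \<le> r X + r Y" using r_Un[of X Y] p(2) by simp
  note l = partition_looks[OF X Y p all]
  have p2: "Y \<inter> X = {}" "Y \<union> X = E" using p by auto
  have l2: "looks E ind [card Y, card X] (phi_FGH (r Y) (r X) (r E))"
    by (rule partition_looks[OF Y X p2]) (use all in blast)
  define m where "m = r E"
  from tX tY show ?thesis
  proof (elim disjE conjE)
    assume a: "card X = r X + 2" "r X + 1 = r E" "card Y = r Y + 2" "r Y + 1 = r E"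
    hence "card X = m + 1" "card Y = m + 1" "r X = m - 1" "r Y = m - 1" "2 \<le> m" using pos by (auto simp: m_def)
    thus ?thesis using l m_def by auto
  next
    assume a: "card X = r X + 1" "r X + 2 = r E" "card Y = r Y + 1" "r Y + 2 = r E"
    \<comment> \<open>The ranks of the two flats add up to at least \<open>r E\<close>, that is,
      \<open>m \<le> 2 * (m - 2)\<close>; hence the family starts at 4.\<close>
    hence "card X = m - 1" "card Y = m - 1" "r X = m - 2" "r Y = m - 2" "4 \<le> m" using pos sum by (auto simp: m_def)
    thus ?thesis using l m_def by auto
  next
    assume a: "card X = r X + 1" "r X + 2 = r E" "card Y = r Y + 2" "r Y + 1 = r E"
    hence "card X = m - 1" "card Y = m + 1" "r X = m - 2" "r Y = m - 1" "3 \<le> m" using pos by (auto simp: m_def)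
    thus ?thesis using l m_def by auto
  next
    assume a: "card X = r X + 2" "r X + 1 = r E" "card Y = r Y + 1" "r Y + 2 = r E"
    hence "card X = m + 1" "card Y = m - 1" "r X = m - 1" "r Y = m - 2" "3 \<le> m" using pos by (auto simp: m_def)
    thus ?thesis using l2 m_def by auto
  qed
qed

text \<open>Suppose \<open>Z\<close> without the common element \<open>f\<close> contained a
  circuit. Deleting an element \<open>z\<close> of it leaves a cyclic flat that still contains
  \<open>f\<close> and is incomparable with \<open>B\<close>. The two meet, so they would have to
  cover \<open>E - {z}\<close>, but they miss the element outside
  \<open>B \<union> Z\<close>.\<close>

lemma crossing_nullity:
  assumes B: "cflat E r B" "ch B" and Z: "cflat E r Z" and n: "\<not> B \<subseteq> Z" "\<not> Z \<subseteq> B" and m: "B \<inter> Z \<noteq> {}" "B \<union> Z \<noteq> E"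
  shows "card Z = r Z + 1"
proof (rule ccontr)
  assume ne: "card Z \<noteq> r Z + 1"
  note BD = cflatD[OF B(1)] and ZD = cflatD[OF Z]
  obtain f where f: "B \<inter> Z = {f}" using crossing_pair(2)[OF B(1) Z n m] by blast
  obtain e where e: "e \<in> E" "e \<notin> B" "e \<notin> Z" using m(2) BD(1) ZD(1) by blast
  have Zne: "Z \<noteq> {}" using n by auto
  have fZ: "f \<in> Z" "f \<in> B" using f by auto
  have "z \<notin> cyc r (Z - {f})" if z: "z \<in> Z - {f}" for z
  proof
    assume zc: "z \<in> cyc r (Z - {f})"
    have zE: "z \<in> E" "z \<notin> B" "z \<in> Z" using z f ZD(1) by auto
    define Z0 where "Z0 = cyc r (Z - {z})"
    note c0 = cflat_dl_cyc[OF Z zE(3), folded Z0_def]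
    have "r Z < card Z" by (rule cflat_card_gt[OF Z Zne])
    hence Z0ne: "Z0 \<noteq> {}" using c0(2) ne by auto
    have Z0Z: "Z0 \<subseteq> Z" unfolding Z0_def using cyc_sub[of "Z - {z}"] by auto
    have "r (Z - {f} - {z}) = r Z" using zc ZD(3)[OF fZ(1)] by (simp add: cyc_def)
    moreover have "Z - {f} - {z} = Z - {z} - {f}" by auto
    ultimately have fZ0: "f \<in> Z0" using fZ z ZD(3)[OF zE(3)] by (auto simp: Z0_def cyc_def)
    have "\<not> B \<subseteq> Z0" using n Z0Z by blast
    moreover have "\<not> Z0 \<subseteq> B"
    proof
      assume "Z0 \<subseteq> B"
      hence "Z0 \<subseteq> B \<inter> Z" using Z0Z by blast
      hence "Z0 = {f}" unfolding f using Z0ne by blast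
      moreover have "r (Z0 - {f}) = r Z0" unfolding Z0_def by (rule cyc_cyclic) (use ZD(1) fZ0 Z0_def in auto)
      ultimately show False using r_single[of f] fZ BD(1) by auto
    qed
    ultimately have d: "B \<inter> Z0 = {} \<or> B \<union> Z0 = clos E r (B \<union> Z0) - {z}"
      and nB: "\<not> Z0 \<subseteq> B" using del_pair(3)[OF zE(1) cflat_dl[OF B(1) zE(2)] c0(1)] by blast+
    have sE: "B \<union> Z0 \<subseteq> E" using BD(1) ZD(1) Z0Z by auto
    have "r B < r (B \<union> Z0)" by (rule cflat_r_less[OF B(1) _ sE]) (use nB in auto)
    hence "r (B \<union> Z0) = r E" using B(2) mono[OF sE] unfolding ch_def by simp
    hence "clos E r (B \<union> Z0) = E" using clos_E_iff[OF sE] by simp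
    hence "B \<union> Z0 = E - {z}" using d fZ fZ0 by blast
    moreover have "e \<in> E - {z}" using e zE by auto
    ultimately show False using e Z0Z by blast
  qed
  hence "cyc r (Z - {f}) = {}" using cyc_sub[of "Z - {f}"] by blast
  hence "card (Z - {f}) = r (Z - {f})" using card_cyc[of "Z - {f}"] ZD(1) by auto
  moreover have "card (Z - {f}) + 1 = card Z" using fZ ZD(4) by (metis Suc_eq_plus1 card_Suc_Diff1)
  ultimately show False using ne ZD(3)[OF fZ(1)] by simp
qed

text \<open>Crossing is a self-dual situation, so \<open>crossing_nullity\<close> in the dual
  supplies the rank of \<open>Z\<close>.\<close>

lemma crossing_ch:
  assumes B: "cflat E r B" "ch B" and Z: "cflat E r Z" and n: "\<not> B \<subseteq> Z" "\<not> Z \<subseteq> B" and m: "B \<inter> Z \<noteq> {}" "B \<union> Z \<noteq> E"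
  shows "ch Z"
proof -
  interpret D: excl_full E "du E r" by (rule excl_full_du)
  note BE = cflatD(1)[OF B(1)] and ZE = cflatD(1)[OF Z]
  have "card (E - Z) = du E r (E - Z) + 1"
  proof (rule D.crossing_nullity)
    show "cflat E (du E r) (E - B)" "cflat E (du E r) (E - Z)" using cflat_du[OF BE] cflat_du[OF ZE] B Z by auto
    show "D.ch (E - B)" using ch_du[OF BE] B(2) by simp
    show "\<not> E - B \<subseteq> E - Z" "\<not> E - Z \<subseteq> E - B" "(E - B) \<inter> (E - Z) \<noteq> {}" "(E - B) \<union> (E - Z) \<noteq> E"
      using n m BE ZE by (blast, blast, blast, blast)
  qed
  moreover have "E - (E - Z) = Z" "(E - Z) \<inter> E = E - Z" using ZE by auto
  ultimately have "r Z + 1 = r E" using du_add[of "E - Z"] by simp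
  thus ?thesis using crossing_nullity[OF B Z n m] by (simp add: ch_def)
qed

text \<open>Both flats are circuit-hyperplanes and no other proper nonempty cyclic flat exists. The
  element they share is the \<open>x\<close> of A_n, and the one they miss is its
  \<open>y\<close>.\<close>

lemma crossing_pair_looks:
  assumes B: "cflat E r B" "ch B" and Z: "cflat E r Z" and n: "\<not> B \<subseteq> Z" "\<not> Z \<subseteq> B" and m: "B \<inter> Z \<noteq> {}" "B \<union> Z \<noteq> E"
    and n3: "\<And>K. cflat E r K \<Longrightarrow> B \<subseteq> K \<or> K \<subseteq> B \<or> Z \<subseteq> K \<or> K \<subseteq> Z"
  shows "\<exists>n\<ge>3. looks E ind [1, 1, n - 1, n - 1] (phi_A n)"
proof -
  have cZ: "ch Z" by (rule crossing_ch[OF B Z n m])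
  obtain f where f: "B \<inter> Z = {f}" using crossing_pair(2)[OF B(1) Z n m] by blast
  obtain e where e: "e \<in> E" "B \<union> Z = E - {e}" using crossing_pair(3)[OF B(1) Z n m] by blast
  note BD = cflatD[OF B(1)] and ZD = cflatD[OF Z]
  define k where "k = r E"
  have rs: "r B = k - 1" "r Z = k - 1" "card B = k" "card Z = k" using B(2) cZ by (auto simp: ch_def k_def)
  have fm: "f \<in> B" "f \<in> Z" using f by auto
  obtain b where b: "b \<in> B" "b \<notin> Z" using n by blast
  have "2 \<le> r B" by (rule crossing_rank[OF Z B(1) fm(2,1) b])
  hence k3: "3 \<le> k" using rs by simp
  have all: "W \<in> {{}, B, Z, E}" if W: "cflat E r W" for W
    using n3[OF W] ch_sub[OF B W] ch_sub[OF Z cZ W] by blast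
  have Beq: "B = {f} \<union> (B - {f})" "Z = {f} \<union> (Z - {f})" using fm by auto
  have Eeq: "E = ({e} \<union> B) \<union> (Z - {f})" using e f by blast
  have dj: "({e} \<union> B) \<inter> (Z - {f}) = {}" "{e} \<inter> B = {}" using e f by blast+
  have cards: "card (B - {f}) = k - 1" "card (Z - {f}) = k - 1" using fm rs BD(4) ZD(4) by simp_all
  have "looks E ind [1, 1, k - 1, k - 1] (phi_A k)"
    unfolding looks_def
  proof (intro exI[of _ "[{f}, {e}, B - {f}, Z - {f}]"] conjI allI impI)
    show "map card [{f}, {e}, B - {f}, Z - {f}] = [1, 1, k - 1, k - 1]" using cards by simp
    show "pdisj [{f}, {e}, B - {f}, Z - {f}]" using dj f fm by auto
    show "\<Union>(set [{f}, {e}, B - {f}, Z - {f}]) = E" using Eeq Beq(1) by auto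
    fix I assume I: "I \<subseteq> E"
    have fI: "finite I" by (rule finite_sub[OF I])
    have 1: "cnt I B = cnt I {f} + cnt I (B - {f})"
      using card_Int_Un[OF fI, of "{f}" "B - {f}"] Beq(1) by auto
    have 2: "cnt I Z = cnt I {f} + cnt I (Z - {f})"
      using card_Int_Un[OF fI, of "{f}" "Z - {f}"] Beq(2) by auto
    have 3: "cnt I E = cnt I {e} + cnt I B + cnt I (Z - {f})"
      using card_Int_Un[OF fI dj(1)] card_Int_Un[OF fI dj(2)] Eeq by simp
    have "ind I \<longleftrightarrow> cnt I B \<le> k - 1 \<and> cnt I Z \<le> k - 1 \<and> cnt I E \<le> k"
      using indep_list[OF all I] rs by (simp add: k_def)
    thus "ind I \<longleftrightarrow> phi_A k (map (\<lambda>P. cnt I P) [{f}, {e}, B - {f}, Z - {f}])"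
      unfolding 3 1 2 by (simp add: phi_A_def eval_nat_numeral) linarith
  qed
  thus ?thesis using k3 by blast
qed

end

text \<open>\<open>P\<close> is independence in the matroid and \<open>P'\<close> in its dual; the
  families \<open>C\<close> and \<open>E\<close>, defined as duals, are expressed through
  \<open>P'\<close>.\<close>

definition listed :: "'a set \<Rightarrow> ('a set \<Rightarrow> bool) \<Rightarrow> ('a set \<Rightarrow> bool) \<Rightarrow> bool" where
  "listed E P P' \<longleftrightarrow> looks E P [2,2,2] phi_1a \<or> looks E P [2,2,2] phi_1b \<or>
     looks E P [1,1,1,1,1,1] phi_wheel \<or> looks E P [1,1,1,1,1,1] phi_whirl \<or>
     (\<exists>n\<ge>3. looks E P [1, 1, n - 1, n - 1] (phi_A n)) \<or>
     (\<exists>n k. 2 \<le> k \<and> k \<le> n \<and> (looks E P [n, n, k] (phi_B n k) \<or> looks E P' [n, n, k] (phi_B n k))) \<or>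
     (\<exists>n\<ge>3. looks E P [n - 1, n - 1, 2] (phi_D n)) \<or>
     (\<exists>n\<ge>3. looks E P' [n - 1, n - 1, 2] (phi_D n)) \<or>
     (\<exists>n\<ge>4. looks E P [n - 1, n - 1] (phi_FGH (n - 2) (n - 2) n)) \<or>
     (\<exists>n\<ge>2. looks E P [n + 1, n + 1] (phi_FGH (n - 1) (n - 1) n)) \<or>
     (\<exists>n\<ge>3. looks E P [n - 1, n + 1] (phi_FGH (n - 2) (n - 1) n))"

text \<open>If there is no antichain of three and every incomparable pair contains a
  circuit-hyperplane, take one of them as the witness \<open>B\<close>. Any pair that violates the
  condition then contains \<open>B\<close>, because a pair without it would form an antichain of
  three with it. So the failure is a flat crossing \<open>B\<close>.\<close>

lemma (in excl_full) full_listed: "listed E ind (\<lambda>I. du E r I = card I)"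
proof (cases "\<exists>X Y K. cflat E r X \<and> cflat E r Y \<and> cflat E r K \<and>
    \<not> X \<subseteq> Y \<and> \<not> Y \<subseteq> X \<and> \<not> X \<subseteq> K \<and> \<not> K \<subseteq> X \<and> \<not> K \<subseteq> Y \<and> \<not> Y \<subseteq> K")
  case True
  then obtain X Y K where XYK: "cflat E r X" "cflat E r Y" "cflat E r K"
    "\<not> X \<subseteq> Y" "\<not> Y \<subseteq> X" "\<not> X \<subseteq> K" "\<not> K \<subseteq> X" "\<not> K \<subseteq> Y" "\<not> Y \<subseteq> K" by (elim exE conjE) (rule that)
  show ?thesis unfolding listed_def using triple_looks[OF XYK] by blast
next
  case False
  hence n3: "X \<subseteq> K \<or> K \<subseteq> X \<or> Y \<subseteq> K \<or> K \<subseteq> Y"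
    if "cflat E r X" "cflat E r Y" "\<not> X \<subseteq> Y" "\<not> Y \<subseteq> X" "cflat E r K" for X Y K using that by blast
  show ?thesis
  proof (cases "\<exists>X Y. cflat E r X \<and> cflat E r Y \<and> \<not> X \<subseteq> Y \<and> \<not> Y \<subseteq> X \<and> \<not> ch X \<and> \<not> ch Y")
    case True
    then obtain X Y where XY: "cflat E r X" "cflat E r Y" "\<not> X \<subseteq> Y" "\<not> Y \<subseteq> X" "\<not> ch X" "\<not> ch Y" by blast
    show ?thesis unfolding listed_def using nonch_pair_looks[OF XY n3[OF XY(1-4)]] by blast
  next
    case nF: False
    have "\<exists>X Y. cflat E r X \<and> cflat E r Y \<and> \<not> X \<subseteq> Y \<and> \<not> Y \<subseteq> X"
    proof (rule ccontr)
      assume "\<not> ?thesis"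
      hence "notchy E r" unfolding notchy_def by blast
      thus False using not_notchy by blast
    qed
    then obtain B C where BC: "cflat E r B" "cflat E r C" "\<not> B \<subseteq> C" "\<not> C \<subseteq> B" "ch B" using nF by blast
    have cB: "r B + 1 = r E" "card B = r B + 1" using BC(5) by (auto simp: ch_def)
    have "\<not> (\<forall>X Y. cflat E r X \<longrightarrow> cflat E r Y \<longrightarrow> \<not> X \<subseteq> Y \<longrightarrow> \<not> Y \<subseteq> X \<longrightarrow>
      (X = B \<or> Y = B) \<and> (X \<inter> Y = {} \<or> X \<union> Y = E))"
    proof
      assume a: "\<forall>X Y. cflat E r X \<longrightarrow> cflat E r Y \<longrightarrow> \<not> X \<subseteq> Y \<longrightarrow> \<not> Y \<subseteq> X \<longrightarrow>
        (X = B \<or> Y = B) \<and> (X \<inter> Y = {} \<or> X \<union> Y = E)"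
      have "notchy E r"
        unfolding notchy_def coloopless loopless by (rule exI[of _ B]) (use a cB in simp)
      thus False using not_notchy by blast
    qed
    then obtain X Y where XY: "cflat E r X" "cflat E r Y" "\<not> X \<subseteq> Y" "\<not> Y \<subseteq> X"
      "\<not> ((X = B \<or> Y = B) \<and> (X \<inter> Y = {} \<or> X \<union> Y = E))" by blast
    have BE: "B \<noteq> E" "B \<noteq> {}" using BC cflatD(1)[OF BC(2)] by auto
    have "X = B \<or> Y = B"
    proof (rule ccontr)
      assume a: "\<not> (X = B \<or> Y = B)"
      have t: "X \<noteq> {}" "X \<noteq> E" "Y \<noteq> {}" "Y \<noteq> E" using XY(3,4) cflatD(1)[OF XY(1)] cflatD(1)[OF XY(2)] by auto
      show False using n3[OF XY(1-4) BC(1)] ch_sub[OF BC(1,5) XY(1)] ch_sub[OF BC(1,5) XY(2)] t a by blast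
    qed
    then obtain Z where Z: "cflat E r Z" "\<not> B \<subseteq> Z" "\<not> Z \<subseteq> B" "B \<inter> Z \<noteq> {}" "B \<union> Z \<noteq> E"
      using XY by (metis Int_commute Un_commute)
    show ?thesis unfolding listed_def
      using crossing_pair_looks[OF BC(1,5) Z n3[OF BC(1) Z(1-3)]] by blast
  qed
qed

theorem exc_listed:
  assumes "rank_matroid E r" "exc E r"
  shows "listed E (\<lambda>I. r I = card I) (\<lambda>I. du E r I = card I)"
proof -
  interpret excl E r using assms by (simp add: excl_def excl_axioms_def)
  interpret D: excl E "du E r" by (rule excl_du)
  show ?thesis
  proof (cases "\<exists>X Y. cflat E r X \<and> cflat E r Y \<and> \<not> X \<subseteq> Y \<and> \<not> Y \<subseteq> X \<and> r (X \<union> Y) \<noteq> r E")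
    case True
    then obtain X Y where XY: "cflat E r X" "cflat E r Y" "\<not> X \<subseteq> Y" "\<not> Y \<subseteq> X" "r (X \<union> Y) \<noteq> r E" by blast
    have "r (X \<union> Y) < r E" using mono[of "X \<union> Y" E] XY cflatD(1)[OF XY(1)] cflatD(1)[OF XY(2)] by simp
    thus ?thesis unfolding listed_def using join_gap_looks[OF XY(1-4)] by blast
  next
    case nD: False
    show ?thesis
    proof (cases "\<exists>X Y. cflat E (du E r) X \<and> cflat E (du E r) Y \<and> \<not> X \<subseteq> Y \<and> \<not> Y \<subseteq> X \<and> du E r (X \<union> Y) \<noteq> du E r E")
      case True
      then obtain X Y where XY: "cflat E (du E r) X" "cflat E (du E r) Y" "\<not> X \<subseteq> Y" "\<not> Y \<subseteq> X"
        "du E r (X \<union> Y) \<noteq> du E r E" by blast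
      have lt: "du E r (X \<union> Y) < du E r E"
        using D.mono[of "X \<union> Y" E] XY D.cflatD(1)[OF XY(1)] D.cflatD(1)[OF XY(2)] by simp
      \<comment> \<open>In the two six-element matroids, a gap in the dual comes with a gap in the
        matroid itself, which is excluded here. So only the dual of a \<open>D\<close> matroid
        remains.\<close>
      have "\<not> (\<exists>U V. cflat E (du E r) U \<and> cflat E (du E r) V \<and> \<not> U \<subseteq> V \<and> \<not> V \<subseteq> U \<and> du E r (U \<inter> V) < cnt U V)"
      proof
        assume "\<exists>U V. cflat E (du E r) U \<and> cflat E (du E r) V \<and> \<not> U \<subseteq> V \<and> \<not> V \<subseteq> U \<and> du E r (U \<inter> V) < cnt U V"
        then obtain U V where UV: "cflat E (du E r) U" "cflat E (du E r) V" "\<not> U \<subseteq> V" "\<not> V \<subseteq> U" "du E r (U \<inter> V) < cnt U V" by blast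
        have s: "U \<subseteq> E" "V \<subseteq> E" using D.cflatD(1)[OF UV(1)] D.cflatD(1)[OF UV(2)] .
        have "E - (E - U) = U" "E - (E - V) = V" using s by auto
        hence "cflat E r (E - U)" "cflat E r (E - V)" using cflat_du[of "E - U"] cflat_du[of "E - V"] UV by auto
        moreover have "\<not> E - U \<subseteq> E - V" "\<not> E - V \<subseteq> E - U" using UV(3,4) s by auto
        ultimately have "r ((E - U) \<union> (E - V)) = r E" using nD by blast
        moreover have "E - (U \<inter> V) = (E - U) \<union> (E - V)" "U \<inter> V \<inter> E = U \<inter> V" using s by auto
        ultimately have "du E r (U \<inter> V) = cnt U V" using du_add[of "U \<inter> V"] by simp
        thus False using UV(5) by simp
      qed
      thus ?thesis unfolding listed_def using D.join_gap_looks[OF XY(1-4) lt] by blast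
    next
      case False
      interpret excl_full E r by unfold_locales (use nD False in blast)+
      show ?thesis by (rule full_listed)
    qed
  qed
qed

section \<open>Minors of the listed matroids\<close>

lemma nested_intro:
  assumes "Z1 \<subseteq> Z2" "Z2 \<subseteq> Z3" "Z3 \<subseteq> E"
  shows "nested_pres E (\<lambda>I. cnt I Z1 \<le> k1 \<and> cnt I Z2 \<le> k2 \<and> cnt I Z3 \<le> k3)"
  unfolding nested_pres_def
  by (rule exI[of _ "{(Z1, k1), (Z2, k2), (Z3, k3)}"]) (use assms in auto)

text \<open>Two bounds besides that of \<open>T\<close> suffice for all minors below. The
  requirement that \<open>B\<close> is not included is put as a count, so that it matches counting
  descriptions of independence.\<close>

lemma notch_intro:
  assumes "finite E" "Z1 \<subseteq> Z2" "Z2 \<subseteq> T" "T \<subseteq> E" "B \<subset> T" "B \<noteq> {}"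
    and c1: "Z1 \<inter> B = {} \<and> (0 < k1 \<or> \<not> T \<subseteq> Z1 \<union> B) \<or> T \<subseteq> Z1 \<union> B \<and> cnt B Z1 < k1"
    and c2: "Z2 \<inter> B = {} \<and> (0 < k2 \<or> \<not> T \<subseteq> Z2 \<union> B) \<or> T \<subseteq> Z2 \<union> B \<and> cnt B Z2 < k2"
  shows "notch_pres E (\<lambda>I. cnt I Z1 \<le> k1 \<and> cnt I Z2 \<le> k2 \<and> cnt I T \<le> card B \<and> cnt I B < card B)"
  unfolding notch_pres_def
proof (rule exI[of _ "{(Z1, k1), (Z2, k2), (T, card B)}"], rule exI[of _ B], rule exI[of _ T], intro conjI allI impI)
  have fB: "finite B" using assms(1,4,5) by (meson finite_subset psubset_imp_subset)
  show "\<forall>p\<in>{(Z1, k1), (Z2, k2), (T, card B)}. \<forall>q\<in>{(Z1, k1), (Z2, k2), (T, card B)}. fst p \<subseteq> fst q \<or> fst q \<subseteq> fst p"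
    using assms(2,3) by auto
  show "\<forall>(Z, k)\<in>{(Z1, k1), (Z2, k2), (T, card B)}. Z \<subseteq> T \<and> ((Z, k) = (T, card B) \<or> Z \<inter> B = {} \<and> (0 < k \<or> \<not> T \<subseteq> Z \<union> B) \<or>
        T \<subseteq> Z \<union> B \<and> cnt B Z < k)"
    using assms(2,3) c1 c2 by simp
  fix I assume "I \<subseteq> E"
  have "cnt I B < card B \<longleftrightarrow> \<not> B \<subseteq> I"
  proof
    assume "cnt I B < card B" thus "\<not> B \<subseteq> I" by (auto simp: Int_absorb1)
  next
    assume "\<not> B \<subseteq> I" thus "cnt I B < card B" by (intro psubset_card_mono fB) auto
  qed
  thus "(cnt I Z1 \<le> k1 \<and> cnt I Z2 \<le> k2 \<and> cnt I T \<le> card B \<and> cnt I B < card B) \<longleftrightarrow>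
    (\<forall>(Z, k)\<in>{(Z1, k1), (Z2, k2), (T, card B)}. cnt I Z \<le> k) \<and> \<not> B \<subseteq> I" by simp
qed (use assms in auto)

lemma notch_intro2:
  assumes "finite E" "Z \<subseteq> T" "T \<subseteq> E" "B \<subset> T" "B \<noteq> {}"
    and "Z \<inter> B = {} \<and> 0 < k \<or> T \<subseteq> Z \<union> B \<and> cnt B Z < k"
  shows "notch_pres E (\<lambda>I. cnt I Z \<le> k \<and> cnt I T \<le> card B \<and> cnt I B < card B)"
proof -
  have "notch_pres E (\<lambda>I. cnt I Z \<le> k \<and> cnt I Z \<le> k \<and> cnt I T \<le> card B \<and> cnt I B < card B)"
    by (rule notch_intro) (use assms in auto)
  thus ?thesis by (rule iffD1[OF pres_cong(2), rotated]) simp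
qed

lemma cnt_insert: "finite I \<Longrightarrow> e \<notin> I \<Longrightarrow> cnt (insert e I) A = cnt I A + (if e \<in> A then 1 else 0)"
  by simp

lemma cnt_single: "card ({e} \<inter> A) = (if e \<in> A then 1 else 0)"
  by simp

lemma cnt_remove: "e \<notin> I \<Longrightarrow> I \<inter> (A - {e}) = I \<inter> A"
  by auto

lemma cnt_less: "finite A \<Longrightarrow> e \<in> A \<Longrightarrow> e \<notin> I \<Longrightarrow> cnt I A < card A"
  by (rule psubset_card_mono) auto

lemma cnt_le: "finite A \<Longrightarrow> cnt I A \<le> card A"
  by (rule card_mono) auto

lemma card_subset_ex: "n \<le> card S \<Longrightarrow> \<exists>T\<subseteq>S. card T = n \<and> finite T"
  by (metis obtain_subset_with_card_n)

context rank_matroid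
begin

lemma pres_notchy: "nested_pres E ind \<or> notch_pres E ind \<Longrightarrow> notchy E r"
  using nested_pres_notchy notch_pres_notchy by blast

lemma del_notchy:
  assumes "nested_pres (E - {e}) Q \<or> notch_pres (E - {e}) Q"
    and Q: "\<And>I. I \<subseteq> E \<Longrightarrow> e \<notin> I \<Longrightarrow> finite I \<Longrightarrow> r I = card I \<longleftrightarrow> Q I"
  shows "notchy (E - {e}) (dl e r)"
proof -
  interpret D: rank_matroid "E - {e}" "dl e r" by (rule rank_matroid_dl)
  have *: "Q I \<longleftrightarrow> dl e r I = card I" if "I \<subseteq> E - {e}" for I
  proof -
    have I: "I \<subseteq> E" "e \<notin> I" using that by auto
    show ?thesis using Q[OF I finite_sub[OF I(1)]] dl_notin[OF I(2)] by auto
  qed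
  show ?thesis
    by (rule D.pres_notchy) (use assms(1) pres_cong[of "E - {e}" Q "\<lambda>I. dl e r I = card I", OF *] in simp)
qed

lemma con_notchy:
  assumes e: "e \<in> E" "r {e} = 1" and "nested_pres (E - {e}) Q \<or> notch_pres (E - {e}) Q"
    and Q: "\<And>I. I \<subseteq> E \<Longrightarrow> e \<notin> I \<Longrightarrow> finite I \<Longrightarrow> insert e I \<subseteq> E \<Longrightarrow> r (insert e I) = card (insert e I) \<longleftrightarrow> Q I"
  shows "notchy (E - {e}) (ct e r)"
proof -
  interpret C: rank_matroid "E - {e}" "ct e r" by (rule rank_matroid_ct[OF e(1)])
  have *: "Q I \<longleftrightarrow> ct e r I = card I" if I: "I \<subseteq> E - {e}" for I
  proof -
    have f: "finite I" "e \<notin> I" using I finite_sub[of I] by auto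
    have "r {e} \<le> r (insert e I)" by (rule mono) auto
    hence "ct e r I = card I \<longleftrightarrow> r (insert e I) = card (insert e I)" using f e by (auto simp: ct_def)
    moreover have "I \<subseteq> E" "insert e I \<subseteq> E" using I e by auto
    ultimately show ?thesis using Q[of I] f by simp
  qed
  show ?thesis
    by (rule C.pres_notchy) (use assms(3) pres_cong[of "E - {e}" Q "\<lambda>I. ct e r I = card I", OF *] in simp)
qed

lemma excI:
  assumes "\<not> notchy E r" "\<And>e. e \<in> E \<Longrightarrow> notchy (E - {e}) (dl e r)" "\<And>e. e \<in> E \<Longrightarrow> notchy (E - {e}) (ct e r)"
  shows "exc E r"
  using assms unfolding exc_def by blast

lemma rank_le: assumes "A \<subseteq> E" "\<And>J. J \<subseteq> A \<Longrightarrow> r J = card J \<Longrightarrow> card J \<le> k" shows "r A \<le> k"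
proof -
  obtain I where "I \<subseteq> A" "r I = card I" "r I = r A" by (rule basis_exists[OF assms(1)])
  thus ?thesis using assms(2)[of I] by simp
qed

lemma rank_ge: "r I = card I \<Longrightarrow> I \<subseteq> A \<Longrightarrow> card I \<le> r A"
  using mono[of I A] by simp

text \<open>A uniform restriction with more elements than its rank is cyclic, and \<open>o\<close>
  makes it a flat. The cyclic flats exhibited below are all of this kind.\<close>

lemma cflat_uniform:
  assumes X: "X \<subseteq> E" "k < card X"
    and i: "\<And>I. I \<subseteq> X \<Longrightarrow> card I \<le> k \<Longrightarrow> r I = card I"
    and u: "\<And>J. J \<subseteq> X \<Longrightarrow> r J = card J \<Longrightarrow> card J \<le> k"
    and o: "\<And>f I. f \<in> E \<Longrightarrow> f \<notin> X \<Longrightarrow> I \<subseteq> X \<Longrightarrow> card I = k \<Longrightarrow> r (insert f I) = k + 1"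
  shows "cflat E r X \<and> r X = k"
proof -
  have fX: "finite X" by (rule finite_sub[OF X(1)])
  obtain I where I: "I \<subseteq> X" "card I = k" using card_subset_ex[of k X] X(2) by auto
  have "r X \<le> k" by (rule rank_le[OF X(1) u])
  moreover have "k \<le> r X" using rank_ge[OF i[OF I(1)] I(1)] I(2) by simp
  ultimately have rX: "r X = k" by simp
  have "cflat E r X"
    unfolding cflat_def
  proof (intro conjI ballI X(1))
    fix f assume f: "f \<in> E - X"
    have "r (insert f I) \<le> r (insert f X)" by (rule mono) (use I in auto)
    thus "r X < r (insert f X)" using o[of f I] f I rX by auto
  next
    fix f assume f: "f \<in> X"
    have "card (X - {f}) + 1 = card X" using f fX by (metis Suc_eq_plus1 card_Suc_Diff1)
    then obtain J where J: "J \<subseteq> X - {f}" "card J = k" using card_subset_ex[of k "X - {f}"] X(2) by auto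
    hence "k \<le> r (X - {f})" using rank_ge[OF i, of J "X - {f}"] by auto
    thus "r (X - {f}) = r X" using rX mono[of "X - {f}" X] by auto
  qed
  thus ?thesis using rX by blast
qed

lemma notchyD:
  assumes "notchy E r" and X: "cflat E r X" and Y: "cflat E r Y" and n: "\<not> X \<subseteq> Y" "\<not> Y \<subseteq> X"
    and l: "\<And>e. e \<in> E \<Longrightarrow> r {e} = 1"
  shows "X \<inter> Y = {} \<or> X \<union> Y = cyc r E" "r (X \<union> Y) = r (cyc r E)"
    "card X = r X + 1 \<and> r X + 1 = r (cyc r E) \<or> card Y = r Y + 1 \<and> r Y + 1 = r (cyc r E)"
proof -
  have L: "loops E r = {}" using l by (auto simp: loops_def)
  obtain B where "\<forall>X Y. cflat E r X \<longrightarrow> cflat E r Y \<longrightarrow> \<not> X \<subseteq> Y \<longrightarrow> \<not> Y \<subseteq> X \<longrightarrow>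
     (X = B \<or> Y = B) \<and> r B + 1 = r (cyc r E) \<and> card B = r B + card ({}::'a set) + 1 \<and>
     (X \<inter> Y = {} \<or> X \<union> Y = cyc r E)"
    using assms(1) unfolding notchy_def L by (rule exE)
  note B = this[rule_format, OF X Y n]
  show "X \<inter> Y = {} \<or> X \<union> Y = cyc r E" using B by blast
  show "card X = r X + 1 \<and> r X + 1 = r (cyc r E) \<or> card Y = r Y + 1 \<and> r Y + 1 = r (cyc r E)" using B by auto
  note XD = cflatD(1)[OF X] and YD = cflatD(1)[OF Y]
  have "r X < r (X \<union> Y)" by (rule cflat_r_less[OF X]) (use n XD YD in auto)
  moreover have "r Y < r (X \<union> Y)" by (rule cflat_r_less[OF Y]) (use n XD YD in auto)
  moreover have "r (X \<union> Y) \<le> r (cyc r E)"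
    by (rule mono) (use cflat_sub_cyc[OF X subset_refl XD] cflat_sub_cyc[OF Y subset_refl YD] in auto)
  ultimately show "r (X \<union> Y) = r (cyc r E)" using B by auto
qed

lemma not_notchy3:
  assumes X: "cflat E r X" and Y: "cflat E r Y" and K: "cflat E r K"
    and n: "\<not> X \<subseteq> Y" "\<not> Y \<subseteq> X" "\<not> X \<subseteq> K" "\<not> K \<subseteq> X" "\<not> K \<subseteq> Y" "\<not> Y \<subseteq> K"
  shows "\<not> notchy E r"
proof
  assume "notchy E r"
  then obtain B where B: "\<forall>X Y. cflat E r X \<longrightarrow> cflat E r Y \<longrightarrow> \<not> X \<subseteq> Y \<longrightarrow> \<not> Y \<subseteq> X \<longrightarrow>
     (X = B \<or> Y = B) \<and> r B + 1 = r (cyc r E) \<and> card B = r B + card (loops E r) + 1 \<and>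
     (X \<inter> Y = loops E r \<or> X \<union> Y = cyc r E)"
    unfolding notchy_def by (rule exE)
  have "X = B \<or> Y = B" "X = B \<or> K = B" "Y = B \<or> K = B"
    using B[rule_format, OF X Y n(1,2)] B[rule_format, OF X K n(3,4)] B[rule_format, OF Y K n(6,5)] by blast+
  thus False using n by blast
qed

lemma mem_cyc: assumes "e \<in> E" "r E \<le> r (E - {e})" shows "e \<in> cyc r E"
  using assms mono[of "E - {e}" E] by (auto simp: cyc_def)

text \<open>By symmetry it is enough to remove elements of \<open>X\<close>. Deletion makes the
  bound on \<open>X\<close> automatic, or makes \<open>X - {e}\<close> a circuit-hyperplane;
  contraction makes the bound on \<open>Y\<close> follow from the total bound, or makes
  \<open>Y\<close> a circuit-hyperplane. In the matroid itself neither flat is one, so the condition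
  fails.\<close>

lemma FGH_exc:
  assumes P: "X \<inter> Y = {}" "X \<union> Y = E"
    and ind: "\<And>I. I \<subseteq> E \<Longrightarrow> r I = card I \<longleftrightarrow> cnt I X \<le> a \<and> cnt I Y \<le> b \<and> cnt I X + cnt I Y \<le> n"
    and tX: "card X = a + 2 \<and> a + 1 = n \<or> card X = a + 1 \<and> a + 2 = n"
    and tY: "card Y = b + 2 \<and> b + 1 = n \<or> card Y = b + 1 \<and> b + 2 = n"
    and ab: "1 \<le> a" "1 \<le> b" "n \<le> a + b"
  shows "exc E r"
proof -
  have main: "notchy (E - {e}) (dl e r) \<and> notchy (E - {e}) (ct e r) \<and> cflat E r X \<and> r X = a"
    if P: "X \<inter> Y = {}" "X \<union> Y = E" and e: "e \<in> X"
    and ind: "\<And>I. I \<subseteq> E \<Longrightarrow> r I = card I \<longleftrightarrow> cnt I X \<le> a \<and> cnt I Y \<le> b \<and> cnt I X + cnt I Y \<le> n"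
    and tX: "card X = a + 2 \<and> a + 1 = n \<or> card X = a + 1 \<and> a + 2 = n"
    and tY: "card Y = b + 2 \<and> b + 1 = n \<or> card Y = b + 1 \<and> b + 2 = n"
    and ab: "1 \<le> a" "1 \<le> b" "n \<le> a + b" for X Y a b e
  proof (intro conjI)
    have f: "finite X" "finite Y" using P fin by auto
    have eE: "e \<in> E" "e \<notin> Y" using e P by auto
    have tot: "cnt I E = cnt I X + cnt I Y" if "finite I" for I
      using card_Int_Un[OF that P(1)] P(2) by simp
    have YE: "Y \<subseteq> E - {e}" using P eE by auto
    have cX: "card (X - {e}) + 1 = card X" using e f by (metis Suc_eq_plus1 card_Suc_Diff1)
    have Xe: "X - {e} \<subset> E - {e}" "X - {e} \<noteq> {}" "Y \<noteq> {}" "Y \<subset> E - {e}"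
    proof -
      show 1: "X - {e} \<noteq> {}"
      proof
        assume "X - {e} = {}"
        hence "card (X - {e}) = 0" by (simp only: card.empty)
        hence "card X = 1" using cX by linarith
        thus False using tX ab by auto
      qed
      show 2: "Y \<noteq> {}" using tY by auto
      show "X - {e} \<subset> E - {e}" "Y \<subset> E - {e}" using 1 2 P eE by auto
    qed
    show "notchy (E - {e}) (dl e r)"
    proof (cases "card X = a + 1")
      case True
      show ?thesis
      proof (rule del_notchy)
        show "nested_pres (E - {e}) (\<lambda>I. cnt I Y \<le> b \<and> cnt I Y \<le> b \<and> cnt I (E - {e}) \<le> n) \<or> notch_pres (E - {e}) (\<lambda>I. cnt I Y \<le> b \<and> cnt I Y \<le> b \<and> cnt I (E - {e}) \<le> n)"
          by (rule disjI1, rule nested_intro) (use YE in auto)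
        show "r I = card I \<longleftrightarrow> cnt I Y \<le> b \<and> cnt I Y \<le> b \<and> cnt I (E - {e}) \<le> n"
          if "I \<subseteq> E" "e \<notin> I" "finite I" for I
          unfolding cnt_remove[OF that(2)] using ind[OF that(1)] tot[OF that(3)] cnt_less[OF f(1) e that(2)] True by auto
      qed
    next
      case False
      hence B: "card (X - {e}) = n" "a < n" "card (X - {e}) = a + 1" using tX cX by auto
      show ?thesis
      proof (rule del_notchy[OF disjI2[OF notch_intro2[of _ Y "E - {e}" "X - {e}" b]]])
        show "r I = card I \<longleftrightarrow> cnt I Y \<le> b \<and> cnt I (E - {e}) \<le> card (X - {e}) \<and> cnt I (X - {e}) < card (X - {e})"
          if "I \<subseteq> E" "e \<notin> I" "finite I" for I
          unfolding cnt_remove[OF that(2)] tot[OF that(3)] using ind[OF that(1)] B by auto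
      qed (use fin YE Xe P ab in auto)
    qed
    have re: "r {e} = 1" using ind[of "{e}"] e eE ab tX by auto
    show "notchy (E - {e}) (ct e r)"
    proof (cases "card Y = b + 2")
      case True
      hence b: "b + 1 = n" using tY by auto
      show ?thesis
      proof (rule con_notchy[OF eE(1) re disjI1[OF nested_intro[of "X - {e}" "X - {e}" "E - {e}" _ "a - 1" "a - 1" "n - 1"]]])
        show "r (insert e I) = card (insert e I) \<longleftrightarrow> cnt I (X - {e}) \<le> a - 1 \<and> cnt I (X - {e}) \<le> a - 1 \<and> cnt I (E - {e}) \<le> n - 1"
          if I: "I \<subseteq> E" "e \<notin> I" "finite I" "insert e I \<subseteq> E" for I
        unfolding cnt_remove[OF I(2)] tot[OF I(3)]
          using ind[OF I(4), unfolded cnt_insert[OF I(3,2)]] e eE ab b by auto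
      qed (use P in auto)
    next
      case False
      hence b: "b + 2 = n" "card Y = b + 1" using tY by auto
      show ?thesis
      proof (rule con_notchy[OF eE(1) re disjI2[OF notch_intro2[of _ "X - {e}" "E - {e}" Y "a - 1"]]])
        show "r (insert e I) = card (insert e I) \<longleftrightarrow> cnt I (X - {e}) \<le> a - 1 \<and> cnt I (E - {e}) \<le> card Y \<and> cnt I Y < card Y"
          if I: "I \<subseteq> E" "e \<notin> I" "finite I" "insert e I \<subseteq> E" for I
        unfolding cnt_remove[OF I(2)] tot[OF I(3)]
          using ind[OF I(4), unfolded cnt_insert[OF I(3,2)]] e eE ab b by auto
        show "(X - {e}) \<inter> Y = {} \<and> 0 < a - 1 \<or> E - {e} \<subseteq> X - {e} \<union> Y \<and> cnt Y (X - {e}) < a - 1" using P ab b by auto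
      qed (use fin Xe P in auto)
    qed
    have u: "cflat E r X \<and> r X = a"
    proof (rule cflat_uniform)
      show "X \<subseteq> E" "a < card X" using P tX by auto
      have IX: "I \<inter> X = I" "I \<inter> Y = {}" "I \<subseteq> E" if "I \<subseteq> X" for I using that P by auto
      show "r I = card I" if "I \<subseteq> X" "card I \<le> a" for I using ind[OF IX(3)[OF that(1)]] that(2) IX[OF that(1)] tX by auto
      show "card J \<le> a" if "J \<subseteq> X" "r J = card J" for J using ind[OF IX(3)[OF that(1)]] that(2) IX[OF that(1)] by auto
      show "r (insert g I) = a + 1" if g: "g \<in> E" "g \<notin> X" "I \<subseteq> X" "card I = a" for g I
      proof -
        have g': "g \<in> Y" "g \<notin> I" "finite I" "insert g I \<subseteq> E" using g P finite_subset[OF g(3) f(1)] by auto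
        have "r (insert g I) = card (insert g I)"
          using ind[OF g'(4), unfolded cnt_insert[OF g'(3,2)]] g'(1) IX[OF g(3)] g ab tX by auto
        thus ?thesis using g' g by simp
      qed
    qed
    show "cflat E r X" "r X = a" using u by auto
  qed
  have P': "Y \<inter> X = {}" "Y \<union> X = E" using P by auto
  have ind': "r I = card I \<longleftrightarrow> cnt I Y \<le> b \<and> cnt I X \<le> a \<and> cnt I Y + cnt I X \<le> n" if "I \<subseteq> E" for I
    using ind[OF that] by auto
  have ab': "n \<le> b + a" using ab by simp
  note mX = main[OF P _ ind tX tY ab] and mY = main[OF P' _ ind' tY tX ab(2,1) ab']
  have ne: "X \<noteq> {}" "Y \<noteq> {}" using tX tY by auto
  have cX: "cflat E r X" "r X = a" and cY: "cflat E r Y" "r Y = b" using ne mX mY by auto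
  show ?thesis
  proof (rule excI)
    show "\<not> notchy E r"
    proof
      assume "notchy E r"
      have l: "r {e} = 1" if "e \<in> E" for e
      proof -
        have "e \<in> X \<and> e \<notin> Y \<or> e \<notin> X \<and> e \<in> Y" "{e} \<subseteq> E" using that P by auto
        thus ?thesis using ind[OF \<open>{e} \<subseteq> E\<close>, unfolded cnt_single] ab tX by auto
      qed
      have n: "\<not> X \<subseteq> Y" "\<not> Y \<subseteq> X" using P ne by auto
      note d = notchyD[OF \<open>notchy E r\<close> cX(1) cY(1) n l]
      have "r E = r (cyc r E)" using d(2) P by simp
      moreover have "n \<le> r E"
      proof -
        obtain S where S: "S \<subseteq> X" "card S = a" "finite S" using card_subset_ex[of a X] tX by auto
        have "n - a \<le> card Y" using ab tY by auto
        then obtain S' where S': "S' \<subseteq> Y" "card S' = n - a" "finite S'" using card_subset_ex by blast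
        have "(S \<union> S') \<inter> X = S" "(S \<union> S') \<inter> Y = S'" "S \<union> S' \<subseteq> E" using S S' P by auto
        moreover have "card (S \<union> S') = card S + card S'" by (rule card_Un_disjoint) (use S S' P in auto)
        ultimately show ?thesis using ind[of "S \<union> S'"] S S' ab tX rank_ge[of "S \<union> S'" E] by auto
      qed
      ultimately show False using d(3) cX(2) cY(2) tX tY by auto
    qed
  qed (use mX mY P in blast)+
qed

end

lemma cnt_ins2: "finite I \<Longrightarrow> x \<notin> A \<Longrightarrow> card (I \<inter> insert x A) = cnt I {x} + cnt I A"
  using card_Int_Un[of I "{x}" A] by simp

lemma card_remove1: "finite A \<Longrightarrow> e \<in> A \<Longrightarrow> card (A - {e}) + 1 = card A"
  by (metis Suc_eq_plus1 card_Suc_Diff1)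

lemma card_le_2E:
  assumes "finite A" "card A \<le> 2"
  obtains "A = {}" | x where "A = {x}" | x y where "A = {x, y}" "x \<noteq> y"
proof -
  consider "card A = 0" | "card A = 1" | "card A = 2" using assms(2) by linarith
  thus thesis
    by cases (use assms(1) that in \<open>auto simp: card_1_singleton_iff card_2_iff\<close>)
qed

context rank_matroid
begin

lemma nested_uniform: "A \<subseteq> E' \<Longrightarrow> nested_pres E' (\<lambda>I. cnt I A \<le> k)"
  using nested_intro[of A A A E' k k k] by simp

lemma nested2: "A \<subseteq> B \<Longrightarrow> B \<subseteq> E' \<Longrightarrow> nested_pres E' (\<lambda>I. cnt I A \<le> j \<and> cnt I B \<le> k)"
  using nested_intro[of A B B E' j k k] by simp

text \<open>Wheel and whirl are treated together through their three-point lines. After a deletion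
  only the lines avoiding \<open>e\<close> matter, after a contraction only those through
  \<open>e\<close>; in either case at most two remain. Two remaining lines cover the deletion, and
  in the contraction they become disjoint parallel pairs, so a notch presentation exists.\<close>

lemma lines_exc:
  assumes E: "card E = 6" and L: "finite \<L>" "\<And>L. L \<in> \<L> \<Longrightarrow> L \<subseteq> E \<and> card L = 3"
    "\<And>L M. L \<in> \<L> \<Longrightarrow> M \<in> \<L> \<Longrightarrow> L \<noteq> M \<Longrightarrow> cnt L M = 1"
    and t: "{X, Y, K} \<subseteq> \<L>" "X \<noteq> Y" "X \<noteq> K" "Y \<noteq> K"
    and ind: "\<And>I. I \<subseteq> E \<Longrightarrow> r I = card I \<longleftrightarrow> (\<forall>L\<in>\<L>. cnt I L \<le> 2) \<and> card I \<le> 3"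
  shows "exc E r"
proof -
  have fL: "finite L" if "L \<in> \<L>" for L using L(2)[OF that] finite_sub by blast
  have un: "card (L \<union> M) = 5" if "L \<in> \<L>" "M \<in> \<L>" "L \<noteq> M" for L M
    using card_Un_Int[OF fL[OF that(1)] fL[OF that(2)]] L(2)[OF that(1)] L(2)[OF that(2)] L(3)[OF that] by simp
  have cE: "card (E - {e}) = 5" if "e \<in> E" for e using card_remove1[OF fin that] E by simp
  have cov: "L \<union> M = E - {e}" if "L \<in> \<L>" "M \<in> \<L>" "L \<noteq> M" "e \<in> E" "e \<notin> L" "e \<notin> M" for L M e
  proof (rule card_subset_eq)
    show "L \<union> M \<subseteq> E - {e}" using L(2)[OF that(1)] L(2)[OF that(2)] that by blast
  qed (use fin un[OF that(1-3)] cE[OF that(4)] in auto)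
  \<comment> \<open>Two lines avoiding \<open>e\<close> already cover the other five points, so a
    third would lie in their union although it shares only one point with each.\<close>
  have av2: "card {L \<in> \<L>. e \<notin> L} \<le> 2" if e: "e \<in> E" for e
  proof (rule ccontr)
    assume "\<not> card {L \<in> \<L>. e \<notin> L} \<le> 2"
    then obtain A where A: "A \<subseteq> {L \<in> \<L>. e \<notin> L}" "card A = 3" using card_subset_ex[of 3 "{L \<in> \<L>. e \<notin> L}"] by auto
    then obtain M N Q where "A = {M, N, Q}" "M \<noteq> N" "M \<noteq> Q" "N \<noteq> Q" by (auto simp: card_3_iff)
    hence MNQ: "M \<in> \<L>" "N \<in> \<L>" "Q \<in> \<L>" "e \<notin> M" "e \<notin> N" "e \<notin> Q" "M \<noteq> N" "M \<noteq> Q" "N \<noteq> Q" using A(1) by auto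
    have "Q \<subseteq> M \<union> N" using cov[OF MNQ(1,2,7) e MNQ(4,5)] L(2)[OF MNQ(3)] MNQ(6) by blast
    hence "Q = (Q \<inter> M) \<union> (Q \<inter> N)" by blast
    hence "card Q \<le> cnt Q M + cnt Q N" by (metis card_Un_le)
    thus False using L(2)[OF MNQ(3)] L(3)[OF MNQ(3,1)] L(3)[OF MNQ(3,2)] MNQ(8,9) by auto
  qed
  have dj: "(L - {e}) \<inter> (M - {e}) = {}" if "L \<in> \<L>" "M \<in> \<L>" "L \<noteq> M" "e \<in> L" "e \<in> M" for L M e
  proof -
    have "cnt L M = 1" by (rule L(3)[OF that(1-3)])
    then obtain x where x: "L \<inter> M = {x}" by (rule card_1_singletonE)
    have "e \<in> L \<inter> M" using that(4,5) by simp
    hence "L \<inter> M = {e}" unfolding x by simp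
    moreover have "(L - {e}) \<inter> (M - {e}) = (L \<inter> M) - {e}" by blast
    ultimately show ?thesis by simp
  qed
  \<comment> \<open>Three lines through \<open>e\<close> would need seven points.\<close>
  have th2: "card {L \<in> \<L>. e \<in> L} \<le> 2" if e: "e \<in> E" for e
  proof (rule ccontr)
    assume "\<not> card {L \<in> \<L>. e \<in> L} \<le> 2"
    then obtain A where A: "A \<subseteq> {L \<in> \<L>. e \<in> L}" "card A = 3" using card_subset_ex[of 3 "{L \<in> \<L>. e \<in> L}"] by auto
    then obtain M N Q where "A = {M, N, Q}" "M \<noteq> N" "M \<noteq> Q" "N \<noteq> Q" by (auto simp: card_3_iff)
    hence MNQ: "M \<in> \<L>" "N \<in> \<L>" "Q \<in> \<L>" "e \<in> M" "e \<in> N" "e \<in> Q" "M \<noteq> N" "M \<noteq> Q" "N \<noteq> Q" using A(1) by auto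
    have c: "card (Z - {e}) = 2" if "Z \<in> \<L>" "e \<in> Z" for Z using card_remove1[OF fL[OF that(1)] that(2)] L(2)[OF that(1)] by simp
    have d: "((M - {e}) \<union> (N - {e})) \<inter> (Q - {e}) = {}"
      using dj[OF MNQ(1,3,8,4,6)] dj[OF MNQ(2,3,9,5,6)] by blast
    have "card ((M - {e}) \<union> (N - {e}) \<union> (Q - {e})) = card ((M - {e}) \<union> (N - {e})) + card (Q - {e})"
      by (rule card_Un_disjoint[OF _ _ d]) (use fL MNQ in auto)
    also have "card ((M - {e}) \<union> (N - {e})) = card (M - {e}) + card (N - {e})"
      by (rule card_Un_disjoint[OF _ _ dj[OF MNQ(1,2,7,4,5)]]) (use fL MNQ in auto)
    finally have "card ((M - {e}) \<union> (N - {e}) \<union> (Q - {e})) = 6" using c MNQ by simp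
    moreover have "(M - {e}) \<union> (N - {e}) \<union> (Q - {e}) \<subseteq> E - {e}"
      using L(2)[OF MNQ(1)] L(2)[OF MNQ(2)] L(2)[OF MNQ(3)] by blast
    hence "card ((M - {e}) \<union> (N - {e}) \<union> (Q - {e})) \<le> card (E - {e})" by (rule card_mono[rotated]) (use fin in simp)
    ultimately show False using cE[OF e] by simp
  qed
  have re: "r {e} = 1" if e: "e \<in> E" for e
  proof -
    have "{e} \<subseteq> E" using e by simp
    thus ?thesis using ind[OF \<open>{e} \<subseteq> E\<close>, unfolded cnt_single] by simp
  qed
  have del: "notchy (E - {e}) (dl e r)" if e: "e \<in> E" for e
  proof -
    define A where "A = {L \<in> \<L>. e \<notin> L}"
    have P: "r I = card I \<longleftrightarrow> (\<forall>L\<in>A. cnt I L \<le> 2) \<and> cnt I (E - {e}) \<le> 3" if I: "I \<subseteq> E" "e \<notin> I" "finite I" for I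
    proof -
      have "cnt I L \<le> 2" if "L \<in> \<L>" "e \<in> L" for L using cnt_less[OF fL[OF that(1)] that(2) I(2)] L(2)[OF that(1)] by simp
      moreover have "I \<inter> (E - {e}) = I" using I by auto
      ultimately show ?thesis using ind[OF I(1)] unfolding A_def by auto
    qed
    have "finite A" "card A \<le> 2" using av2[OF e] L(1) by (simp_all add: A_def)
    thus ?thesis
    proof (cases rule: card_le_2E)
      case 1
      show ?thesis by (rule del_notchy[OF disjI1[OF nested_uniform[of "E - {e}" _ 3]]]) (use P 1 in auto)
    next
      case (2 M)
      have "M \<in> \<L>" "e \<notin> M" using 2 by (auto simp: A_def)
      hence sM: "M \<subseteq> E - {e}" using L(2)[of M] by blast
      show ?thesis
        by (rule del_notchy[OF disjI1[OF nested2[OF sM subset_refl, where j = 2 and k = 3]]]) (use P 2 in auto)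
    next
      case (3 M N)
      have MN: "M \<in> \<L>" "N \<in> \<L>" "e \<notin> M" "e \<notin> N" using 3 by (auto simp: A_def)
      note c = cov[OF MN(1,2) 3(2) e MN(3,4)]
      have c3: "card M = 3" "card N = 3" "cnt M N = 1" using L(2,3) MN 3(2) by auto
      show ?thesis
      proof (rule del_notchy[OF disjI2[OF notch_intro2[of _ N "E - {e}" M 2]]])
        have "M \<noteq> E - {e}"
        proof
          assume "M = E - {e}"
          hence "card M = card (E - {e})" by (simp only:)
          thus False using c3 cE[OF e] by simp
        qed
        moreover have "M \<subseteq> E - {e}" unfolding c[symmetric] by blast
        ultimately show "M \<subset> E - {e}" by blast
        show "M \<noteq> {}" using c3 by auto
        show "r I = card I \<longleftrightarrow> cnt I N \<le> 2 \<and> cnt I (E - {e}) \<le> card M \<and> cnt I M < card M"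
          if I: "I \<subseteq> E" "e \<notin> I" "finite I" for I using P[OF I] 3(1) c3 by auto

        show "N \<subseteq> E - {e}" unfolding c[symmetric] by blast
        show "N \<inter> M = {} \<and> (0::nat) < 2 \<or> E - {e} \<subseteq> N \<union> M \<and> cnt M N < 2"
          unfolding c[symmetric] using c3(3) by auto
      qed (use fin in simp_all)
    qed
  qed
  have con: "notchy (E - {e}) (ct e r)" if e: "e \<in> E" for e
  proof -
    define A where "A = {L \<in> \<L>. e \<in> L}"
    have P: "r (insert e I) = card (insert e I) \<longleftrightarrow> (\<forall>L\<in>A. cnt I (L - {e}) \<le> 1) \<and> cnt I (E - {e}) \<le> 2"
      if I: "I \<subseteq> E" "e \<notin> I" "finite I" for I
    proof -
      have i: "insert e I \<subseteq> E" "I \<inter> (E - {e}) = I" using I e by auto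
      define c where "c = (\<lambda>L. cnt I (L - {e}))"
      have q: "cnt (insert e I) L = c L + (if e \<in> L then 1 else 0)" for L
        unfolding c_def cnt_remove[OF I(2)] by (rule cnt_insert[OF I(3,2)])
      have cI: "c L \<le> card I" for L unfolding c_def by (rule card_mono[OF I(3)]) auto
      have cs: "card (insert e I) = card I + 1" using I by simp
      have "(\<forall>L\<in>\<L>. cnt (insert e I) L \<le> 2) \<and> card (insert e I) \<le> 3 \<longleftrightarrow> (\<forall>L\<in>A. c L \<le> 1) \<and> card I \<le> 2"
        unfolding q cs
      proof (intro iffI conjI ballI)
        fix L assume a: "(\<forall>L\<in>A. c L \<le> 1) \<and> card I \<le> 2" and L: "L \<in> \<L>"
        show "c L + (if e \<in> L then 1 else 0) \<le> 2" using a L cI[of L] by (auto simp: A_def)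
      qed (auto simp: A_def)
      hence "(\<forall>L\<in>\<L>. cnt (insert e I) L \<le> 2) \<and> card (insert e I) \<le> 3 \<longleftrightarrow>
        (\<forall>L\<in>A. cnt I (L - {e}) \<le> 1) \<and> card I \<le> 2" unfolding c_def .
      thus ?thesis using ind[OF i(1)] i(2) by simp
    qed
    have "finite A" "card A \<le> 2" using th2[OF e] L(1) by (simp_all add: A_def)
    thus ?thesis
    proof (cases rule: card_le_2E)
      case 1
      show ?thesis by (rule con_notchy[OF e re[OF e] disjI1[OF nested_uniform[of "E - {e}" _ 2]]]) (use P 1 in auto)
    next
      case (2 M)
      have "M \<in> \<L>" using 2 by (auto simp: A_def)
      hence sM: "M - {e} \<subseteq> E - {e}" using L(2)[of M] by blast
      show ?thesis
        by (rule con_notchy[OF e re[OF e] disjI1[OF nested2[OF sM subset_refl, where j = 1 and k = 2]]]) (use P 2 in auto)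
    next
      case (3 M N)
      have MN: "M \<in> \<L>" "N \<in> \<L>" "e \<in> M" "e \<in> N" using 3 by (auto simp: A_def)
      have c2: "card (M - {e}) = 2" using card_remove1[OF fL[OF MN(1)] MN(3)] L(2)[OF MN(1)] by simp
      show ?thesis
      proof (rule con_notchy[OF e re[OF e] disjI2[OF notch_intro2[of _ "N - {e}" "E - {e}" "M - {e}" 1]]])
        have "M - {e} \<subseteq> E - {e}" using L(2)[OF MN(1)] by blast
        moreover have "M - {e} \<noteq> E - {e}"
        proof
          assume "M - {e} = E - {e}"
          hence "card (M - {e}) = card (E - {e})" by (simp only:)
          thus False using c2 cE[OF e] by simp
        qed
        ultimately show "M - {e} \<subset> E - {e}" by blast
        show "M - {e} \<noteq> {}"
        proof
          assume "M - {e} = {}"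
          hence "card (M - {e}) = 0" by (simp only: card.empty)
          thus False using c2 by simp
        qed
        show "N - {e} \<subseteq> E - {e}" using L(2)[OF MN(2)] by blast
        show "(N - {e}) \<inter> (M - {e}) = {} \<and> (0::nat) < 1 \<or> E - {e} \<subseteq> N - {e} \<union> (M - {e}) \<and> card ((M - {e}) \<inter> (N - {e})) < 1"
          using dj[OF MN(1,2) 3(2) MN(3,4)] by blast
        show "r (insert e I) = card (insert e I) \<longleftrightarrow> cnt I (N - {e}) \<le> 1 \<and> cnt I (E - {e}) \<le> card (M - {e}) \<and> cnt I (M - {e}) < card (M - {e})"
          if I: "I \<subseteq> E" "e \<notin> I" "finite I" for I using P[OF I] 3(1) c2 by auto
      qed (use fin in auto)
    qed
  qed
  have cf: "cflat E r M" if M: "M \<in> \<L>" for M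
  proof -
    have MD: "M \<subseteq> E" "card M = 3" using L(2)[OF M] by auto
    have "cflat E r M \<and> r M = 2"
    proof (rule cflat_uniform[OF MD(1)])
      show "2 < card M" using MD by simp
      show "r I = card I" if I: "I \<subseteq> M" "card I \<le> 2" for I
      proof -
        have "I \<subseteq> E" using I MD by auto
        moreover have "cnt I N \<le> 2" for N using cnt_le[OF finite_sub[OF \<open>I \<subseteq> E\<close>], of N] I(2) by (simp add: Int_commute)
        ultimately show ?thesis using ind[of I] I(2) by simp
      qed
      show "card J \<le> 2" if J: "J \<subseteq> M" "r J = card J" for J
      proof -
        have "J \<subseteq> E" "J \<inter> M = J" using J MD by auto
        thus ?thesis using ind[of J] J(2) M by fastforce
      qed
      show "r (insert g I) = 2 + 1" if g: "g \<in> E" "g \<notin> M" "I \<subseteq> M" "card I = 2" for g I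
      proof -
        have fI: "finite I" and gI: "g \<notin> I" and sE: "insert g I \<subseteq> E" using g MD finite_subset[OF g(3) fL[OF M]] by auto
        have "cnt (insert g I) N \<le> 2" if N: "N \<in> \<L>" for N
        proof (cases "N = M")
          case True
          thus ?thesis using g cnt_insert[OF fI gI, of M] cnt_le[OF fI, of M] by (simp add: Int_commute)
        next
          case False
          have "cnt I N \<le> cnt M N" by (rule card_mono) (use g fL[OF M] in auto)
          thus ?thesis using cnt_insert[OF fI gI, of N] L(3)[OF M N] False by auto
        qed
        thus ?thesis using ind[OF sE] g fI gI by simp
      qed
    qed
    thus ?thesis by blast
  qed
  have inc: "\<not> M \<subseteq> N" if "M \<in> \<L>" "N \<in> \<L>" "M \<noteq> N" for M N
    using card_subset_eq[OF fL[OF that(2)], of M] L(2) that by auto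
  have m: "X \<in> \<L>" "Y \<in> \<L>" "K \<in> \<L>" using t(1) by auto
  show ?thesis
    by (rule excI[OF not_notchy3[OF cf[OF m(1)] cf[OF m(2)] cf[OF m(3)]]]) (use inc m t(2-4) del con in auto)
qed

text \<open>Deleting an element frees its block and leaves two circuits, one of them a
  circuit-hyperplane. Contracting an element of \<open>X\<close> makes \<open>X - {e}\<close> a
  circuit-hyperplane and the bound on \<open>Y\<close> a consequence of the total bound; contracting
  one of \<open>K\<close> makes the bounds on both \<open>X\<close> and \<open>Y\<close> redundant.
  The condition fails because \<open>X\<close>, \<open>Y\<close> and \<open>K\<close> form an
  antichain.\<close>

lemma B_exc:
  assumes P: "X \<inter> Y = {}" "(X \<union> Y) \<inter> K = {}" "X \<union> Y \<union> K = E"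
    and ind: "\<And>I. I \<subseteq> E \<Longrightarrow> r I = card I \<longleftrightarrow> cnt I X \<le> n - 1 \<and> cnt I Y \<le> n - 1 \<and> cnt I K \<le> k - 1 \<and>
       cnt I X + cnt I Y + cnt I K \<le> n"
    and c: "card X = n" "card Y = n" "card K = k" "2 \<le> k" "k \<le> n"
  shows "exc E r"
proof -
  have sub: "X \<subseteq> E" "Y \<subseteq> E" "K \<subseteq> E" using P by auto
  have f: "finite X" "finite Y" "finite K" using finite_sub sub by auto
  have ne: "X \<noteq> {}" "Y \<noteq> {}" "K \<noteq> {}" using c by auto
  have tot: "cnt I E = cnt I X + cnt I Y + cnt I K" if "finite I" for I
    using card_Int_Un[OF that P(2)] card_Int_Un[OF that P(1)] P(3) by simp
  have re: "r {e} = 1" if e: "e \<in> E" for e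
  proof -
    have "{e} \<subseteq> E" "e \<in> X \<and> e \<notin> Y \<and> e \<notin> K \<or> e \<notin> X \<and> e \<in> Y \<and> e \<notin> K \<or> e \<notin> X \<and> e \<notin> Y \<and> e \<in> K" using e P by auto
    thus ?thesis using ind[OF \<open>{e} \<subseteq> E\<close>, unfolded cnt_single] c by auto
  qed
  have main: "notchy (E - {e}) (dl e r) \<and> notchy (E - {e}) (ct e r) \<and> cflat E r X"
    if P: "X \<inter> Y = {}" "(X \<union> Y) \<inter> K = {}" "X \<union> Y \<union> K = E" and e: "e \<in> X"
    and ind: "\<And>I. I \<subseteq> E \<Longrightarrow> r I = card I \<longleftrightarrow> cnt I X \<le> n - 1 \<and> cnt I Y \<le> n - 1 \<and> cnt I K \<le> k - 1 \<and>
       cnt I X + cnt I Y + cnt I K \<le> n"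
    and c: "card X = n" "card Y = n" "finite X" "finite Y" for X Y e
  proof (intro conjI)
    have tot: "cnt I E = cnt I X + cnt I Y + cnt I K" if "finite I" for I
      using card_Int_Un[OF that P(2)] card_Int_Un[OF that P(1)] P(3) by simp
    have eE: "e \<in> E" "e \<notin> Y" "e \<notin> K" using e P by auto
    have cX: "card (X - {e}) + 1 = n" using card_remove1[OF c(3) e] c by simp
    show "notchy (E - {e}) (dl e r)"
    proof (rule del_notchy[OF disjI2[OF notch_intro2[of _ K "E - {e}" Y "k - 1"]]])
      show "r I = card I \<longleftrightarrow> cnt I K \<le> k - 1 \<and> cnt I (E - {e}) \<le> card Y \<and> cnt I Y < card Y"
        if I: "I \<subseteq> E" "e \<notin> I" "finite I" for I
        unfolding cnt_remove[OF I(2)] tot[OF I(3)] using ind[OF I(1)] cnt_less[OF c(3) e I(2)] c \<open>2 \<le> k\<close> \<open>k \<le> n\<close> by auto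
      show "Y \<noteq> {}" using c \<open>2 \<le> k\<close> \<open>k \<le> n\<close> by auto
      show "Y \<subset> E - {e}" using P eE \<open>K \<noteq> {}\<close> by blast
    qed (use fin P eE \<open>2 \<le> k\<close> in auto)
    show "notchy (E - {e}) (ct e r)"
    proof (rule con_notchy[OF eE(1) re[OF eE(1)] disjI2[OF notch_intro2[of _ K "E - {e}" "X - {e}" "k - 1"]]])
      show "r (insert e I) = card (insert e I) \<longleftrightarrow> cnt I K \<le> k - 1 \<and> cnt I (E - {e}) \<le> card (X - {e}) \<and> cnt I (X - {e}) < card (X - {e})"
        if I: "I \<subseteq> E" "e \<notin> I" "finite I" "insert e I \<subseteq> E" for I
      unfolding cnt_remove[OF I(2)] tot[OF I(3)]
        using ind[OF I(4), unfolded cnt_insert[OF I(3,2)]] e eE cX by auto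
      show "X - {e} \<noteq> {}"
      proof
        assume "X - {e} = {}"
        hence "card (X - {e}) = 0" by (simp only: card.empty)
        thus False using cX \<open>2 \<le> k\<close> \<open>k \<le> n\<close> by linarith
      qed
      show "X - {e} \<subset> E - {e}" using P eE \<open>K \<noteq> {}\<close> by blast
    qed (use fin P eE \<open>2 \<le> k\<close> in auto)
    have "cflat E r X \<and> r X = n - 1"
    proof (rule cflat_uniform)
      show "X \<subseteq> E" "n - 1 < card X" using P c \<open>2 \<le> k\<close> \<open>k \<le> n\<close> by auto
      have IX: "I \<inter> X = I" "I \<inter> Y = {}" "I \<inter> K = {}" "I \<subseteq> E" if "I \<subseteq> X" for I using that P by auto
      show "r I = card I" if "I \<subseteq> X" "card I \<le> n - 1" for I using ind[OF IX(4)[OF that(1)]] that(2) IX[OF that(1)] by auto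
      show "card J \<le> n - 1" if "J \<subseteq> X" "r J = card J" for J using ind[OF IX(4)[OF that(1)]] that(2) IX[OF that(1)] by auto
      show "r (insert g I) = n - 1 + 1" if g: "g \<in> E" "g \<notin> X" "I \<subseteq> X" "card I = n - 1" for g I
      proof -
        have g': "g \<in> Y \<and> g \<notin> K \<or> g \<notin> Y \<and> g \<in> K" "g \<notin> I" "finite I" "insert g I \<subseteq> E" using g P finite_subset[OF g(3) c(3)] by auto
        have "r (insert g I) = card (insert g I)"
          using ind[OF g'(4), unfolded cnt_insert[OF g'(3,2)]] g'(1) IX[OF g(3)] g \<open>2 \<le> k\<close> \<open>k \<le> n\<close> by auto
        thus ?thesis using g' g by simp
      qed
    qed
    thus "cflat E r X" by blast
  qed
  have P': "Y \<inter> X = {}" "(Y \<union> X) \<inter> K = {}" "Y \<union> X \<union> K = E" using P by auto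
  have ind': "r I = card I \<longleftrightarrow> cnt I Y \<le> n - 1 \<and> cnt I X \<le> n - 1 \<and> cnt I K \<le> k - 1 \<and>
       cnt I Y + cnt I X + cnt I K \<le> n" if "I \<subseteq> E" for I using ind[OF that] by auto
  note mX = main[OF P _ ind c(1,2) f(1,2)] and mY = main[OF P' _ ind' c(2,1) f(2,1)]
  have mK: "notchy (E - {e}) (dl e r) \<and> notchy (E - {e}) (ct e r)" if e: "e \<in> K" for e
  proof
    have eE: "e \<in> E" "e \<notin> X" "e \<notin> Y" using e P by auto
    show "notchy (E - {e}) (dl e r)"
    proof (rule del_notchy[OF disjI2[OF notch_intro2[of _ Y "E - {e}" X "n - 1"]]])
      show "r I = card I \<longleftrightarrow> cnt I Y \<le> n - 1 \<and> cnt I (E - {e}) \<le> card X \<and> cnt I X < card X"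
        if I: "I \<subseteq> E" "e \<notin> I" "finite I" for I
        unfolding cnt_remove[OF I(2)] tot[OF I(3)] using ind[OF I(1)] cnt_less[OF f(3) e I(2)] c by auto
      show "X \<subset> E - {e}" using P eE ne by blast
    qed (use fin P eE ne c in auto)
    show "notchy (E - {e}) (ct e r)"
    proof (rule con_notchy[OF eE(1) re[OF eE(1)] disjI1[OF nested2[of "K - {e}" "E - {e}" _ "k - 2" "n - 1"]]])
      show "r (insert e I) = card (insert e I) \<longleftrightarrow> cnt I (K - {e}) \<le> k - 2 \<and> cnt I (E - {e}) \<le> n - 1"
        if I: "I \<subseteq> E" "e \<notin> I" "finite I" "insert e I \<subseteq> E" for I
      unfolding cnt_remove[OF I(2)] tot[OF I(3)]
        using ind[OF I(4), unfolded cnt_insert[OF I(3,2)]] e eE c by auto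
    qed (use sub in auto)
  qed
  have "cflat E r K \<and> r K = k - 1"
  proof (rule cflat_uniform)
    show "K \<subseteq> E" "k - 1 < card K" using sub c by auto
    have IX: "I \<inter> X = {}" "I \<inter> Y = {}" "I \<inter> K = I" "I \<subseteq> E" if "I \<subseteq> K" for I using that P by auto
    show "r I = card I" if "I \<subseteq> K" "card I \<le> k - 1" for I using ind[OF IX(4)[OF that(1)]] that(2) IX[OF that(1)] c by auto
    show "card J \<le> k - 1" if "J \<subseteq> K" "r J = card J" for J using ind[OF IX(4)[OF that(1)]] that(2) IX[OF that(1)] by auto
    show "r (insert g I) = k - 1 + 1" if g: "g \<in> E" "g \<notin> K" "I \<subseteq> K" "card I = k - 1" for g I
    proof -
      have g': "g \<in> X \<and> g \<notin> Y \<or> g \<notin> X \<and> g \<in> Y" "g \<notin> I" "finite I" "insert g I \<subseteq> E" using g P finite_subset[OF g(3) f(3)] by auto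
      have "r (insert g I) = card (insert g I)"
        using ind[OF g'(4), unfolded cnt_insert[OF g'(3,2)]] g'(1) IX[OF g(3)] g c by auto
      thus ?thesis using g' g by simp
    qed
  qed
  moreover have "cflat E r X" "cflat E r Y" using mX mY ne by auto
  ultimately have "\<not> notchy E r" using not_notchy3[of X Y K] P ne by blast
  thus ?thesis
  proof (rule excI)
    fix e assume "e \<in> E"
    thus "notchy (E - {e}) (dl e r)" "notchy (E - {e}) (ct e r)" using P(3) mX mY mK by blast+
  qed
qed

end

lemma counts_ex:
  assumes "X \<inter> Y = {}" "(X \<union> Y) \<inter> K = {}" "a \<le> card X" "b \<le> card Y" "c \<le> card K"
  shows "\<exists>I\<subseteq>X \<union> Y \<union> K. finite I \<and> card I = a + b + c \<and> cnt I X = a \<and> cnt I Y = b \<and> cnt I K = c"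
proof -
  obtain S where S: "S \<subseteq> X" "card S = a" "finite S" using card_subset_ex[OF assms(3)] by blast
  obtain T where T: "T \<subseteq> Y" "card T = b" "finite T" using card_subset_ex[OF assms(4)] by blast
  obtain U where U: "U \<subseteq> K" "card U = c" "finite U" using card_subset_ex[OF assms(5)] by blast
  have "(S \<union> T \<union> U) \<inter> X = S" "(S \<union> T \<union> U) \<inter> Y = T" "(S \<union> T \<union> U) \<inter> K = U" "S \<inter> T = {}" "(S \<union> T) \<inter> U = {}"
    using S T U assms(1,2) by blast+
  moreover have "card (S \<union> T \<union> U) = a + b + c"
    using calculation(4,5) S T U by (simp add: card_Un_disjoint)
  ultimately show ?thesis using S T U by (intro exI[of _ "S \<union> T \<union> U"]) auto
qed

context rank_matroid
begin

lemma cflat_parallel: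
  assumes "X \<subseteq> E" "card X = 2" "\<And>x. x \<in> X \<Longrightarrow> r {x} = 1" "r X \<noteq> 2"
    and o: "\<And>f x. f \<in> E \<Longrightarrow> f \<notin> X \<Longrightarrow> x \<in> X \<Longrightarrow> r {f, x} = 2"
  shows "cflat E r X \<and> r X = 1"
proof (rule cflat_uniform[OF assms(1)])
  have fX: "finite X" by (rule finite_sub[OF assms(1)])
  show "1 < card X" using assms by simp
  show "r I = card I" if I: "I \<subseteq> X" "card I \<le> 1" for I
  proof -
    consider "I = {}" | x where "I = {x}"
      using I(2) finite_subset[OF I(1) fX] by (cases "card I") (auto simp: card_1_singleton_iff)
    thus ?thesis by cases (use I assms rank_le[of "{}" 0] in auto)
  qed
  show "card J \<le> 1" if J: "J \<subseteq> X" "r J = card J" for J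
    using card_subset_eq[OF fX J(1)] card_mono[OF fX J(1)] assms J by fastforce
  show "r (insert f I) = 1 + 1" if "f \<in> E" "f \<notin> X" "I \<subseteq> X" "card I = 1" for f I
    using that o by (auto simp: card_1_singleton_iff)
qed

text \<open>The condition would force \<open>X \<union> Y\<close> to span, as there are no coloops,
  but its rank is \<open>n - 1\<close>. Removing an element of \<open>X\<close> or \<open>Y\<close>
  leaves a chain. Deleting an element of \<open>K\<close> turns the other one into a coloop, so
  \<open>X \<union> Y\<close> becomes the top; contracting it makes \<open>X \<union> Y\<close>
  spanning.\<close>

lemma D_exc:
  assumes P: "X \<inter> Y = {}" "(X \<union> Y) \<inter> K = {}" "X \<union> Y \<union> K = E"
    and ind: "\<And>I. I \<subseteq> E \<Longrightarrow> r I = card I \<longleftrightarrow> cnt I X \<le> n - 2 \<and> cnt I Y \<le> n - 2 \<and>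
       cnt I X + cnt I Y \<le> n - 1 \<and> cnt I X + cnt I Y + cnt I K \<le> n"
    and c: "card X = n - 1" "card Y = n - 1" "card K = 2" "3 \<le> n"
  shows "exc E r"
proof -
  have sub: "X \<subseteq> E" "Y \<subseteq> E" "K \<subseteq> E" using P by auto
  have f: "finite X" "finite Y" "finite K" using finite_sub sub by auto
  have ne: "X \<noteq> {}" "Y \<noteq> {}" "K \<noteq> {}" using c by auto
  have cE: "cnt I E = cnt I X + cnt I Y + cnt I K" if "finite I" for I
    using card_Int_Un[OF that P(2)] card_Int_Un[OF that P(1)] P(3) by simp
  have re: "r {e} = 1" if e: "e \<in> E" for e
  proof -
    have "{e} \<subseteq> E" "e \<in> X \<and> e \<notin> Y \<and> e \<notin> K \<or> e \<notin> X \<and> e \<in> Y \<and> e \<notin> K \<or> e \<notin> X \<and> e \<notin> Y \<and> e \<in> K" using e P by auto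
    thus ?thesis using ind[OF \<open>{e} \<subseteq> E\<close>, unfolded cnt_single] c by auto
  qed
  have main: "notchy (E - {e}) (dl e r) \<and> notchy (E - {e}) (ct e r) \<and> cflat E r X"
    if P: "X \<inter> Y = {}" "(X \<union> Y) \<inter> K = {}" "X \<union> Y \<union> K = E" and e: "e \<in> X"
    and ind: "\<And>I. I \<subseteq> E \<Longrightarrow> r I = card I \<longleftrightarrow> cnt I X \<le> n - 2 \<and> cnt I Y \<le> n - 2 \<and>
       cnt I X + cnt I Y \<le> n - 1 \<and> cnt I X + cnt I Y + cnt I K \<le> n"
    and c: "card X = n - 1" "card Y = n - 1" "finite X" "finite Y" for X Y e
  proof (intro conjI)
    have tot: "cnt I E = cnt I X + cnt I Y + cnt I K" "cnt I (X \<union> Y) = cnt I X + cnt I Y" if "finite I" for I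
      using card_Int_Un[OF that P(2)] card_Int_Un[OF that P(1)] P(3) by simp_all
    have eE: "e \<in> E" "e \<notin> Y" "e \<notin> K" using e P by auto
    show "notchy (E - {e}) (dl e r)"
    proof (rule del_notchy[OF disjI1[OF nested_intro[of Y "(X \<union> Y) - {e}" "E - {e}" _ "n - 2" "n - 1" n]]])
      show "r I = card I \<longleftrightarrow> cnt I Y \<le> n - 2 \<and> cnt I (X \<union> Y - {e}) \<le> n - 1 \<and> cnt I (E - {e}) \<le> n"
        if I: "I \<subseteq> E" "e \<notin> I" "finite I" for I
        unfolding cnt_remove[OF I(2)] tot[OF I(3)] using ind[OF I(1)] cnt_less[OF c(3) e I(2)] c by auto
    qed (use P eE in auto)
    show "notchy (E - {e}) (ct e r)"
    proof (rule con_notchy[OF eE(1) re[OF eE(1)] disjI1[OF nested_intro[of "X - {e}" "(X \<union> Y) - {e}" "E - {e}" _ "n - 3" "n - 2" "n - 1"]]])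
      show "r (insert e I) = card (insert e I) \<longleftrightarrow> cnt I (X - {e}) \<le> n - 3 \<and> cnt I (X \<union> Y - {e}) \<le> n - 2 \<and> cnt I (E - {e}) \<le> n - 1"
        if I: "I \<subseteq> E" "e \<notin> I" "finite I" "insert e I \<subseteq> E" for I
      unfolding cnt_remove[OF I(2)] tot[OF I(3)]
        using ind[OF I(4), unfolded cnt_insert[OF I(3,2)]] e eE \<open>3 \<le> n\<close> by auto
    qed (use P in auto)
    have "cflat E r X \<and> r X = n - 2"
    proof (rule cflat_uniform)
      show "X \<subseteq> E" "n - 2 < card X" using P c \<open>3 \<le> n\<close> by auto
      have IX: "I \<inter> X = I" "I \<inter> Y = {}" "I \<inter> K = {}" "I \<subseteq> E" if "I \<subseteq> X" for I using that P by auto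
      show "r I = card I" if "I \<subseteq> X" "card I \<le> n - 2" for I using ind[OF IX(4)[OF that(1)]] that(2) IX[OF that(1)] by auto
      show "card J \<le> n - 2" if "J \<subseteq> X" "r J = card J" for J using ind[OF IX(4)[OF that(1)]] that(2) IX[OF that(1)] by auto
      show "r (insert g I) = n - 2 + 1" if g: "g \<in> E" "g \<notin> X" "I \<subseteq> X" "card I = n - 2" for g I
      proof -
        have g': "g \<in> Y \<and> g \<notin> K \<or> g \<notin> Y \<and> g \<in> K" "g \<notin> I" "finite I" "insert g I \<subseteq> E" using g P finite_subset[OF g(3) c(3)] by auto
        have "r (insert g I) = card (insert g I)"
          using ind[OF g'(4), unfolded cnt_insert[OF g'(3,2)]] g'(1) IX[OF g(3)] g \<open>3 \<le> n\<close> by auto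
        thus ?thesis using g' g by simp
      qed
    qed
    thus "cflat E r X" by blast
  qed
  have P': "Y \<inter> X = {}" "(Y \<union> X) \<inter> K = {}" "Y \<union> X \<union> K = E" using P by auto
  have ind': "r I = card I \<longleftrightarrow> cnt I Y \<le> n - 2 \<and> cnt I X \<le> n - 2 \<and>
       cnt I Y + cnt I X \<le> n - 1 \<and> cnt I Y + cnt I X + cnt I K \<le> n" if "I \<subseteq> E" for I using ind[OF that] by auto
  note mX = main[OF P _ ind c(1,2) f(1,2)] and mY = main[OF P' _ ind' c(2,1) f(2,1)]
  have mK: "notchy (E - {e}) (dl e r) \<and> notchy (E - {e}) (ct e r)" if e: "e \<in> K" for e
  proof
    have tot: "cnt I (X \<union> Y) = cnt I X + cnt I Y" if "finite I" for I
      using card_Int_Un[OF that P(1)] .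
    have eE: "e \<in> E" "e \<notin> X" "e \<notin> Y" using e P by auto
    show "notchy (E - {e}) (dl e r)"
    proof (rule del_notchy[OF disjI2[OF notch_intro2[of _ Y "X \<union> Y" X "n - 2"]]])
      show "r I = card I \<longleftrightarrow> cnt I Y \<le> n - 2 \<and> cnt I (X \<union> Y) \<le> card X \<and> cnt I X < card X"
        if I: "I \<subseteq> E" "e \<notin> I" "finite I" for I
        unfolding tot[OF I(3)] using ind[OF I(1)] cnt_less[OF f(3) e I(2)] c by auto
      show "X \<subset> X \<union> Y" using P ne by blast
    qed (use fin P eE ne c in auto)
    show "notchy (E - {e}) (ct e r)"
    proof (rule con_notchy[OF eE(1) re[OF eE(1)] disjI2[OF notch_intro2[of _ Y "E - {e}" X "n - 2"]]])
      show "r (insert e I) = card (insert e I) \<longleftrightarrow> cnt I Y \<le> n - 2 \<and> cnt I (E - {e}) \<le> card X \<and> cnt I X < card X"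
        if I: "I \<subseteq> E" "e \<notin> I" "finite I" "insert e I \<subseteq> E" for I
      unfolding cnt_remove[OF I(2)] cE[OF I(3)]
        using ind[OF I(4), unfolded cnt_insert[OF I(3,2)]] e eE c by auto
      show "X \<subset> E - {e}" using P eE ne by blast
    qed (use fin P eE ne c in auto)
  qed
  have cf: "cflat E r X" "cflat E r Y" using mX mY ne by auto
  have rE: "r E \<le> n"
  proof (rule rank_le)
    show "card J \<le> n" if "J \<subseteq> E" "r J = card J" for J
      using ind[OF that(1)] that(2) cE[OF finite_sub[OF that(1)]] that(1) by (simp add: Int_absorb2)
  qed simp
  have Kc: "e \<in> cyc r E" if e: "e \<in> K" for e
  proof (rule mem_cyc)
    show "e \<in> E" using e P by auto
    have le: "n - 2 \<le> card X" "1 \<le> card Y" "1 \<le> card (K - {e})" using card_remove1[OF f(3) e] c by simp_all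
    have "(X \<union> Y) \<inter> (K - {e}) = {}" using P by auto
    note ex = counts_ex[OF P(1) this le]
    obtain I where I: "I \<subseteq> X \<union> Y \<union> (K - {e})" "finite I" "card I = n - 2 + 1 + 1"
      "cnt I X = n - 2" "cnt I Y = 1" "cnt I (K - {e}) = 1"
      using ex by blast
    have "I \<subseteq> E - {e}" "I \<subseteq> E" "e \<notin> I" using I(1) P e by auto
    moreover have "cnt I K = 1" using I(6) cnt_remove[OF \<open>e \<notin> I\<close>] by simp
    ultimately have "r I = card I" using ind[of I] I c(4) by auto
    from rank_ge[OF this \<open>I \<subseteq> E - {e}\<close>] show "r E \<le> r (E - {e})" using rE I(3) c(4) by simp
  qed
  have "E \<subseteq> cyc r E" using Kc cflat_sub_cyc[OF cf(1) subset_refl sub(1)] cflat_sub_cyc[OF cf(2) subset_refl sub(2)] P(3) by blast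
  hence cyc: "cyc r E = E" by (auto simp: cyc_def)
  have "\<not> notchy E r"
  proof
    assume "notchy E r"
    have n: "\<not> X \<subseteq> Y" "\<not> Y \<subseteq> X" using P ne by auto
    have "r (X \<union> Y) = r E" using notchyD(2)[OF \<open>notchy E r\<close> cf n re] cyc by simp
    moreover have "r (X \<union> Y) \<le> n - 1"
    proof (rule rank_le)
      show "X \<union> Y \<subseteq> E" using P by auto
      show "card J \<le> n - 1" if J: "J \<subseteq> X \<union> Y" "r J = card J" for J
      proof -
        have J1: "J \<subseteq> E" using J P by auto
        note J' = J1 finite_sub[OF J1]
        have "J \<inter> (X \<union> Y) = J" using J by auto
        thus ?thesis using ind[OF J'(1)] J(2) card_Int_Un[OF J'(2) P(1)] by simp
      qed
    qed
    moreover have "n \<le> r E"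
    proof -
      have le: "n - 2 \<le> card X" "1 \<le> card Y" "1 \<le> card K" using c by simp_all
      obtain I where I: "I \<subseteq> X \<union> Y \<union> K" "card I = n - 2 + 1 + 1"
        "cnt I X = n - 2" "cnt I Y = 1" "cnt I K = 1"
        using counts_ex[OF P(1,2) le] by blast
      have IE: "I \<subseteq> E" using I(1) P(3) by blast
      have "r I = card I" using ind[OF IE] I c(4) by auto
      from rank_ge[OF this IE] show ?thesis using I(2) c(4) by simp
    qed
    ultimately show False using c by simp
  qed
  thus ?thesis
  proof (rule excI)
    fix e assume "e \<in> E"
    thus "notchy (E - {e}) (dl e r)" "notchy (E - {e}) (ct e r)" using P(3) mX mY mK by blast+
  qed
qed

text \<open>The three parallel pairs form an antichain. Contracting an element turns its partner
  into a loop, and this is the reason for the bound 0 and the second member of the chain in the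
  notch presentation.\<close>

lemma sum_exc:
  assumes P: "X \<inter> Y = {}" "(X \<union> Y) \<inter> K = {}" "X \<union> Y \<union> K = E"
    and ind: "\<And>I. I \<subseteq> E \<Longrightarrow> r I = card I \<longleftrightarrow> cnt I X \<le> 1 \<and> cnt I Y \<le> 1 \<and> cnt I K \<le> 1"
    and c: "card X = 2" "card Y = 2" "card K = 2"
  shows "exc E r"
proof -
  have ne: "X \<noteq> {}" "Y \<noteq> {}" "K \<noteq> {}" using c by auto
  have main: "notchy (E - {e}) (dl e r) \<and> notchy (E - {e}) (ct e r) \<and> cflat E r X"
    if P: "X \<inter> Y = {}" "X \<inter> K = {}" "Y \<inter> K = {}" "X \<union> Y \<union> K = E" and e: "e \<in> X"
    and ind: "\<And>I. I \<subseteq> E \<Longrightarrow> r I = card I \<longleftrightarrow> cnt I X \<le> 1 \<and> cnt I Y \<le> 1 \<and> cnt I K \<le> 1"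
    and c: "card X = 2" "card Y = 2" "card K = 2" for X Y K e
  proof (intro conjI)
    have ne: "X \<noteq> {}" "Y \<noteq> {}" "K \<noteq> {}" using c by auto
    have f: "finite X" "finite Y" "finite K" using P(4) fin by auto
    have tot: "cnt I E = cnt I X + cnt I Y + cnt I K"
      "cnt I (Y \<union> K) = cnt I Y + cnt I K" "cnt I (X \<union> K) = cnt I X + cnt I K" if "finite I" for I
      using card_Int_Un[OF that, of "X \<union> Y" K] card_Int_Un[OF that, of X Y] card_Int_Un[OF that, of Y K] card_Int_Un[OF that, of X K] P
      by (simp_all add: Int_Un_distrib2)
    have eE: "e \<in> E" "e \<notin> Y" "e \<notin> K" using e P by auto
    have re: "r {g} = 1" if g: "g \<in> E" for g
    proof -
      have "{g} \<subseteq> E" using g by auto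
      thus ?thesis using ind[OF \<open>{g} \<subseteq> E\<close>, unfolded cnt_single] by auto
    qed
    show "notchy (E - {e}) (dl e r)"
    proof (rule del_notchy[OF disjI2[OF notch_intro2[of _ K "Y \<union> K" Y 1]]])
      show "r I = card I \<longleftrightarrow> cnt I K \<le> 1 \<and> cnt I (Y \<union> K) \<le> card Y \<and> cnt I Y < card Y"
        if I: "I \<subseteq> E" "e \<notin> I" "finite I" for I
        unfolding tot[OF I(3)] using ind[OF I(1)] cnt_less[OF f(1) e I(2)] c by auto
      show "Y \<subset> Y \<union> K" using P ne by blast
    qed (use fin P eE ne in auto)
    show "notchy (E - {e}) (ct e r)"
    proof (rule con_notchy[OF eE(1) re[OF eE(1)] disjI2[OF notch_intro[of _ "X - {e}" "X \<union> K - {e}" "E - {e}" Y 0 1]]])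
      show "r (insert e I) = card (insert e I) \<longleftrightarrow> cnt I (X - {e}) \<le> 0 \<and> cnt I (X \<union> K - {e}) \<le> 1 \<and>
          cnt I (E - {e}) \<le> card Y \<and> cnt I Y < card Y"
        if I: "I \<subseteq> E" "e \<notin> I" "finite I" "insert e I \<subseteq> E" for I
      unfolding cnt_remove[OF I(2)] tot[OF I(3)]
        using ind[OF I(4), unfolded cnt_insert[OF I(3,2)]] e eE c by auto
      show "Y \<subset> E - {e}" using P eE ne by blast
      have "\<not> E - {e} \<subseteq> X - {e} \<union> Y" using P eE ne by blast
      thus "(X - {e}) \<inter> Y = {} \<and> (0 < (0::nat) \<or> \<not> E - {e} \<subseteq> X - {e} \<union> Y) \<or> E - {e} \<subseteq> X - {e} \<union> Y \<and> cnt Y (X - {e}) < 0"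
        using P by auto
      show "(X \<union> K - {e}) \<inter> Y = {} \<and> (0 < (1::nat) \<or> \<not> E - {e} \<subseteq> X \<union> K - {e} \<union> Y) \<or> E - {e} \<subseteq> X \<union> K - {e} \<union> Y \<and> cnt Y (X \<union> K - {e}) < 1"
        using P by auto
    qed (use fin P ne in auto)
    have "cflat E r X \<and> r X = 1"
    proof (rule cflat_parallel)
      have XE: "X \<subseteq> E" using P by auto
      show "r {x} = 1" if "x \<in> X" for x using XE re that by auto
      show "X \<subseteq> E" "card X = 2" using XE c by auto
      show "r X \<noteq> 2" using ind[OF XE] c by auto
      show "r {g, x} = 2" if g: "g \<in> E" "g \<notin> X" "x \<in> X" for g x
      proof -
        have g': "x \<notin> Y" "x \<notin> K" "g \<notin> {x}" "{g, x} \<subseteq> E" "g \<notin> Y \<or> g \<notin> K" using g P by auto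
        thus ?thesis using ind[OF g'(4), unfolded cnt_insert[OF _ g'(3), simplified] cnt_single] g by auto
      qed
    qed
    thus "cflat E r X" by blast
  qed
  have p: "X \<inter> K = {}" "Y \<inter> K = {}" "Y \<inter> X = {}" "K \<inter> X = {}" "K \<inter> Y = {}" "Y \<union> X \<union> K = E" "K \<union> X \<union> Y = E" using P by auto
  have i: "r I = card I \<longleftrightarrow> cnt I Y \<le> 1 \<and> cnt I X \<le> 1 \<and> cnt I K \<le> 1"
    "r I = card I \<longleftrightarrow> cnt I K \<le> 1 \<and> cnt I X \<le> 1 \<and> cnt I Y \<le> 1" if "I \<subseteq> E" for I using ind[OF that] by auto
  note mX = main[OF P(1) p(1,2) P(3) _ ind c] and mY = main[OF p(3,2,1,6) _ i(1) c(2,1,3)] and mK = main[OF p(4,5) P(1) p(7) _ i(2) c(3,1,2)]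
  have "cflat E r X" "cflat E r Y" "cflat E r K" using mX mY mK ne by auto
  hence "\<not> notchy E r" using not_notchy3[of X Y K] P(1) p(1-5) ne by blast
  thus ?thesis
  proof (rule excI)
    fix e assume "e \<in> E"
    thus "notchy (E - {e}) (dl e r)" "notchy (E - {e}) (ct e r)" using P(3) mX mY mK by blast+
  qed
qed

text \<open>The two parallel pairs are cyclic flats whose union has rank 2, while the matroid has
  rank 3 and no coloops.\<close>

lemma trunc_sum_exc:
  assumes P: "X \<inter> Y = {}" "X \<inter> K = {}" "Y \<inter> K = {}" "X \<union> Y \<union> K = E"
    and ind: "\<And>I. I \<subseteq> E \<Longrightarrow> r I = card I \<longleftrightarrow> cnt I X \<le> 1 \<and> cnt I Y \<le> 1 \<and> cnt I X + cnt I K \<le> 2"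
    and c: "card X = 2" "card Y = 2" "card K = 2"
  shows "exc E r"
proof -
  have ne: "X \<noteq> {}" "Y \<noteq> {}" "K \<noteq> {}" using c by auto
  have f: "finite X" "finite Y" "finite K" using P(4) fin by auto
  have tot: "cnt I E = cnt I X + cnt I Y + cnt I K"
    "cnt I (X \<union> Y) = cnt I X + cnt I Y" "cnt I (Y \<union> X) = cnt I X + cnt I Y"
    "cnt I (X \<union> K) = cnt I X + cnt I K" if "finite I" for I
    using card_Int_Un[OF that, of "X \<union> Y" K] card_Int_Un[OF that, of X Y] card_Int_Un[OF that, of X K] P
    by (simp_all add: Int_Un_distrib2 Un_commute)
  have re: "r {g} = 1" if g: "g \<in> E" for g
  proof -
    have "{g} \<subseteq> E" "g \<notin> X \<or> g \<notin> K" using g P by auto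
    thus ?thesis using ind[OF \<open>{g} \<subseteq> E\<close>, unfolded cnt_single] by auto
  qed
  have sub: "X \<subseteq> E" "Y \<subseteq> E" "K \<subseteq> E" using P by auto
  have X: "notchy (E - {e}) (dl e r) \<and> notchy (E - {e}) (ct e r)" if e: "e \<in> X" for e
  proof
    have eE: "e \<in> E" "e \<notin> Y" "e \<notin> K" using e P by auto
    have B: "card (X \<union> K - {e}) = 3"
      using card_remove1[of "X \<union> K" e] card_Un_disjoint[OF f(1,3) P(2)] f e c by simp
    show "notchy (E - {e}) (dl e r)"
    proof (rule del_notchy[OF disjI2[OF notch_intro2[of _ Y "E - {e}" "X \<union> K - {e}" 1]]])
      show "r I = card I \<longleftrightarrow> cnt I Y \<le> 1 \<and> cnt I (E - {e}) \<le> card (X \<union> K - {e}) \<and> cnt I (X \<union> K - {e}) < card (X \<union> K - {e})"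
        if I: "I \<subseteq> E" "e \<notin> I" "finite I" for I
        unfolding cnt_remove[OF I(2)] tot[OF I(3)] B using ind[OF I(1)] cnt_less[OF f(1) e I(2)] c by auto
      show "X \<union> K - {e} \<noteq> {}" using ne eE by auto
      show "X \<union> K - {e} \<subset> E - {e}" using P ne eE by blast
    qed (use fin P eE ne in auto)
    show "notchy (E - {e}) (ct e r)"
    proof (rule con_notchy[OF eE(1) re[OF eE(1)] disjI2[OF notch_intro[of _ "X - {e}" "X \<union> K - {e}" "E - {e}" Y 0 1]]])
      show "r (insert e I) = card (insert e I) \<longleftrightarrow> cnt I (X - {e}) \<le> 0 \<and> cnt I (X \<union> K - {e}) \<le> 1 \<and>
          cnt I (E - {e}) \<le> card Y \<and> cnt I Y < card Y"
        if I: "I \<subseteq> E" "e \<notin> I" "finite I" "insert e I \<subseteq> E" for I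
      unfolding cnt_remove[OF I(2)] tot[OF I(3)]
        using ind[OF I(4), unfolded cnt_insert[OF I(3,2)]] e eE c by auto
      show "Y \<subset> E - {e}" using P eE ne by blast
      have "\<not> E - {e} \<subseteq> X - {e} \<union> Y" using P eE ne by blast
      thus "(X - {e}) \<inter> Y = {} \<and> (0 < (0::nat) \<or> \<not> E - {e} \<subseteq> X - {e} \<union> Y) \<or> E - {e} \<subseteq> X - {e} \<union> Y \<and> cnt Y (X - {e}) < 0"
        using P by auto
      show "(X \<union> K - {e}) \<inter> Y = {} \<and> (0 < (1::nat) \<or> \<not> E - {e} \<subseteq> X \<union> K - {e} \<union> Y) \<or> E - {e} \<subseteq> X \<union> K - {e} \<union> Y \<and> cnt Y (X \<union> K - {e}) < 1"
        using P by auto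
    qed (use fin P ne in auto)
  qed
  have Y: "notchy (E - {e}) (dl e r) \<and> notchy (E - {e}) (ct e r)" if e: "e \<in> Y" for e
  proof
    have eE: "e \<in> E" "e \<notin> X" "e \<notin> K" using e P by auto
    show "notchy (E - {e}) (dl e r)"
    proof (rule del_notchy[OF disjI1[OF nested2[of X "X \<union> K" _ 1 2]]])
      show "r I = card I \<longleftrightarrow> cnt I X \<le> 1 \<and> cnt I (X \<union> K) \<le> 2"
        if I: "I \<subseteq> E" "e \<notin> I" "finite I" for I
        unfolding tot[OF I(3)] using ind[OF I(1)] cnt_less[OF f(2) e I(2)] c by auto
    qed (use P eE in auto)
    show "notchy (E - {e}) (ct e r)"
    proof (rule con_notchy[OF eE(1) re[OF eE(1)] disjI1[OF nested_intro[of "Y - {e}" "Y \<union> X - {e}" "E - {e}" _ 0 1 2]]])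
      show "r (insert e I) = card (insert e I) \<longleftrightarrow> cnt I (Y - {e}) \<le> 0 \<and> cnt I (Y \<union> X - {e}) \<le> 1 \<and> cnt I (E - {e}) \<le> 2"
        if I: "I \<subseteq> E" "e \<notin> I" "finite I" "insert e I \<subseteq> E" for I
      unfolding cnt_remove[OF I(2)] tot[OF I(3)]
        using ind[OF I(4), unfolded cnt_insert[OF I(3,2)]] e eE c by auto
    qed (use P in auto)
  qed
  have K: "notchy (E - {e}) (dl e r) \<and> notchy (E - {e}) (ct e r)" if e: "e \<in> K" for e
  proof
    have eE: "e \<in> E" "e \<notin> X" "e \<notin> Y" using e P by auto
    show "notchy (E - {e}) (dl e r)"
    proof (rule del_notchy[OF disjI2[OF notch_intro2[of _ Y "X \<union> Y" X 1]]])
      show "r I = card I \<longleftrightarrow> cnt I Y \<le> 1 \<and> cnt I (X \<union> Y) \<le> card X \<and> cnt I X < card X"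
        if I: "I \<subseteq> E" "e \<notin> I" "finite I" for I
        unfolding tot[OF I(3)] using ind[OF I(1)] cnt_less[OF f(3) e I(2)] c by auto
      show "X \<subset> X \<union> Y" using P ne by blast
    qed (use fin P eE ne in auto)
    show "notchy (E - {e}) (ct e r)"
    proof (rule con_notchy[OF eE(1) re[OF eE(1)] disjI2[OF notch_intro2[of _ "X \<union> K - {e}" "E - {e}" Y 1]]])
      show "r (insert e I) = card (insert e I) \<longleftrightarrow> cnt I (X \<union> K - {e}) \<le> 1 \<and> cnt I (E - {e}) \<le> card Y \<and> cnt I Y < card Y"
        if I: "I \<subseteq> E" "e \<notin> I" "finite I" "insert e I \<subseteq> E" for I
      unfolding cnt_remove[OF I(2)] tot[OF I(3)]
        using ind[OF I(4), unfolded cnt_insert[OF I(3,2)]] e eE c by auto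
      show "Y \<subset> E - {e}" using P eE ne by blast
    qed (use fin P ne eE in auto)
  qed
  have cX: "cflat E r X \<and> r X = 1"
  proof (rule cflat_parallel)
    show "X \<subseteq> E" "card X = 2" using sub c by auto
    show "r {x} = 1" if "x \<in> X" for x using sub re that by auto
    show "r X \<noteq> 2" using ind[OF sub(1)] c by auto
    show "r {g, x} = 2" if g: "g \<in> E" "g \<notin> X" "x \<in> X" for g x
    proof -
      have g': "x \<notin> Y" "x \<notin> K" "g \<notin> {x}" "{g, x} \<subseteq> E" using g P by auto
      thus ?thesis using ind[OF g'(4), unfolded cnt_insert[OF _ g'(3), simplified] cnt_single] g by auto
    qed
  qed
  have cY: "cflat E r Y \<and> r Y = 1"
  proof (rule cflat_parallel)
    show "Y \<subseteq> E" "card Y = 2" using sub c by auto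
    show "r {x} = 1" if "x \<in> Y" for x using sub re that by auto
    show "r Y \<noteq> 2" using ind[OF sub(2)] c by auto
    show "r {g, x} = 2" if g: "g \<in> E" "g \<notin> Y" "x \<in> Y" for g x
    proof -
      have g': "x \<notin> X" "x \<notin> K" "g \<notin> {x}" "{g, x} \<subseteq> E" "g \<notin> X \<or> g \<notin> K" using g P by auto
      thus ?thesis using ind[OF g'(4), unfolded cnt_insert[OF _ g'(3), simplified] cnt_single] g by auto
    qed
  qed
  have rE: "r E \<le> 3"
  proof (rule rank_le)
    show "card J \<le> 3" if "J \<subseteq> E" "r J = card J" for J
      using ind[OF that(1)] that(2) tot(1)[OF finite_sub[OF that(1)]] that(1) by (simp add: Int_absorb2)
  qed simp
  have P2: "(X \<union> Y) \<inter> K = {}" using P by auto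
  have Kc: "e \<in> cyc r E" and re3: "3 \<le> r E" if e: "e \<in> K" for e
  proof -
    have "1 \<le> card (K - {e})" using card_remove1[OF f(3) e] c by simp
    moreover have "(X \<union> Y) \<inter> (K - {e}) = {}" using P by auto
    ultimately obtain I where I: "I \<subseteq> X \<union> Y \<union> (K - {e})" "finite I" "card I = 1 + 1 + 1"
      "cnt I X = 1" "cnt I Y = 1" "cnt I (K - {e}) = 1"
      using counts_ex[OF P(1), of "K - {e}" 1 1 1] c by auto
    have "I \<subseteq> E - {e}" "I \<subseteq> E" "e \<notin> I" using I(1) P e by auto
    moreover have "cnt I K = 1" using I(6) cnt_remove[OF \<open>e \<notin> I\<close>] by simp
    ultimately have "3 \<le> r (E - {e})" using ind[of I] rank_ge[of I "E - {e}"] I by auto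
    thus "e \<in> cyc r E" "3 \<le> r E" using rE e sub mono[of "E - {e}" E] by (auto intro!: mem_cyc)
  qed
  have "E \<subseteq> cyc r E" using Kc cflat_sub_cyc[OF conjunct1[OF cX] subset_refl sub(1)] cflat_sub_cyc[OF conjunct1[OF cY] subset_refl sub(2)] P(4) by blast
  hence cyc: "cyc r E = E" by (auto simp: cyc_def)
  have "\<not> notchy E r"
  proof
    assume "notchy E r"
    have n: "\<not> X \<subseteq> Y" "\<not> Y \<subseteq> X" using P ne by auto
    have "r (X \<union> Y) = r E" using notchyD(2)[OF \<open>notchy E r\<close> conjunct1[OF cX] conjunct1[OF cY] n re] cyc by simp
    moreover have "r (X \<union> Y) \<le> 2" using submod[of X Y] sub cX cY by auto
    moreover have "3 \<le> r E" using re3 ne by auto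
    ultimately show False by simp
  qed
  thus ?thesis
  proof (rule excI)
    fix e assume "e \<in> E"
    thus "notchy (E - {e}) (dl e r)" "notchy (E - {e}) (ct e r)" using P(4) X Y K by blast+
  qed
qed

text \<open>The two circuit-hyperplanes share the element of \<open>F\<close>, while their union
  misses the element of \<open>G\<close>, which is not a coloop. Removing an element of
  \<open>P\<close> or \<open>Q\<close> leaves at most one of the two and so a chain. Deleting the
  element of \<open>F\<close>, or contracting that of \<open>G\<close>, leaves a uniform matroid;
  contracting the element of \<open>F\<close> makes the two disjoint, and deleting that of
  \<open>G\<close> makes them a cover.\<close>

lemma A_exc:
  assumes P: "(F \<union> G) \<inter> (P \<union> Q) = {}" "F \<inter> G = {}" "P \<inter> Q = {}" "F \<union> G \<union> (P \<union> Q) = E"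
    and ind: "\<And>I. I \<subseteq> E \<Longrightarrow> r I = card I \<longleftrightarrow> cnt I F + cnt I P \<le> n - 1 \<and> cnt I F + cnt I Q \<le> n - 1 \<and>
      cnt I F + cnt I G + cnt I P + cnt I Q \<le> n"
    and c: "card F = 1" "card G = 1" "card P = n - 1" "card Q = n - 1" "3 \<le> n"
  shows "exc E r"
proof -
  have ne: "F \<noteq> {}" "G \<noteq> {}" "P \<noteq> {}" "Q \<noteq> {}" using c by auto
  have f: "finite F" "finite G" "finite P" "finite Q" using P(4) fin by auto
  have dj: "F \<inter> P = {}" "F \<inter> Q = {}" "G \<inter> P = {}" "G \<inter> Q = {}" using P(1) by blast+
  have tot: "cnt I E = cnt I F + cnt I G + cnt I P + cnt I Q"
    "cnt I (F \<union> P) = cnt I F + cnt I P" "cnt I (F \<union> Q) = cnt I F + cnt I Q" if "finite I" for I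
    using card_Int_Un[OF that P(1)] card_Int_Un[OF that P(2)] card_Int_Un[OF that P(3)] card_Int_Un[OF that dj(1)] card_Int_Un[OF that dj(2)] P(4) by simp_all
  have re: "r {g} = 1" if g: "g \<in> E" for g
  proof -
    have "{g} \<subseteq> E" "(if g \<in> F then 1 else 0) + (if g \<in> G then 1 else 0) + (if g \<in> P then 1 else 0) + (if g \<in> Q then 1 else 0) \<le> (1::nat)"
      using g P(2,3) dj by (auto split: if_splits)
    thus ?thesis using ind[OF \<open>{g} \<subseteq> E\<close>, unfolded cnt_single] c(5) by (auto split: if_splits)
  qed
  have rE: "r E \<le> n"
  proof (rule rank_le)
    show "card J \<le> n" if "J \<subseteq> E" "r J = card J" for J
      using ind[OF that(1)] that(2) tot(1)[OF finite_sub[OF that(1)]] that(1) by (simp add: Int_absorb2)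
  qed simp
  have main: "notchy (E - {e}) (dl e r) \<and> notchy (E - {e}) (ct e r) \<and> cflat E r (F \<union> P)"
    if P: "(F \<union> G) \<inter> (P \<union> Q) = {}" "P \<inter> Q = {}" "F \<union> G \<union> (P \<union> Q) = E" and e: "e \<in> P"
    and ind: "\<And>I. I \<subseteq> E \<Longrightarrow> r I = card I \<longleftrightarrow> cnt I F + cnt I P \<le> n - 1 \<and> cnt I F + cnt I Q \<le> n - 1 \<and>
      cnt I F + cnt I G + cnt I P + cnt I Q \<le> n"
    and tot: "\<And>I. finite I \<Longrightarrow> cnt I E = cnt I F + cnt I G + cnt I P + cnt I Q"
    "\<And>I. finite I \<Longrightarrow> cnt I (F \<union> P) = cnt I F + cnt I P" "\<And>I. finite I \<Longrightarrow> cnt I (F \<union> Q) = cnt I F + cnt I Q"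
    and c': "card P = n - 1" "card Q = n - 1" "finite P" "finite Q" for P Q e
  proof (intro conjI)
    have eE: "e \<in> E" "e \<notin> F" "e \<notin> G" "e \<notin> Q" using e P by auto
    have dj: "F \<inter> P = {}" using P(1) by blast
    show "notchy (E - {e}) (dl e r)"
    proof (rule del_notchy[OF disjI1[OF nested2[of "F \<union> Q" "E - {e}" _ "n - 1" n]]])
      show "r I = card I \<longleftrightarrow> cnt I (F \<union> Q) \<le> n - 1 \<and> cnt I (E - {e}) \<le> n"
        if I: "I \<subseteq> E" "e \<notin> I" "finite I" for I
        unfolding cnt_remove[OF I(2)] tot(1)[OF I(3)] tot(3)[OF I(3)]
        using ind[OF I(1)] cnt_less[OF c'(3) e I(2)] c' cnt_le[OF f(1), of I] c(1) by auto
    qed (use P eE in auto)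
    show "notchy (E - {e}) (ct e r)"
    proof (rule con_notchy[OF eE(1) re[OF eE(1)] disjI1[OF nested2[of "F \<union> P - {e}" "E - {e}" _ "n - 2" "n - 1"]]])
      show "r (insert e I) = card (insert e I) \<longleftrightarrow> cnt I (F \<union> P - {e}) \<le> n - 2 \<and> cnt I (E - {e}) \<le> n - 1"
        if I: "I \<subseteq> E" "e \<notin> I" "finite I" "insert e I \<subseteq> E" for I
      unfolding cnt_remove[OF I(2)] tot(1)[OF I(3)] tot(2)[OF I(3)]
        using ind[OF I(4), unfolded cnt_insert[OF I(3,2)]] e eE c(5) by auto
    qed (use P in auto)
    have "cflat E r (F \<union> P) \<and> r (F \<union> P) = n - 1"
    proof (rule cflat_uniform)
      have fFP: "finite (F \<union> P)" using f(1) c'(3) by simp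
      have "card (F \<union> P) = card F + card P" by (rule card_Un_disjoint[OF f(1) c'(3) dj])
      thus "F \<union> P \<subseteq> E" "n - 1 < card (F \<union> P)" using P c' c(1,5) by auto
      have IX: "cnt I F + cnt I P = card I" "cnt I Q = 0" "cnt I G = 0" "I \<subseteq> E" "finite I" if "I \<subseteq> F \<union> P" for I
      proof -
        show fI: "finite I" by (rule finite_subset[OF that fFP])
        have "I \<inter> (F \<union> P) = I" "I \<inter> Q = {}" "I \<inter> G = {}" using that P \<open>F \<inter> G = {}\<close> by auto
        thus "cnt I F + cnt I P = card I" "cnt I Q = 0" "cnt I G = 0" using tot(2)[OF fI] by simp_all
        show "I \<subseteq> E" using that P by auto
      qed
      show "r I = card I" if "I \<subseteq> F \<union> P" "card I \<le> n - 1" for I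
        using ind[OF IX(4)[OF that(1)]] that(2) IX(1-3)[OF that(1)] cnt_le[OF f(1), of I] c(1,5) by auto
      show "card J \<le> n - 1" if "J \<subseteq> F \<union> P" "r J = card J" for J using ind[OF IX(4)[OF that(1)]] that(2) IX(1-3)[OF that(1)] by auto
      show "r (insert g I) = n - 1 + 1" if g: "g \<in> E" "g \<notin> F \<union> P" "I \<subseteq> F \<union> P" "card I = n - 1" for g I
      proof -
        have g': "g \<in> Q \<and> g \<notin> G \<or> g \<notin> Q \<and> g \<in> G" "g \<notin> I" "insert g I \<subseteq> E" using g P by auto
        have "r (insert g I) = card (insert g I)"
          using ind[OF g'(3), unfolded cnt_insert[OF IX(5)[OF g(3)] g'(2)]] g'(1) IX(1-3)[OF g(3)] g c(5) cnt_le[OF f(1), of I] c(1) by auto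
        thus ?thesis using g' g IX(5)[OF g(3)] c(5) by simp
      qed
    qed
    thus "cflat E r (F \<union> P)" by blast
  qed
  have P': "(F \<union> G) \<inter> (Q \<union> P) = {}" "Q \<inter> P = {}" "F \<union> G \<union> (Q \<union> P) = E" using P by auto
  have ind': "r I = card I \<longleftrightarrow> cnt I F + cnt I Q \<le> n - 1 \<and> cnt I F + cnt I P \<le> n - 1 \<and>
      cnt I F + cnt I G + cnt I Q + cnt I P \<le> n" if "I \<subseteq> E" for I using ind[OF that] by auto
  have tot1': "cnt I E = cnt I F + cnt I G + cnt I Q + cnt I P" if "finite I" for I using tot[OF that] by simp
  note mP = main[OF P(1,3,4) _ ind tot(1,2,3) c(3,4) f(3,4)] and mQ = main[OF P' _ ind' tot1' tot(3,2) c(4,3) f(4,3)]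
  have cf: "cflat E r (F \<union> P)" "cflat E r (F \<union> Q)" using mP mQ ne by auto
  have cFP: "card (F \<union> P) = n" using card_Un_disjoint[OF f(1,3) dj(1)] c by simp
  have mF: "notchy (E - {e}) (dl e r) \<and> notchy (E - {e}) (ct e r)" if e: "e \<in> F" for e
  proof
    have eE: "e \<in> E" "e \<notin> G" "e \<notin> P" "e \<notin> Q" using e P dj by auto
    show "notchy (E - {e}) (dl e r)"
    proof (rule del_notchy[OF disjI1[OF nested_uniform[of "E - {e}" _ n]]])
      show "r I = card I \<longleftrightarrow> cnt I (E - {e}) \<le> n"
        if I: "I \<subseteq> E" "e \<notin> I" "finite I" for I
        unfolding cnt_remove[OF I(2)] tot[OF I(3)]
        using ind[OF I(1)] cnt_less[OF f(1) e I(2)] cnt_le[OF f(3), of I] cnt_le[OF f(4), of I] c by auto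
    qed auto
    show "notchy (E - {e}) (ct e r)"
    proof (rule con_notchy[OF eE(1) re[OF eE(1)] disjI2[OF notch_intro2[of _ Q "E - {e}" P "n - 2"]]])
      show "r (insert e I) = card (insert e I) \<longleftrightarrow> cnt I Q \<le> n - 2 \<and> cnt I (E - {e}) \<le> card P \<and> cnt I P < card P"
        if I: "I \<subseteq> E" "e \<notin> I" "finite I" "insert e I \<subseteq> E" for I
      unfolding cnt_remove[OF I(2)] tot[OF I(3)]
        using ind[OF I(4), unfolded cnt_insert[OF I(3,2)]] cnt_less[OF f(1) e I(2)] e eE c by auto
      show "P \<subset> E - {e}" using P eE ne by blast
    qed (use fin P ne eE c in auto)
  qed
  have mG: "notchy (E - {e}) (dl e r) \<and> notchy (E - {e}) (ct e r) \<and> e \<in> cyc r E" if e: "e \<in> G" for e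
  proof (intro conjI)
    have eE: "e \<in> E" "e \<notin> F" "e \<notin> P" "e \<notin> Q" using e P dj by auto
    have Ge: "G = {e}" using e c(2) by (auto simp: card_1_singleton_iff)
    show "notchy (E - {e}) (dl e r)"
    proof (rule del_notchy[OF disjI2[OF notch_intro2[of _ "F \<union> Q" "E - {e}" "F \<union> P" "n - 1"]]])
      show "r I = card I \<longleftrightarrow> cnt I (F \<union> Q) \<le> n - 1 \<and> cnt I (E - {e}) \<le> card (F \<union> P) \<and> cnt I (F \<union> P) < card (F \<union> P)"
        if I: "I \<subseteq> E" "e \<notin> I" "finite I" for I
        unfolding cnt_remove[OF I(2)] tot[OF I(3)] cFP
        using ind[OF I(1)] cnt_less[OF f(2) e I(2)] c by auto
      have "(F \<union> P) \<inter> (F \<union> Q) = F" using P(3) dj by blast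
      moreover have "E - {e} \<subseteq> F \<union> Q \<union> (F \<union> P)" using P(4) Ge by blast
      ultimately show "(F \<union> Q) \<inter> (F \<union> P) = {} \<and> 0 < n - 1 \<or> E - {e} \<subseteq> F \<union> Q \<union> (F \<union> P) \<and> card ((F \<union> P) \<inter> (F \<union> Q)) < n - 1" using c(1,5) by simp linarith
      show "F \<union> P \<subset> E - {e}" using P(3,4) dj eE ne by blast
    qed (use fin P(4) eE ne in auto)
    show "notchy (E - {e}) (ct e r)"
    proof (rule con_notchy[OF eE(1) re[OF eE(1)] disjI1[OF nested_uniform[of "E - {e}" _ "n - 1"]]])
      show "r (insert e I) = card (insert e I) \<longleftrightarrow> cnt I (E - {e}) \<le> n - 1"
        if I: "I \<subseteq> E" "e \<notin> I" "finite I" "insert e I \<subseteq> E" for I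
      unfolding cnt_remove[OF I(2)] tot[OF I(3)]
        using ind[OF I(4), unfolded cnt_insert[OF I(3,2)]] cnt_less[OF f(2) e I(2)] e eE c by auto
    qed auto
    have "{} \<inter> P = {}" "({} \<union> P) \<inter> Q = {}" using P(3) by auto
    note ex = counts_ex[OF this]
    have le: "0 \<le> card ({} :: 'a set)" "n - 1 \<le> card P" "1 \<le> card Q" using c by simp_all
    obtain I where I: "I \<subseteq> {} \<union> P \<union> Q" "card I = 0 + (n - 1) + 1" "cnt I P = n - 1" "cnt I Q = 1"
      using ex[OF le] by blast
    have "I \<subseteq> E" "I \<subseteq> E - {e}" "I \<inter> F = {}" "I \<inter> G = {}" using I(1) P(1,4) eE by blast+
    hence "n \<le> r (E - {e})" using ind[of I] rank_ge[of I "E - {e}"] I c(5) by auto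
    thus "e \<in> cyc r E" using rE by (intro mem_cyc eE(1)) simp
  qed
  have "\<not> notchy E r"
  proof
    assume n: "notchy E r"
    have i: "\<not> F \<union> P \<subseteq> F \<union> Q" "\<not> F \<union> Q \<subseteq> F \<union> P" using P(3) dj ne by blast+
    obtain e where e: "e \<in> G" using ne by auto
    have "e \<in> cyc r E" using mG[OF e] by blast
    moreover have "e \<notin> F \<union> P \<union> (F \<union> Q)" using e P(2) dj by blast
    moreover have "(F \<union> P) \<inter> (F \<union> Q) \<noteq> {}" using ne by blast
    ultimately show False using notchyD(1)[OF n cf i re] by blast
  qed
  thus ?thesis
  proof (rule excI)
    fix e assume "e \<in> E"
    thus "notchy (E - {e}) (dl e r)" "notchy (E - {e}) (ct e r)" using P(4) mP mQ mF mG by blast+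
  qed
qed

end

section \<open>From counting descriptions to excluded minors\<close>

lemma map_card_Cons: "map card Ps = c # cs \<longleftrightarrow> (\<exists>P Qs. Ps = P # Qs \<and> card P = c \<and> map card Qs = cs)"
  by (cases Ps) auto

lemma looks2E:
  assumes "looks E P [a, b] \<phi>"
  obtains X Y where "card X = a" "card Y = b" "X \<inter> Y = {}" "X \<union> Y = E"
    "\<forall>I. I \<subseteq> E \<longrightarrow> (P I \<longleftrightarrow> \<phi> [cnt I X, cnt I Y])"
proof -
  obtain Ps where Ps: "map card Ps = [a, b]" "pdisj Ps" "\<Union>(set Ps) = E"
    "\<forall>I. I \<subseteq> E \<longrightarrow> (P I \<longleftrightarrow> \<phi> (map (\<lambda>P. cnt I P) Ps))"
    using assms unfolding looks_def by (elim exE conjE) (rule that)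
  obtain X Y where "Ps = [X, Y]" "card X = a" "card Y = b" using Ps(1) unfolding map_card_Cons map_is_Nil_conv by blast
  thus thesis by (intro that[of X Y]) (use Ps(2-4) in simp_all)
qed

lemma looks3: "looks E P [a, b, c] \<phi> \<longleftrightarrow> (\<exists>X Y K. card X = a \<and> card Y = b \<and> card K = c \<and>
    X \<inter> Y = {} \<and> X \<inter> K = {} \<and> Y \<inter> K = {} \<and> X \<union> Y \<union> K = E \<and>
    (\<forall>I. I \<subseteq> E \<longrightarrow> (P I \<longleftrightarrow> \<phi> [cnt I X, cnt I Y, cnt I K])))" (is "_ = ?R")
proof
  assume "looks E P [a, b, c] \<phi>"
  then obtain Ps where Ps: "map card Ps = [a, b, c]" "pdisj Ps" "\<Union>(set Ps) = E"
    "\<forall>I. I \<subseteq> E \<longrightarrow> (P I \<longleftrightarrow> \<phi> (map (\<lambda>P. cnt I P) Ps))" unfolding looks_def by (elim exE conjE) (rule that)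
  obtain X Y K where XY: "Ps = [X, Y, K]" "card X = a" "card Y = b" "card K = c" using Ps(1) unfolding map_card_Cons map_is_Nil_conv by blast
  show ?R
    by (rule exI[of _ X], rule exI[of _ Y], rule exI[of _ K])
      (use Ps(2-4) XY in \<open>simp add: Int_Un_distrib Un_assoc\<close>)
next
  assume ?R
  then obtain X Y K where "card X = a" "card Y = b" "card K = c" "X \<inter> Y = {}" "X \<inter> K = {}" "Y \<inter> K = {}" "X \<union> Y \<union> K = E"
    "\<forall>I. I \<subseteq> E \<longrightarrow> (P I \<longleftrightarrow> \<phi> [cnt I X, cnt I Y, cnt I K])" by (elim exE conjE) (rule that)
  thus "looks E P [a, b, c] \<phi>" unfolding looks_def
    by (intro exI[of _ "[X, Y, K]"]) (simp add: Int_Un_distrib Un_assoc)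
qed

lemma looks4E:
  assumes "looks E P [a, b, c, d] \<phi>"
  obtains F G X Y where "card F = a" "card G = b" "card X = c" "card Y = d"
    "(F \<union> G) \<inter> (X \<union> Y) = {}" "F \<inter> G = {}" "X \<inter> Y = {}" "F \<union> G \<union> (X \<union> Y) = E"
    "\<forall>I. I \<subseteq> E \<longrightarrow> (P I \<longleftrightarrow> \<phi> [cnt I F, cnt I G, cnt I X, cnt I Y])"
proof -
  obtain Ps where Ps: "map card Ps = [a, b, c, d]" "pdisj Ps" "\<Union>(set Ps) = E"
    "\<forall>I. I \<subseteq> E \<longrightarrow> (P I \<longleftrightarrow> \<phi> (map (\<lambda>P. cnt I P) Ps))"
    using assms unfolding looks_def by (elim exE conjE) (rule that)
  obtain F G X Y where "Ps = [F, G, X, Y]" "card F = a" "card G = b" "card X = c" "card Y = d"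
    using Ps(1) unfolding map_card_Cons map_is_Nil_conv by blast
  thus thesis
    by (intro that[of F G X Y]) (use Ps(2-4) in \<open>simp_all add: Int_Un_distrib Int_Un_distrib2 Un_assoc\<close>)
qed

lemma looks6: "looks E P [1, 1, 1, 1, 1, 1] \<phi> \<longleftrightarrow> (\<exists>x y k a b c. distinct [x, y, k, a, b, c] \<and> E = {x, y, k, a, b, c} \<and>
    (\<forall>I. I \<subseteq> E \<longrightarrow> (P I \<longleftrightarrow> \<phi> [cnt I {x}, cnt I {y}, cnt I {k}, cnt I {a}, cnt I {b}, cnt I {c}])))"
  (is "_ = ?R")
proof
  assume "looks E P [1, 1, 1, 1, 1, 1] \<phi>"
  then obtain Ps where Ps: "map card Ps = [1, 1, 1, 1, 1, 1]" "pdisj Ps" "\<Union>(set Ps) = E"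
    "\<forall>I. I \<subseteq> E \<longrightarrow> (P I \<longleftrightarrow> \<phi> (map (\<lambda>P. cnt I P) Ps))" unfolding looks_def by (elim exE conjE) (rule that)
  obtain x y k a b c where XY: "Ps = [{x}, {y}, {k}, {a}, {b}, {c}]"
    using Ps(1) unfolding map_card_Cons map_is_Nil_conv One_nat_def card_1_singleton_iff by blast
  show ?R
    by (rule exI[of _ x], rule exI[of _ y], rule exI[of _ k], rule exI[of _ a], rule exI[of _ b], rule exI[of _ c])
      (use Ps(2-4) XY in auto)
next
  assume ?R
  then obtain x y k a b c where "distinct [x, y, k, a, b, c]" "E = {x, y, k, a, b, c}"
    "\<forall>I. I \<subseteq> E \<longrightarrow> (P I \<longleftrightarrow> \<phi> [cnt I {x}, cnt I {y}, cnt I {k}, cnt I {a}, cnt I {b}, cnt I {c}])"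
    by (elim exE conjE) (rule that)
  thus "looks E P [1, 1, 1, 1, 1, 1] \<phi>" unfolding looks_def
    by (intro exI[of _ "[{x}, {y}, {k}, {a}, {b}, {c}]"]) auto
qed

context rank_matroid
begin

lemma looks_B_exc: "looks E ind [n, n, k] (phi_B n k) \<Longrightarrow> 2 \<le> k \<Longrightarrow> k \<le> n \<Longrightarrow> exc E r"
  unfolding looks3 phi_B_def
  by (elim exE conjE, erule B_exc[where n = n and k = k, rotated 2]) (simp_all add: Int_Un_distrib2)

lemma looks_D_exc: "looks E ind [n - 1, n - 1, 2] (phi_D n) \<Longrightarrow> 3 \<le> n \<Longrightarrow> exc E r"
  unfolding looks3 phi_D_def
  by (elim exE conjE, erule D_exc[where n = n, rotated 2]) (simp_all add: Int_Un_distrib2)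

lemma looks_FGH_exc:
  "looks E ind [p, q] (phi_FGH a b n) \<Longrightarrow> p = a + 2 \<and> a + 1 = n \<or> p = a + 1 \<and> a + 2 = n \<Longrightarrow>
    q = b + 2 \<and> b + 1 = n \<or> q = b + 1 \<and> b + 2 = n \<Longrightarrow> 1 \<le> a \<Longrightarrow> 1 \<le> b \<Longrightarrow> n \<le> a + b \<Longrightarrow> exc E r"
  unfolding phi_FGH_def
  by (erule looks2E, erule FGH_exc[where a = a and b = b and n = n, rotated 1]) simp_all

lemma looks_A_exc: "looks E ind [1, 1, n - 1, n - 1] (phi_A n) \<Longrightarrow> 3 \<le> n \<Longrightarrow> exc E r"
  unfolding phi_A_def
  by (erule looks4E, erule A_exc[where n = n, rotated 3]) (simp_all add: numeral_2_eq_2 numeral_3_eq_3)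

lemma looks_lines_exc:
  assumes "looks E ind [1, 1, 1, 1, 1, 1] phi_wheel \<or> looks E ind [1, 1, 1, 1, 1, 1] phi_whirl"
  shows "exc E r"
proof -
  have *: "exc E r" if d: "distinct [x, y, k, a, b, c]" "E = {x, y, k, a, b, c}" and L: "\<L> = {{x, a, b}, {y, a, c}, {k, b, c}} \<or> \<L> = {{x, a, b}, {y, a, c}, {k, b, c}, {x, y, k}}"
    and i: "\<And>I. I \<subseteq> E \<Longrightarrow> r I = card I \<longleftrightarrow> (\<forall>L\<in>\<L>. cnt I L \<le> 2) \<and> card I \<le> 3" for x y k a b c \<L>
  proof (rule lines_exc[of \<L> "{x, a, b}" "{y, a, c}" "{k, b, c}"])
    show "card E = 6" using d by simp
    show "L \<subseteq> E \<and> card L = 3" if "L \<in> \<L>" for L using that L d by auto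
    show "cnt L M = 1" if "L \<in> \<L>" "M \<in> \<L>" "L \<noteq> M" for L M using that L d by (elim disjE) (simp_all, auto)
  qed (use L d i in auto)
  have ct: "cnt I {x, y, z} = cnt I {x} + cnt I {y} + cnt I {z}"
    if "finite I" "distinct [x, y, z]" for I and x y z :: 'a
    using cnt_ins2[OF that(1), of x "{y, z}"] cnt_ins2[OF that(1), of y "{z}"] that(2) by simp
  have ct6: "card I = cnt I {x} + cnt I {y} + cnt I {k} + cnt I {a} + cnt I {b} + cnt I {c}"
    if d: "distinct [x, y, k, a, b, c]" "E = {x, y, k, a, b, c}" and "I \<subseteq> E" for I x y k a b c
  proof -
    have fI: "finite I" by (rule finite_sub[OF that(3)])
    have "I \<inter> E = I" using that(3) by auto
    moreover have "cnt I E = cnt I {x, y, k} + cnt I {a, b, c}"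
    proof -
      have "{x, y, k} \<union> {a, b, c} = E" "{x, y, k} \<inter> {a, b, c} = {}" using d by auto
      thus ?thesis using card_Int_Un[OF fI, of "{x, y, k}" "{a, b, c}"] by simp
    qed
    ultimately show ?thesis using ct[OF fI, of x y k] ct[OF fI, of a b c] d(1) by simp
  qed
  obtain \<phi> where "looks E ind [1, 1, 1, 1, 1, 1] \<phi>" and p: "\<phi> = phi_wheel \<or> \<phi> = phi_whirl" using assms by blast
  then obtain x y k a b c where h: "distinct [x, y, k, a, b, c]" "E = {x, y, k, a, b, c}" and
    i: "\<forall>I. I \<subseteq> E \<longrightarrow> (r I = card I \<longleftrightarrow> \<phi> [cnt I {x}, cnt I {y}, cnt I {k}, cnt I {a}, cnt I {b}, cnt I {c}])"
    unfolding looks6 by (elim exE conjE) (rule that)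
  define \<L> where "\<L> = {{x, a, b}, {y, a, c}, {k, b, c}} \<union> (if \<phi> = phi_wheel then {{x, y, k}} else {})"
  show ?thesis
  proof (rule *[OF h])
    show "\<L> = {{x, a, b}, {y, a, c}, {k, b, c}} \<or> \<L> = {{x, a, b}, {y, a, c}, {k, b, c}, {x, y, k}}" by (simp add: \<L>_def insert_commute)
    fix I assume I: "I \<subseteq> E"
    note f = finite_sub[OF I]
    have "cnt I {x, a, b} = cnt I {x} + cnt I {a} + cnt I {b}"
      "cnt I {y, a, c} = cnt I {y} + cnt I {a} + cnt I {c}"
      "cnt I {k, b, c} = cnt I {k} + cnt I {b} + cnt I {c}"
      "cnt I {x, y, k} = cnt I {x} + cnt I {y} + cnt I {k}"
      by (rule ct[OF f], use h in simp)+
    thus "r I = card I \<longleftrightarrow> (\<forall>L\<in>\<L>. cnt I L \<le> 2) \<and> card I \<le> 3"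
      using i[rule_format, OF I] ct6[OF h I] p unfolding \<L>_def phi_wheel_def[abs_def] phi_whirl_def by auto
  qed
qed

lemma looks_sum_exc: "looks E ind [2, 2, 2] phi_1a \<Longrightarrow> exc E r"
  unfolding looks3 phi_1a_def
  by (elim exE conjE, erule sum_exc[rotated 2]) (simp_all add: Int_Un_distrib2)

lemma looks_trunc_sum_exc: "looks E ind [2, 2, 2] phi_1b \<Longrightarrow> exc E r"
  unfolding looks3 phi_1b_def
  by (elim exE conjE, erule trunc_sum_exc[rotated 3]) (simp_all add: Int_Un_distrib2)

end

lemma listed_exc:
  assumes r: "rank_matroid E r" and l: "listed E (\<lambda>I. r I = card I) (\<lambda>I. du E r I = card I)"
  shows "exc E r"
proof -
  interpret rank_matroid E r by (rule r)
  interpret D: rank_matroid E "du E r" by (rule rank_matroid_du)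
  from l[unfolded listed_def] show ?thesis
  proof (elim disjE exE conjE)
    fix n k assume "2 \<le> k" "k \<le> n" "looks E (\<lambda>I. du E r I = card I) [n, n, k] (phi_B n k)"
    thus ?thesis using D.looks_B_exc exc_du by blast
  next
    fix n :: nat assume "3 \<le> n" "looks E (\<lambda>I. du E r I = card I) [n - 1, n - 1, 2] (phi_D n)"
    thus ?thesis using D.looks_D_exc exc_du by blast
  next
    fix n :: nat assume "4 \<le> n" "looks E ind [n - 1, n - 1] (phi_FGH (n - 2) (n - 2) n)"
    thus ?thesis by (intro looks_FGH_exc) auto
  next
    fix n :: nat assume "2 \<le> n" "looks E ind [n + 1, n + 1] (phi_FGH (n - 1) (n - 1) n)"
    thus ?thesis by (intro looks_FGH_exc) auto
  next
    fix n :: nat assume "3 \<le> n" "looks E ind [n - 1, n + 1] (phi_FGH (n - 2) (n - 1) n)"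
    thus ?thesis by (intro looks_FGH_exc) auto
  qed (blast intro: looks_sum_exc looks_trunc_sum_exc looks_lines_exc looks_A_exc looks_B_exc looks_D_exc)+
qed

section \<open>The matroids as constructed\<close>

abbreviation indep :: "'a matroid \<Rightarrow> 'a set \<Rightarrow> bool" where "indep M \<equiv> \<lambda>I. I \<in> indeps M"

abbreviation mlooks :: "'a matroid \<Rightarrow> nat list \<Rightarrow> (nat list \<Rightarrow> bool) \<Rightarrow> bool" where
  "mlooks M \<equiv> looks (ground M) (indep M)"

lemma looksE:
  assumes "looks E P cs \<phi>"
  obtains Ps where "map card Ps = cs" "pdisj Ps" "\<Union>(set Ps) = E"
    "\<forall>I. I \<subseteq> E \<longrightarrow> (P I \<longleftrightarrow> \<phi> (map (\<lambda>P. cnt I P) Ps))"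
  using assms unfolding looks_def by (elim exE conjE) (rule that)

lemma looksI:
  assumes "map card Ps = cs" "pdisj Ps" "\<Union>(set Ps) = E"
    "\<And>I. I \<subseteq> E \<Longrightarrow> P I \<longleftrightarrow> \<phi> (map (\<lambda>P. cnt I P) Ps)"
  shows "looks E P cs \<phi>"
  unfolding looks_def by (rule exI[of _ Ps]) (use assms in simp)

lemma looks_ind_cong: "(\<And>I. I \<subseteq> E \<Longrightarrow> P I = Q I) \<Longrightarrow> looks E P cs \<phi> = looks E Q cs \<phi>"
  unfolding looks_def by simp

text \<open>Counts of a subset never exceed the block sizes, so the two conditions have to agree
  only below these sizes. This brings the conditions produced by the constructions into the form
  used in \<open>listed\<close>.\<close>

lemma looks_cong:
  assumes "looks E P cs \<phi>" "finite E"
    and "\<And>c. length c = length cs \<Longrightarrow> \<forall>i<length cs. c ! i \<le> cs ! i \<Longrightarrow> \<phi> c \<longleftrightarrow> \<psi> c"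
  shows "looks E P cs \<psi>"
proof (rule looksE[OF assms(1)], rule looksI)
  fix Ps I assume Ps: "map card Ps = cs" "\<Union>(set Ps) = E" "\<forall>I. I \<subseteq> E \<longrightarrow> (P I \<longleftrightarrow> \<phi> (map (\<lambda>P. cnt I P) Ps))"
    and I: "I \<subseteq> E"
  have "card (I \<inter> Ps ! i) \<le> card (Ps ! i)" if "i < length Ps" for i
    by (rule cnt_le[OF finite_subset[OF _ assms(2)]]) (use Ps(2) nth_mem[OF that] in blast)
  hence "\<phi> (map (\<lambda>P. cnt I P) Ps) \<longleftrightarrow> \<psi> (map (\<lambda>P. cnt I P) Ps)"
    by (intro assms(3)) (use Ps(1) in auto)
  thus "P I \<longleftrightarrow> \<psi> (map (\<lambda>P. cnt I P) Ps)" using Ps(3)[rule_format, OF I] by simp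
qed

lemma pdisj_bij:
  assumes "length Ps = length Ps'" "map card Ps = map card Ps'" "pdisj Ps" "pdisj Ps'"
    "\<forall>P\<in>set Ps. finite P" "\<forall>P\<in>set Ps'. finite P"
  shows "\<exists>f. bij_betw f (\<Union>(set Ps)) (\<Union>(set Ps')) \<and> map ((`) f) Ps = Ps'"
  using assms
proof (induction Ps Ps' rule: list_induct2)
  case Nil
  thus ?case by (auto simp: bij_betw_def)
next
  case (Cons P Ps P' Ps')
  then obtain f where f: "bij_betw f (\<Union>(set Ps)) (\<Union>(set Ps'))" "map ((`) f) Ps = Ps'" by auto
  obtain g where g: "bij_betw g P P'" using finite_same_card_bij[of P P'] Cons.prems by auto
  define h where "h = (\<lambda>x. if x \<in> P then g x else f x)"
  have dj: "P \<inter> \<Union>(set Ps) = {}" "P' \<inter> \<Union>(set Ps') = {}" using Cons.prems(2,3) by simp_all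
  have hf: "h x = f x" if "x \<in> \<Union>(set Ps)" for x using that dj(1) by (auto simp: h_def)
  have "bij_betw h (P \<union> \<Union>(set Ps)) (P' \<union> \<Union>(set Ps'))"
  proof (rule bij_betw_combine[OF _ _ dj(2)])
    show "bij_betw h P P'" using g by (subst bij_betw_cong[of _ _ g]) (simp_all add: h_def)
    show "bij_betw h (\<Union>(set Ps)) (\<Union>(set Ps'))" using f(1) by (subst bij_betw_cong[of _ _ f]) (rule hf)
  qed
  moreover have "h ` P = P'" using g by (auto simp: h_def bij_betw_def)
  moreover have "map ((`) h) Ps = map ((`) f) Ps" by (rule map_cong) (use hf in \<open>auto intro!: image_cong\<close>)
  ultimately show ?case using f(2) by (intro exI[of _ h]) simp
qed

text \<open>Any bijection that matches blocks of equal size preserves all counts and therefore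
  independence. Conversely, an isomorphism pulls the partition back.\<close>

lemma looks_iso:
  assumes L: "mlooks M' cs \<phi>" and fin: "finite (ground M)" "finite (ground M')"
  shows "matroid_iso M M' \<longleftrightarrow> mlooks M cs \<phi>"
proof -
  obtain Ps' where P': "map card Ps' = cs" "pdisj Ps'" "\<Union>(set Ps') = ground M'"
    "\<forall>I. I \<subseteq> ground M' \<longrightarrow> (indep M' I \<longleftrightarrow> \<phi> (map (\<lambda>P. cnt I P) Ps'))"
    by (rule looksE[OF L]) (rule that)
  show ?thesis
  proof
    assume "matroid_iso M M'"
    then obtain f where f: "bij_betw f (ground M) (ground M')"
      "\<And>X. X \<subseteq> ground M \<Longrightarrow> indep M X \<longleftrightarrow> indep M' (f ` X)" unfolding matroid_iso_def by blast
    note inj = bij_betw_imp_inj_on[OF f(1)] and im = bij_betw_imp_surj_on[OF f(1)]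
    define pre where "pre = (\<lambda>P. {x \<in> ground M. f x \<in> P})"
    have cnt: "card (I \<inter> pre P) = card (f ` I \<inter> P)" if "I \<subseteq> ground M" for I P
    proof -
      have "f ` (I \<inter> pre P) = f ` I \<inter> P" using that by (auto simp: pre_def)
      moreover have "inj_on f (I \<inter> pre P)" by (rule inj_on_subset[OF inj]) (use that in auto)
      ultimately show ?thesis using card_image by metis
    qed
    show "mlooks M cs \<phi>"
    proof (rule looksI)
      have "card (pre P) = card P" if "P \<in> set Ps'" for P
      proof -
        have "ground M \<inter> pre P = pre P" by (auto simp: pre_def)
        moreover have "f ` ground M \<inter> P = P" using that P'(3) im by auto
        ultimately show ?thesis using cnt[OF subset_refl, of P] by simp
      qed
      thus "map card (map pre Ps') = cs" using P'(1) by (metis (no_types, lifting) list.map_cong0 list.map_comp comp_apply)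
      have pU: "pre P \<inter> pre Q = pre (P \<inter> Q)" "pre {} = {}" for P Q by (auto simp: pre_def)
      have pUn: "\<Union>(set (map pre Qs)) = pre (\<Union>(set Qs))" for Qs by (auto simp: pre_def)
      have "pdisj Qs \<Longrightarrow> pdisj (map pre Qs)" for Qs
      proof (induction Qs)
        case (Cons Q Qs)
        have "pre Q \<inter> \<Union>(set (map pre Qs)) = {}" unfolding pUn pU(1) using Cons.prems pU(2) by simp
        thus ?case using Cons by simp
      qed simp
      thus "pdisj (map pre Ps')" using P'(2) .
      show "\<Union>(set (map pre Ps')) = ground M" unfolding pUn P'(3) using im by (auto simp: pre_def)
      show "indep M I \<longleftrightarrow> \<phi> (map (\<lambda>P. cnt I P) (map pre Ps'))" if "I \<subseteq> ground M" for I
      proof -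
        have "f ` I \<subseteq> ground M'" using that im by auto
        thus ?thesis using f(2)[OF that] P'(4) cnt[OF that] by (simp add: comp_def)
      qed
    qed
  next
    assume "mlooks M cs \<phi>"
    then obtain Ps where P: "map card Ps = cs" "pdisj Ps" "\<Union>(set Ps) = ground M"
      "\<forall>I. I \<subseteq> ground M \<longrightarrow> (indep M I \<longleftrightarrow> \<phi> (map (\<lambda>P. cnt I P) Ps))" by (rule looksE) (rule that)
    have "map card Ps = map card Ps'" using P(1) P'(1) by simp
    moreover have "length Ps = length Ps'" using map_eq_imp_length_eq[OF calculation] .
    moreover have "\<forall>P\<in>set Ps. finite P" "\<forall>P\<in>set Ps'. finite P"
      using P(3) P'(3) fin by (metis Union_upper finite_subset)+
    ultimately obtain f where f: "bij_betw f (ground M) (ground M')" "map ((`) f) Ps = Ps'"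
      using pdisj_bij[of Ps Ps'] P(2,3) P'(2,3) by auto
    show "matroid_iso M M'" unfolding matroid_iso_def
    proof (intro exI[of _ f] conjI allI impI f(1))
      fix X assume X: "X \<subseteq> ground M"
      have "card (f ` X \<inter> f ` P) = cnt X P" if "P \<in> set Ps" for P
      proof -
        have PM: "P \<subseteq> ground M" using that P(3) by auto
        note inj = bij_betw_imp_inj_on[OF f(1)]
        have "f ` (X \<inter> P) = f ` X \<inter> f ` P" by (rule inj_on_image_Int[OF inj X PM])
        moreover have "inj_on f (X \<inter> P)" by (rule inj_on_subset[OF inj]) (use X in auto)
        ultimately show ?thesis using card_image by metis
      qed
      hence "map (\<lambda>P. card (f ` X \<inter> P)) Ps' = map (\<lambda>P. cnt X P) Ps"
        unfolding f(2)[symmetric] by simp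
      moreover have "f ` X \<subseteq> ground M'" using X bij_betw_imp_surj_on[OF f(1)] by auto
      ultimately show "indep M X \<longleftrightarrow> indep M' (f ` X)" using P(4)[rule_format, OF X] P'(4) by simp
    qed
  qed
qed

section \<open>Counting descriptions of the constructions\<close>

lemma looks_uniform: "mlooks (uniform_matroid k n) [n] (\<lambda>c. c ! 0 \<le> k)"
  by (rule looksI[of "[{1..n}]"]) (auto simp: uniform_matroid_def Int_absorb2)

lemma indep_direct_sum: "indep (direct_sum M M') I \<longleftrightarrow> indep M (Inl -` I) \<and> indep M' (Inr -` I)"
proof
  assume "indep (direct_sum M M') I"
  then obtain A B where "I = A <+> B" "indep M A" "indep M' B" by (auto simp: direct_sum_def)
  moreover have "Inl -` (A <+> B) = A" "Inr -` (A <+> B) = B" for A :: "'a set" and B :: "'b set" by auto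
  ultimately show "indep M (Inl -` I) \<and> indep M' (Inr -` I)" by simp
next
  assume "indep M (Inl -` I) \<and> indep M' (Inr -` I)"
  moreover have "I = (Inl -` I) <+> (Inr -` I)"
  proof (rule set_eqI)
    show "x \<in> I \<longleftrightarrow> x \<in> (Inl -` I) <+> (Inr -` I)" for x by (cases x) auto
  qed
  ultimately show "indep (direct_sum M M') I" unfolding direct_sum_def by auto
qed

lemma card_Int_image: "inj f \<Longrightarrow> card (I \<inter> f ` P) = card (f -` I \<inter> P)"
proof -
  assume f: "inj f"
  have "I \<inter> f ` P = f ` (f -` I \<inter> P)" by auto
  thus ?thesis using card_image[OF inj_on_subset[OF f subset_UNIV]] by metis
qed

lemma pdisj_append: "pdisj (Ps @ Qs) \<longleftrightarrow> pdisj Ps \<and> pdisj Qs \<and> \<Union>(set Ps) \<inter> \<Union>(set Qs) = {}"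
  by (induction Ps) auto

lemma pdisj_image: "inj f \<Longrightarrow> pdisj (map ((`) f) Ps) \<longleftrightarrow> pdisj Ps"
proof (induction Ps)
  case (Cons P Ps)
  have "\<Union>(set (map ((`) f) Ps)) = f ` \<Union>(set Ps)" by auto
  hence "f ` P \<inter> \<Union>(set (map ((`) f) Ps)) = {} \<longleftrightarrow> P \<inter> \<Union>(set Ps) = {}"
    using image_Int[OF Cons.prems, of P "\<Union>(set Ps)"] by (metis image_is_empty)
  thus ?case using Cons by simp
qed simp

lemma looks_direct_sum:
  assumes "mlooks M as \<phi>" "mlooks M' bs \<psi>"
  shows "mlooks (direct_sum M M') (as @ bs) (\<lambda>c. \<phi> (take (length as) c) \<and> \<psi> (drop (length as) c))"
proof -
  obtain Ps where P: "map card Ps = as" "pdisj Ps" "\<Union>(set Ps) = ground M"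
    "\<forall>I. I \<subseteq> ground M \<longrightarrow> (indep M I \<longleftrightarrow> \<phi> (map (\<lambda>P. cnt I P) Ps))"
    by (rule looksE[OF assms(1)]) (rule that)
  obtain Qs where Q: "map card Qs = bs" "pdisj Qs" "\<Union>(set Qs) = ground M'"
    "\<forall>I. I \<subseteq> ground M' \<longrightarrow> (indep M' I \<longleftrightarrow> \<psi> (map (\<lambda>P. cnt I P) Qs))"
    by (rule looksE[OF assms(2)]) (rule that)
  have g: "ground (direct_sum M M') = Inl ` ground M \<union> Inr ` ground M'" by (auto simp: direct_sum_def)
  let ?R = "map ((`) Inl) Ps @ map ((`) Inr) Qs"
  have U: "\<Union>(set (map ((`) f) Ps)) = f ` \<Union>(set Ps)" for f :: "'x \<Rightarrow> 'y" and Ps by auto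
  show ?thesis
  proof (rule looksI[of ?R])
    show "map card ?R = as @ bs" using P(1) Q(1) by (simp add: comp_def card_image)
    show "pdisj ?R" unfolding pdisj_append U using P(2) Q(2) by (auto simp: pdisj_image)
    show "\<Union>(set ?R) = ground (direct_sum M M')" unfolding g set_append Union_Un_distrib U P(3) Q(3) ..
    fix I assume "I \<subseteq> ground (direct_sum M M')"
    hence I: "Inl -` I \<subseteq> ground M" "Inr -` I \<subseteq> ground M'" unfolding g by auto
    have l: "length as = length Ps" using P(1) by auto
    show "indep (direct_sum M M') I \<longleftrightarrow> \<phi> (take (length as) (map (\<lambda>P. cnt I P) ?R)) \<and> \<psi> (drop (length as) (map (\<lambda>P. cnt I P) ?R))"
      unfolding indep_direct_sum P(4)[rule_format, OF I(1)] Q(4)[rule_format, OF I(2)] l by (simp add: comp_def card_Int_image)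
  qed
qed

lemma card_pdisj: "pdisj Ps \<Longrightarrow> finite I \<Longrightarrow> card (I \<inter> \<Union>(set Ps)) = sum_list (map (\<lambda>P. cnt I P) Ps)"
proof (induction Ps)
  case (Cons P Ps)
  have "P \<inter> \<Union>(set Ps) = {}" using Cons.prems by simp
  thus ?case using card_Int_Un[OF Cons.prems(2), of P "\<Union>(set Ps)"] Cons by simp
qed simp

lemma looks_truncation:
  assumes "mlooks M cs \<phi>" "finite (ground M)"
  shows "mlooks (truncation n M) cs (\<lambda>c. \<phi> c \<and> sum_list c \<le> n)"
proof (rule looksE[OF assms(1)], rule looksI)
  fix Ps I assume P: "pdisj Ps" "\<Union>(set Ps) = ground M" "\<forall>I. I \<subseteq> ground M \<longrightarrow> (indep M I \<longleftrightarrow> \<phi> (map (\<lambda>P. cnt I P) Ps))"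
  show "\<Union>(set Ps) = ground (truncation n M)" using P(2) by (simp add: truncation_def)
  assume "I \<subseteq> ground (truncation n M)"
  hence I: "I \<subseteq> ground M" by (simp add: truncation_def)
  have "card I = sum_list (map (\<lambda>P. cnt I P) Ps)"
    using card_pdisj[OF P(1) finite_subset[OF I assms(2)]] I unfolding P(2) by (simp add: Int_absorb2)
  thus "indep (truncation n M) I \<longleftrightarrow> \<phi> (map (\<lambda>P. cnt I P) Ps) \<and> sum_list (map (\<lambda>P. cnt I P) Ps) \<le> n"
    using P(3)[rule_format, OF I] by (simp add: truncation_def)
qed

section \<open>The constructions yield matroids\<close>

lemma matroid_uniform: "matroid (uniform_matroid k n)"
  unfolding matroid_def
proof (intro conjI ballI allI impI)
  fix I J assume I: "indep (uniform_matroid k n) I" and J: "indep (uniform_matroid k n) J" and "card I < card J"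
  have f: "finite I" using I finite_subset by (auto simp: uniform_matroid_def)
  hence "\<not> J \<subseteq> I" using \<open>card I < card J\<close> card_mono[of I J] by auto
  then obtain e where "e \<in> J" "e \<notin> I" by auto
  thus "\<exists>e\<in>J - I. indep (uniform_matroid k n) (insert e I)"
    using I J f \<open>card I < card J\<close> by (intro bexI[of _ e]) (auto simp: uniform_matroid_def)
next
  fix I J assume I: "indep (uniform_matroid k n) I" and J: "J \<subseteq> I"
  hence "card J \<le> card I" by (intro card_mono) (auto simp: uniform_matroid_def finite_subset)
  thus "indep (uniform_matroid k n) J" using I J by (auto simp: uniform_matroid_def)
qed (auto simp: uniform_matroid_def)

lemma matroid_truncation:
  assumes M: "matroid M" shows "matroid (truncation n M)"
  unfolding matroid_def
proof (intro conjI ballI allI impI)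
  note D = matroidD[OF M]
  have g: "ground (truncation n M) = ground M" "indep (truncation n M) I \<longleftrightarrow> indep M I \<and> card I \<le> n" for I
    by (simp_all add: truncation_def)
  show "finite (ground (truncation n M))" "indep (truncation n M) {}" using D(1,3) g by auto
  show "I \<subseteq> ground (truncation n M)" if "indep (truncation n M) I" for I using that D(2) g by auto
  show "indep (truncation n M) J" if "indep (truncation n M) I" "J \<subseteq> I" for I J
    using that D(4)[of I J] card_mono[OF finite_subset[OF D(2) D(1)], of I J] unfolding g by simp
  show "\<exists>e\<in>J - I. indep (truncation n M) (insert e I)" if "indep (truncation n M) I" "indep (truncation n M) J" "card I < card J" for I J
  proof -
    have "indep M I" "indep M J" using that unfolding g by auto
    from D(5)[OF this that(3)] obtain e where e: "e \<in> J - I" "indep M (insert e I)" by (rule bexE)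
    have "card (insert e I) \<le> card I + 1" by (simp add: card_insert_le_m1 le_SucI card_insert_if)
    thus ?thesis using e that unfolding g by (intro bexI[of _ e]) auto
  qed
qed

lemma matroid_direct_sum:
  assumes M: "matroid M" and M': "matroid M'" shows "matroid (direct_sum M M')"
  unfolding matroid_def
proof (intro conjI ballI allI impI)
  note D = matroidD[OF M] and D' = matroidD[OF M']
  have g: "ground (direct_sum M M') = ground M <+> ground M'" by (simp add: direct_sum_def)
  show "finite (ground (direct_sum M M'))" unfolding g using D(1) D'(1) by simp
  show "I \<subseteq> ground (direct_sum M M')" if "indep (direct_sum M M') I" for I
  proof
    fix x assume "x \<in> I"
    thus "x \<in> ground (direct_sum M M')" using D(2)[of "Inl -` I"] D'(2)[of "Inr -` I"] that unfolding g indep_direct_sum by (cases x) auto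
  qed
  show "indep (direct_sum M M') {}" unfolding indep_direct_sum using D(3) D'(3) by simp
  show "indep (direct_sum M M') J" if "indep (direct_sum M M') I" "J \<subseteq> I" for I J
    using that D(4)[OF _ vimage_mono[OF that(2)]] D'(4)[OF _ vimage_mono[OF that(2)]] unfolding indep_direct_sum by simp
  show "\<exists>e\<in>J - I. indep (direct_sum M M') (insert e I)"
    if I: "indep (direct_sum M M') I" "indep (direct_sum M M') J" "card I < card J" for I J
  proof -
    have c: "card X = card (Inl -` X) + card (Inr -` X)" if "indep (direct_sum M M') X" for X
    proof -
      have "X = (Inl -` X) <+> (Inr -` X)"
      proof (rule set_eqI)
        show "x \<in> X \<longleftrightarrow> x \<in> (Inl -` X) <+> (Inr -` X)" for x by (cases x) auto
      qed
      moreover have "finite (Inl -` X)" "finite (Inr -` X)"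
        using that D(1,2) D'(1,2) finite_subset unfolding indep_direct_sum by metis+
      ultimately show ?thesis using card_Plus by metis
    qed
    have v: "Inl -` insert (Inl x) I = insert x (Inl -` I)" "Inr -` insert (Inl x) I = Inr -` I"
      "Inl -` insert (Inr y) I = Inl -` I" "Inr -` insert (Inr y) I = insert y (Inr -` I)" for x y by auto
    consider "card (Inl -` I) < card (Inl -` J)" | "card (Inr -` I) < card (Inr -` J)"
      using I(3) c[OF I(1)] c[OF I(2)] by linarith
    thus ?thesis
    proof cases
      case 1
      have "indep M (Inl -` I)" "indep M (Inl -` J)" using I unfolding indep_direct_sum by auto
      from D(5)[OF this 1] obtain x where "x \<in> Inl -` J - Inl -` I" "indep M (insert x (Inl -` I))" by (rule bexE)
      thus ?thesis using I by (intro bexI[of _ "Inl x"]) (auto simp: indep_direct_sum v)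
    next
      case 2
      have "indep M' (Inr -` I)" "indep M' (Inr -` J)" using I unfolding indep_direct_sum by auto
      from D'(5)[OF this 2] obtain x where "x \<in> Inr -` J - Inr -` I" "indep M' (insert x (Inr -` I))" by (rule bexE)
      thus ?thesis using I by (intro bexI[of _ "Inr x"]) (auto simp: indep_direct_sum v)
    qed
  qed
qed

lemma indep_free_extension:
  "indep (free_extension M) I \<longleftrightarrow> indep M (Some -` I) \<and> (None \<in> I \<longrightarrow> card (Some -` I) < matroid_rank M)"
proof -
  have e: "I = (if None \<in> I then insert None (Some ` (Some -` I)) else Some ` (Some -` I))"
  proof (rule set_eqI)
    show "x \<in> I \<longleftrightarrow> x \<in> (if None \<in> I then insert None (Some ` (Some -` I)) else Some ` (Some -` I))" for x by (cases x) auto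
  qed
  have s: "Some -` Some ` A = A" "Some -` insert None (Some ` A) = A" for A :: "'a set" by auto
  show ?thesis
  proof (cases "None \<in> I")
    case True
    hence e': "I = insert None (Some ` (Some -` I))" using e by simp
    have "indep (free_extension M) I \<longleftrightarrow> (\<exists>A. I = insert None (Some ` A) \<and> indep M A \<and> card A < matroid_rank M)"
      using True by (auto simp: free_extension_def)
    also have "\<dots> \<longleftrightarrow> indep M (Some -` I) \<and> card (Some -` I) < matroid_rank M" using e' s(2) by metis
    finally show ?thesis using True by simp
  next
    case False
    hence e': "I = Some ` (Some -` I)" using e by simp
    have "indep (free_extension M) I \<longleftrightarrow> (\<exists>A. I = Some ` A \<and> indep M A)"
      using False by (auto simp: free_extension_def)
    also have "\<dots> \<longleftrightarrow> indep M (Some -` I)" using e' s(1) by metis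
    finally show ?thesis using False by simp
  qed
qed

lemma card_option_set: "finite X \<Longrightarrow> card X = card (Some -` X) + (if None \<in> X then 1 else 0)"
proof -
  assume f: "finite X"
  have e: "X = (if None \<in> X then insert None (Some ` (Some -` X)) else Some ` (Some -` X))"
  proof (rule set_eqI)
    show "x \<in> X \<longleftrightarrow> x \<in> (if None \<in> X then insert None (Some ` (Some -` X)) else Some ` (Some -` X))" for x by (cases x) auto
  qed
  have "finite (Some -` X)" by (rule finite_vimageI[OF f]) simp
  moreover have "card (Some ` A) = card A" "finite A \<Longrightarrow> card (insert None (Some ` A)) = card A + 1" for A :: "'a set"
    by (simp_all add: card_image)
  ultimately have "card (insert None (Some ` (Some -` X))) = card (Some -` X) + 1" "card (Some ` (Some -` X)) = card (Some -` X)"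
    by blast+
  thus ?thesis using e by (metis add.right_neutral)
qed

lemma matroid_free_extension:
  assumes M: "matroid M" shows "matroid (free_extension M)"
  unfolding matroid_def
proof (intro conjI ballI allI impI)
  note D = matroidD[OF M]
  have g: "ground (free_extension M) = insert None (Some ` ground M)" by (simp add: free_extension_def)
  show fg: "finite (ground (free_extension M))" unfolding g using D(1) by simp
  show sub: "I \<subseteq> ground (free_extension M)" if "indep (free_extension M) I" for I
  proof
    fix x assume "x \<in> I"
    thus "x \<in> ground (free_extension M)" using D(2)[of "Some -` I"] that unfolding g indep_free_extension by (cases x) auto
  qed
  show "indep (free_extension M) {}" unfolding indep_free_extension using D(3) by simp
  show "indep (free_extension M) J" if I: "indep (free_extension M) I" "J \<subseteq> I" for I J
  proof -
    have v: "Some -` J \<subseteq> Some -` I" using I(2) by auto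
    have "finite (Some -` I)" using I(1) D(1,2) finite_subset unfolding indep_free_extension by metis
    hence "card (Some -` J) \<le> card (Some -` I)" using v by (rule card_mono)
    thus ?thesis using I D(4)[OF _ v] unfolding indep_free_extension by auto
  qed
  show "\<exists>e\<in>J - I. indep (free_extension M) (insert e I)"
    if I: "indep (free_extension M) I" "indep (free_extension M) J" "card I < card J" for I J
  proof -
    define A B where "A = Some -` I" and "B = Some -` J"
    have fI: "finite I" "finite J" using sub[OF I(1)] sub[OF I(2)] fg finite_subset by blast+
    have c: "card I = card A + (if None \<in> I then 1 else 0)" "card J = card B + (if None \<in> J then 1 else 0)"
      unfolding A_def B_def by (rule card_option_set[OF fI(1)], rule card_option_set[OF fI(2)])
    have AB: "indep M A" "indep M B" "None \<in> I \<longrightarrow> card A < matroid_rank M" "None \<in> J \<longrightarrow> card B < matroid_rank M"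
      using I unfolding indep_free_extension A_def B_def by auto
    have rB: "card B \<le> matroid_rank M" unfolding matroid_rank_def by (rule rank_of_ge[OF M AB(2) D(2)[OF AB(2)]])
    have v: "Some -` insert (Some x) I = insert x A" "Some -` insert None I = A" for x unfolding A_def by auto
    show ?thesis
    proof (cases "card A < card B")
      case True
      from D(5)[OF AB(1,2) this] obtain e where e: "e \<in> B - A" "indep M (insert e A)" by (rule bexE)
      have "finite A" using AB(1) D(1,2) finite_subset by metis
      hence "card (insert e A) = card A + 1" using e by simp
      hence "indep (free_extension M) (insert (Some e) I)" unfolding indep_free_extension v
        using e(2) c I(3) rB AB(4) by (auto split: if_splits)
      thus ?thesis using e(1) by (intro bexI[of _ "Some e"]) (auto simp: A_def B_def)
    next
      case False
      hence n: "None \<in> J" "None \<notin> I" "card A = card B" using c I(3) by (auto split: if_splits)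
      hence "indep (free_extension M) (insert None I)" unfolding indep_free_extension v using AB by auto
      thus ?thesis using n by (intro bexI[of _ None]) auto
    qed
  qed
qed

lemmas matroid_constructions = matroid_uniform matroid_truncation matroid_direct_sum matroid_free_extension

lemma matroid_B: "matroid (B_matroid n k)" and matroid_D: "matroid (D_matroid n)"
  unfolding B_matroid_def D_matroid_def by (intro matroid_constructions)+

lemma looks_trunc_two:
  "mlooks (truncation n (direct_sum (uniform_matroid a p) (uniform_matroid b q))) [p, q] (phi_FGH a b n)"
proof -
  have "matroid (direct_sum (uniform_matroid a p) (uniform_matroid b q))" by (intro matroid_constructions)
  note f = matroidD(1)[OF this] matroidD(1)[OF matroid_truncation[OF this]]
  note L = looks_truncation[OF looks_direct_sum[OF looks_uniform looks_uniform] f(1), unfolded append_Cons append_Nil]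
  show ?thesis by (rule looks_cong[OF L f(2)]) (auto simp: length_Suc_conv phi_FGH_def)
qed

lemma looks_B: "mlooks (B_matroid n k) [n, n, k] (phi_B n k)"
proof -
  have "matroid (direct_sum (direct_sum (uniform_matroid (n - 1) n) (uniform_matroid (n - 1) n)) (uniform_matroid (k - 1) k))"
    by (intro matroid_constructions)
  note f = matroidD(1)[OF this] matroidD(1)[OF matroid_B[of n k]]
  note L = looks_truncation[where n = n, OF looks_direct_sum[OF looks_direct_sum[OF looks_uniform looks_uniform] looks_uniform] f(1), unfolded append_Cons append_Nil, folded B_matroid_def]
  show ?thesis by (rule looks_cong[OF L f(2)]) (auto simp: length_Suc_conv phi_B_def)
qed

lemma looks_1a:
  "mlooks (direct_sum (direct_sum (uniform_matroid 1 2) (uniform_matroid 1 2)) (uniform_matroid 1 2)) [2, 2, 2] phi_1a"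
proof -
  have "matroid (direct_sum (direct_sum (uniform_matroid 1 2) (uniform_matroid 1 2)) (uniform_matroid 1 2))"
    by (intro matroid_constructions)
  note f = matroidD(1)[OF this]
  note L = looks_direct_sum[OF looks_direct_sum[OF looks_uniform looks_uniform] looks_uniform, unfolded append_Cons append_Nil]
  show ?thesis by (rule looks_cong[OF L f]) (auto simp: length_Suc_conv phi_1a_def)
qed

text \<open>The two summands \<open>U_{1,1}\<close> arrive as separate blocks of size one. They are
  merged into one block of size two, because independence depends only on their total count.\<close>

lemma looks_1b:
  "mlooks (direct_sum (truncation 2 (direct_sum (direct_sum (uniform_matroid 1 2) (uniform_matroid 1 1)) (uniform_matroid 1 1)))
     (uniform_matroid 1 2)) [2, 2, 2] phi_1b" (is "mlooks ?M _ _")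
proof -
  have m: "matroid (direct_sum (direct_sum (uniform_matroid 1 2) (uniform_matroid 1 1)) (uniform_matroid 1 1))" "matroid ?M"
    by (intro matroid_constructions)+
  note f = matroidD(1)[OF m(1)] matroidD(1)[OF m(2)]
  note L = looks_direct_sum[OF looks_truncation[OF looks_direct_sum[OF looks_direct_sum[OF looks_uniform looks_uniform] looks_uniform] f(1)] looks_uniform, unfolded append_Cons append_Nil]
  have "mlooks ?M [2, 1, 1, 2] (\<lambda>c. c ! 0 \<le> 1 \<and> c ! 0 + c ! 1 + c ! 2 \<le> 2 \<and> c ! 3 \<le> 1)"
  proof (rule looks_cong[OF L f(2)])
    fix c :: "nat list" assume "length c = length [2, 1, 1, 2 :: nat]" "\<forall>i<length [2, 1, 1, 2 :: nat]. c ! i \<le> [2, 1, 1, 2] ! i"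
    note h = this
    have c: "length c = 4" "c ! 1 \<le> 1" "c ! 2 \<le> 1"
      using h(1) h(2)[rule_format, of 1] h(2)[rule_format, of 2] by simp_all
    obtain p q s t where "c = [p, q, s, t]" using c(1) by (auto simp: length_Suc_conv numeral_eq_Suc)
    thus "((\<lambda>c. (((\<lambda>c. c ! 0 \<le> 1) (take (length [2 :: nat]) (take (length [2, 1 :: nat]) c)) \<and> (\<lambda>c. c ! 0 \<le> 1) (drop (length [2 :: nat]) (take (length [2, 1 :: nat]) c))) \<and>
        (\<lambda>c. c ! 0 \<le> 1) (drop (length [2, 1 :: nat]) c)) \<and> sum_list c \<le> 2) (take (length [2, 1, 1 :: nat]) c) \<and> (\<lambda>c. c ! 0 \<le> 1) (drop (length [2, 1, 1 :: nat]) c))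
      \<longleftrightarrow> (c ! 0 \<le> 1 \<and> c ! 0 + c ! 1 + c ! 2 \<le> 2 \<and> c ! 3 \<le> 1)"
      using c by auto
  qed
  from this obtain F G X Y where P: "card F = 2" "card G = 1" "card X = 1" "card Y = 2"
    "(F \<union> G) \<inter> (X \<union> Y) = {}" "F \<inter> G = {}" "X \<inter> Y = {}" "F \<union> G \<union> (X \<union> Y) = ground ?M"
    "\<forall>I. I \<subseteq> ground ?M \<longrightarrow> (indep ?M I \<longleftrightarrow> (\<lambda>c. c ! 0 \<le> 1 \<and> c ! 0 + c ! 1 + c ! 2 \<le> 2 \<and> c ! 3 \<le> 1) [cnt I F, cnt I G, cnt I X, cnt I Y])"
    by (rule looks4E)
  have dj: "G \<inter> X = {}" "F \<inter> Y = {}" "F \<inter> (G \<union> X) = {}" "Y \<inter> (G \<union> X) = {}" using P(5-7) by blast+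
  have fin: "finite G" "finite X" using P(2,3) by (simp_all add: card_ge_0_finite)
  show ?thesis unfolding looks3
  proof (rule exI[of _ F], rule exI[of _ Y], rule exI[of _ "G \<union> X"], intro conjI allI impI)
    show "card (G \<union> X) = 2" using card_Un_disjoint[OF fin dj(1)] P by simp
    show "F \<union> Y \<union> (G \<union> X) = ground ?M" using P(8) by blast
    fix I assume I: "I \<subseteq> ground ?M"
    show "indep ?M I \<longleftrightarrow> phi_1b [cnt I F, cnt I Y, cnt I (G \<union> X)]"
      using P(9)[rule_format, OF I] card_Int_Un[OF finite_subset[OF I f(2)] dj(1)] by (auto simp: phi_1b_def)
  qed (use P dj in auto)
qed

text \<open>The new element \<open>None\<close> and the coloop of the direct sum are interchangeable
  in the free extension and make up the third block. The rank \<open>n\<close> is computed first,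
  because it decides when \<open>None\<close> may be added.\<close>

lemma looks_D: assumes n: "3 \<le> n" shows "mlooks (D_matroid n) [n - 1, n - 1, 2] (phi_D n)"
proof -
  define M where "M = direct_sum (truncation (n - 1) (direct_sum (uniform_matroid (n - 2) (n - 1)) (uniform_matroid (n - 2) (n - 1)))) (uniform_matroid 1 1)"
  have D: "D_matroid n = free_extension M" unfolding D_matroid_def M_def ..
  have m: "matroid (direct_sum (uniform_matroid (n - 2) (n - 1)) (uniform_matroid (n - 2) (n - 1)))" "matroid M"
    unfolding M_def by (intro matroid_constructions)+
  note f = matroidD(1)[OF m(1)] matroidD(1)[OF m(2)]
  note L = looks_direct_sum[OF looks_truncation[OF looks_direct_sum[OF looks_uniform looks_uniform] f(1)] looks_uniform, unfolded append_Cons append_Nil, of "n - 1" 1 1, folded M_def]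
  have "mlooks M [n - 1, n - 1, 1] (\<lambda>c. c ! 0 \<le> n - 2 \<and> c ! 1 \<le> n - 2 \<and> c ! 0 + c ! 1 \<le> n - 1)"
    by (rule looks_cong[OF L f(2)]) (auto simp: length_Suc_conv All_less_Suc)
  then obtain X Y K where P: "card X = n - 1" "card Y = n - 1" "card K = 1" "X \<inter> Y = {}" "X \<inter> K = {}" "Y \<inter> K = {}"
    "X \<union> Y \<union> K = ground M"
    "\<forall>I. I \<subseteq> ground M \<longrightarrow> (indep M I \<longleftrightarrow> (\<lambda>c. c ! 0 \<le> n - 2 \<and> c ! 1 \<le> n - 2 \<and> c ! 0 + c ! 1 \<le> n - 1) [cnt I X, cnt I Y, cnt I K])"
    unfolding looks3 by (elim exE conjE) (rule that)
  have ind: "indep M I \<longleftrightarrow> cnt I X \<le> n - 2 \<and> cnt I Y \<le> n - 2 \<and> cnt I X + cnt I Y \<le> n - 1" if "I \<subseteq> ground M" for I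
    using P(8)[rule_format, OF that] by simp
  have dj: "(X \<union> Y) \<inter> K = {}" using P(5,6) by blast
  have fK: "finite K" by (rule finite_subset[OF _ f(2)]) (use P(7) in blast)
  have tot: "card I = cnt I X + cnt I Y + cnt I K" if "I \<subseteq> ground M" for I
  proof -
    have fI: "finite I" by (rule finite_subset[OF that f(2)])
    have "I \<inter> (X \<union> Y \<union> K) = I" using that P(7) by blast
    thus ?thesis using card_Int_Un[OF fI dj] card_Int_Un[OF fI P(4)] by simp
  qed
  have rank: "matroid_rank M = n"
  proof (rule antisym)
    obtain I where I: "indep M I" "I \<subseteq> ground M" "card I = matroid_rank M"
      using rank_of_obtain[OF m(2)] unfolding matroid_rank_def by metis
    show "matroid_rank M \<le> n" using ind[OF I(2)] tot[OF I(2)] I(1,3) cnt_le[OF fK, of I] P(3) n by auto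
    have le: "n - 2 \<le> card X" "1 \<le> card Y" "1 \<le> card K" using P(1-3) n by auto
    obtain J where J: "J \<subseteq> X \<union> Y \<union> K" "card J = n - 2 + 1 + 1" "cnt J X = n - 2" "cnt J Y = 1" "cnt J K = 1"
      using counts_ex[OF P(4) dj le] by blast
    have JM: "J \<subseteq> ground M" using J(1) P(7) by simp
    have "indep M J" using ind[OF JM] J n by auto
    from rank_of_ge[OF m(2) this JM] show "n \<le> matroid_rank M" using J(2) n by (simp add: matroid_rank_def)
  qed
  show ?thesis unfolding D looks3
  proof (rule exI[of _ "Some ` X"], rule exI[of _ "Some ` Y"], rule exI[of _ "insert None (Some ` K)"], intro conjI allI impI)
    show "card (Some ` X) = n - 1" "card (Some ` Y) = n - 1" using P by (simp_all add: card_image)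
    show "card (insert None (Some ` K)) = 2" using P(3) fK by (simp add: card_image)
    show "Some ` X \<union> Some ` Y \<union> insert None (Some ` K) = ground (free_extension M)"
      unfolding free_extension_def using P(7) by auto
    fix I assume I: "I \<subseteq> ground (free_extension M)"
    have fI: "finite I" by (rule finite_subset[OF I]) (use f(2) in \<open>simp add: free_extension_def\<close>)
    have sI: "Some -` I \<subseteq> ground M" using I by (auto simp: free_extension_def)
    have "card (I \<inter> insert None (Some ` K)) = (if None \<in> I then 1 else 0) + card (Some -` I \<inter> K)"
      using cnt_ins2[OF fI, of None "Some ` K"] card_Int_image[of Some I K] by auto
    moreover have "card (Some -` I \<inter> K) \<le> 1" using cnt_le[OF fK, of "Some -` I"] P(3) by simp
    ultimately show "indep (free_extension M) I \<longleftrightarrow> phi_D n [card (I \<inter> Some ` X), card (I \<inter> Some ` Y), card (I \<inter> insert None (Some ` K))]"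
      unfolding indep_free_extension ind[OF sI] rank tot[OF sI]
      using n by (auto simp: phi_D_def card_Int_image)
  qed (use P in auto)
qed

text \<open>The rim edges come first, then the spokes, in such an order that the triangles through
  the hub are the index triples \<open>0 3 4\<close>, \<open>1 3 5\<close> and \<open>2 4 5\<close>
  of \<open>phi_whirl\<close>, and the rim is \<open>0 1 2\<close>.\<close>

abbreviation K4 :: "nat set set" where
  "K4 \<equiv> {{1, 2}, {2, 3}, {1, 3}, {0, 2}, {0, 1}, {0, 3}}"

lemma wheel_ground: "{e :: nat set. e \<subseteq> {0..3} \<and> card e = 2} = K4" (is "?L = ?R")
proof (intro equalityI subsetI)
  have i: "i = 0 \<or> i = 1 \<or> i = 2 \<or> i = 3" if "i \<in> {0..3}" for i :: nat using that by auto
  fix e :: "nat set" assume "e \<in> ?L"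
  then obtain x y where e: "e = {x, y}" "x \<noteq> y" "x \<in> {0..3}" "y \<in> {0..3}" by (auto simp: card_2_iff)
  show "e \<in> ?R" using i[OF e(3)] i[OF e(4)] e(2) unfolding e(1) by (elim disjE) (simp_all add: doubleton_eq_iff)
qed auto

lemma cycle_edges_3: "cycle_edges [a, b, c] = {{a, b}, {b, c}, {c, a}}"
proof -
  have "cycle_edges [a, b, c] = (\<lambda>i. {[a, b, c] ! i, [a, b, c] ! (Suc i mod 3)}) ` {..<3}"
    unfolding cycle_edges_def by auto
  also have "{..<3} = {0, 1, 2 :: nat}" by auto
  finally show ?thesis by simp
qed

lemma cycle_edges_4: "cycle_edges [a, b, c, d] = {{a, b}, {b, c}, {c, d}, {d, a}}"
proof -
  have "cycle_edges [a, b, c, d] = (\<lambda>i. {[a, b, c, d] ! i, [a, b, c, d] ! (Suc i mod 4)}) ` {..<4}"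
    unfolding cycle_edges_def by auto
  also have "{..<4} = {0, 1, 2, 3 :: nat}" by auto
  finally show ?thesis by simp
qed

lemma cnt1: "cnt X {e} = (if e \<in> X then 1 else 0)"
  by simp

lemma card_sub6:
  assumes "distinct [x, y, k, a, b, c]" "X \<subseteq> {x, y, k, a, b, c}"
  shows "card X = (if x \<in> X then 1 else 0) + (if y \<in> X then 1 else 0) + (if k \<in> X then 1 else 0) +
    (if a \<in> X then 1 else 0) + (if b \<in> X then 1 else 0) + (if c \<in> X then 1 else 0)"
proof -
  have f: "finite X" using assms(2) finite_subset by blast
  have "x \<notin> {y, k, a, b, c}" "y \<notin> {k, a, b, c}" "k \<notin> {a, b, c}" "a \<notin> {b, c}" "b \<notin> {c}" using assms(1) by simp_all
  note d = this
  have "cnt X {x, y, k, a, b, c} = cnt X {x} + (cnt X {y} + (cnt X {k} + (cnt X {a} + (cnt X {b} + cnt X {c}))))"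
    unfolding cnt_ins2[OF f d(1)] cnt_ins2[OF f d(2)] cnt_ins2[OF f d(3)] cnt_ins2[OF f d(4)] cnt_ins2[OF f d(5)] ..
  moreover have "X \<inter> {x, y, k, a, b, c} = X" using assms(2) by (rule Int_absorb2)
  ultimately show ?thesis unfolding cnt1 by (simp only: add.assoc)
qed

text \<open>On four vertices a cycle has length three or four. The bound
  \<open>card X \<le> 3\<close> excludes a four-cycle, and conversely any four edges contain a
  triangle or a four-cycle.\<close>

lemma wheel_indep:
  assumes X: "X \<subseteq> K4"
  shows "indep wheel3 X \<longleftrightarrow> \<not> ({1, 2} \<in> X \<and> {0, 2} \<in> X \<and> {0, 1} \<in> X) \<and> \<not> ({2, 3} \<in> X \<and> {0, 2} \<in> X \<and> {0, 3} \<in> X) \<and>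
    \<not> ({1, 3} \<in> X \<and> {0, 1} \<in> X \<and> {0, 3} \<in> X) \<and> \<not> ({1, 2} \<in> X \<and> {2, 3} \<in> X \<and> {1, 3} \<in> X) \<and> card X \<le> 3" (is "_ \<longleftrightarrow> ?R")
proof -
  have fX: "finite X" using X finite_subset by blast
  have w: "indep wheel3 X \<longleftrightarrow> \<not> (\<exists>vs. 3 \<le> length vs \<and> distinct vs \<and> cycle_edges vs \<subseteq> X)"
    unfolding wheel3_def cycle_matroid_def wheel_ground using X by simp
  have cX: "card X = (if {1, 2} \<in> X then 1 else 0) + (if {2, 3} \<in> X then 1 else 0) + (if {1, 3} \<in> X then 1 else 0) +
    (if {0, 2} \<in> X then 1 else 0) + (if {0, 1} \<in> X then 1 else 0) + (if {0, 3} \<in> X then 1 else 0)"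
    by (rule card_sub6[OF _ X]) (simp add: doubleton_eq_iff)
  show ?thesis
  proof
    assume "indep wheel3 X"
    hence nc: "\<not> cycle_edges vs \<subseteq> X" if "3 \<le> length vs" "distinct vs" for vs using w that by blast
    have "\<not> cycle_edges [0, 1, 2] \<subseteq> X" "\<not> cycle_edges [0, 2, 3] \<subseteq> X" "\<not> cycle_edges [0, 1, 3] \<subseteq> X" "\<not> cycle_edges [1, 2, 3] \<subseteq> X"
      "\<not> cycle_edges [0, 1, 2, 3] \<subseteq> X" "\<not> cycle_edges [0, 1, 3, 2] \<subseteq> X" "\<not> cycle_edges [0, 2, 1, 3] \<subseteq> X"
      by (rule nc; simp)+
    thus ?R unfolding cX cycle_edges_3 cycle_edges_4 insert_subset
      by (simp add: insert_commute split: if_splits) blast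
  next
    assume R: ?R
    show "indep wheel3 X" unfolding w
    proof
      assume "\<exists>vs. 3 \<le> length vs \<and> distinct vs \<and> cycle_edges vs \<subseteq> X"
      then obtain vs where vs: "3 \<le> length vs" "distinct vs" "cycle_edges vs \<subseteq> X" by blast
      have "set vs \<subseteq> {0..3}"
      proof
        fix v assume "v \<in> set vs"
        then obtain i where i: "i < length vs" "v = vs ! i" by (auto simp: in_set_conv_nth)
        hence "{vs ! i, vs ! (Suc i mod length vs)} \<in> X" using vs(3) unfolding cycle_edges_def by blast
        hence "v \<in> \<Union> K4" using X i(2) by blast
        thus "v \<in> {0..3}" by auto
      qed
      hence "length vs \<le> 4" using card_mono[of "{0..3}" "set vs"] distinct_card[OF vs(2)] by simp
      then consider "length vs = 3" | "length vs = 4" using vs(1) by linarith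
      thus False
      proof cases
        case 1
        then obtain a b c where v: "vs = [a, b, c]" by (auto simp: length_Suc_conv numeral_eq_Suc)
        have "a \<in> {0..3}" "b \<in> {0..3}" "c \<in> {0..3}" using \<open>set vs \<subseteq> {0..3}\<close> v by auto
        moreover have i: "i = 0 \<or> i = 1 \<or> i = 2 \<or> i = 3" if "i \<in> {0..3}" for i :: nat using that by auto
        ultimately have "a = 0 \<or> a = 1 \<or> a = 2 \<or> a = 3" "b = 0 \<or> b = 1 \<or> b = 2 \<or> b = 3" "c = 0 \<or> c = 1 \<or> c = 2 \<or> c = 3" by blast+
        moreover have "a \<noteq> b" "b \<noteq> c" "a \<noteq> c" "{a, b} \<in> X" "{b, c} \<in> X" "{c, a} \<in> X"
          using vs(2,3) unfolding v cycle_edges_3 by auto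
        ultimately show False using R by (elim disjE) (simp_all add: insert_commute)
      next
        case 2
        then obtain a b c d where v: "vs = [a, b, c, d]" by (auto simp: length_Suc_conv numeral_eq_Suc)
        have "card (cycle_edges vs) = 4" using vs(2) unfolding v cycle_edges_4 by (auto simp: doubleton_eq_iff)
        thus False using card_mono[OF fX vs(3)] R by simp
      qed
    qed
  qed
qed

lemma wheel_distinct: "distinct [{1, 2}, {2, 3}, {1, 3}, {0, 2}, {0, 1}, {0, 3 :: nat}]"
  by (simp add: doubleton_eq_iff)

lemma ground_wheel: "ground wheel3 = K4"
  unfolding wheel3_def cycle_matroid_def wheel_ground by simp

lemma ground_whirl: "ground whirl3 = K4"
  unfolding whirl3_def relaxation_def matroid_of_bases_def ground_wheel by simp

lemma looks_wheel: "mlooks wheel3 [1, 1, 1, 1, 1, 1] phi_wheel"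
  unfolding looks6
proof (rule exI[of _ "{1, 2}"], rule exI[of _ "{2, 3}"], rule exI[of _ "{1, 3}"], rule exI[of _ "{0, 2}"], rule exI[of _ "{0, 1}"], rule exI[of _ "{0, 3}"],
    intro conjI allI impI wheel_distinct ground_wheel)
  fix X assume "X \<subseteq> ground wheel3"
  hence X: "X \<subseteq> K4" unfolding ground_wheel .
  show "indep wheel3 X \<longleftrightarrow> phi_wheel [card (X \<inter> {{1, 2}}), card (X \<inter> {{2, 3}}), card (X \<inter> {{1, 3}}), card (X \<inter> {{0, 2}}), card (X \<inter> {{0, 1}}), card (X \<inter> {{0, 3}})]"
    unfolding wheel_indep[OF X] card_sub6[OF wheel_distinct X] phi_wheel_def phi_whirl_def cnt1
    by (cases "{1, 2} \<in> X"; cases "{2, 3} \<in> X"; cases "{1, 3} \<in> X"; cases "{0, 2} \<in> X"; cases "{0, 1} \<in> X"; cases "{0, 3} \<in> X"; simp)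
qed

text \<open>All proper subsets of the rim are independent already, so the relaxation adds the rim
  and nothing else.\<close>

lemma indep_whirl:
  assumes X: "X \<subseteq> K4"
  shows "indep whirl3 X \<longleftrightarrow> indep wheel3 X \<or> X = {{1, 2}, {2, 3}, {1, 3}}"
proof -
  have i: "indep whirl3 X \<longleftrightarrow> (\<exists>B\<in>insert {{1, 2}, {2, 3}, {1, 3}} (bases wheel3). X \<subseteq> B)"
    by (simp add: whirl3_def relaxation_def matroid_of_bases_def)
  show ?thesis
  proof
    assume "indep whirl3 X"
    then obtain B where "B = {{1, 2}, {2, 3}, {1, 3}} \<or> B \<in> bases wheel3" "X \<subseteq> B" using i by blast
    thus "indep wheel3 X \<or> X = {{1, 2}, {2, 3}, {1, 3}}"
    proof (elim disjE)
      assume B: "B \<in> bases wheel3" "X \<subseteq> B"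
      hence "indep wheel3 B" by (simp add: bases_def)
      hence "\<not> (\<exists>vs. 3 \<le> length vs \<and> distinct vs \<and> cycle_edges vs \<subseteq> B)"
        unfolding wheel3_def cycle_matroid_def by simp
      hence "\<not> (\<exists>vs. 3 \<le> length vs \<and> distinct vs \<and> cycle_edges vs \<subseteq> X)"
        using subset_trans[OF _ B(2)] by blast
      hence "indep wheel3 X" using X unfolding wheel3_def cycle_matroid_def wheel_ground by simp
      thus ?thesis ..
    next
      assume B: "B = {{1, 2}, {2, 3}, {1, 3}}" "X \<subseteq> B"
      have "{0, 2} \<notin> B" "{0, 1} \<notin> B" "{0, 3} \<notin> B" unfolding B(1) by (simp_all add: doubleton_eq_iff)
      hence n: "{0, 2} \<notin> X" "{0, 1} \<notin> X" "{0, 3} \<notin> X" using subsetD[OF B(2)] by blast+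
      show ?thesis
      proof (cases "{1, 2} \<in> X \<and> {2, 3} \<in> X \<and> {1, 3} \<in> X")
        case True
        hence "B \<subseteq> X" unfolding B(1) by simp
        hence "X = B" by (rule equalityI[OF B(2)])
        thus ?thesis unfolding B(1) ..
      next
        case False
        hence "indep wheel3 X" unfolding wheel_indep[OF X] card_sub6[OF wheel_distinct X] by (simp add: n)
        thus ?thesis ..
      qed
    qed
  next
    assume "indep wheel3 X \<or> X = {{1, 2}, {2, 3}, {1, 3}}"
    thus "indep whirl3 X"
    proof
      assume w: "indep wheel3 X"
      have "indeps wheel3 \<subseteq> Pow (ground wheel3)" unfolding wheel3_def cycle_matroid_def by auto
      hence "finite (indeps wheel3)" by (rule finite_subset) (simp add: ground_wheel)
      from finite_has_maximal2[OF this w] obtain B where "indep wheel3 B" "X \<subseteq> B" "\<forall>I\<in>indeps wheel3. B \<subseteq> I \<longrightarrow> B = I" by blast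
      thus ?thesis unfolding i bases_def by blast
    qed (use i in blast)
  qed
qed

lemma looks_whirl: "mlooks whirl3 [1, 1, 1, 1, 1, 1] phi_whirl"
  unfolding looks6
proof (rule exI[of _ "{1, 2}"], rule exI[of _ "{2, 3}"], rule exI[of _ "{1, 3}"], rule exI[of _ "{0, 2}"], rule exI[of _ "{0, 1}"], rule exI[of _ "{0, 3}"],
    intro conjI allI impI wheel_distinct ground_whirl)
  fix X assume "X \<subseteq> ground whirl3"
  hence X: "X \<subseteq> K4" unfolding ground_whirl .
  have rim: "X = {{1, 2}, {2, 3}, {1, 3}} \<longleftrightarrow> {1, 2} \<in> X \<and> {2, 3} \<in> X \<and> {1, 3} \<in> X \<and> {0, 2} \<notin> X \<and> {0, 1} \<notin> X \<and> {0, 3} \<notin> X"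
  proof
    assume "X = {{1, 2}, {2, 3}, {1, 3}}"
    thus "{1, 2} \<in> X \<and> {2, 3} \<in> X \<and> {1, 3} \<in> X \<and> {0, 2} \<notin> X \<and> {0, 1} \<notin> X \<and> {0, 3} \<notin> X"
      by (simp add: doubleton_eq_iff)
  next
    assume a: "{1, 2} \<in> X \<and> {2, 3} \<in> X \<and> {1, 3} \<in> X \<and> {0, 2} \<notin> X \<and> {0, 1} \<notin> X \<and> {0, 3} \<notin> X"
    show "X = {{1, 2}, {2, 3}, {1, 3}}"
    proof (rule equalityI)
      show "X \<subseteq> {{1, 2}, {2, 3}, {1, 3}}"
      proof
        fix e assume e: "e \<in> X"
        from subsetD[OF X e] have "e \<in> {{1, 2}, {2, 3}, {1, 3}} \<or> e = {0, 2} \<or> e = {0, 1} \<or> e = {0, 3}"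
          unfolding insert_iff empty_iff by argo
        thus "e \<in> {{1, 2}, {2, 3}, {1, 3}}" using a e by metis
      qed
    qed (use a in simp)
  qed
  show "indep whirl3 X \<longleftrightarrow> phi_whirl [card (X \<inter> {{1, 2}}), card (X \<inter> {{2, 3}}), card (X \<inter> {{1, 3}}), card (X \<inter> {{0, 2}}), card (X \<inter> {{0, 1}}), card (X \<inter> {{0, 3}})]"
    unfolding indep_whirl[OF X] rim wheel_indep[OF X] card_sub6[OF wheel_distinct X] phi_whirl_def cnt1
    by (cases "{1, 2} \<in> X"; cases "{2, 3} \<in> X"; cases "{1, 3} \<in> X"; cases "{0, 2} \<in> X"; cases "{0, 1} \<in> X"; cases "{0, 3} \<in> X"; simp)
qed

text \<open>A concrete candidate for A_n, defined by its counting description. In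
  \<open>is_A_iso\<close> the matroid axioms for it are transferred from the given matroid along an
  isomorphism.\<close>

definition A_matroid :: "nat \<Rightarrow> A_element matroid" where
  "A_matroid n = \<lparr>ground = {X_elem, Y_elem} \<union> A_elem ` {2..n} \<union> B_elem ` {2..n},
     indeps = {I. I \<subseteq> {X_elem, Y_elem} \<union> A_elem ` {2..n} \<union> B_elem ` {2..n} \<and>
       phi_A n [cnt I {X_elem}, cnt I {Y_elem}, card (I \<inter> A_elem ` {2..n}), card (I \<inter> B_elem ` {2..n})]}\<rparr>"

lemma card_A_line: "card (A_elem ` {2..n}) = n - 1" "card (B_elem ` {2..n}) = n - 1"
  by (simp_all add: card_image inj_on_def)

lemma looks_A_ground:
  assumes "ground A = {X_elem, Y_elem} \<union> A_elem ` {2..n} \<union> B_elem ` {2..n}"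
    and "\<And>I. I \<subseteq> ground A \<Longrightarrow> indep A I \<longleftrightarrow> phi_A n [cnt I {X_elem}, cnt I {Y_elem}, card (I \<inter> A_elem ` {2..n}), card (I \<inter> B_elem ` {2..n})]"
  shows "mlooks A [1, 1, n - 1, n - 1] (phi_A n)"
proof (rule looksI[of "[{X_elem}, {Y_elem}, A_elem ` {2..n}, B_elem ` {2..n}]"])
  show "map card [{X_elem}, {Y_elem}, A_elem ` {2..n}, B_elem ` {2..n}] = [1, 1, n - 1, n - 1]" by (simp add: card_A_line)
  show "pdisj [{X_elem}, {Y_elem}, A_elem ` {2..n}, B_elem ` {2..n}]" by auto
  show "\<Union>(set [{X_elem}, {Y_elem}, A_elem ` {2..n}, B_elem ` {2..n}]) = ground A" using assms(1) by auto
qed (use assms(2) in simp)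

lemma looks_A: "mlooks (A_matroid n) [1, 1, n - 1, n - 1] (phi_A n)"
  by (rule looks_A_ground) (simp_all add: A_matroid_def)

lemma A_line_count:
  assumes "finite I"
  shows "card (I \<inter> insert X_elem (A_elem ` {2..n})) = cnt I {X_elem} + card (I \<inter> A_elem ` {2..n})"
    "card (I \<inter> insert X_elem (B_elem ` {2..n})) = cnt I {X_elem} + card (I \<inter> B_elem ` {2..n})"
  by (rule cnt_ins2[OF assms]; force)+

lemma A_total_count:
  assumes "I \<subseteq> {X_elem, Y_elem} \<union> A_elem ` {2..n} \<union> B_elem ` {2..n}"
  shows "card I = cnt I {X_elem} + cnt I {Y_elem} + card (I \<inter> A_elem ` {2..n}) + card (I \<inter> B_elem ` {2..n})"
proof -
  have f: "finite I" by (rule finite_subset[OF assms]) simp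
  have "{X_elem} \<inter> {Y_elem} = {}" "A_elem ` {2..n} \<inter> B_elem ` {2..n} = {}"
    "({X_elem} \<union> {Y_elem}) \<inter> (A_elem ` {2..n} \<union> B_elem ` {2..n}) = {}" by auto
  note c = card_Int_Un[OF f this(1)] card_Int_Un[OF f this(2)] card_Int_Un[OF f this(3)]
  have "I \<inter> ({X_elem} \<union> {Y_elem} \<union> (A_elem ` {2..n} \<union> B_elem ` {2..n})) = I" using assms by blast
  thus ?thesis using c by simp
qed

text \<open>In a paving matroid of rank \<open>n\<close>, a dependent set with at most
  \<open>n\<close> elements has exactly \<open>n\<close> elements and rank \<open>n - 1\<close>. Its
  closure is a dependent hyperplane, hence one of the two given ones, and the set exceeds the bound
  there.\<close>

lemma is_A_looks:
  assumes A: "is_A n A" and n: "3 \<le> n"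
  shows "mlooks A [1, 1, n - 1, n - 1] (phi_A n)"
proof (rule looks_A_ground)
  have M: "matroid A" and g: "ground A = {X_elem, Y_elem} \<union> A_elem ` {2..n} \<union> B_elem ` {2..n}"
    and rk: "rank_of A (ground A) = n" and pav: "paving A"
    and hyp: "{H \<in> hyperplanes A. \<not> indep A H} = {insert X_elem (A_elem ` {2..n}), insert X_elem (B_elem ` {2..n})}"
    using A unfolding is_A_def matroid_rank_def by auto
  show "ground A = {X_elem, Y_elem} \<union> A_elem ` {2..n} \<union> B_elem ` {2..n}" by (rule g)
  interpret rank_matroid "ground A" "rank_of A" by (rule rank_matroid_rank_of[OF M])
  note D = matroidD[OF M]
  fix I assume I: "I \<subseteq> ground A"
  have fI: "finite I" by (rule finite_sub[OF I])
  note ln = A_line_count[OF fI, of n] and tot = A_total_count[OF I[unfolded g]]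
  have phi: "phi_A n [cnt I {X_elem}, cnt I {Y_elem}, card (I \<inter> A_elem ` {2..n}), card (I \<inter> B_elem ` {2..n})] \<longleftrightarrow>
    card (I \<inter> insert X_elem (A_elem ` {2..n})) \<le> n - 1 \<and> card (I \<inter> insert X_elem (B_elem ` {2..n})) \<le> n - 1 \<and> card I \<le> n"
    unfolding ln tot by (simp add: phi_A_def numeral_2_eq_2 numeral_3_eq_3)
  have rH: "rank_of A H = n - 1" if "H \<in> {insert X_elem (A_elem ` {2..n}), insert X_elem (B_elem ` {2..n})}" for H
    using that unfolding hyp[symmetric] hyperplanes_def matroid_rank_def rk by auto
  show "indep A I \<longleftrightarrow> phi_A n [cnt I {X_elem}, cnt I {Y_elem}, card (I \<inter> A_elem ` {2..n}), card (I \<inter> B_elem ` {2..n})]"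
    unfolding phi
  proof
    assume i: "indep A I"
    have "cnt I H \<le> rank_of A H" for H by (rule rank_of_ge[OF M D(4)[OF i]]) auto
    thus "card (I \<inter> insert X_elem (A_elem ` {2..n})) \<le> n - 1 \<and> card (I \<inter> insert X_elem (B_elem ` {2..n})) \<le> n - 1 \<and> card I \<le> n"
      using rH rank_of_ge[OF M i I] rk by (metis insertCI)
  next
    assume p: "card (I \<inter> insert X_elem (A_elem ` {2..n})) \<le> n - 1 \<and> card (I \<inter> insert X_elem (B_elem ` {2..n})) \<le> n - 1 \<and> card I \<le> n"
    show "indep A I"
    proof (rule ccontr)
      assume ni: "\<not> indep A I"
      have "finite {D. D \<subseteq> I \<and> \<not> indep A D}" by (rule finite_subset[of _ "Pow I"]) (use fI in auto)
      moreover have "I \<in> {D. D \<subseteq> I \<and> \<not> indep A D}" using ni by simp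
      ultimately obtain C where C: "C \<subseteq> I" "\<not> indep A C" "\<forall>D\<in>{D. D \<subseteq> I \<and> \<not> indep A D}. D \<subseteq> C \<longrightarrow> C = D"
        using finite_has_minimal2[of "{D. D \<subseteq> I \<and> \<not> indep A D}" I] by blast
      have sC: "indep A D" if "D \<subset> C" for D using C(1,3) that by blast
      have "C \<in> circuits A" unfolding circuits_def using C(1,2) sC I by blast
      hence "n \<le> card C" using pav rk unfolding paving_def matroid_rank_def by auto
      hence "C = I" using card_seteq[OF fI C(1)] p by linarith
      hence cI: "card I = n" using \<open>n \<le> card C\<close> p by simp
      have "rank_of A I \<noteq> n" using ni indeps_iff[OF M, of I] I cI by simp
      moreover have "rank_of A I \<le> n" using rcard[of I] I cI by (simp add: Int_absorb2)
      moreover have "n - 1 \<le> rank_of A I"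
      proof -
        obtain e where e: "e \<in> I" using cI n by fastforce
        have "indep A (I - {e})" by (rule sC) (use e \<open>C = I\<close> in auto)
        hence "card (I - {e}) \<le> rank_of A I" by (rule rank_of_ge[OF M]) auto
        thus ?thesis using card_remove1[OF fI e] cI by simp
      qed
      ultimately have rI: "rank_of A I = n - 1" by linarith
      define H where "H = {e \<in> ground A. rank_of A (insert e I) = rank_of A I}"
      have IH: "I \<subseteq> H" and HG: "H \<subseteq> ground A" using I by (auto simp: H_def insert_absorb)
      have "H = clos (ground A) (rank_of A) I" unfolding H_def clos_def by simp
      hence rH': "rank_of A H = n - 1" using r_clos[OF I] rI by simp
      have "H \<in> flats A" unfolding flats_def
      proof (intro CollectI conjI ballI HG)
        fix e assume e: "e \<in> ground A - H"
        have "rank_of A I < rank_of A (insert e I)" using e mono[OF subset_insertI, of I e] by (auto simp: H_def)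
        also have "\<dots> \<le> rank_of A (insert e H)" by (rule mono) (use IH in auto)
        finally show "rank_of A H < rank_of A (insert e H)" using rH' rI by simp
      qed
      moreover have "\<not> indep A H" using D(4)[of H I] IH ni by blast
      ultimately have H: "H \<in> {insert X_elem (A_elem ` {2..n}), insert X_elem (B_elem ` {2..n})}"
        unfolding hyp[symmetric] hyperplanes_def matroid_rank_def rk using rH' n by simp
      have "I \<inter> H = I" using IH by blast
      hence "cnt I H = n" using cI by simp
      thus False using H p n by auto
    qed
  qed
qed

lemma matroid_isoD:
  assumes M: "matroid M" and iso: "matroid_iso M M'" and sub: "\<And>I. indep M' I \<Longrightarrow> I \<subseteq> ground M'"
  shows "matroid M'"
proof -
  obtain f where f: "bij_betw f (ground M) (ground M')" "\<And>X. X \<subseteq> ground M \<Longrightarrow> indep M X \<longleftrightarrow> indep M' (f ` X)"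
    using iso unfolding matroid_iso_def by blast
  note inj = bij_betw_imp_inj_on[OF f(1)] and im = bij_betw_imp_surj_on[OF f(1)] and D = matroidD[OF M]
  have pre: "\<exists>I. I \<subseteq> ground M \<and> I' = f ` I" if "I' \<subseteq> ground M'" for I'
    using that unfolding im[symmetric] subset_image_iff by blast
  have card: "card (f ` I) = card I" if "I \<subseteq> ground M" for I by (rule card_image[OF inj_on_subset[OF inj that]])
  show ?thesis unfolding matroid_def
  proof (intro conjI ballI allI impI)
    show "finite (ground M')" using D(1) im by (metis finite_imageI)
    show "indep M' {}" using f(2)[of "{}"] D(3) by simp
    show "I' \<subseteq> ground M'" if "indep M' I'" for I' using sub that .
    show "indep M' J'" if h: "indep M' I'" "J' \<subseteq> I'" for I' J'
    proof -
      obtain I where I: "I \<subseteq> ground M" "I' = f ` I" using pre[OF sub[OF h(1)]] by blast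
      obtain J where J: "J \<subseteq> I" "J' = f ` J" using h(2) unfolding I(2) subset_image_iff by blast
      have "indep M I" using f(2)[OF I(1)] h(1) I(2) by simp
      hence "indep M J" using D(4) J(1) by blast
      moreover have "J \<subseteq> ground M" using J(1) I(1) by blast
      ultimately show ?thesis using f(2) J(2) by blast
    qed
    show "\<exists>e\<in>J' - I'. indep M' (insert e I')" if h: "indep M' I'" "indep M' J'" "card I' < card J'" for I' J'
    proof -
      obtain I where I: "I \<subseteq> ground M" "I' = f ` I" using pre[OF sub[OF h(1)]] by blast
      obtain J where J: "J \<subseteq> ground M" "J' = f ` J" using pre[OF sub[OF h(2)]] by blast
      have "indep M I" "indep M J" "card I < card J" using f(2)[OF I(1)] f(2)[OF J(1)] h I(2) J(2) card[OF I(1)] card[OF J(1)] by simp_all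
      from D(5)[OF this] obtain e where e: "e \<in> J - I" "indep M (insert e I)" by (rule bexE)
      have eM: "insert e I \<subseteq> ground M" using e J I by blast
      have "indep M' (insert (f e) I')" using f(2)[OF eM] e(2) I(2) by simp
      moreover have "f e \<in> J'" using e J(2) by blast
      moreover have "f e \<notin> I'"
      proof
        assume "f e \<in> I'"
        then obtain x where "x \<in> I" "f e = f x" using I(2) by blast
        hence "e = x" using inj_onD[OF inj, of e x] eM I(1) by blast
        thus False using e \<open>x \<in> I\<close> by blast
      qed
      ultimately show ?thesis by blast
    qed
  qed
qed

text \<open>A dependent hyperplane contains a dependent set of size \<open>n\<close>, and such a set
  is one of the two given sets. Each of these together with any further element already has full
  rank, so the hyperplane equals it.\<close>

lemma is_A_A_matroid:
  assumes M: "matroid (A_matroid n)" and n: "3 \<le> n"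
  shows "is_A n (A_matroid n)"
proof -
  define G where "G = {X_elem, Y_elem} \<union> A_elem ` {2..n} \<union> B_elem ` {2..n}"
  define H1 H2 where "H1 = insert X_elem (A_elem ` {2..n})" and "H2 = insert X_elem (B_elem ` {2..n})"
  define A where "A = A_matroid n"
  note M = M[folded A_def]
  have g: "ground A = G" by (simp add: A_def A_matroid_def G_def)
  interpret rank_matroid "ground A" "rank_of A" by (rule rank_matroid_rank_of[OF M])
  note D = matroidD[OF M]
  have sub: "H1 \<subseteq> G" "H2 \<subseteq> G" by (auto simp: H1_def H2_def G_def)
  have fG: "finite G" by (simp add: G_def)
  have ind: "indep A I \<longleftrightarrow> cnt I H1 \<le> n - 1 \<and> cnt I H2 \<le> n - 1 \<and> card I \<le> n" if "I \<subseteq> G" for I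
  proof -
    have f: "finite I" by (rule finite_subset[OF that fG])
    have "indep A I \<longleftrightarrow> phi_A n [cnt I {X_elem}, cnt I {Y_elem}, card (I \<inter> A_elem ` {2..n}), card (I \<inter> B_elem ` {2..n})]"
      using that by (simp add: A_def A_matroid_def G_def)
    thus ?thesis unfolding H1_def H2_def A_line_count[OF f] A_total_count[OF that[unfolded G_def]]
      by (simp add: phi_A_def numeral_2_eq_2 numeral_3_eq_3)
  qed
  have cH: "card H1 = n" "card H2 = n" unfolding H1_def H2_def
    by (subst card_insert_disjoint; use card_A_line[of n] n in auto)+
  have i12: "H1 \<inter> H2 = {X_elem}" by (auto simp: H1_def H2_def)
  have fH: "finite H1" "finite H2" using finite_subset[OF _ fG] sub by blast+
  have XH: "X_elem \<in> H1" "X_elem \<in> H2" by (auto simp: H1_def H2_def)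
  have main: "rank_of A H = n - 1 \<and> \<not> indep A H \<and> (\<forall>e\<in>G - H. rank_of A (insert e H) = n)"
    if H: "H \<subseteq> G" "card H = n" "H \<inter> H' = {X_elem}" "X_elem \<in> H" "finite H"
    and ind: "\<And>I. I \<subseteq> G \<Longrightarrow> indep A I \<longleftrightarrow> cnt I H \<le> n - 1 \<and> cnt I H' \<le> n - 1 \<and> card I \<le> n" for H H'
  proof -
    have c: "card (H - {X_elem}) = n - 1" using card_remove1[OF H(5,4)] H(2) by simp
    have "(H - {X_elem}) \<inter> H = H - {X_elem}" "(H - {X_elem}) \<inter> H' = {}" "H - {X_elem} \<subseteq> G" using H by blast+
    hence "indep A (H - {X_elem})" using ind[of "H - {X_elem}"] c by simp
    hence 1: "n - 1 \<le> rank_of A H" using rank_of_ge[OF M, of "H - {X_elem}" H] c by auto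
    have 2: "rank_of A H \<le> n - 1"
    proof -
      obtain J where J: "indep A J" "J \<subseteq> H" "card J = rank_of A H" by (rule rank_of_obtain[OF M])
      have "J \<subseteq> G" "J \<inter> H = J" using J(2) H(1) by blast+
      thus ?thesis using ind[of J] J by simp
    qed
    have 3: "rank_of A (insert e H) = n" if e: "e \<in> G - H" for e
    proof (rule antisym)
      obtain J where J: "indep A J" "card J = rank_of A (insert e H)" by (rule rank_of_obtain[OF M])
      thus "rank_of A (insert e H) \<le> n" using ind[of J] D(2)[OF J(1)] g by simp
      define J where "J = insert e (H - {X_elem})"
      have "card J = n" unfolding J_def using c e H(5) n by simp
      moreover have "J \<inter> H = H - {X_elem}" "J \<subseteq> G" using e H(1) by (auto simp: J_def)
      moreover have "J \<inter> H' \<subseteq> {e}" using H(3) by (auto simp: J_def)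
      hence "cnt J H' \<le> 1" using card_mono[of "{e}" "J \<inter> H'"] by simp
      ultimately have "indep A J" using ind[of J] c n by simp
      thus "n \<le> rank_of A (insert e H)" using rank_of_ge[OF M, of J "insert e H"] \<open>card J = n\<close> by (auto simp: J_def)
    qed
    have "H \<inter> H = H" by simp
    hence "\<not> indep A H" using ind[OF H(1)] H(2) n by simp
    thus ?thesis using 1 2 3 by simp
  qed
  have ind': "indep A I \<longleftrightarrow> cnt I H2 \<le> n - 1 \<and> cnt I H1 \<le> n - 1 \<and> card I \<le> n" if "I \<subseteq> G" for I
    using ind[OF that] by blast
  have i21: "H2 \<inter> H1 = {X_elem}" using i12 by blast
  note m1 = main[OF sub(1) cH(1) i12 XH(1) fH(1) ind] and m2 = main[OF sub(2) cH(2) i21 XH(2) fH(2) ind']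
  have rk: "rank_of A G = n"
  proof (rule antisym)
    obtain J where J: "indep A J" "card J = rank_of A G" by (rule rank_of_obtain[OF M])
    thus "rank_of A G \<le> n" using ind[of J] D(2)[OF J(1)] g by simp
    have "Y_elem \<in> G - H1" by (auto simp: G_def H1_def)
    hence "rank_of A (insert Y_elem H1) = n" "insert Y_elem H1 \<subseteq> G" using m1 sub by auto
    thus "n \<le> rank_of A G" using mono[of "insert Y_elem H1" G] g by simp
  qed
  have mr: "matroid_rank A = n" unfolding matroid_rank_def g by (rule rk)
  have "paving A" unfolding paving_def mr
  proof
    fix C assume "C \<in> circuits A"
    hence C: "C \<subseteq> G" "\<not> indep A C" by (auto simp: circuits_def g)
    have fC: "finite C" by (rule finite_subset[OF C(1) fG])
    have "cnt C H1 \<le> card C" "cnt C H2 \<le> card C" by (rule card_mono[OF fC]; blast)+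
    thus "n \<le> card C" using ind[OF C(1)] C(2) by linarith
  qed
  moreover have "{H \<in> hyperplanes A. \<not> indep A H} = {H1, H2}"
  proof (intro equalityI subsetI)
    fix H assume "H \<in> {H1, H2}"
    thus "H \<in> {H \<in> hyperplanes A. \<not> indep A H}"
      unfolding hyperplanes_def flats_def mr g using m1 m2 sub n by auto
  next
    fix H assume H: "H \<in> {H \<in> hyperplanes A. \<not> indep A H}"
    hence h: "H \<subseteq> G" "rank_of A H = n - 1" "\<not> indep A H" unfolding hyperplanes_def flats_def mr g using n by auto
    have fH': "finite H" by (rule finite_subset[OF h(1) fG])
    have cle: "cnt H H1 \<le> card H" "cnt H H2 \<le> card H" by (rule card_mono[OF fH']; blast)+
    hence "n \<le> card H" using ind[OF h(1)] h(3) by linarith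
    then obtain T where T: "T \<subseteq> H" "card T = n" "finite T" using card_subset_ex[of n H] by blast
    have TG: "T \<subseteq> G" using T(1) h(1) by blast
    have "\<not> indep A T" using rank_of_ge[OF M _ T(1)] T(2) h(2) n by auto
    then consider "n \<le> cnt T H1" | "n \<le> cnt T H2" using ind[OF TG] T(2) by linarith
    hence "H1 \<subseteq> H \<or> H2 \<subseteq> H"
    proof cases
      case 1
      have "T \<inter> H1 = H1" by (rule card_seteq[OF fH(1)]) (use 1 cH in auto)
      thus ?thesis using T(1) by blast
    next
      case 2
      have "T \<inter> H2 = H2" by (rule card_seteq[OF fH(2)]) (use 2 cH in auto)
      thus ?thesis using T(1) by blast
    qed
    moreover have "H = L" if L: "L \<subseteq> H" "\<forall>e\<in>G - L. rank_of A (insert e L) = n" for L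
    proof (rule ccontr)
      assume "H \<noteq> L"
      then obtain e where e: "e \<in> H" "e \<notin> L" using L(1) by blast
      hence "rank_of A (insert e L) = n" using L(2) h(1) by blast
      moreover have "rank_of A (insert e L) \<le> rank_of A H" by (rule mono) (use e L(1) h(1) g in auto)
      ultimately show False using h(2) n by simp
    qed
    ultimately show "H \<in> {H1, H2}" using m1 m2 by blast
  qed
  ultimately show ?thesis unfolding is_A_def A_def[symmetric] mr using M g unfolding G_def H1_def H2_def by blast
qed

lemma is_A_iso:
  assumes M: "matroid M" and n: "3 \<le> n"
  shows "(\<exists>A. is_A n A \<and> matroid_iso M A) \<longleftrightarrow> mlooks M [1, 1, n - 1, n - 1] (phi_A n)"
proof
  assume "\<exists>A. is_A n A \<and> matroid_iso M A"
  then obtain A where A: "is_A n A" "matroid_iso M A" by blast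
  hence "matroid A" by (simp add: is_A_def)
  from looks_iso[OF is_A_looks[OF A(1) n] matroidD(1)[OF M] matroidD(1)[OF this]] A(2)
  show "mlooks M [1, 1, n - 1, n - 1] (phi_A n)" by simp
next
  assume L: "mlooks M [1, 1, n - 1, n - 1] (phi_A n)"
  have "finite (ground (A_matroid n))" by (simp add: A_matroid_def)
  from looks_iso[OF looks_A matroidD(1)[OF M] this] L have i: "matroid_iso M (A_matroid n)" by simp
  have "matroid (A_matroid n)" by (rule matroid_isoD[OF M i]) (simp add: A_matroid_def)
  thus "\<exists>A. is_A n A \<and> matroid_iso M A" using is_A_A_matroid[OF _ n] i by blast
qed

section \<open>The classification\<close>

lemma mlooks_rank: "matroid M \<Longrightarrow> mlooks M cs \<phi> \<longleftrightarrow> looks (ground M) (\<lambda>I. rank_of M I = card I) cs \<phi>"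
  by (rule looks_ind_cong) (simp add: indeps_iff)

lemma iso_looks:
  assumes M: "matroid M" and M': "matroid M'" "mlooks M' cs \<phi>"
  shows "matroid_iso M M' \<longleftrightarrow> looks (ground M) (\<lambda>I. rank_of M I = card I) cs \<phi>"
  using looks_iso[OF M'(2) matroidD(1)[OF M] matroidD(1)[OF M'(1)]] mlooks_rank[OF M] by simp

lemma iso_dual_looks:
  assumes M: "matroid M" and M': "matroid M'" "mlooks M' cs \<phi>"
  shows "matroid_iso M (dual_matroid M') \<longleftrightarrow> looks (ground M) (\<lambda>I. du (ground M) (rank_of M) I = card I) cs \<phi>"
  unfolding matroid_iso_dual_dual[OF M M'(1)] using iso_looks[OF dual_matroid_rank(2)[OF M] M'] dual_matroid_rank(1,3)[OF M] by simp

theorem theorem8p8: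
  fixes M :: "'a matroid"
  assumes "matroid M"
  shows "excluded_minor notch_matroid M \<longleftrightarrow>
     matroid_iso M (direct_sum (direct_sum (uniform_matroid 1 2) (uniform_matroid 1 2))
                               (uniform_matroid 1 2)) \<or>
     matroid_iso M (direct_sum
                      (truncation 2 (direct_sum (direct_sum (uniform_matroid 1 2) (uniform_matroid 1 1))
                                                (uniform_matroid 1 1)))
                      (uniform_matroid 1 2)) \<or>
     matroid_iso M wheel3 \<or>
     matroid_iso M whirl3 \<or>
     (\<exists>n\<ge>3. \<exists>A. is_A n A \<and> matroid_iso M A) \<or>
     (\<exists>n k. 2 \<le> k \<and> k \<le> n \<and> (matroid_iso M (B_matroid n k) \<or> matroid_iso M (C_matroid (n + k) k))) \<or>
     (\<exists>n\<ge>3. matroid_iso M (D_matroid n)) \<or>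
     (\<exists>n\<ge>3. matroid_iso M (E_matroid n)) \<or>
     (\<exists>n\<ge>4. matroid_iso M (F_matroid n)) \<or>
     (\<exists>n\<ge>2. matroid_iso M (G_matroid n)) \<or>
     (\<exists>n\<ge>3. matroid_iso M (H_matroid n))"
proof -
  have r: "rank_matroid (ground M) (rank_of M)" by (rule rank_matroid_rank_of[OF assms])
  note iso = iso_looks[OF assms] and dual_iso = iso_dual_looks[OF assms]
  have C: "C_matroid (n + k) k = dual_matroid (B_matroid n k)" for n k by (simp add: C_matroid_def)
  have A: "(\<exists>n\<ge>3. \<exists>A. is_A n A \<and> matroid_iso M A) \<longleftrightarrow>
    (\<exists>n\<ge>3. looks (ground M) (\<lambda>I. rank_of M I = card I) [1, 1, n - 1, n - 1] (phi_A n))"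
    using is_A_iso[OF assms] mlooks_rank[OF assms] by (metis (no_types, lifting))
  have D: "(\<exists>n\<ge>3. matroid_iso M (D_matroid n)) \<longleftrightarrow>
    (\<exists>n\<ge>3. looks (ground M) (\<lambda>I. rank_of M I = card I) [n - 1, n - 1, 2] (phi_D n))"
    using iso[OF matroid_D looks_D] by blast
  have E: "(\<exists>n\<ge>3. matroid_iso M (E_matroid n)) \<longleftrightarrow>
    (\<exists>n\<ge>3. looks (ground M) (\<lambda>I. du (ground M) (rank_of M) I = card I) [n - 1, n - 1, 2] (phi_D n))"
    unfolding E_matroid_def using dual_iso[OF matroid_D looks_D] by blast
  have mW: "matroid_iso M wheel3 \<longleftrightarrow> looks (ground M) (\<lambda>I. rank_of M I = card I) [1, 1, 1, 1, 1, 1] phi_wheel"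
    "matroid_iso M whirl3 \<longleftrightarrow> looks (ground M) (\<lambda>I. rank_of M I = card I) [1, 1, 1, 1, 1, 1] phi_whirl"
    using looks_iso[OF looks_wheel matroidD(1)[OF assms]] looks_iso[OF looks_whirl matroidD(1)[OF assms]] mlooks_rank[OF assms]
    by (simp_all add: ground_wheel ground_whirl)
  have m: "matroid (direct_sum (direct_sum (uniform_matroid 1 2) (uniform_matroid 1 2)) (uniform_matroid 1 2))"
    "matroid (direct_sum (truncation 2 (direct_sum (direct_sum (uniform_matroid 1 2) (uniform_matroid 1 1)) (uniform_matroid 1 1))) (uniform_matroid 1 2))"
    "matroid (truncation n (direct_sum (uniform_matroid a p) (uniform_matroid b q)))" for n a p b q
    by (intro matroid_constructions)+
  \<comment> \<open>Each isomorphism is replaced by its counting description, for \<open>C\<close>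
    and \<open>E\<close> in the dual; the right-hand side is then \<open>listed\<close>.\<close>
  show ?thesis
    unfolding excluded_minor_notch[OF assms] A D E mW C iso[OF m(1) looks_1a] iso[OF m(2) looks_1b]
      iso[OF matroid_B looks_B] dual_iso[OF matroid_B looks_B] F_matroid_def G_matroid_def H_matroid_def
      iso[OF m(3) looks_trunc_two] listed_def[symmetric]
    using exc_listed[OF r] listed_exc[OF r] by blast
qed

end
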